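(* Let an SC-cube in $\mathbb{RP}^3$ be given, with vertices $x,x_i,x_{ij},x_{123}$. Characteristic conics around the SC-cube close up and bound unique SC-patches: for each $i$, with $\{i,j,k\}=\{1,2,3\}$, and each point $\tilde x^i$ on the boundary arc $b^i$ joining $x$ and $x_i$, the characteristic conic arcs obtained by starting at $\tilde x^i$ and successively following, through the four supercyclidic faces that contain edges of direction $i$, the characteristic conics transversal to the direction $i$, form a closed curve composed of four conic arcs, and these four arcs are the boundary of a unique SC-patch. The patches so obtained constitute three families $\mathcal{F}^1,\mathcal{F}^2,\mathcal{F}^3$, where the patches of $\mathcal{F}^i$ interpolate smoothly between the two opposite supercyclidic faces of the cube with respect to the direction $i$. These SC-patches have the following properties. (i) For each direction $i$ there exists a unique point $q^i$ which is the common intersection of the characteristic lines $a^i$ of all patches in $\mathcal{F}^j\cup\mathcal{F}^k$, $\{i,j,k\}=\{1,2,3\}$. (ii) Patches $f^i\in\mathcal{F}^i$ and $f^j\in\mathcal{F}^j$, $i\neq j$, intersect along a common characteristic conic that is associated with their shared net direction. (iii) Any two patches $f^i,\tilde f^i\in\mathcal{F}^i$ are classical fundamental transforms of each other. In particular, this holds for opposite supercyclidic faces of the initial SC-cube.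
   Context: A supercyclide is a surface in $\mathbb{RP}^3$ generated by two conjugate families of conics (its characteristic conics) such that the tangent planes along each conic envelop a quadratic cone. For each of the two families the supporting planes form a pencil whose axis is called a characteristic line; only generic supercyclides are considered, i.e. those of degree four with skew characteristic lines. An SC-patch is the restriction of a conjugate parametrization of a supercyclide whose parameter lines are characteristic conics to a closed rectangle; it is adapted to the (planar) quadrilateral formed by its four vertices, and its boundary consists of four conic arcs joining adjacent vertices. A Q-cube is a combinatorial cube $x,x_i,x_{ij},x_{123}$ in $\mathbb{RP}^3$ with planar faces. An SC-cube is a Q-cube with SC-patches adapted to its six faces such that, at each edge, the boundary curves of the two patches associated with that edge coincide. Data are assumed generic (in particular boundary planes, i.e. planes of the boundary arcs, do not contain the Laplace points of the faces through which opposite boundary arcs are perspective). For a patch having net directions $i$ and $k$, the characteristic line $a^i$ is the axis of the pencil of planes supporting the characteristic conics of direction $i$ of that patch. A patch in $\mathcal{F}^i$ has the two net directions $j,k\ne i$; the shared net direction of $f^i\in\mathcal{F}^i$ and $f^j\in\mathcal{F}^j$, $i\neq j$, is the remaining direction $k$. Classical fundamental transforms: two smooth conjugate nets $f,f^+$ (parametrized surfaces over a common domain) are fundamental transforms of each other if at every point of the domain and for each coordinate direction $r$ the vectors $\partial_r f$, $\partial_r f^+$ and $f^+-f$ (in an affine chart) are coplanar, i.e. the tangent lines at corresponding points to corresponding parameter lines intersect. For patches $f^i,\tilde f^i\in\mathcal{F}^i$, points correspond to each other if they are joined by the common characteristic conic (of direction $i$) of a patch of $\mathcal{F}^j$ and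 a patch of $\mathcal{F}^k$.
   Formalization: Genericity is made explicit: the cube is not planar, the four boundary planes of a direction are not in one pencil, and every closed loop of characteristic arcs is in general position (planes without common point, opposite arcs disjoint, tangents off the opposite axis, bounded patches quartic). *)

theory Defs
  imports "HOL-Analysis.Analysis"
begin

section \<open>Real projective 3-space\<close>

text \<open>
  Points, lines and planes of \<open>\<real>P\<^sup>3\<close> are the linear subspaces of \<open>\<real>\<^sup>4\<close> of dimension 1, 2 and 3;
  incidence is inclusion, and projective subspaces are disjoint iff they intersect in \<open>{0}\<close>.
\<close>

type_synonym pt = "(real^4) set"

definition rp3 :: "pt set" where
  "rp3 = {p. subspace p \<and> dim p = 1}"

definition join :: "pt set \<Rightarrow> (real^4) set" where
  "join A = span (\<Union>A)"

definition is_conic :: "pt set \<Rightarrow> bool" where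
  "is_conic C \<longleftrightarrow> (\<exists>E (M::real^4^4).
     subspace E \<and> dim E = 3 \<and> transpose M = M \<and>
     (\<forall>v\<in>E. (\<forall>w\<in>E. v \<bullet> (M *v w) = 0) \<longrightarrow> v = 0) \<and>
     C = {p\<in>rp3. p \<subseteq> E \<and> (\<forall>v\<in>p. v \<bullet> (M *v v) = 0)} \<and> C \<noteq> {})"

text \<open>The vertex of the cone given by \<open>M\<close> is the kernel of \<open>M\<close>.\<close>

definition quadratic_cone :: "real^4^4 \<Rightarrow> bool" where
  "quadratic_cone M \<longleftrightarrow> transpose M = M \<and> dim {v. M *v v = 0} = 1"

definition cone_tangent_plane :: "real^4^4 \<Rightarrow> real^4 \<Rightarrow> (real^4) set" where
  "cone_tangent_plane M v = {w. w \<bullet> (M *v v) = 0}"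

definition form :: "nat \<Rightarrow> (real^4 \<Rightarrow> real) \<Rightarrow> bool" where
  "form d P \<longleftrightarrow> (\<exists>c. P = (\<lambda>x. \<Sum>\<alpha> | (\<Sum>r\<in>UNIV. \<alpha> r) = d. c \<alpha> * (\<Prod>r\<in>UNIV. (x $ r) ^ \<alpha> r)))"

definition vanishes_on :: "(real^4 \<Rightarrow> real) \<Rightarrow> pt set \<Rightarrow> bool" where
  "vanishes_on P S \<longleftrightarrow> (\<forall>p\<in>S. \<forall>v\<in>p. P v = 0)"

text \<open>
  The Zariski closure of a piece of an irreducible algebraic surface is that surface, so its degree
  is the least degree of a nonzero form vanishing on the piece.
\<close>

definition has_degree :: "pt set \<Rightarrow> nat \<Rightarrow> bool" where
  "has_degree S d \<longleftrightarrow>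
     (\<exists>P. form d P \<and> P \<noteq> (\<lambda>_. 0) \<and> vanishes_on P S) \<and>
     (\<forall>d'<d. \<forall>P. form d' P \<and> vanishes_on P S \<longrightarrow> P = (\<lambda>_. 0))"

section \<open>Smooth parametrizations\<close>

primrec Ck_on :: "nat \<Rightarrow> 'a::real_normed_vector set \<Rightarrow> ('a \<Rightarrow> 'b::real_normed_vector) \<Rightarrow> bool" where
  "Ck_on 0 U f = continuous_on U f"
| "Ck_on (Suc n) U f =
     (\<exists>D. (\<forall>x\<in>U. (f has_derivative D x) (at x)) \<and> (\<forall>h. Ck_on n U (\<lambda>x. D x h)))"

definition smooth_on :: "'a::real_normed_vector set \<Rightarrow> ('a \<Rightarrow> 'b::real_normed_vector) \<Rightarrow> bool" where
  "smooth_on U f \<longleftrightarrow> (\<forall>n. Ck_on n U f)"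

text \<open>
  The three net directions are the elements of the three-element type \<^typ>\<open>3\<close>. A patch with the two
  directions different from \<open>i\<close> is a map on the cube \<open>[0,1]\<^sup>3\<close> that does not depend on the \<open>i\<close>-th
  coordinate, i.e. a map on a square whose sides are labelled by the two remaining directions.
\<close>

type_synonym patch = "real^3 \<Rightarrow> pt"

definition distinct3 :: "3 \<Rightarrow> 3 \<Rightarrow> 3 \<Rightarrow> bool" where
  "distinct3 i j k \<longleftrightarrow> i \<noteq> j \<and> i \<noteq> k \<and> j \<noteq> k"

definition cube :: "(real^3) set" where
  "cube = {x. \<forall>r. 0 \<le> x $ r \<and> x $ r \<le> 1}"

definition cube_nhd :: "real \<Rightarrow> (real^3) set" where
  "cube_nhd e = {x. \<forall>r. - e < x $ r \<and> x $ r < 1 + e}"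

definition verts :: "(real^3) set" where
  "verts = {x. \<forall>r. x $ r = 0 \<or> x $ r = 1}"

definition upd :: "real^3 \<Rightarrow> 3 \<Rightarrow> real \<Rightarrow> real^3" where
  "upd x i t = (\<chi> r. if r = i then t else x $ r)"

definition flip :: "3 \<Rightarrow> real^3 \<Rightarrow> real^3" where
  "flip i x = upd x i (1 - x $ i)"

definition line_at :: "3 \<Rightarrow> real^3 \<Rightarrow> (real^3) set" where
  "line_at r x = {y. \<forall>s. s \<noteq> r \<longrightarrow> y $ s = x $ s}"

definition pd :: "3 \<Rightarrow> (real^3 \<Rightarrow> real^4) \<Rightarrow> real^3 \<Rightarrow> real^4" where
  "pd r F x = frechet_derivative F (at x) (axis r 1)"

definition smooth_lift :: "(real^3 \<Rightarrow> pt) \<Rightarrow> (real^3 \<Rightarrow> real^4) \<Rightarrow> bool" where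
  "smooth_lift f F \<longleftrightarrow>
     (\<exists>e>0. smooth_on (cube_nhd e) F \<and> (\<forall>x\<in>cube_nhd e. F x \<noteq> 0)) \<and> (\<forall>x\<in>cube. f x = span {F x})"

text \<open>The tangent line does not depend on the chosen lift.\<close>

definition tangent_line :: "3 \<Rightarrow> patch \<Rightarrow> real^3 \<Rightarrow> (real^4) set" where
  "tangent_line r f x = (let F = (SOME F. smooth_lift f F) in span {F x, pd r F x})"

text \<open>
  Homogeneous coordinates \<open>F\<close> of a regular conjugate net with directions \<open>j, k \<noteq> i\<close>: in homogeneous
  coordinates the tangent plane is spanned by \<open>F, F\<^sub>j, F\<^sub>k\<close>, and the net is conjugate iff
  \<open>F\<^sub>j\<^sub>k\<close> lies in it.
\<close>

definition tangent_plane :: "3 \<Rightarrow> (real^3 \<Rightarrow> real^4) \<Rightarrow> real^3 \<Rightarrow> (real^4) set" where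
  "tangent_plane i F x = span (insert (F x) {pd r F x | r. r \<noteq> i})"

definition conj_param :: "3 \<Rightarrow> (real^3) set \<Rightarrow> (real^3 \<Rightarrow> real^4) \<Rightarrow> bool" where
  "conj_param i U F \<longleftrightarrow>
     smooth_on U F \<and>
     (\<forall>x\<in>U. \<forall>y\<in>U. y \<in> line_at i x \<longrightarrow> F y = F x) \<and>
     (\<forall>x\<in>U. dim (tangent_plane i F x) = 3 \<and>
        (\<forall>j k. distinct3 i j k \<longrightarrow> pd j (pd k F) x \<in> tangent_plane i F x))"

definition conjugate_net :: "3 \<Rightarrow> patch \<Rightarrow> bool" where
  "conjugate_net i f \<longleftrightarrow>
     (\<exists>e>0. \<exists>F. conj_param i (cube_nhd e) F \<and> (\<forall>x\<in>cube. f x = span {F x}))"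

definition fundamental_transforms :: "3 \<Rightarrow> patch \<Rightarrow> patch \<Rightarrow> bool" where
  "fundamental_transforms i f g \<longleftrightarrow>
     conjugate_net i f \<and> conjugate_net i g \<and>
     (\<forall>x\<in>cube. \<forall>r. r \<noteq> i \<longrightarrow> tangent_line r f x \<inter> tangent_line r g x \<noteq> {0})"

section \<open>Supercyclidic patches\<close>

text \<open>
  Conjugate parametrization of a supercyclide by characteristic conics. The tangent planes along a
  conic envelop a quadratic cone: by conjugacy, the generator along which such a plane touches its
  envelope passes through the point of the conic, so the cone touches the surface along the conic.
\<close>

definition char_param :: "3 \<Rightarrow> (real^3) set \<Rightarrow> (real^3 \<Rightarrow> real^4) \<Rightarrow> bool" where
  "char_param i U F \<longleftrightarrow>
     conj_param i U F \<and>
     (\<forall>x\<in>U. \<forall>r. r \<noteq> i \<longrightarrow>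
        (\<exists>C. is_conic C \<and> (\<forall>y\<in>U \<inter> line_at r x. span {F y} \<in> C)) \<and>
        (\<exists>M. quadratic_cone M \<and>
           (\<forall>y\<in>U \<inter> line_at r x. F y \<bullet> (M *v F y) = 0 \<and> M *v F y \<noteq> 0 \<and>
              tangent_plane i F y = cone_tangent_plane M (F y))))"

text \<open>
  A patch is the restriction to \<open>[0,1]\<close>-parameters of a characteristic parametrization defined on a
  larger open domain; any closed rectangle is brought to this form by affine parameter changes.
  Its parameter lines are arcs of conics, hence traversed injectively.
\<close>

definition sc_patch :: "3 \<Rightarrow> patch \<Rightarrow> bool" where
  "sc_patch i f \<longleftrightarrow>
     (\<exists>e>0. \<exists>F. char_param i (cube_nhd e) F \<and> (\<forall>x\<in>cube. f x = span {F x})) \<and>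
     (\<forall>r. r \<noteq> i \<longrightarrow> (\<forall>x\<in>cube. \<forall>y\<in>cube. y \<in> line_at r x \<and> f y = f x \<longrightarrow> y = x))"

definition param_arc :: "3 \<Rightarrow> patch \<Rightarrow> real^3 \<Rightarrow> pt set" where
  "param_arc r f x = f ` (cube \<inter> line_at r x)"

definition char_line :: "3 \<Rightarrow> patch \<Rightarrow> (real^4) set" where
  "char_line r f = (\<Inter>x\<in>cube. join (param_arc r f x))"

text \<open>
  The supporting planes of each family form a pencil, i.e. they intersect in a line, the
  characteristic line; the two characteristic lines are skew.
\<close>

definition generic_sc_patch :: "3 \<Rightarrow> patch \<Rightarrow> bool" where
  "generic_sc_patch i f \<longleftrightarrow>
     sc_patch i f \<and>
     (\<forall>r. r \<noteq> i \<longrightarrow> dim (char_line r f) = 2) \<and>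
     (\<forall>j k. distinct3 i j k \<longrightarrow> char_line j f \<inter> char_line k f = {0}) \<and>
     has_degree (f ` cube) 4"

text \<open>\<open>g\<close> is the same patch as \<open>f\<close>, with both parameters changed monotonically.\<close>

definition reparam :: "patch \<Rightarrow> patch \<Rightarrow> bool" where
  "reparam f g \<longleftrightarrow>
     (\<exists>\<sigma> :: 3 \<Rightarrow> real \<Rightarrow> real.
        (\<forall>r. strict_mono_on {0..1} (\<sigma> r) \<and> \<sigma> r ` {0..1} = {0..1}) \<and>
        (\<forall>x\<in>cube. g x = f (\<chi> r. \<sigma> r (x $ r))))"

section \<open>SC-cubes\<close>

definition q_cube :: "(real^3 \<Rightarrow> pt) \<Rightarrow> bool" where
  "q_cube X \<longleftrightarrow>
     (\<forall>v\<in>verts. X v \<in> rp3) \<and>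
     (\<forall>i. \<forall>e\<in>{0,1}. dim (join (X ` {v\<in>verts. v $ i = e})) \<le> 3)"

text \<open>
  \<open>S i e\<close> is the patch adapted to the face \<open>{v. v $ i = e}\<close>. An edge of direction \<open>k\<close> starting or
  ending at \<open>v\<close> belongs to the faces \<open>(i, v $ i)\<close> and \<open>(j, v $ j)\<close>.
\<close>

definition sc_cube :: "(real^3 \<Rightarrow> pt) \<Rightarrow> (3 \<Rightarrow> real \<Rightarrow> patch) \<Rightarrow> bool" where
  "sc_cube X S \<longleftrightarrow>
     q_cube X \<and>
     (\<forall>i. \<forall>e\<in>{0,1}. generic_sc_patch i (S i e) \<and> (\<forall>v\<in>verts. v $ i = e \<longrightarrow> S i e v = X v)) \<and>
     (\<forall>v\<in>verts. \<forall>i j k. distinct3 i j k \<longrightarrow>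
        param_arc k (S i (v $ i)) v = param_arc k (S j (v $ j)) v)"

definition boundary_arc :: "(3 \<Rightarrow> real \<Rightarrow> patch) \<Rightarrow> 3 \<Rightarrow> real^3 \<Rightarrow> pt set" where
  "boundary_arc S i v = (\<Union>j\<in>-{i}. param_arc i (S j (v $ j)) v)"

section \<open>Characteristic conics around the cube\<close>

text \<open>
  The four faces containing the edges of direction \<open>i\<close>, in cyclic order, are crossed alternately in
  the directions \<open>j\<close> and \<open>k\<close>, starting at the edge from \<open>x\<close> to \<open>x\<^sub>i\<close>.
\<close>

definition strip_face :: "(3 \<Rightarrow> real \<Rightarrow> patch) \<Rightarrow> 3 \<Rightarrow> 3 \<Rightarrow> nat \<Rightarrow> patch" where
  "strip_face S j k n =
     (if n = 0 then S k 0 else if n = 1 then S j 1 else if n = 2 then S k 1 else S j 0)"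

definition strip_dir :: "3 \<Rightarrow> 3 \<Rightarrow> nat \<Rightarrow> 3" where
  "strip_dir j k n = (if even n then j else k)"

definition strip_level :: "nat \<Rightarrow> real" where
  "strip_level n = (if n < 2 then 0 else 1)"

text \<open>
  \<open>y n\<close> is the parameter at which the \<open>n\<close>-th face is entered. The \<open>n\<close>-th arc is the transversal
  characteristic conic arc through this point; its other end point is the entry point of the
  next face.
\<close>

definition chain_point :: "(3 \<Rightarrow> real \<Rightarrow> patch) \<Rightarrow> 3 \<Rightarrow> 3 \<Rightarrow> (nat \<Rightarrow> real^3) \<Rightarrow> nat \<Rightarrow> pt" where
  "chain_point S j k y n = strip_face S j k n (y n)"

definition chain_end :: "(3 \<Rightarrow> real \<Rightarrow> patch) \<Rightarrow> 3 \<Rightarrow> 3 \<Rightarrow> (nat \<Rightarrow> real^3) \<Rightarrow> nat \<Rightarrow> pt" where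
  "chain_end S j k y n = strip_face S j k n (flip (strip_dir j k n) (y n))"

definition chain_arc :: "(3 \<Rightarrow> real \<Rightarrow> patch) \<Rightarrow> 3 \<Rightarrow> 3 \<Rightarrow> (nat \<Rightarrow> real^3) \<Rightarrow> nat \<Rightarrow> pt set" where
  "chain_arc S j k y n = param_arc (strip_dir j k n) (strip_face S j k n) (y n)"

definition conic_chain :: "(3 \<Rightarrow> real \<Rightarrow> patch) \<Rightarrow> 3 \<Rightarrow> 3 \<Rightarrow> (nat \<Rightarrow> real^3) \<Rightarrow> bool" where
  "conic_chain S j k y \<longleftrightarrow>
     (\<forall>n<4. y n \<in> cube \<and> y n $ strip_dir j k n = strip_level n) \<and>
     (\<forall>n<3. chain_end S j k y n = chain_point S j k y (Suc n))"

definition corner :: "3 \<Rightarrow> 3 \<Rightarrow> nat \<Rightarrow> real^3" where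
  "corner j k n = (\<chi> r. if r = j \<and> n \<in> {1,2} \<or> r = k \<and> n \<in> {2,3} then 1 else 0)"

definition bounded_by_chain ::
  "(3 \<Rightarrow> real \<Rightarrow> patch) \<Rightarrow> 3 \<Rightarrow> 3 \<Rightarrow> (nat \<Rightarrow> real^3) \<Rightarrow> patch \<Rightarrow> bool" where
  "bounded_by_chain S j k y g \<longleftrightarrow>
     (\<forall>n<4. g (corner j k n) = chain_point S j k y n \<and>
            param_arc (strip_dir j k n) g (corner j k n) = chain_arc S j k y n)"

definition family :: "(3 \<Rightarrow> real \<Rightarrow> patch) \<Rightarrow> 3 \<Rightarrow> patch set" where
  "family S i = {g. generic_sc_patch i g \<and>
     (\<exists>j k y. distinct3 i j k \<and> conic_chain S j k y \<and> bounded_by_chain S j k y g)}"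

definition slice :: "3 \<Rightarrow> real \<Rightarrow> (real^3 \<Rightarrow> pt) \<Rightarrow> patch" where
  "slice i t G = (\<lambda>x. G (upd x i t))"

text \<open>
  \<open>p\<close> and \<open>q\<close> are joined by a characteristic conic of direction \<open>i\<close> common to a patch of each of
  the two families different from the \<open>i\<close>-th one.
\<close>

definition corresponding :: "(3 \<Rightarrow> real \<Rightarrow> patch) \<Rightarrow> 3 \<Rightarrow> pt \<Rightarrow> pt \<Rightarrow> bool" where
  "corresponding S i p q \<longleftrightarrow>
     (\<exists>j k. distinct3 i j k \<and>
        (\<exists>g\<in>family S j. \<exists>h\<in>family S k. \<exists>x\<in>cube. \<exists>y\<in>cube.
           param_arc i g x = param_arc i h y \<and> p \<in> param_arc i g x \<and> q \<in> param_arc i g x))"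

text \<open>
  After a parameter change of \<open>g\<close> corresponding points belong to equal parameters, and the two
  nets are fundamental transforms of each other.
\<close>

definition related_by_fundamental_transform ::
  "(3 \<Rightarrow> real \<Rightarrow> patch) \<Rightarrow> 3 \<Rightarrow> patch \<Rightarrow> patch \<Rightarrow> bool" where
  "related_by_fundamental_transform S i f g \<longleftrightarrow>
     (\<exists>g'. reparam g g' \<and> (\<forall>x\<in>cube. corresponding S i (f x) (g' x)) \<and> fundamental_transforms i f g')"

section \<open>Genericity\<close>

text \<open>
  No boundary plane contains the Laplace point \<open>(x \<or> x\<^sub>j) \<inter> (x\<^sub>i \<or> x\<^sub>i\<^sub>j)\<close> through which its boundary
  arc (of direction \<open>i\<close>) is perspective to the opposite arc of a face.
\<close>

definition generic_laplace :: "(real^3 \<Rightarrow> pt) \<Rightarrow> (3 \<Rightarrow> real \<Rightarrow> patch) \<Rightarrow> bool" where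
  "generic_laplace X S \<longleftrightarrow>
     (\<forall>v\<in>verts. \<forall>i j. i \<noteq> j \<longrightarrow>
        join {X v, X (flip j v)} \<inter> join {X (flip i v), X (flip i (flip j v))} \<inter>
        join (boundary_arc S i v) = {0})"

text \<open>
  The loop of four conic arcs is in general position: the four planes of its arcs have no common
  point, i.e. the planes of opposite arcs intersect in two skew lines; opposite arcs are disjoint;
  the tangents of an arc do not meet the intersection line of the planes of the two adjacent arcs.
  A degeneration here makes a characteristic line, a conic or a tangent cone of the spanned
  surface degenerate. The last condition excludes supercyclides of lower degree.
\<close>

definition generic_chain :: "(3 \<Rightarrow> real \<Rightarrow> patch) \<Rightarrow> 3 \<Rightarrow> 3 \<Rightarrow> 3 \<Rightarrow> (nat \<Rightarrow> real^3) \<Rightarrow> bool" where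
  "generic_chain S i j k y \<longleftrightarrow>
     (\<Inter>n\<in>{..<4}. join (chain_arc S j k y n)) = {0} \<and>
     (\<forall>n<2. chain_arc S j k y n \<inter> chain_arc S j k y (n + 2) = {}) \<and>
     (\<forall>n<4. \<forall>z\<in>cube \<inter> line_at (strip_dir j k n) (y n).
        tangent_line (strip_dir j k n) (strip_face S j k n) z \<inter>
        join (chain_arc S j k y ((n + 1) mod 4)) \<inter> join (chain_arc S j k y ((n + 3) mod 4)) = {0}) \<and>
     (\<forall>g. sc_patch i g \<and> bounded_by_chain S j k y g \<longrightarrow> has_degree (g ` cube) 4)"

text \<open>
  Moreover, the cube is not planar, and the four boundary planes of a direction do not belong to one
  pencil (otherwise all characteristic lines of that direction coincide).
\<close>

definition generic_cube :: "(real^3 \<Rightarrow> pt) \<Rightarrow> (3 \<Rightarrow> real \<Rightarrow> patch) \<Rightarrow> bool" where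
  "generic_cube X S \<longleftrightarrow>
     generic_laplace X S \<and>
     join (X ` verts) = UNIV \<and>
     (\<forall>i. dim (\<Inter>v\<in>verts. join (boundary_arc S i v)) \<le> 1) \<and>
     (\<forall>i j k y. distinct3 i j k \<and> conic_chain S j k y \<longrightarrow> generic_chain S i j k y)"

end

theory Submission
  imports Defs
begin

text \<open>
  A generic patch is determined by its two boundary conics at a corner \<open>x\<close>: if \<open>\<real>\<^sup>4\<close> is split into the
  two skew characteristic lines, tangency along cones forces the homogeneous coordinates of the patch
  to be \<open>p(u) / l(u) + q(v) / m(v) - x\<close>, where \<open>p\<close>, \<open>q\<close> are the quadratic parametrizations of the conics
  and \<open>l\<close>, \<open>m\<close> are nonvanishing quadratic polynomials. Applied to the three faces at a vertex of the
  cube, this yields nine quadratic functions, from which one trivariate net \<open>Net(u\<^sub>1, u\<^sub>2, u\<^sub>3)\<close> is built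
  by the planarity of the elementary quadrilaterals. Comparing shared edge arcs shows that the three
  opposite faces are the coordinate surfaces \<open>u\<^sub>i = 1\<close> of this net. Hence chains of conics are
  boundaries of coordinate surfaces \<open>u\<^sub>i = t\<close> and close up, and such a surface is again of the above
  normal form; genericity of the chain makes it a generic patch, and the planes of its boundary arcs
  determine \<open>l\<close> and \<open>m\<close>. The point \<open>q\<^sup>i\<close> is the point of the plane of the edge conic of direction \<open>i\<close>
  annihilated by the two linear forms belonging to this edge, and corresponding tangents of two
  surfaces \<open>u\<^sub>i = t\<close>, \<open>u\<^sub>i = t'\<close> meet in the vertex of the cone that touches a third coordinate surface
  along the conic joining the points.
\<close>

section \<open>Smooth maps\<close>

text \<open>Why tangency along cones forces the additive normal form: let V and W be the two skew
  characteristic lines. The planes of one family contain V and those of the other contain W, so a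
  point of the patch is G(u, v) = \<alpha>(u, v) A(u) + \<beta>(u, v) B(v) with A(u) in V and B(v)
  in W. The vertex of the cone touching along a conic v = const turns out to lie in W. Therefore the
  logarithmic v-derivatives of \<alpha> and \<beta> differ by a function of v alone, the quotient
  \<alpha> / \<beta> is a product of a function of u and a function of v, and rescaling gives a
  translation surface. The obstacle afterwards is that projective arcs carry neither a scale nor a
  parameter. Both are controlled by Bernstein form with a prescribed first vector and a prescribed
  end point: the only freedom left is to replace the control points B, C by r B, r^2 C with r > 0,
  so the quadratic coefficients of different patches along a common arc become comparable.\<close>

lemma Ck_on_SucI:
  assumes "\<And>x. x \<in> U \<Longrightarrow> (f has_derivative D x) (at x)" "\<And>h. Ck_on n U (\<lambda>x. D x h)"
  shows "Ck_on (Suc n) U f"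
proof -
  have "(\<forall>x\<in>U. (f has_derivative D x) (at x)) \<and> (\<forall>h. Ck_on n U (\<lambda>x. D x h))"
    by (intro conjI ballI allI) (fact assms)+
  then show ?thesis unfolding Ck_on.simps by (rule exI[of _ D])
qed

text \<open>In the product and quotient rules the derivative contains the function itself, which
  therefore has to be available at the lower order as well.\<close>

lemma Ck_on_Suc_D: "Ck_on (Suc n) U f \<Longrightarrow> Ck_on n U f"
proof (induction n arbitrary: f)
  case 0
  then obtain D where "\<forall>x\<in>U. (f has_derivative D x) (at x)" by auto
  then show ?case
    by (auto intro!: continuous_at_imp_continuous_on has_derivative_continuous)
next
  case (Suc n)
  then obtain D where D: "\<forall>x\<in>U. (f has_derivative D x) (at x)"
    "\<forall>h. Ck_on (Suc n) U (\<lambda>x. D x h)" by (auto simp del: Ck_on.simps(1) simp: Ck_on.simps(2)[of "Suc n"])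
  have "\<forall>h. Ck_on n U (\<lambda>x. D x h)" using Suc.IH D(2) by blast
  with D(1) show ?case by (intro Ck_on_SucI) blast+
qed

text \<open>\<open>U\<close> is open because \<open>Ck_on\<close> asks for derivatives in the full
  space, not within \<open>U\<close>; two functions agreeing on \<open>U\<close> then have the same
  derivatives there.\<close>

lemma Ck_on_cong:
  assumes "open U" "\<And>x. x \<in> U \<Longrightarrow> f x = g x" "Ck_on n U f"
  shows "Ck_on n U g"
proof (cases n)
  case 0
  then show ?thesis using assms by (simp cong: continuous_on_cong)
next
  case (Suc m)
  then obtain D where D: "\<forall>x\<in>U. (f has_derivative D x) (at x)"
    "\<forall>h. Ck_on m U (\<lambda>x. D x h)" using assms(3) by auto
  have "(g has_derivative D x) (at x)" if "x \<in> U" for x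
    using D(1) that assms(1,2) by (meson has_derivative_transform_within_open)
  then show ?thesis using D(2) Suc by auto
qed

lemma Ck_on_const: "Ck_on n U (\<lambda>_. c)"
proof (induction n arbitrary: c)
  case (Suc n)
  show ?case by (rule Ck_on_SucI[where D = "\<lambda>_ _. 0"]) (simp_all add: Suc)
qed simp

lemma Ck_on_add:
  assumes "Ck_on n U f" "Ck_on n U g" shows "Ck_on n U (\<lambda>x. f x + g x)"
  using assms
proof (induction n arbitrary: f g)
  case 0 then show ?case by (simp add: continuous_on_add)
next
  case (Suc n)
  obtain D where D: "\<forall>x\<in>U. (f has_derivative D x) (at x)" "\<forall>h. Ck_on n U (\<lambda>x. D x h)"
    using Suc.prems(1) by auto
  obtain E where E: "\<forall>x\<in>U. (g has_derivative E x) (at x)" "\<forall>h. Ck_on n U (\<lambda>x. E x h)"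
    using Suc.prems(2) by auto
  have "\<forall>x\<in>U. ((\<lambda>x. f x + g x) has_derivative (\<lambda>h. D x h + E x h)) (at x)"
    using D(1) E(1) by (auto intro!: has_derivative_add)
  moreover have "\<forall>h. Ck_on n U (\<lambda>x. D x h + E x h)" using D(2) E(2) Suc.IH by blast
  ultimately show ?case by (intro Ck_on_SucI[where D = "\<lambda>x h. D x h + E x h"]) blast+
qed

lemma Ck_on_bounded_linear:
  assumes "bounded_linear L" "Ck_on n U f" shows "Ck_on n U (\<lambda>x. L (f x))"
  using assms(2)
proof (induction n arbitrary: f)
  case 0 then show ?case
    using assms(1) by (simp add: bounded_linear.continuous_on)
next
  case (Suc n)
  obtain D where D: "\<forall>x\<in>U. (f has_derivative D x) (at x)" "\<forall>h. Ck_on n U (\<lambda>x. D x h)"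
    using Suc.prems(1) by auto
  have "\<forall>x\<in>U. ((\<lambda>x. L (f x)) has_derivative (\<lambda>h. L (D x h))) (at x)"
    using D(1) bounded_linear.has_derivative[OF assms(1)] by blast
  moreover have "\<forall>h. Ck_on n U (\<lambda>x. L (D x h))" using D(2) Suc.IH by blast
  ultimately show ?case by (intro Ck_on_SucI[where D = "\<lambda>x h. L (D x h)"]) blast+
qed

lemma Ck_on_scaleR:
  fixes f :: "'a::real_normed_vector \<Rightarrow> real" and g :: "'a \<Rightarrow> 'b::real_normed_vector"
  assumes "Ck_on n U f" "Ck_on n U g" shows "Ck_on n U (\<lambda>x. f x *\<^sub>R g x)"
  using assms
proof (induction n arbitrary: f g)
  case 0 then show ?case by (simp add: continuous_on_scaleR)
next
  case (Suc n)
  obtain D where D: "\<forall>x\<in>U. (f has_derivative D x) (at x)" "\<forall>h. Ck_on n U (\<lambda>x. D x h)"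
    using Suc.prems(1) by auto
  obtain E where E: "\<forall>x\<in>U. (g has_derivative E x) (at x)" "\<forall>h. Ck_on n U (\<lambda>x. E x h)"
    using Suc.prems(2) by auto
  have "\<forall>x\<in>U. ((\<lambda>x. f x *\<^sub>R g x) has_derivative (\<lambda>h. f x *\<^sub>R E x h + D x h *\<^sub>R g x)) (at x)"
    using D(1) E(1) by (auto intro!: has_derivative_scaleR)
  moreover have "\<forall>h. Ck_on n U (\<lambda>x. f x *\<^sub>R E x h + D x h *\<^sub>R g x)"
    using D(2) E(2) Suc.IH Ck_on_Suc_D[OF Suc.prems(1)] Ck_on_Suc_D[OF Suc.prems(2)]
    by (auto intro!: Ck_on_add)
  ultimately show ?case by (intro Ck_on_SucI[where D = "\<lambda>x h. f x *\<^sub>R E x h + D x h *\<^sub>R g x"]) blast+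
qed

lemma Ck_on_inverse:
  fixes f :: "'a::real_normed_vector \<Rightarrow> real"
  assumes "Ck_on n U f" "\<And>x. x \<in> U \<Longrightarrow> f x \<noteq> 0" shows "Ck_on n U (\<lambda>x. inverse (f x))"
  using assms
proof (induction n arbitrary: f)
  case 0 then show ?case by (simp add: continuous_on_inverse)
next
  case (Suc n)
  obtain D where D: "\<forall>x\<in>U. (f has_derivative D x) (at x)" "\<forall>h. Ck_on n U (\<lambda>x. D x h)"
    using Suc.prems(1) by auto
  have "\<forall>x\<in>U. ((\<lambda>x. inverse (f x)) has_derivative (\<lambda>h. - (inverse (f x) * D x h * inverse (f x)))) (at x)"
    using D(1) Suc.prems(2) by (auto intro!: has_derivative_inverse)
  moreover have "\<forall>h. Ck_on n U (\<lambda>x. - (inverse (f x) * D x h * inverse (f x)))"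
  proof
    fix h
    have I: "Ck_on n U (\<lambda>x. inverse (f x))"
      using Suc.IH[OF Ck_on_Suc_D[OF Suc.prems(1)]] Suc.prems(2) by blast
    have "Ck_on n U (\<lambda>x. inverse (f x) *\<^sub>R (D x h *\<^sub>R inverse (f x)))"
      using I D(2) by (intro Ck_on_scaleR) auto
    from Ck_on_bounded_linear[OF bounded_linear_minus[OF bounded_linear_ident] this]
    show "Ck_on n U (\<lambda>x. - (inverse (f x) * D x h * inverse (f x)))"
      by (simp add: mult.assoc)
  qed
  ultimately show ?case by (intro Ck_on_SucI[where D = "\<lambda>x h. - (inverse (f x) * D x h * inverse (f x))"]) blast+
qed

text \<open>Affine inner maps cover coordinate projections and the restriction to parameter lines.
  Nonlinear reparametrizations occur inside Bernstein polynomials, where sums and products do the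
  work.\<close>

lemma Ck_on_affine:
  assumes "Ck_on n U f" "bounded_linear l" "\<And>x. x \<in> V \<Longrightarrow> c + l x \<in> U"
  shows "Ck_on n V (\<lambda>x. f (c + l x))"
  using assms(1)
proof (induction n arbitrary: f)
  case 0
  have "continuous_on V (\<lambda>x. c + l x)"
    using linear_continuous_on[OF assms(2)] by (intro continuous_intros)
  then show ?case using 0 assms(3)
    by (auto intro: continuous_on_compose2)
next
  case (Suc n)
  obtain D where D: "\<forall>x\<in>U. (f has_derivative D x) (at x)" "\<forall>h. Ck_on n U (\<lambda>x. D x h)"
    using Suc.prems(1) by auto
  have "((\<lambda>x. f (c + l x)) has_derivative (\<lambda>h. D (c + l x) (l h))) (at x)" if "x \<in> V" for x
  proof -
    have "((\<lambda>x. c + l x) has_derivative l) (at x)"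
      using has_derivative_add[OF has_derivative_const bounded_linear_imp_has_derivative[OF assms(2)]]
      by simp
    then show ?thesis
      using D(1) assms(3)[OF that] has_derivative_compose by blast
  qed
  moreover have "\<forall>h. Ck_on n V (\<lambda>x. D (c + l x) (l h))" using D(2) Suc.IH by blast
  ultimately show ?case by (intro Ck_on_SucI[where D = "\<lambda>x h. D (c + l x) (l h)"]) blast+
qed

lemma Ck_on_subset: "Ck_on n U f \<Longrightarrow> V \<subseteq> U \<Longrightarrow> Ck_on n V f"
  using Ck_on_affine[OF _ bounded_linear_ident, of n U f V 0] by auto

lemma smooth_on_const: "smooth_on U (\<lambda>_. c)"
  by (simp add: smooth_on_def Ck_on_const)

lemma smooth_on_add: "smooth_on U f \<Longrightarrow> smooth_on U g \<Longrightarrow> smooth_on U (\<lambda>x. f x + g x)"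
  unfolding smooth_on_def by (rule allI, rule Ck_on_add) (erule spec)+

lemma smooth_on_bounded_linear: "bounded_linear L \<Longrightarrow> smooth_on U f \<Longrightarrow> smooth_on U (\<lambda>x. L (f x))"
  unfolding smooth_on_def using Ck_on_bounded_linear by blast

lemma smooth_on_scaleR:
  fixes f :: "'a::real_normed_vector \<Rightarrow> real" and g :: "'a \<Rightarrow> 'b::real_normed_vector"
  shows "smooth_on U f \<Longrightarrow> smooth_on U g \<Longrightarrow> smooth_on U (\<lambda>x. f x *\<^sub>R g x)"
  unfolding smooth_on_def by (rule allI, rule Ck_on_scaleR) (erule spec)+

lemma smooth_on_mult:
  fixes f :: "'a::real_normed_vector \<Rightarrow> real"
  shows "smooth_on U f \<Longrightarrow> smooth_on U g \<Longrightarrow> smooth_on U (\<lambda>x. f x * g x)"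
  using smooth_on_scaleR[of U f g] unfolding real_scaleR_def .

lemma smooth_on_diff: "smooth_on U f \<Longrightarrow> smooth_on U g \<Longrightarrow> smooth_on U (\<lambda>x. f x - g x)"
  using smooth_on_add[of U f "\<lambda>x. - g x"]
    smooth_on_bounded_linear[OF bounded_linear_minus[OF bounded_linear_ident], of U g] by simp

lemma smooth_on_divide:
  fixes f :: "'a::real_normed_vector \<Rightarrow> real"
  assumes "smooth_on U f" "smooth_on U g" "\<And>x. x \<in> U \<Longrightarrow> g x \<noteq> 0"
  shows "smooth_on U (\<lambda>x. f x / g x)"
proof -
  have "smooth_on U (\<lambda>x. inverse (g x))"
    using assms(2,3) unfolding smooth_on_def by (blast intro: Ck_on_inverse)
  from smooth_on_mult[OF assms(1) this] show ?thesis by (simp add: divide_inverse)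
qed

lemma smooth_on_power:
  fixes f :: "'a::real_normed_vector \<Rightarrow> real"
  shows "smooth_on U f \<Longrightarrow> smooth_on U (\<lambda>x. f x ^ n)"
proof (induction n)
  case 0
  show ?case unfolding power_0 by (rule smooth_on_const)
next
  case (Suc n)
  then show ?case unfolding power_Suc using smooth_on_mult by blast
qed

lemma smooth_on_linear: "bounded_linear l \<Longrightarrow> smooth_on U l"
proof -
  assume l: "bounded_linear l"
  have "Ck_on n U l" for n
  proof (cases n)
    case 0 then show ?thesis using l by (simp add: linear_continuous_on)
  next
    case (Suc m)
    have "\<forall>x\<in>U. (l has_derivative l) (at x)" using l by (simp add: bounded_linear_imp_has_derivative)
    then show ?thesis unfolding Suc by (intro Ck_on_SucI[where D = "\<lambda>_. l"] Ck_on_const) blast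
  qed
  then show ?thesis by (simp add: smooth_on_def)
qed

lemma smooth_on_ident: "smooth_on U (\<lambda>x. x)"
  by (rule smooth_on_linear) (rule bounded_linear_ident)

lemma smooth_on_inner: "smooth_on U f \<Longrightarrow> smooth_on U (\<lambda>x. g \<bullet> f x)"
  by (rule smooth_on_bounded_linear[OF bounded_linear_inner_right])

lemma smooth_on_affine:
  "smooth_on U f \<Longrightarrow> bounded_linear l \<Longrightarrow> (\<And>x. x \<in> V \<Longrightarrow> c + l x \<in> U) \<Longrightarrow> smooth_on V (\<lambda>x. f (c + l x))"
  unfolding smooth_on_def by (blast intro: Ck_on_affine)

lemma smooth_on_subset: "smooth_on U f \<Longrightarrow> V \<subseteq> U \<Longrightarrow> smooth_on V f"
  unfolding smooth_on_def by (blast intro: Ck_on_subset)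

lemmas smooth_intros = smooth_on_const smooth_on_add smooth_on_scaleR smooth_on_mult smooth_on_diff
  smooth_on_power smooth_on_ident smooth_on_inner

lemma smooth_on_has_derivative:
  assumes "smooth_on U F" "x \<in> U"
  shows "(F has_derivative frechet_derivative F (at x)) (at x)"
proof -
  have "Ck_on (Suc 0) U F" using assms(1) by (simp only: smooth_on_def)
  then obtain D where "(F has_derivative D x) (at x)" using assms(2) by auto
  then show ?thesis by (metis differentiableI frechet_derivative_works)
qed

lemma smooth_on_continuous: "smooth_on U f \<Longrightarrow> continuous_on U f"
  unfolding smooth_on_def by (metis Ck_on.simps(1))

text \<open>\<open>Ck_on\<close> supplies a separate derivative for every order; uniqueness
  identifies all of them with \<open>frechet_derivative\<close>, so that one and the same function
  is smooth.\<close>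

lemma smooth_on_pd:
  assumes "open U" "smooth_on U F" shows "smooth_on U (pd r F)"
  unfolding smooth_on_def
proof
  fix n
  have "Ck_on (Suc n) U F" using assms(2) by (simp only: smooth_on_def)
  then obtain D where D: "\<forall>x\<in>U. (F has_derivative D x) (at x)" "\<forall>h. Ck_on n U (\<lambda>x. D x h)"
    by auto
  have "D x (axis r 1) = pd r F x" if "x \<in> U" for x
    using D(1) that frechet_derivative_at unfolding pd_def by metis
  then show "Ck_on n U (pd r F)"
    by (rule Ck_on_cong[OF assms(1), where f = "\<lambda>x. D x (axis r 1)"]) (assumption, rule D(2)[rule_format])
qed

lemma smooth_on_real_deriv:
  fixes f :: "real \<Rightarrow> 'b::real_normed_vector"
  assumes "open U" "smooth_on U f"
  obtains f' where "smooth_on U f'" "\<And>x. x \<in> U \<Longrightarrow> (f has_vector_derivative f' x) (at x)"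
proof (rule that[of "\<lambda>x. frechet_derivative f (at x) 1"])
  have "Ck_on n U (\<lambda>x. frechet_derivative f (at x) 1)" for n
  proof -
    have "Ck_on (Suc n) U f" using assms(2) by (simp only: smooth_on_def)
    then obtain D where D: "\<forall>x\<in>U. (f has_derivative D x) (at x)" "\<forall>h. Ck_on n U (\<lambda>x. D x h)"
      by auto
    have "D x 1 = frechet_derivative f (at x) 1" if "x \<in> U" for x
      using D(1) that frechet_derivative_at by metis
    then show ?thesis
      by (rule Ck_on_cong[OF assms(1), where f = "\<lambda>x. D x 1"]) (assumption, rule D(2)[rule_format])
  qed
  then show "smooth_on U (\<lambda>x. frechet_derivative f (at x) 1)"
    unfolding smooth_on_def by (rule allI)
  fix x assume "x \<in> U"
  note D = smooth_on_has_derivative[OF assms(2) this]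
  have *: "frechet_derivative f (at x) h = h *\<^sub>R frechet_derivative f (at x) 1" for h
    using linear_scale[OF has_derivative_linear[OF D], of h 1]
    unfolding real_scaleR_def mult.right_neutral .
  show "(f has_vector_derivative frechet_derivative f (at x) 1) (at x)"
    unfolding has_vector_derivative_def by (rule has_derivative_eq_rhs[OF D], rule ext, rule *)
qed

section \<open>The parameter cube\<close>

lemma cube_nhd_open: "open (cube_nhd e)"
proof -
  have "cube_nhd e = (\<Inter>r. {x. - e < x $ r} \<inter> {x. x $ r < 1 + e})" by (auto simp: cube_nhd_def)
  moreover have "open ({x::real^3. - e < x $ r} \<inter> {x. x $ r < 1 + e})" for r
    by (intro open_Int open_Collect_less continuous_intros)
  ultimately show ?thesis by (simp add: open_INT)
qed

lemma cube_subset_nhd: "e > 0 \<Longrightarrow> cube \<subseteq> cube_nhd e"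
  unfolding cube_def cube_nhd_def by (smt (verit) Collect_mono)

lemma distinct3_cases:
  assumes "distinct3 i j k" obtains "r = i" | "r = j" | "r = k"
  using assms unfolding distinct3_def using exhaust_3 by metis

lemma distinct3_all: "distinct3 i j k \<Longrightarrow> (\<forall>r. P r) \<longleftrightarrow> P i \<and> P j \<and> P k"
  by (metis distinct3_cases)

lemma distinct3_other: "distinct3 i j k \<Longrightarrow> {r. r \<noteq> i} = {j, k}"
  using distinct3_cases[of i j k] by (auto simp: distinct3_def)

lemma distinct3_ex: "j \<noteq> i \<Longrightarrow> \<exists>k. distinct3 i j k"
proof -
  assume "j \<noteq> i"
  have "card {i, j} < card (UNIV :: 3 set)" by (simp add: card_insert_if)
  then obtain k where "k \<notin> {i, j}" by (metis UNIV_eq_I less_irrefl)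
  then show ?thesis using \<open>j \<noteq> i\<close> by (auto simp: distinct3_def)
qed

lemma dist_ex: obtains j k where "distinct3 i j k"
proof -
  have "card {i} < card (UNIV :: 3 set)" by simp
  then obtain j where "j \<noteq> i" by (metis UNIV_eq_I less_irrefl singletonI)
  then show ?thesis using distinct3_ex that by blast
qed

definition pt3 :: "3 \<Rightarrow> 3 \<Rightarrow> real \<Rightarrow> real \<Rightarrow> real \<Rightarrow> real^3" where
  "pt3 i j a b c = (\<chi> r. if r = i then a else if r = j then b else c)"

lemma pt3_nth: "pt3 i j a b c $ i = a" "i \<noteq> j \<Longrightarrow> pt3 i j a b c $ j = b"
  "r \<noteq> i \<Longrightarrow> r \<noteq> j \<Longrightarrow> pt3 i j a b c $ r = c"
  by (auto simp: pt3_def)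

lemma pt3_cube: "pt3 i j a b c \<in> cube" if "a \<in> {0..1}" "b \<in> {0..1}" "c \<in> {0..1}"
  using that by (auto simp: cube_def pt3_def)

lemma pt3_cube_nhd: "pt3 i j a b c \<in> cube_nhd e" if "a \<in> {-e<..<1+e}" "b \<in> {-e<..<1+e}" "c \<in> {-e<..<1+e}"
  using that by (auto simp: cube_nhd_def pt3_def)

lemma cube_nth: "w \<in> cube \<Longrightarrow> w $ r \<in> {0..1}"
  by (auto simp: cube_def)

section \<open>Independent vectors and hyperplanes\<close>

text \<open>Stated with coefficients rather than as \<open>independent {a, b}\<close>: being a
  property of a set, the latter does not notice a repeated vector.\<close>

definition indep2 :: "'a::real_vector \<Rightarrow> 'a \<Rightarrow> bool" where
  "indep2 a b \<longleftrightarrow> (\<forall>\<alpha> \<beta>. \<alpha> *\<^sub>R a + \<beta> *\<^sub>R b = 0 \<longrightarrow> \<alpha> = 0 \<and> \<beta> = 0)"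

definition indep3 :: "'a::real_vector \<Rightarrow> 'a \<Rightarrow> 'a \<Rightarrow> bool" where
  "indep3 a b c \<longleftrightarrow>
     (\<forall>\<alpha> \<beta> \<gamma>. \<alpha> *\<^sub>R a + \<beta> *\<^sub>R b + \<gamma> *\<^sub>R c = 0 \<longrightarrow> \<alpha> = 0 \<and> \<beta> = 0 \<and> \<gamma> = 0)"

definition indep4 :: "'a::real_vector \<Rightarrow> 'a \<Rightarrow> 'a \<Rightarrow> 'a \<Rightarrow> bool" where
  "indep4 a b c d \<longleftrightarrow>
     (\<forall>\<alpha> \<beta> \<gamma> \<delta>. \<alpha> *\<^sub>R a + \<beta> *\<^sub>R b + \<gamma> *\<^sub>R c + \<delta> *\<^sub>R d = 0 \<longrightarrow>
        \<alpha> = 0 \<and> \<beta> = 0 \<and> \<gamma> = 0 \<and> \<delta> = 0)"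

lemma mem_span1: "w \<in> span {a} \<longleftrightarrow> (\<exists>\<alpha>. w = \<alpha> *\<^sub>R a)"
  by (auto simp: span_singleton)

lemma mem_span2: "w \<in> span {a, b} \<longleftrightarrow> (\<exists>\<alpha> \<beta>. w = \<alpha> *\<^sub>R a + \<beta> *\<^sub>R b)"
  by (simp add: span_breakdown_eq algebra_simps)

lemma mem_span3: "w \<in> span {a, b, c} \<longleftrightarrow> (\<exists>\<alpha> \<beta> \<gamma>. w = \<alpha> *\<^sub>R a + \<beta> *\<^sub>R b + \<gamma> *\<^sub>R c)"
  by (simp add: span_breakdown_eq algebra_simps)

lemma indep2_independent:
  assumes "indep2 a b" shows "independent {a, b}" "a \<noteq> b"
proof -
  have "a \<noteq> b" "b \<noteq> 0"
    using assms[unfolded indep2_def, rule_format, of 1 "-1"] assms[unfolded indep2_def, rule_format, of 0 1]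
    by auto
  moreover have "a \<notin> span {b}"
  proof
    assume "a \<in> span {b}"
    then obtain \<alpha> where "a = \<alpha> *\<^sub>R b" by (auto simp: mem_span1)
    then show False using assms[unfolded indep2_def, rule_format, of 1 "-\<alpha>"] by simp
  qed
  ultimately show "independent {a, b}" "a \<noteq> b" by (auto simp: independent_insert)
qed

lemma indep3_D:
  assumes "indep3 a b c" shows "indep2 b c" "indep2 a b" "indep2 a c" "a \<notin> span {b, c}"
proof -
  show "indep2 b c" unfolding indep2_def
    using assms[unfolded indep3_def, rule_format, of 0] by simp
  show "indep2 a b" unfolding indep2_def
    using assms[unfolded indep3_def, rule_format, of _ _ 0] by auto
  show "indep2 a c" unfolding indep2_def
    using assms[unfolded indep3_def, rule_format, of _ 0] by auto
  show "a \<notin> span {b, c}"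
  proof
    assume "a \<in> span {b, c}"
    then obtain \<beta> \<gamma> where "a = \<beta> *\<^sub>R b + \<gamma> *\<^sub>R c" by (auto simp: mem_span2)
    then show False using assms[unfolded indep3_def, rule_format, of "-1" \<beta> \<gamma>] by simp
  qed
qed

lemma indep3_independent:
  assumes "indep3 a b c" shows "independent {a, b, c}" "card {a, b, c} = 3"
proof -
  note D = indep3_D[OF assms]
  have "a \<noteq> b" "a \<noteq> c" using D(4) span_base[of _ "{b, c}"] by auto
  with D indep2_independent[OF D(1)] show "independent {a, b, c}" "card {a, b, c} = 3"
    by (auto simp: independent_insert)
qed

lemma indep4_D:
  assumes "indep4 a b c d"
  shows "indep3 b c d" "indep3 a b c" "a \<notin> span {b, c, d}"
proof -
  show "indep3 b c d" unfolding indep3_def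
    using assms[unfolded indep4_def, rule_format, of 0] by simp
  show "indep3 a b c" unfolding indep3_def
    using assms[unfolded indep4_def, rule_format, of _ _ _ 0] by auto
  show "a \<notin> span {b, c, d}"
  proof
    assume "a \<in> span {b, c, d}"
    then obtain \<beta> \<gamma> \<delta> where "a = \<beta> *\<^sub>R b + \<gamma> *\<^sub>R c + \<delta> *\<^sub>R d" by (auto simp: mem_span3)
    then show False using assms[unfolded indep4_def, rule_format, of "-1" \<beta> \<gamma> \<delta>] by simp
  qed
qed

lemma indep4_independent:
  assumes "indep4 a b c d" shows "independent {a, b, c, d}" "card {a, b, c, d} = 4"
proof -
  note D = indep4_D[OF assms]
  have "a \<noteq> b" "a \<noteq> c" "a \<noteq> d" using D(3) span_base[of _ "{b, c, d}"] by auto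
  with D indep3_independent[OF D(1)] show "independent {a, b, c, d}" "card {a, b, c, d} = 4"
    by (auto simp: independent_insert)
qed

lemma dim_span2: "indep2 a b \<Longrightarrow> dim (span {a, b}) = 2"
  using indep2_independent[of a b] by (simp add: dim_eq_card_independent)

lemma dim_span3: "indep3 a b c \<Longrightarrow> dim (span {a, b, c}) = 3"
  using indep3_independent[of a b c] by (metis dim_span dim_eq_card_independent)

lemma indep3_spanI:
  fixes a b c :: "'a::euclidean_space"
  assumes "dim (span {a, b, c}) = 3" shows "indep3 a b c"
  unfolding indep3_def
proof (intro allI impI)
  have "card {a, b, c} \<le> 3" by (simp add: card_insert_if)
  moreover have "3 \<le> card {a, b, c}" using dim_le_card'[of "{a, b, c}"] assms by simp
  ultimately have c: "card {a, b, c} = 3" by simp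
  then have d: "a \<noteq> b" "a \<noteq> c" "b \<noteq> c" by (auto simp: card_insert_if split: if_splits)
  have i: "independent {a, b, c}"
    by (rule card_le_dim_spanning[of _ "span {a, b, c}"]) (use assms c in \<open>auto intro: span_base\<close>)
  fix \<alpha> \<beta> \<gamma> assume 0: "\<alpha> *\<^sub>R a + \<beta> *\<^sub>R b + \<gamma> *\<^sub>R c = 0"
  define u where "u v = (if v = a then \<alpha> else if v = b then \<beta> else \<gamma>)" for v
  have "(\<Sum>v\<in>{a, b, c}. u v *\<^sub>R v) = 0" using 0 d by (simp add: u_def add.assoc)
  then have "\<forall>v\<in>{a, b, c}. u v = 0" using independentD[OF i, of "{a,b,c}" u] by auto
  then show "\<alpha> = 0 \<and> \<beta> = 0 \<and> \<gamma> = 0" using d by (auto simp: u_def split: if_splits)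
qed

lemma span3_eqI:
  fixes a b c :: "'a::euclidean_space"
  assumes "indep3 a b c" "a \<in> E" "b \<in> E" "c \<in> E" "subspace E" "dim E = 3"
  shows "E = span {a, b, c}"
proof -
  have "span {a, b, c} \<subseteq> E" using assms by (intro span_minimal) auto
  then show ?thesis using assms dim_span3[OF assms(1)] subspace_dim_equal[of "span {a,b,c}" E]
    by (metis le_refl subspace_span)
qed

lemma linear_inner_repr:
  fixes g :: "real^4 \<Rightarrow> real" assumes "linear g" shows "\<exists>p. \<forall>w. g w = p \<bullet> w"
proof (intro exI allI)
  fix w
  have "g w = g (\<Sum>b\<in>Basis. (w \<bullet> b) *\<^sub>R b)" by (simp add: euclidean_representation)
  also have "\<dots> = (\<Sum>b\<in>Basis. (w \<bullet> b) * g b)"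
    using assms by (simp add: linear_sum linear_scale)
  also have "\<dots> = (\<Sum>b\<in>Basis. g b *\<^sub>R b) \<bullet> w"
    unfolding inner_sum_left inner_scaleR_left by (simp add: inner_commute mult.commute)
  finally show "g w = (\<Sum>b\<in>Basis. g b *\<^sub>R b) \<bullet> w" .
qed

text \<open>Coordinates with respect to a basis are written as inner products, so that
  differentiating them along a curve or evaluating them on combinations is bilinearity.\<close>

lemma dual4:
  fixes a b c d :: "real^4"
  assumes "indep4 a b c d"
  obtains p q r s where
    "p \<bullet> a = 1" "p \<bullet> b = 0" "p \<bullet> c = 0" "p \<bullet> d = 0"
    "q \<bullet> a = 0" "q \<bullet> b = 1" "q \<bullet> c = 0" "q \<bullet> d = 0"
    "r \<bullet> a = 0" "r \<bullet> b = 0" "r \<bullet> c = 1" "r \<bullet> d = 0"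
    "s \<bullet> a = 0" "s \<bullet> b = 0" "s \<bullet> c = 0" "s \<bullet> d = 1"
    "\<And>w. w = (p \<bullet> w) *\<^sub>R a + (q \<bullet> w) *\<^sub>R b + (r \<bullet> w) *\<^sub>R c + (s \<bullet> w) *\<^sub>R d"
proof -
  note I = indep4_independent[OF assms]
  have ne: "a \<noteq> b" "a \<noteq> c" "a \<noteq> d" "b \<noteq> c" "b \<noteq> d" "c \<noteq> d"
    using I(2) by (auto simp: card_insert_if split: if_splits)
  have ex: "\<exists>p::real^4. \<forall>e\<in>{a,b,c,d}. p \<bullet> e = (if e = f then 1 else 0)" for f
  proof -
    obtain g :: "real^4 \<Rightarrow> real" where "linear g" "\<forall>e\<in>{a,b,c,d}. g e = (if e = f then 1 else 0)"
      using linear_independent_extend[OF I(1), of "\<lambda>e. if e = f then 1 else 0"] by blast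
    then show ?thesis using linear_inner_repr by metis
  qed
  obtain p q r s :: "real^4" where
    p: "\<forall>e\<in>{a,b,c,d}. p \<bullet> e = (if e = a then 1 else 0)" and q: "\<forall>e\<in>{a,b,c,d}. q \<bullet> e = (if e = b then 1 else 0)"
    and r: "\<forall>e\<in>{a,b,c,d}. r \<bullet> e = (if e = c then 1 else 0)" and s: "\<forall>e\<in>{a,b,c,d}. s \<bullet> e = (if e = d then 1 else 0)"
    using ex[of a] ex[of b] ex[of c] ex[of d] by blast
  have "UNIV \<subseteq> span {a, b, c, d}"
    using card_eq_dim[of "{a,b,c,d}" UNIV] I by (simp add: dim_UNIV)
  then have "w \<in> span {a, b, c, d}" for w by blast
  then have ex4: "\<exists>\<alpha> \<beta> \<gamma> \<delta>. w = \<alpha> *\<^sub>R a + \<beta> *\<^sub>R b + \<gamma> *\<^sub>R c + \<delta> *\<^sub>R d" for w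
    by (simp add: span_breakdown_eq algebra_simps)
  have w: "w = (p \<bullet> w) *\<^sub>R a + (q \<bullet> w) *\<^sub>R b + (r \<bullet> w) *\<^sub>R c + (s \<bullet> w) *\<^sub>R d" for w
  proof -
    obtain \<alpha> \<beta> \<gamma> \<delta> where w: "w = \<alpha> *\<^sub>R a + \<beta> *\<^sub>R b + \<gamma> *\<^sub>R c + \<delta> *\<^sub>R d"
      using ex4 by blast
    show ?thesis using p q r s ne unfolding w by (simp add: inner_add_right)
  qed
  show ?thesis by (rule that[of p q r s]) (use p q r s ne w in auto)
qed

lemma indep3_extend:
  fixes a b c :: "real^4" assumes "indep3 a b c" obtains d where "indep4 a b c d"
proof -
  have "span {a, b, c} \<noteq> UNIV"
  proof
    assume "span {a, b, c} = UNIV"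
    then have "dim (UNIV :: (real^4) set) = 3" using dim_span3[OF assms] by simp
    then show False by (simp only: dim_UNIV) simp
  qed
  then obtain d where d: "d \<notin> span {a, b, c}" by blast
  have "indep4 a b c d" unfolding indep4_def
  proof (intro allI impI)
    fix \<alpha> \<beta> \<gamma> \<delta> assume 0: "\<alpha> *\<^sub>R a + \<beta> *\<^sub>R b + \<gamma> *\<^sub>R c + \<delta> *\<^sub>R d = 0"
    have "\<delta> = 0"
    proof (rule ccontr)
      assume "\<delta> \<noteq> 0"
      have "\<delta> *\<^sub>R d = - (\<alpha> *\<^sub>R a + \<beta> *\<^sub>R b + \<gamma> *\<^sub>R c)" using 0 by (simp add: add_eq_0_iff)
      moreover have "- (\<alpha> *\<^sub>R a + \<beta> *\<^sub>R b + \<gamma> *\<^sub>R c) \<in> span {a, b, c}"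
        using mem_span3 by (blast intro: span_neg)
      ultimately have "inverse \<delta> *\<^sub>R (\<delta> *\<^sub>R d) \<in> span {a, b, c}" using span_scale by metis
      then show False using d \<open>\<delta> \<noteq> 0\<close> by simp
    qed
    with 0 assms show "\<alpha> = 0 \<and> \<beta> = 0 \<and> \<gamma> = 0 \<and> \<delta> = 0" by (simp add: indep3_def)
  qed
  then show ?thesis by (rule that)
qed

lemma hyperplane_normal:
  fixes E :: "(real^4) set" assumes "subspace E" "dim E = 3"
  obtains n where "n \<noteq> 0" "E = {w. n \<bullet> w = 0}"
proof -
  have "dim E < DIM(real^4)" using assms by simp
  then obtain n where n: "n \<noteq> 0" "\<And>y. y \<in> span E \<Longrightarrow> orthogonal n y"
    by (rule orthogonal_to_subspace_exists) blast
  have "E \<subseteq> {w. n \<bullet> w = 0}" using n(2) span_base[of _ E] by (auto simp: orthogonal_def)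
  moreover have "dim {w. n \<bullet> w = 0} = 3" using dim_hyperplane[OF n(1)] by simp
  ultimately have "E = {w. n \<bullet> w = 0}"
    using subspace_dim_equal[OF assms(1) subspace_hyperplane[of n]] assms(2) by simp
  then show ?thesis using n(1) that by blast
qed

lemma plane_basis:
  fixes V :: "(real^4) set" assumes "subspace V" "dim V = 2"
  obtains a b where "indep2 a b" "V = span {a, b}"
proof -
  obtain B where B: "B \<subseteq> V" "independent B" "V \<subseteq> span B" "card B = dim V" by (rule basis_exists)
  then obtain a b where ab: "B = {a, b}" "a \<noteq> b" using assms(2) by (metis card_2_iff)
  have "V = span {a, b}" using B ab assms(1) by (metis span_subspace)
  moreover have "indep2 a b" unfolding indep2_def
  proof (intro allI impI)
    fix \<alpha> \<beta> assume 0: "\<alpha> *\<^sub>R a + \<beta> *\<^sub>R b = 0"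
    define u where "u v = (if v = a then \<alpha> else \<beta>)" for v
    have "(\<Sum>v\<in>B. u v *\<^sub>R v) = 0" using 0 ab by (simp add: u_def)
    moreover have "finite B" using ab(1) by simp
    ultimately have "\<forall>v\<in>B. u v = 0" using independentD[OF B(2) _ subset_refl, of u] by blast
    then show "\<alpha> = 0 \<and> \<beta> = 0" using ab by (auto simp: u_def split: if_splits)
  qed
  ultimately show ?thesis using that by blast
qed

lemma subspace_dim1:
  assumes "subspace V" "dim V = 1" obtains a where "a \<noteq> 0" "V = span {a}"
proof -
  obtain B where B: "B \<subseteq> V" "independent B" "V \<subseteq> span B" "card B = dim V" by (rule basis_exists)
  then obtain a where a: "B = {a}" using assms(2) by (metis card_1_singletonE)
  then show ?thesis using B assms(1) that[of a] span_subspace[of B V] dependent_zero by auto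
qed

lemma span1_eq:
  fixes v w :: "'a::real_vector"
  shows "span {v} = span {w} \<longleftrightarrow> (\<exists>c. c \<noteq> 0 \<and> v = c *\<^sub>R w)"
proof
  assume e: "span {v} = span {w}"
  then obtain c d where c: "v = c *\<^sub>R w" "w = d *\<^sub>R v"
    by (metis mem_span1 span_base singletonI)
  show "\<exists>c. c \<noteq> 0 \<and> v = c *\<^sub>R w"
  proof (cases "c = 0")
    case True
    \<comment> \<open>Here \<open>v\<close> vanishes and with it \<open>w\<close>, which is a
      multiple of \<open>v\<close>.\<close>
    then show ?thesis using c by (intro exI[of _ 1]) simp
  qed (use c in blast)
next
  assume "\<exists>c. c \<noteq> 0 \<and> v = c *\<^sub>R w"
  then show "span {v} = span {w}" using span_image_scale[of "{w}" "\<lambda>_. c" for c] by (metis finite.emptyI finite_insert image_insert image_empty singletonD span_image_scale)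
qed

lemma span1_rp3: "v \<noteq> 0 \<Longrightarrow> span {v} \<in> rp3"
  by (auto simp: rp3_def dim_eq_card_independent)

text \<open>Openness of linear independence is read off the determinant.\<close>

lemma indep4_det:
  fixes a b c d :: "real^4"
  shows "indep4 a b c d \<longleftrightarrow> det (\<chi> i::4. if i = 1 then a else if i = 2 then b else if i = 3 then c else d) \<noteq> 0"
    (is "_ \<longleftrightarrow> det ?A \<noteq> 0")
proof -
  have "det ?A \<noteq> 0 \<longleftrightarrow> (\<exists>B. ?A ** B = mat 1)"
    unfolding invertible_det_nz[symmetric] invertible_right_inverse ..
  also have "\<dots> \<longleftrightarrow> (\<forall>f. (\<Sum>i\<in>UNIV. f i *s row i ?A) = 0 \<longrightarrow> (\<forall>i. f i = 0))"
    by (rule matrix_right_invertible_independent_rows)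
  also have "\<dots> \<longleftrightarrow> (\<forall>f::4\<Rightarrow>real. f 1 *\<^sub>R a + f 2 *\<^sub>R b + f 3 *\<^sub>R c + f 4 *\<^sub>R d = 0 \<longrightarrow>
      f 1 = 0 \<and> f 2 = 0 \<and> f 3 = 0 \<and> f 4 = 0)"
    by (simp add: sum_4 forall_4 row_def scalar_mult_eq_scaleR)
  also have "\<dots> \<longleftrightarrow> indep4 a b c d"
  proof
    assume L: "\<forall>f::4\<Rightarrow>real. f 1 *\<^sub>R a + f 2 *\<^sub>R b + f 3 *\<^sub>R c + f 4 *\<^sub>R d = 0 \<longrightarrow>
      f 1 = 0 \<and> f 2 = 0 \<and> f 3 = 0 \<and> f 4 = 0"
    show "indep4 a b c d" unfolding indep4_def
    proof (intro allI impI)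
      fix \<alpha> \<beta> \<gamma> \<delta> assume "\<alpha> *\<^sub>R a + \<beta> *\<^sub>R b + \<gamma> *\<^sub>R c + \<delta> *\<^sub>R d = 0"
      then show "\<alpha> = 0 \<and> \<beta> = 0 \<and> \<gamma> = 0 \<and> \<delta> = 0"
        using L[rule_format, of "\<lambda>i. if i = 1 then \<alpha> else if i = 2 then \<beta> else if i = 3 then \<gamma> else \<delta>"] by simp
    qed
  qed (simp add: indep4_def)
  finally show ?thesis by blast
qed

text \<open>Genericity speaks about the closed parameter square, while patches have to extend to an
  open neighbourhood of it; compactness carries nonvanishing from the one to the other.\<close>

lemma nonzero_on_unit_nhd:
  fixes f :: "real \<Rightarrow> real"
  assumes "e0 > 0" "continuous_on {-e0<..<1+e0} f" "\<And>u. u \<in> {0..1} \<Longrightarrow> f u \<noteq> 0"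
  obtains e where "e > 0" "e \<le> e0" "\<And>u. u \<in> {-e<..<1+e} \<Longrightarrow> f u \<noteq> 0"
proof -
  define S where "S = {-e0<..<1+e0} \<inter> f -` (- {0})"
  have "open S" unfolding S_def
    using assms(2) by (rule continuous_open_preimage) auto
  moreover have "{0..1} \<subseteq> S" using assms by (auto simp: S_def)
  ultimately obtain e where e: "e > 0" "(\<Union>x\<in>{0..1::real}. ball x e) \<subseteq> S"
    using compact_subset_open_imp_ball_epsilon_subset[of "{0..1::real}" S] compact_Icc by metis
  have "f u \<noteq> 0" if "u \<in> {-min e e0<..<1+min e e0}" for u
  proof -
    have "u \<in> (\<Union>x\<in>{0..1::real}. ball x e)"
    proof (rule UN_I[of "max 0 (min 1 u)"])
      show "u \<in> ball (max 0 (min 1 u)) e" using that e(1) by (auto simp: dist_real_def max_def min_def split: if_splits)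
    qed simp
    then have "u \<in> S" using e(2) by blast
    then show ?thesis by (simp add: S_def)
  qed
  then show ?thesis using e(1) assms(1) by (intro that[of "min e e0"]) auto
qed

lemma nonzero_on_cube_nhd:
  fixes f :: "real^3 \<Rightarrow> 'a::real_normed_vector"
  assumes "continuous_on UNIV f" "\<And>u. u \<in> cube \<Longrightarrow> f u \<noteq> 0"
  obtains e where "e > 0" "\<And>u. u \<in> cube_nhd e \<Longrightarrow> f u \<noteq> 0"
proof -
  have c: "compact cube"
  proof -
    have "cube = cbox 0 (\<chi> r. 1)" by (auto simp: cube_def mem_box_cart)
    then show ?thesis by (metis compact_cbox)
  qed
  have "open (f -` (- {0}))" using assms(1) by (intro open_vimage) auto
  moreover have "cube \<subseteq> f -` (- {0})" using assms(2) by auto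
  ultimately obtain e where e: "e > 0" "(\<Union>x\<in>cube. ball x e) \<subseteq> f -` (- {0})"
    using compact_subset_open_imp_ball_epsilon_subset[OF c] by metis
  \<comment> \<open>The quarter leaves room for the sum of three coordinate errors, which bounds the
    distance from \<open>u\<close> to its nearest point \<open>w\<close> in the cube.\<close>
  have "f u \<noteq> 0" if u: "u \<in> cube_nhd (e/4)" for u
  proof -
    define w :: "real^3" where "w = (\<chi> r. max 0 (min 1 (u $ r)))"
    have d: "\<bar>(w - u) $ r\<bar> \<le> e/4" for r
      using u[unfolded cube_nhd_def, simplified, rule_format, of r] e(1) by (auto simp: w_def max_def min_def)
    have "norm (w - u) \<le> (\<Sum>r\<in>UNIV. \<bar>(w - u) $ r\<bar>)" by (rule norm_le_l1_cart)
    also have "\<dots> \<le> 3 * (e / 4)" using d[of 1] d[of 2] d[of 3] by (simp add: sum_3)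
    also have "\<dots> < e" using e(1) by simp
    finally have "u \<in> ball w e" by (simp add: dist_norm)
    moreover have "w \<in> cube" by (auto simp: w_def cube_def)
    ultimately show ?thesis using e(2) by blast
  qed
  then show ?thesis using e(1) by (intro that[of "e/4"]) auto
qed

section \<open>Conic arcs in Bernstein form\<close>

text \<open>The middle coefficient lacks the factor 2 of a Bezier curve. With this scaling the
  product of the outer coordinates is the square of the middle one, and the sum of the coordinates
  with weights 1, 2, 1 is constantly 1, which recovers scale and parameter of a point.\<close>

definition bern :: "'a::real_vector \<Rightarrow> 'a \<Rightarrow> 'a \<Rightarrow> real \<Rightarrow> 'a" where
  "bern A B C u = (1 - u)\<^sup>2 *\<^sub>R A + (u * (1 - u)) *\<^sub>R B + u\<^sup>2 *\<^sub>R C"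

definition dbern :: "'a::real_vector \<Rightarrow> 'a \<Rightarrow> 'a \<Rightarrow> real \<Rightarrow> 'a" where
  "dbern A B C u = (- 2 * (1 - u)) *\<^sub>R A + (1 - 2 * u) *\<^sub>R B + (2 * u) *\<^sub>R C"

definition conic_arc :: "real^4 \<Rightarrow> real^4 \<Rightarrow> real^4 \<Rightarrow> pt set" where
  "conic_arc A B C = (\<lambda>u. span {bern A B C u}) ` {0..1}"

lemma bern_0 [simp]: "bern A B C 0 = A" and bern_1 [simp]: "bern A B C 1 = C"
  by (simp_all add: bern_def)

lemma bern_half: "bern A B C (1/2) = (1/4) *\<^sub>R (A + B + C)"
  by (simp add: bern_def power2_eq_square algebra_simps)

lemma bern_add: "bern A B C u + bern A' B' C' u = bern (A + A') (B + B') (C + C') u"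
  by (simp add: bern_def algebra_simps)

lemma bern_scale: "c *\<^sub>R bern A B C u = bern (c *\<^sub>R A) (c *\<^sub>R B) (c *\<^sub>R C) u"
  by (simp add: bern_def algebra_simps)

lemma bern_scale_left: "bern (a::real) b c u *\<^sub>R A = bern (a *\<^sub>R A) (b *\<^sub>R A) (c *\<^sub>R A) u"
  by (simp add: bern_def algebra_simps)

lemma bern_real: "bern (a::real) b c u = (1 - u)\<^sup>2 * a + u * (1 - u) * b + u\<^sup>2 * c"
  by (simp add: bern_def)

lemma bern_deriv: "(bern A B C has_vector_derivative dbern A B C u) (at u within S)"
  unfolding bern_def dbern_def
  by (rule derivative_eq_intros refl | simp add: algebra_simps power2_eq_square)+

lemma smooth_on_bern:
  assumes "smooth_on U f" shows "smooth_on U (\<lambda>x. bern A B C (f x))"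
  unfolding bern_def by (intro smooth_intros assms)

lemma bern_span: "bern A B C u \<in> span {A, B, C}"
  unfolding bern_def mem_span3 by blast

lemma bern_indep_tangent:
  assumes "indep3 A B C" shows "indep2 (bern A B C u) (dbern A B C u)"
  unfolding indep2_def
proof (intro allI impI)
  fix \<alpha> \<beta> assume 0: "\<alpha> *\<^sub>R bern A B C u + \<beta> *\<^sub>R dbern A B C u = 0"
  have "(\<alpha> * (1-u)\<^sup>2 - 2 * \<beta> * (1-u)) *\<^sub>R A + (\<alpha> * (u * (1-u)) + \<beta> * (1 - 2*u)) *\<^sub>R B
      + (\<alpha> * u\<^sup>2 + 2 * \<beta> * u) *\<^sub>R C = \<alpha> *\<^sub>R bern A B C u + \<beta> *\<^sub>R dbern A B C u"
    by (simp add: bern_def dbern_def algebra_simps)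
  with 0 have e: "\<alpha> * (1-u)\<^sup>2 - 2 * \<beta> * (1-u) = 0" "\<alpha> * (u * (1-u)) + \<beta> * (1 - 2*u) = 0"
      "\<alpha> * u\<^sup>2 + 2 * \<beta> * u = 0"
    using assms unfolding indep3_def by metis+
  have "\<alpha> = 0" using e by algebra
  moreover have "\<beta> = 0" using e by algebra
  ultimately show "\<alpha> = 0 \<and> \<beta> = 0" by blast
qed

lemma bern_nz: "indep3 A B C \<Longrightarrow> bern A B C u \<noteq> 0"
  using bern_indep_tangent[of A B C u] unfolding indep2_def
  by (metis add.right_neutral scaleR_zero_left scaleR_zero_right zero_neq_one)

lemma bern_parallel:
  assumes "indep3 A B C" "bern A B C s = c *\<^sub>R bern A B C u" shows "s = u" "c = 1"
proof -
  have "((1-s)\<^sup>2 - c * (1-u)\<^sup>2) *\<^sub>R A + (s*(1-s) - c * (u*(1-u))) *\<^sub>R B + (s\<^sup>2 - c * u\<^sup>2) *\<^sub>R C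
     = bern A B C s - c *\<^sub>R bern A B C u"
    by (simp add: bern_def algebra_simps)
  with assms have e: "(1-s)\<^sup>2 - c * (1-u)\<^sup>2 = 0" "s*(1-s) - c * (u*(1-u)) = 0" "s\<^sup>2 - c * u\<^sup>2 = 0"
    unfolding indep3_def by (metis diff_self)+
  show "c = 1" using e by algebra
  show "s = u" using e by algebra
qed

lemma conic_arc_join: "join (conic_arc A B C) = span {A, B, C}"
proof
  show "join (conic_arc A B C) \<subseteq> span {A, B, C}"
    unfolding join_def conic_arc_def
  proof (rule span_minimal)
    show "\<Union>((\<lambda>u. span {bern A B C u}) ` {0..1}) \<subseteq> span {A, B, C}"
      by (auto simp: mem_span1 intro!: span_scale bern_span)
  qed simp
  have m: "bern A B C u \<in> join (conic_arc A B C)" if "u \<in> {0..1}" for u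
    unfolding join_def conic_arc_def using that by (intro span_base) (auto intro: span_base)
  have "A \<in> join (conic_arc A B C)" "C \<in> join (conic_arc A B C)" using m[of 0] m[of 1] by auto
  \<comment> \<open>The middle control point need not lie on the arc; it is recovered from the point
    at parameter 1/2.\<close>
  moreover have "4 *\<^sub>R bern A B C (1/2) - A - C = B" by (simp add: bern_half)
  moreover have "4 *\<^sub>R bern A B C (1/2) - A - C \<in> join (conic_arc A B C)"
    using m[of "1/2"] calculation(1,2) unfolding join_def by (intro span_diff span_scale) auto
  ultimately have "A \<in> join (conic_arc A B C)" "C \<in> join (conic_arc A B C)" "B \<in> join (conic_arc A B C)" by simp_all
  then show "span {A, B, C} \<subseteq> join (conic_arc A B C)"
    unfolding join_def by (intro span_minimal) auto
qed

text \<open>Independence of the control points says that the span of the arc has dimension 3, and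
  this depends on the arc only as a set of points.\<close>

lemma conic_arc_indep:
  assumes "indep3 A' B' C'" "conic_arc A B C = conic_arc A' B' C'" shows "indep3 A B C"
  using assms conic_arc_join dim_span3 indep3_spanI by metis

text \<open>Fixing the first vector and the end point leaves the projective parameter changes that
  fix 0 and 1. These are u to r u / (1 - u + r u), and they multiply \<open>B\<close> by r and
  \<open>C\<close> by r^2.\<close>

lemma conic_arc_rep_unique:
  assumes I: "indep3 A B C" and a: "conic_arc A B C = conic_arc A B' C'" and C: "C' = \<gamma> *\<^sub>R C"
  obtains r where "r > 0" "B' = r *\<^sub>R B" "C' = r\<^sup>2 *\<^sub>R C"
proof -
  have "B' \<in> span {A, B, C}" using a conic_arc_join[of A B C] conic_arc_join[of A B' C'] span_superset[of "{A,B',C'}"] by auto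
  then obtain b0 b1 b2 where B: "B' = b0 *\<^sub>R A + b1 *\<^sub>R B + b2 *\<^sub>R C" by (auto simp: mem_span3)
  have "\<gamma> \<noteq> 0"
    using conic_arc_indep[OF I a[symmetric]] C unfolding indep3_def
    by (metis add.right_neutral scaleR_zero_left scaleR_zero_right zero_neq_one)
  have key: "\<exists>c s. c \<noteq> 0 \<and> s \<in> {0..1} \<and> (1-u)\<^sup>2 + u*(1-u)*b0 = c * (1-s)\<^sup>2 \<and> u*(1-u)*b1 = c * (s*(1-s))
      \<and> u\<^sup>2 * \<gamma> + u*(1-u)*b2 = c * s\<^sup>2" if u: "u \<in> {0..1}" for u
  proof -
    have "span {bern A B' C' u} \<in> conic_arc A B C" using a u by (auto simp: conic_arc_def)
    then obtain s c where s: "s \<in> {0..1}" "c \<noteq> 0" "bern A B' C' u = c *\<^sub>R bern A B C s"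
      by (auto simp: conic_arc_def span1_eq)
    have "((1-u)\<^sup>2 + u*(1-u)*b0 - c * (1-s)\<^sup>2) *\<^sub>R A + (u*(1-u)*b1 - c * (s*(1-s))) *\<^sub>R B
       + (u\<^sup>2 * \<gamma> + u*(1-u)*b2 - c * s\<^sup>2) *\<^sub>R C = bern A B' C' u - c *\<^sub>R bern A B C s"
      unfolding B C by (simp add: bern_def algebra_simps)
    then have "(1-u)\<^sup>2 + u*(1-u)*b0 - c * (1-s)\<^sup>2 = 0" "u*(1-u)*b1 - c * (s*(1-s)) = 0"
       "u\<^sup>2 * \<gamma> + u*(1-u)*b2 - c * s\<^sup>2 = 0"
      using I s(3) unfolding indep3_def by (metis diff_self)+
    then show ?thesis using s by (intro exI[of _ c] exI[of _ s]) simp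
  qed
  \<comment> \<open>The equation of the old conic, evaluated along the new arc. The ends match
    already, so three sample values of u determine the unknown coefficients.\<close>
  have sq: "(u*(1-u)*b1)\<^sup>2 = ((1-u)\<^sup>2 + u*(1-u)*b0) * (u\<^sup>2 * \<gamma> + u*(1-u)*b2)" if "u \<in> {0..1}" for u
    using key[OF that] by (auto simp: power2_eq_square)
  have s1: "b1\<^sup>2 = (1 + b0) * (\<gamma> + b2)" using sq[of "1/2"] by (simp add: power2_eq_square field_simps)
  have s2: "2 * b1\<^sup>2 = (2 + b0) * (\<gamma> + 2*b2)" using sq[of "1/3"] by (simp add: power2_eq_square field_simps)
  have s3: "2 * b1\<^sup>2 = (1 + 2*b0) * (2 * \<gamma> + b2)" using sq[of "2/3"] by (simp add: power2_eq_square field_simps)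
  have "b2 = 0" "b0 * \<gamma> = 0" using s1 s2 s3 by algebra+
  with \<open>\<gamma> \<noteq> 0\<close> have "b0 = 0" by simp
  then have g: "\<gamma> = b1\<^sup>2" using s1 \<open>b2 = 0\<close> by simp
  obtain c s where cs: "s \<in> {0..1}" "1/4 = c * (1-s)\<^sup>2" "b1/4 = c * (s*(1-s))"
    using key[of "1/2"] \<open>b0 = 0\<close> by (auto simp: power2_eq_square)
  \<comment> \<open>The equation of the conic fixes \<open>b1\<close> only up to sign. The sign is
    decided by the arc, whose coordinates are nonnegative.\<close>
  have "c \<ge> 0"
  proof (rule ccontr)
    assume "\<not> c \<ge> 0"
    then have "c * (1-s)\<^sup>2 \<le> 0" by (intro mult_nonpos_nonneg) auto
    then show False using cs(2) by simp
  qed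
  then have "b1 / 4 \<ge> 0" unfolding cs(3) using cs(1) by auto
  then have "b1 > 0" using g \<open>\<gamma> \<noteq> 0\<close> by (cases "b1 = 0") auto
  then show ?thesis using that[of b1] B C g \<open>b0 = 0\<close> \<open>b2 = 0\<close> by simp
qed

section \<open>Translational nets in homogeneous coordinates\<close>

text \<open>Up to the factor \<open>l u * m v\<close> this is the translation surface \<open>p / l + q / m - x\<close>.\<close>

definition tnet ::
  "(real \<Rightarrow> real^4) \<Rightarrow> (real \<Rightarrow> real) \<Rightarrow> (real \<Rightarrow> real^4) \<Rightarrow> (real \<Rightarrow> real) \<Rightarrow> real^4 \<Rightarrow> real \<Rightarrow> real \<Rightarrow> real^4"
  where "tnet p l q m x u v = m v *\<^sub>R p u + l u *\<^sub>R q v - (l u * m v) *\<^sub>R x"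

lemma tnet_swap: "tnet p l q m x u v = tnet q m p l x v u"
  by (simp add: tnet_def algebra_simps)

lemma scaleR_nth_has_derivative:
  fixes m :: "real \<Rightarrow> real" and p :: "real \<Rightarrow> real^4" and w :: "real^3"
  assumes "(p has_vector_derivative p') (at (w $ j))" "(m has_vector_derivative m') (at (w $ k))"
  shows "((\<lambda>w. m (w $ k) *\<^sub>R p (w $ j)) has_derivative
     (\<lambda>h. m (w $ k) *\<^sub>R (h $ j *\<^sub>R p') + (h $ k *\<^sub>R m') *\<^sub>R p (w $ j))) (at w)"
proof -
  have n: "((\<lambda>w::real^3. w $ r) has_derivative (\<lambda>h. h $ r)) (at w)" for r
    by (rule bounded_linear_imp_has_derivative[OF bounded_linear_vec_nth])
  have "((\<lambda>w. m (w $ k)) has_derivative (\<lambda>h. h $ k *\<^sub>R m')) (at w)"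
    using has_derivative_compose[OF n, of m "\<lambda>h. h *\<^sub>R m'"] assms(2)
    unfolding has_vector_derivative_def by blast
  moreover have "((\<lambda>w. p (w $ j)) has_derivative (\<lambda>h. h $ j *\<^sub>R p')) (at w)"
    using has_derivative_compose[OF n, of p "\<lambda>h. h *\<^sub>R p'"] assms(1)
    unfolding has_vector_derivative_def by blast
  ultimately show ?thesis by (rule has_derivative_scaleR)
qed

lemma tnet_has_derivative:
  fixes w :: "real^3"
  assumes p: "(p has_vector_derivative p' (w $ j)) (at (w $ j))"
    and l: "(l has_vector_derivative l' (w $ j)) (at (w $ j))"
    and q: "(q has_vector_derivative q' (w $ k)) (at (w $ k))"
    and m: "(m has_vector_derivative m' (w $ k)) (at (w $ k))"
  shows "((\<lambda>w. tnet p l q m x (w $ j) (w $ k)) has_derivative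
     (\<lambda>h. h $ j *\<^sub>R tnet p' l' q m x (w $ j) (w $ k) + h $ k *\<^sub>R tnet p l q' m' x (w $ j) (w $ k))) (at w)"
proof -
  have mx: "((\<lambda>v. m v *\<^sub>R x) has_vector_derivative m' (w $ k) *\<^sub>R x) (at (w $ k))"
    using has_derivative_scaleR_left[OF m[unfolded has_vector_derivative_def], of x]
    unfolding has_vector_derivative_def by simp
  have "((\<lambda>w. m (w $ k) *\<^sub>R p (w $ j) + l (w $ j) *\<^sub>R q (w $ k) - l (w $ j) *\<^sub>R (m (w $ k) *\<^sub>R x)) has_derivative
     (\<lambda>h. (m (w $ k) *\<^sub>R (h $ j *\<^sub>R p' (w $ j)) + (h $ k *\<^sub>R m' (w $ k)) *\<^sub>R p (w $ j)) +
       (l (w $ j) *\<^sub>R (h $ k *\<^sub>R q' (w $ k)) + (h $ j *\<^sub>R l' (w $ j)) *\<^sub>R q (w $ k)) -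
       (l (w $ j) *\<^sub>R (h $ k *\<^sub>R (m' (w $ k) *\<^sub>R x)) + (h $ j *\<^sub>R l' (w $ j)) *\<^sub>R (m (w $ k) *\<^sub>R x)))) (at w)"
    by (intro has_derivative_diff has_derivative_add scaleR_nth_has_derivative assms mx)
  then show ?thesis by (simp add: tnet_def algebra_simps)
qed

lemma pd_eqI:
  assumes "(F has_derivative D) (at w)" shows "pd r F w = D (axis r 1)"
  unfolding pd_def using frechet_derivative_at[OF assms] by simp

lemma pd_cong:
  assumes "open U" "w \<in> U" "\<And>x. x \<in> U \<Longrightarrow> F x = G x" "(G has_derivative D) (at w)"
  shows "pd r F w = D (axis r 1)"
proof -
  have "(F has_derivative D) (at w)"
    by (rule has_derivative_transform_within_open[OF assms(4,1,2)]) (simp add: assms(3))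
  then show ?thesis by (rule pd_eqI)
qed

lemma tangent_plane_eq:
  assumes "distinct3 i j k" shows "tangent_plane i F w = span {F w, pd j F w, pd k F w}"
proof -
  have "{pd r F w | r. r \<noteq> i} = {pd j F w, pd k F w}"
    unfolding setcompr_eq_image distinct3_other[OF assms] by simp
  then show ?thesis by (simp add: tangent_plane_def)
qed

text \<open>The derivatives are parameters of the locale, so that the same computations serve
  Bernstein curves and their regular reparametrizations.\<close>

locale smooth_tnet =
  fixes i j k :: 3 and p p' q q' :: "real \<Rightarrow> real^4" and l l' m m' :: "real \<Rightarrow> real" and x :: "real^4"
    and e :: real
  assumes dist: "distinct3 i j k"
    and smooth: "smooth_on {-e<..<1+e} p" "smooth_on {-e<..<1+e} l"
      "smooth_on {-e<..<1+e} q" "smooth_on {-e<..<1+e} m"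
      "smooth_on {-e<..<1+e} p'" "smooth_on {-e<..<1+e} l'"
      "smooth_on {-e<..<1+e} q'" "smooth_on {-e<..<1+e} m'"
    and deriv: "\<And>u. u \<in> {-e<..<1+e} \<Longrightarrow> (p has_vector_derivative p' u) (at u)"
      "\<And>u. u \<in> {-e<..<1+e} \<Longrightarrow> (l has_vector_derivative l' u) (at u)"
      "\<And>u. u \<in> {-e<..<1+e} \<Longrightarrow> (q has_vector_derivative q' u) (at u)"
      "\<And>u. u \<in> {-e<..<1+e} \<Longrightarrow> (m has_vector_derivative m' u) (at u)"
begin

abbreviation "F \<equiv> \<lambda>w::real^3. tnet p l q m x (w $ j) (w $ k)"

lemma ne: "i \<noteq> j" "i \<noteq> k" "j \<noteq> k" "k \<noteq> j"
  using dist by (auto simp: distinct3_def)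

lemma nhd_nth: "w \<in> cube_nhd e \<Longrightarrow> w $ r \<in> {-e<..<1+e}"
  by (auto simp: cube_nhd_def)

lemma smooth_nth:
  assumes "smooth_on {-e<..<1+e} f" shows "smooth_on (cube_nhd e) (\<lambda>w::real^3. f (w $ r))"
proof -
  have "smooth_on (cube_nhd e) (\<lambda>w::real^3. f (0 + w $ r))"
    by (rule smooth_on_affine[OF assms bounded_linear_vec_nth]) (simp add: cube_nhd_def)
  then show ?thesis by simp
qed

lemma smooth_F: "smooth_on (cube_nhd e) F"
  unfolding tnet_def by (intro smooth_intros smooth_nth smooth)

lemma pd_F:
  assumes "w \<in> cube_nhd e"
  shows "pd j F w = tnet p' l' q m x (w $ j) (w $ k)" "pd k F w = tnet p l q' m' x (w $ j) (w $ k)"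
proof -
  note n = nhd_nth[OF assms]
  note D = tnet_has_derivative[where p = p and p' = p' and l = l and l' = l' and q = q and q' = q' and m = m
      and m' = m' and w = w and j = j and k = k and x = x, OF deriv(1)[OF n] deriv(2)[OF n] deriv(3)[OF n] deriv(4)[OF n]]
  show "pd j F w = tnet p' l' q m x (w $ j) (w $ k)" "pd k F w = tnet p l q' m' x (w $ j) (w $ k)"
    using pd_eqI[OF D, of j] pd_eqI[OF D, of k] ne by (simp_all add: axis_def)
qed

lemma pd_pd_F:
  assumes "w \<in> cube_nhd e"
  shows "pd j (pd k F) w = tnet p' l' q' m' x (w $ j) (w $ k)" "pd k (pd j F) w = tnet p' l' q' m' x (w $ j) (w $ k)"
proof -
  have o: "open {-e<..<1+e}" by simp
  obtain p'' where p'': "\<And>u. u \<in> {-e<..<1+e} \<Longrightarrow> (p' has_vector_derivative p'' u) (at u)"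
    using smooth_on_real_deriv[OF o smooth(5)] by metis
  obtain l'' where l'': "\<And>u. u \<in> {-e<..<1+e} \<Longrightarrow> (l' has_vector_derivative l'' u) (at u)"
    using smooth_on_real_deriv[OF o smooth(6)] by metis
  obtain q'' where q'': "\<And>u. u \<in> {-e<..<1+e} \<Longrightarrow> (q' has_vector_derivative q'' u) (at u)"
    using smooth_on_real_deriv[OF o smooth(7)] by metis
  obtain m'' where m'': "\<And>u. u \<in> {-e<..<1+e} \<Longrightarrow> (m' has_vector_derivative m'' u) (at u)"
    using smooth_on_real_deriv[OF o smooth(8)] by metis
  note n = nhd_nth[OF assms]
  note D1 = tnet_has_derivative[where p = p and p' = p' and l = l and l' = l' and q = q' and q' = q'' and m = m'
      and m' = m'' and w = w and j = j and k = k and x = x, OF deriv(1)[OF n] deriv(2)[OF n] q''[OF n] m''[OF n]]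
  note D2 = tnet_has_derivative[where p = p' and p' = p'' and l = l' and l' = l'' and q = q and q' = q' and m = m
      and m' = m' and w = w and j = j and k = k and x = x, OF p''[OF n] l''[OF n] deriv(3)[OF n] deriv(4)[OF n]]
  show "pd j (pd k F) w = tnet p' l' q' m' x (w $ j) (w $ k)"
    using pd_cong[OF cube_nhd_open assms pd_F(2) D1, of j] ne by (simp add: axis_def)
  show "pd k (pd j F) w = tnet p' l' q' m' x (w $ j) (w $ k)"
    using pd_cong[OF cube_nhd_open assms pd_F(1) D2, of k] ne by (simp add: axis_def)
qed

lemma tangent_plane_F:
  assumes "w \<in> cube_nhd e"
  shows "tangent_plane i F w = span {tnet p l q m x (w $ j) (w $ k), tnet p' l' q m x (w $ j) (w $ k),
    tnet p l q' m' x (w $ j) (w $ k)}"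
  using tangent_plane_eq[OF dist, of F w] pd_F[OF assms] by simp

lemma conj_param_F:
  assumes nz: "\<And>u. u \<in> {-e<..<1+e} \<Longrightarrow> l u \<noteq> 0" "\<And>u. u \<in> {-e<..<1+e} \<Longrightarrow> m u \<noteq> 0"
    and ind: "\<And>u v. u \<in> {-e<..<1+e} \<Longrightarrow> v \<in> {-e<..<1+e} \<Longrightarrow>
      indep3 (tnet p l q m x u v) (tnet p' l' q m x u v) (tnet p l q' m' x u v)"
  shows "conj_param i (cube_nhd e) F"
  unfolding conj_param_def
proof (intro conjI ballI allI impI)
  fix w assume w: "w \<in> cube_nhd e"
  show "dim (tangent_plane i F w) = 3"
    unfolding tangent_plane_F[OF w] by (intro dim_span3 ind nhd_nth w)
  fix j' k' assume d: "distinct3 i j' k'"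
  let ?u = "w $ j" and ?v = "w $ k"
  \<comment> \<open>After division by \<open>l u * m v\<close> the net is a function of u plus a
    function of v, whose mixed derivative vanishes; undoing the division produces these three
    coefficients.\<close>
  have "tnet p' l' q' m' x ?u ?v = (m' ?v / m ?v) *\<^sub>R tnet p' l' q m x ?u ?v
      + (l' ?u / l ?u) *\<^sub>R tnet p l q' m' x ?u ?v - (l' ?u * m' ?v / (l ?u * m ?v)) *\<^sub>R tnet p l q m x ?u ?v"
    using nz(1)[OF nhd_nth[OF w], of j] nz(2)[OF nhd_nth[OF w], of k]
    by (simp add: tnet_def scaleR_diff_right scaleR_add_right field_simps)
  also have "\<dots> \<in> tangent_plane i F w"
    unfolding tangent_plane_F[OF w] by (intro span_diff span_add span_scale span_base) auto
  finally have t: "tnet p' l' q' m' x ?u ?v \<in> tangent_plane i F w" .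
  have "j' = j \<and> k' = k \<or> j' = k \<and> k' = j"
    using d dist distinct3_cases[OF dist, of j'] distinct3_cases[OF dist, of k'] unfolding distinct3_def by metis
  then show "pd j' (pd k' F) w \<in> tangent_plane i F w"
    using t pd_pd_F[OF w] by auto
next
  fix w y assume "y \<in> line_at i w"
  then show "F y = F w" using dist by (auto simp: line_at_def distinct3_def)
qed (rule smooth_F)

end

section \<open>The quadratic cone through a conic\<close>

text \<open>In coordinates a, b, c dual to \<open>A\<close>, \<open>B\<close>, \<open>C\<close> the
  curve satisfies b^2 = a c. Reading this as an equation on the whole space, independent of the
  coordinate along \<open>L\<close>, gives the cone over the curve with vertex
  \<open>L\<close>.\<close>

lemma bern_cone:
  fixes A B C L :: "real^4"
  assumes "indep4 A B C L"
  obtains M where "quadratic_cone M" "is_conic {p\<in>rp3. p \<subseteq> span {A, B, C} \<and> (\<forall>v\<in>p. v \<bullet> (M *v v) = 0)}"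
    "\<And>u. bern A B C u \<bullet> (M *v bern A B C u) = 0" "\<And>u. M *v bern A B C u \<noteq> 0"
    "\<And>u. cone_tangent_plane M (bern A B C u) = span {bern A B C u, dbern A B C u, L}"
proof -
  obtain a b c d :: "real^4" where
    a: "a \<bullet> A = 1" "a \<bullet> B = 0" "a \<bullet> C = 0" "a \<bullet> L = 0" and
    b: "b \<bullet> A = 0" "b \<bullet> B = 1" "b \<bullet> C = 0" "b \<bullet> L = 0" and
    c: "c \<bullet> A = 0" "c \<bullet> B = 0" "c \<bullet> C = 1" "c \<bullet> L = 0" and
    w: "\<And>w. w = (a \<bullet> w) *\<^sub>R A + (b \<bullet> w) *\<^sub>R B + (c \<bullet> w) *\<^sub>R C + (d \<bullet> w) *\<^sub>R L"
    by (rule dual4[OF assms]) blast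
  define M :: "real^4^4" where "M = (\<chi> r s. 2 * (b $ r * b $ s) - a $ r * c $ s - c $ r * a $ s)"
  have Mv: "M *v v = (2 * (b \<bullet> v)) *\<^sub>R b - (c \<bullet> v) *\<^sub>R a - (a \<bullet> v) *\<^sub>R c" for v
    by (simp add: vec_eq_iff M_def matrix_vector_mult_def inner_vec_def sum_distrib_right sum_distrib_left
        sum_subtractf sum.distrib algebra_simps)
  have vM: "v \<bullet> (M *v u) = 2 * ((b \<bullet> v) * (b \<bullet> u)) - (a \<bullet> v) * (c \<bullet> u) - (c \<bullet> v) * (a \<bullet> u)" for v u
    unfolding Mv by (simp add: inner_diff_right inner_commute[of v] algebra_simps)
  have tr: "transpose M = M" by (simp add: transpose_def M_def vec_eq_iff algebra_simps)
  have ker: "M *v v = 0 \<longleftrightarrow> a \<bullet> v = 0 \<and> b \<bullet> v = 0 \<and> c \<bullet> v = 0" for v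
  proof
    assume "M *v v = 0"
    then have "A \<bullet> (M *v v) = 0" "B \<bullet> (M *v v) = 0" "C \<bullet> (M *v v) = 0" by simp_all
    then show "a \<bullet> v = 0 \<and> b \<bullet> v = 0 \<and> c \<bullet> v = 0" unfolding vM using a b c by simp
  qed (simp add: Mv)
  have Lnz: "L \<noteq> 0" using assms unfolding indep4_def by (metis add.right_neutral scaleR_zero_left scaleR_zero_right zero_neq_one)
  have "{v. M *v v = 0} = span {L}"
  proof (intro set_eqI iffI)
    fix v assume "v \<in> {v. M *v v = 0}"
    then have "a \<bullet> v = 0" "b \<bullet> v = 0" "c \<bullet> v = 0" by (auto simp: ker)
    then have "v = (d \<bullet> v) *\<^sub>R L" using w[of v] by simp
    then show "v \<in> span {L}" unfolding mem_span1 ..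
  next
    fix v assume "v \<in> span {L}"
    then show "v \<in> {v. M *v v = 0}" using a b c by (auto simp: ker mem_span1)
  qed
  then have "dim {v. M *v v = 0} = 1" using Lnz by (simp add: dim_eq_card_independent)
  then have qc: "quadratic_cone M" using tr by (simp add: quadratic_cone_def)
  have bu: "a \<bullet> bern A B C u = (1-u)\<^sup>2" "b \<bullet> bern A B C u = u * (1-u)" "c \<bullet> bern A B C u = u\<^sup>2" for u
    using a b c by (simp_all add: bern_def inner_add_right)
  have du: "a \<bullet> dbern A B C u = - 2 * (1-u)" "b \<bullet> dbern A B C u = 1 - 2 * u" "c \<bullet> dbern A B C u = 2 * u" for u
    using a b c by (simp_all add: dbern_def inner_add_right)
  have iso: "bern A B C u \<bullet> (M *v bern A B C u) = 0" for u
    unfolding vM bu by (simp add: power2_eq_square algebra_simps)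
  have nz: "M *v bern A B C u \<noteq> 0" for u
    unfolding ker bu by (cases "u = 0") auto
  have ct: "cone_tangent_plane M (bern A B C u) = span {bern A B C u, dbern A B C u, L}" for u
  proof -
    let ?n = "M *v bern A B C u"
    have i3: "indep3 (bern A B C u) (dbern A B C u) L"
      unfolding indep3_def
    proof (intro allI impI)
      fix \<alpha> \<beta> \<gamma> assume 0: "\<alpha> *\<^sub>R bern A B C u + \<beta> *\<^sub>R dbern A B C u + \<gamma> *\<^sub>R L = 0"
      have e: "(\<alpha> * (1-u)\<^sup>2 + \<beta> * (- 2 * (1-u))) *\<^sub>R A + (\<alpha> * (u*(1-u)) + \<beta> * (1 - 2*u)) *\<^sub>R B
         + (\<alpha> * u\<^sup>2 + \<beta> * (2*u)) *\<^sub>R C + \<gamma> *\<^sub>R L = 0"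
        using 0 by (simp add: bern_def dbern_def algebra_simps)
      have "\<alpha> *\<^sub>R bern A B C u + \<beta> *\<^sub>R dbern A B C u = 0" "\<gamma> = 0"
        using assms[unfolded indep4_def, rule_format, OF e] 0 by auto
      then show "\<alpha> = 0 \<and> \<beta> = 0 \<and> \<gamma> = 0"
        using bern_indep_tangent[OF indep4_D(2)[OF assms], of u] unfolding indep2_def by blast
    qed
    have "{w. w \<bullet> ?n = 0} = span {bern A B C u, dbern A B C u, L}"
    proof (rule span3_eqI[OF i3])
      show "bern A B C u \<in> {w. w \<bullet> ?n = 0}" using iso by simp
      show "dbern A B C u \<in> {w. w \<bullet> ?n = 0}"
        unfolding mem_Collect_eq vM bu du by (simp add: power2_eq_square field_simps)
      show "L \<in> {w. w \<bullet> ?n = 0}" unfolding mem_Collect_eq vM using a b c by simp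
      have h: "{w. w \<bullet> ?n = 0} = {w. ?n \<bullet> w = 0}" by (simp add: inner_commute)
      show "subspace {w. w \<bullet> ?n = 0}" unfolding h by (rule subspace_hyperplane)
      show "dim {w. w \<bullet> ?n = 0} = 3" unfolding h dim_hyperplane[OF nz] by simp
    qed
    then show ?thesis by (simp add: cone_tangent_plane_def)
  qed
  let ?E = "span {A, B, C}" and ?C = "{p\<in>rp3. p \<subseteq> span {A, B, C} \<and> (\<forall>v\<in>p. v \<bullet> (M *v v) = 0)}"
  have "is_conic ?C" unfolding is_conic_def
  proof (intro exI[of _ ?E] exI[of _ M] conjI ballI impI)
    show "dim ?E = 3" by (rule dim_span3[OF indep4_D(2)[OF assms]])
    fix v assume v: "v \<in> ?E" "\<forall>u\<in>?E. v \<bullet> (M *v u) = 0"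
    then obtain \<alpha> \<beta> \<gamma> where ve: "v = \<alpha> *\<^sub>R A + \<beta> *\<^sub>R B + \<gamma> *\<^sub>R C" by (auto simp: mem_span3)
    have "v \<bullet> (M *v A) = 0" "v \<bullet> (M *v B) = 0" "v \<bullet> (M *v C) = 0" using v(2) by (simp_all add: span_base)
    then show "v = 0" unfolding vM unfolding ve using a b c by (simp add: inner_add_right)
  next
    have "span {A} \<in> ?C"
    proof -
      have "A \<noteq> 0" using bern_nz[OF indep4_D(2)[OF assms], of 0] by simp
      moreover have "span {A} \<subseteq> ?E" by (rule span_mono) simp
      moreover have "v \<bullet> (M *v v) = 0" if v: "v \<in> span {A}" for v
      proof -
        obtain t where "v = t *\<^sub>R A" using v by (auto simp: mem_span1)
        then show ?thesis using a b c by (simp add: vM)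
      qed
      ultimately show ?thesis by (simp add: span1_rp3)
    qed
    then show "?C \<noteq> {}" by blast
  qed (use tr in auto)
  then show ?thesis using that[OF qc _ iso nz ct] by blast
qed

section \<open>Patches spanned by two conic arcs\<close>

text \<open>The kernel, in the plane of the first arc, of the form with values 1, \<open>l1\<close>,
  \<open>l2\<close> at \<open>x\<close>, \<open>z\<close>, \<open>y\<close>. For a patch in normal
  form it gives the characteristic line of the direction of this arc: passing from the first arc to
  a parallel conic multiplies these vectors by a scalar (case s = 0 of \<open>ctrl_linear\<close>),
  so all planes of the family contain them.\<close>

definition char_plane :: "real^4 \<Rightarrow> real^4 \<Rightarrow> real^4 \<Rightarrow> real \<Rightarrow> real \<Rightarrow> (real^4) set" where
  "char_plane x z y l1 l2 = {\<alpha> *\<^sub>R x + \<zeta> *\<^sub>R z + \<beta> *\<^sub>R y | \<alpha> \<zeta> \<beta>. \<alpha> + \<zeta> * l1 + \<beta> * l2 = 0}"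

text \<open>Control points of the parameter conic at \<open>v\<close>, as images of the control
  points \<open>P\<close> of the first arc; \<open>a\<close> is the coefficient of the denominator
  that belongs to \<open>P\<close>.\<close>

definition ctrl :: "real^4 \<Rightarrow> real \<Rightarrow> (real \<Rightarrow> real^4) \<Rightarrow> (real \<Rightarrow> real) \<Rightarrow> real^4 \<Rightarrow> real \<Rightarrow> real^4" where
  "ctrl P a q m x v = m v *\<^sub>R P + a *\<^sub>R (q v - m v *\<^sub>R x)"

text \<open>This is \<open>(m v)\<^sup>2\<close> times the derivative of q / m. In the translation
  surface it is the v-direction common to all points of a conic v = const, hence the vertex of the
  cone touching along that conic.\<close>

definition vertex :: "(real \<Rightarrow> real^4) \<Rightarrow> (real \<Rightarrow> real^4) \<Rightarrow> (real \<Rightarrow> real) \<Rightarrow> (real \<Rightarrow> real) \<Rightarrow> real \<Rightarrow> real^4" where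
  "vertex q q' m m' v = m v *\<^sub>R q' v - m' v *\<^sub>R q v"

lemma tnet_bern:
  "tnet (bern x z y) (bern 1 l1 l2) q m x u v =
     bern (ctrl x 1 q m x v) (ctrl z l1 q m x v) (ctrl y l2 q m x v) u"
  by (simp add: tnet_def bern_def ctrl_def algebra_simps)

lemma tnet_dbern:
  "tnet (dbern x z y) (dbern 1 l1 l2) q m x u v =
     dbern (ctrl x 1 q m x v) (ctrl z l1 q m x v) (ctrl y l2 q m x v) u"
  by (simp add: tnet_def dbern_def ctrl_def algebra_simps)

lemma tnet_vertex:
  "m v *\<^sub>R tnet p l q' m' x u v = m' v *\<^sub>R tnet p l q m x u v + l u *\<^sub>R vertex q q' m m' v"
  by (simp add: tnet_def vertex_def algebra_simps)

lemma ctrl_linear: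
  assumes "\<alpha> + \<zeta> * l1 + \<beta> * l2 = s"
  shows "\<alpha> *\<^sub>R ctrl x 1 q m x v + \<zeta> *\<^sub>R ctrl z l1 q m x v + \<beta> *\<^sub>R ctrl y l2 q m x v
    = m v *\<^sub>R (\<alpha> *\<^sub>R x + \<zeta> *\<^sub>R z + \<beta> *\<^sub>R y) + s *\<^sub>R (q v - m v *\<^sub>R x)"
  unfolding assms[symmetric] by (simp add: ctrl_def algebra_simps)

text \<open>The cone along the conic at \<open>v\<close> is nondegenerate if its vertex lies off the
  plane of the conic. A linear dependence would produce a common nonzero vector of the tangent of
  \<open>q\<close> and the characteristic line, contrary to \<open>V\<close>.\<close>

lemma ctrl_indep4:
  assumes I: "indep3 x z y" and m: "m v \<noteq> 0" and q: "indep2 (q v) (q' v)"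
    and V: "span {q v, q' v} \<inter> char_plane x z y l1 l2 \<subseteq> {0}"
  shows "indep4 (ctrl x 1 q m x v) (ctrl z l1 q m x v) (ctrl y l2 q m x v) (vertex q q' m m' v)"
  unfolding indep4_def
proof (intro allI impI)
  fix \<alpha> \<zeta> \<beta> \<kappa>
  assume 0: "\<alpha> *\<^sub>R ctrl x 1 q m x v + \<zeta> *\<^sub>R ctrl z l1 q m x v + \<beta> *\<^sub>R ctrl y l2 q m x v
    + \<kappa> *\<^sub>R vertex q q' m m' v = 0"
  define s where "s = \<alpha> + \<zeta> * l1 + \<beta> * l2"
  define P where "P = \<alpha> *\<^sub>R x + \<zeta> *\<^sub>R z + \<beta> *\<^sub>R y"
  have e: "m v *\<^sub>R P + s *\<^sub>R (q v - m v *\<^sub>R x) + \<kappa> *\<^sub>R vertex q q' m m' v = 0"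
    using 0 ctrl_linear[OF s_def[symmetric], of x q m v z y] by (simp add: P_def)
  define Q where "Q = (s - \<kappa> * m' v) *\<^sub>R q v + (\<kappa> * m v) *\<^sub>R q' v"
  have "Q = (- m v) *\<^sub>R (P - s *\<^sub>R x)"
    using e unfolding Q_def vertex_def by (simp add: algebra_simps add_eq_0_iff)
  also have "\<dots> = (- m v * (\<alpha> - s)) *\<^sub>R x + (- m v * \<zeta>) *\<^sub>R z + (- m v * \<beta>) *\<^sub>R y"
    by (simp add: P_def algebra_simps)
  also have "\<dots> \<in> char_plane x z y l1 l2"
    unfolding char_plane_def mem_Collect_eq
    by (intro exI conjI, rule refl) (simp add: s_def algebra_simps)
  finally have "Q \<in> char_plane x z y l1 l2" .
  moreover have "Q \<in> span {q v, q' v}" unfolding Q_def mem_span2 by blast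
  ultimately have Q: "Q = 0" using V by blast
  then have "s - \<kappa> * m' v = 0" "\<kappa> * m v = 0" using q unfolding Q_def indep2_def by blast+
  then have k: "\<kappa> = 0" "s = 0" using m by auto
  then have "P = 0" using e m by simp
  then show "\<alpha> = 0 \<and> \<zeta> = 0 \<and> \<beta> = 0 \<and> \<kappa> = 0" using I k unfolding P_def indep3_def by blast
qed

lemma line_at_other: "distinct3 i j k \<Longrightarrow> y \<in> line_at j w \<Longrightarrow> y $ k = w $ k \<and> y $ i = w $ i"
  by (auto simp: line_at_def distinct3_def)

text \<open>\<open>Tv\<close> is a combination of the point \<open>T\<close> and the vertex
  \<open>L\<close>. Exchanging the two brings the tangent plane into the form in which
  \<open>bern_cone\<close> describes the tangent planes of a cone.\<close>

lemma indep3_vertexI: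
  assumes "indep4 A B C L" "T = bern A B C u" "Tu = dbern A B C u" "mv *\<^sub>R Tv = c *\<^sub>R T + lu *\<^sub>R L" "lu \<noteq> 0" "mv \<noteq> 0"
  shows "indep3 T Tu Tv" "span {T, Tu, Tv} = span {T, Tu, L}"
proof -
  have t2: "indep2 T Tu" using bern_indep_tangent[OF indep4_D(2)[OF assms(1)]] assms(2,3) by simp
  show i3: "indep3 T Tu Tv" unfolding indep3_def
  proof (intro allI impI)
    fix \<alpha> \<beta> \<gamma> assume 0: "\<alpha> *\<^sub>R T + \<beta> *\<^sub>R Tu + \<gamma> *\<^sub>R Tv = 0"
    have "mv *\<^sub>R (\<alpha> *\<^sub>R T + \<beta> *\<^sub>R Tu + \<gamma> *\<^sub>R Tv) = (mv * \<alpha> + \<gamma> * c) *\<^sub>R T + (mv * \<beta>) *\<^sub>R Tu + (\<gamma> * lu) *\<^sub>R L"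
    proof -
      have "mv *\<^sub>R (\<gamma> *\<^sub>R Tv) = \<gamma> *\<^sub>R (c *\<^sub>R T + lu *\<^sub>R L)" unfolding assms(4)[symmetric] by simp
      then show ?thesis by (simp add: algebra_simps)
    qed
    then have e: "(mv * \<alpha> + \<gamma> * c) *\<^sub>R T + (mv * \<beta>) *\<^sub>R Tu + (\<gamma> * lu) *\<^sub>R L = 0" using 0 by simp
    have "((mv * \<alpha> + \<gamma> * c) * (1-u)\<^sup>2 + mv * \<beta> * (- 2 * (1-u))) *\<^sub>R A
      + ((mv * \<alpha> + \<gamma> * c) * (u*(1-u)) + mv * \<beta> * (1 - 2*u)) *\<^sub>R B
      + ((mv * \<alpha> + \<gamma> * c) * u\<^sup>2 + mv * \<beta> * (2*u)) *\<^sub>R C + (\<gamma> * lu) *\<^sub>R L = 0"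
      using e unfolding assms(2,3) by (simp add: bern_def dbern_def algebra_simps)
    then have "\<gamma> * lu = 0" using assms(1) unfolding indep4_def by blast
    then have "\<gamma> = 0" using assms(5) by simp
    then have "\<alpha> *\<^sub>R T + \<beta> *\<^sub>R Tu = 0" using 0 by simp
    then show "\<alpha> = 0 \<and> \<beta> = 0 \<and> \<gamma> = 0" using t2 \<open>\<gamma> = 0\<close> unfolding indep2_def by blast
  qed
  have Tv: "Tv = (c / mv) *\<^sub>R T + (lu / mv) *\<^sub>R L"
  proof -
    have "Tv = inverse mv *\<^sub>R (mv *\<^sub>R Tv)" using assms(6) by simp
    also have "\<dots> = (c / mv) *\<^sub>R T + (lu / mv) *\<^sub>R L" unfolding assms(4) by (simp add: scaleR_add_right divide_inverse mult.commute)
    finally show ?thesis .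
  qed
  have L: "L = (mv / lu) *\<^sub>R Tv - (c / lu) *\<^sub>R T"
    unfolding Tv using assms(5,6) by (simp add: scaleR_add_right)
  have "Tv \<in> span {T, Tu, L}" unfolding Tv by (intro span_add span_scale span_base) auto
  moreover have "L \<in> span {T, Tu, Tv}" unfolding L by (intro span_diff span_scale span_base) auto
  ultimately show "span {T, Tu, Tv} = span {T, Tu, L}"
    by (intro antisym span_minimal) (auto simp: span_base)
qed

lemma continuous_on_det4:
  fixes a b c d :: "real \<Rightarrow> real^4"
  assumes "continuous_on S a" "continuous_on S b" "continuous_on S c" "continuous_on S d"
  shows "continuous_on S (\<lambda>v. det (\<chi> i::4. if i = 1 then a v else if i = 2 then b v else if i = 3 then c v else d v))"
proof -
  have *: "continuous_on S (\<lambda>v. (\<chi> i::4. if i = 1 then a v else if i = 2 then b v else if i = 3 then c v else d v) $ r $ s)"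
    for r s
    using exhaust_4[of r] assms by (auto intro!: continuous_on_component)
  show ?thesis unfolding det_def
    by (intro continuous_on_sum continuous_on_mult continuous_on_const continuous_on_prod *)
qed

lemma indep4_nhd:
  fixes a b c d :: "real \<Rightarrow> real^4"
  assumes "e0 > 0" "continuous_on {-e0<..<1+e0} a" "continuous_on {-e0<..<1+e0} b"
    "continuous_on {-e0<..<1+e0} c" "continuous_on {-e0<..<1+e0} d"
    "\<And>v. v \<in> {0..1} \<Longrightarrow> indep4 (a v) (b v) (c v) (d v)"
  obtains e where "e > 0" "e \<le> e0" "\<And>v. v \<in> {-e<..<1+e} \<Longrightarrow> indep4 (a v) (b v) (c v) (d v)"
proof -
  note c = continuous_on_det4[OF assms(2-5)]
  show ?thesis
  proof (rule nonzero_on_unit_nhd[OF assms(1) c])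
    show "det (\<chi> i::4. if i = 1 then a v else if i = 2 then b v else if i = 3 then c v else d v) \<noteq> 0"
      if "v \<in> {0..1}" for v
      using assms(6)[OF that] unfolding indep4_det .
  next
    fix e assume e: "0 < e" "e \<le> e0"
      "\<And>v. v \<in> {-e<..<1+e} \<Longrightarrow>
        det (\<chi> i::4. if i = 1 then a v else if i = 2 then b v else if i = 3 then c v else d v) \<noteq> 0"
    show thesis by (rule that[OF e(1,2)]) (unfold indep4_det, rule e(3))
  qed
qed

lemma cone_along:
  assumes i4: "indep4 A B C L"
    and F: "\<And>y. y \<in> Y \<Longrightarrow> \<exists>u. F y = bern A B C u \<and> tangent_plane i F y = span {F y, dbern A B C u, L}"
  shows "(\<exists>K. is_conic K \<and> (\<forall>y\<in>Y. span {F y} \<in> K)) \<and>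
    (\<exists>M. quadratic_cone M \<and> (\<forall>y\<in>Y. F y \<bullet> (M *v F y) = 0 \<and> M *v F y \<noteq> 0 \<and>
       tangent_plane i F y = cone_tangent_plane M (F y)))"
proof -
  obtain M where M: "quadratic_cone M" "is_conic {p\<in>rp3. p \<subseteq> span {A, B, C} \<and> (\<forall>v\<in>p. v \<bullet> (M *v v) = 0)}"
    "\<And>u. bern A B C u \<bullet> (M *v bern A B C u) = 0" "\<And>u. M *v bern A B C u \<noteq> 0"
    "\<And>u. cone_tangent_plane M (bern A B C u) = span {bern A B C u, dbern A B C u, L}"
    by (rule bern_cone[OF i4]) (rule that)
  have "span {F y} \<in> {p\<in>rp3. p \<subseteq> span {A, B, C} \<and> (\<forall>v\<in>p. v \<bullet> (M *v v) = 0)}" if y: "y \<in> Y" for y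
  proof -
    obtain u where u: "F y = bern A B C u" using F[OF y] by blast
    have "span {F y} \<in> rp3" unfolding u by (intro span1_rp3 bern_nz indep4_D(2)[OF i4])
    moreover have "span {F y} \<subseteq> span {A, B, C}" unfolding u using bern_span by (intro span_minimal) auto
    moreover have "v \<bullet> (M *v v) = 0" if "v \<in> span {F y}" for v
      using that M(3)[of u] unfolding u mem_span1 by (auto simp: matrix_vector_mult_scaleR)
    ultimately show ?thesis by blast
  qed
  moreover have "F y \<bullet> (M *v F y) = 0 \<and> M *v F y \<noteq> 0 \<and> tangent_plane i F y = cone_tangent_plane M (F y)"
    if y: "y \<in> Y" for y
    using F[OF y] M(3-5) by metis
  ultimately show ?thesis using M(1,2) by blast
qed

text \<open>A converse to \<open>normal_form\<close>. With v fixed, \<open>tnet\<close> is a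
  Bernstein curve with control points \<open>ctrl\<close>, and by \<open>tnet_vertex\<close> its
  tangent planes all contain \<open>vertex\<close>, so \<open>bern_cone\<close> applies. The other
  direction follows by \<open>tnet_swap\<close>.\<close>

lemma tnet_sc_patch:
  fixes z y2 z' y' x :: "real^4" and l1 l2 m1 m2 :: real
  defines "p \<equiv> bern x z y2" and "q \<equiv> bern x z' y'" and "l \<equiv> bern 1 l1 l2" and "m \<equiv> bern 1 m1 m2"
    and "p' \<equiv> dbern x z y2" and "q' \<equiv> dbern x z' y'" and "l' \<equiv> dbern 1 l1 l2" and "m' \<equiv> dbern 1 m1 m2"
  assumes dist: "distinct3 i j k"
    and l: "\<And>u. u \<in> {0..1} \<Longrightarrow> l u \<noteq> 0" and m: "\<And>v. v \<in> {0..1} \<Longrightarrow> m v \<noteq> 0"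
    and q4: "\<And>v. v \<in> {0..1} \<Longrightarrow>
      indep4 (ctrl x 1 q m x v) (ctrl z l1 q m x v) (ctrl y2 l2 q m x v) (vertex q q' m m' v)"
    and p4: "\<And>u. u \<in> {0..1} \<Longrightarrow>
      indep4 (ctrl x 1 p l x u) (ctrl z' m1 p l x u) (ctrl y' m2 p l x u) (vertex p p' l l' u)"
  shows "sc_patch i (\<lambda>w. span {tnet p l q m x (w $ j) (w $ k)})"
proof -
  have sm: "smooth_on U (bern A B C)" "smooth_on U (dbern A B C)" for U and A B C :: "'v::real_normed_vector"
    unfolding bern_def dbern_def by (intro smooth_intros)+
  have cont: "continuous_on U (bern A B C)" "continuous_on U (dbern A B C)" for U and A B C :: "'v::real_normed_vector"
    by (intro smooth_on_continuous sm)+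
  have cc: "continuous_on U (\<lambda>v. ctrl P a (bern A B C) (bern b c d) x v)"
    "continuous_on U (\<lambda>v. vertex (bern A B C) (dbern A B C) (bern b c d) (dbern b c d) v)"
    for P A B C :: "real^4" and a b c d :: real and U
    unfolding ctrl_def vertex_def by (intro continuous_intros cont)+
  have cq: "continuous_on U (\<lambda>v. ctrl P a q m x v)" "continuous_on U (\<lambda>v. vertex q q' m m' v)"
    and cp: "continuous_on U (\<lambda>v. ctrl P a p l x v)" "continuous_on U (\<lambda>v. vertex p p' l l' v)" for P a U
    unfolding p_def q_def l_def m_def p'_def q'_def l'_def m'_def by (rule cc)+
  \<comment> \<open>The initial radius 1 is arbitrary, as Bernstein curves are defined on the whole
    line; each further condition shrinks the radius.\<close>
  obtain e1 where e1: "e1 > 0" "e1 \<le> 1" "\<And>u. u \<in> {-e1<..<1+e1} \<Longrightarrow> l u \<noteq> 0"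
    using nonzero_on_unit_nhd[of 1 l] l cont unfolding l_def by (metis zero_less_one)
  obtain e2 where e2: "e2 > 0" "e2 \<le> e1" "\<And>u. u \<in> {-e2<..<1+e2} \<Longrightarrow> m u \<noteq> 0"
    using nonzero_on_unit_nhd[of e1 m] m cont e1(1) unfolding m_def by metis
  obtain e3 where e3: "e3 > 0" "e3 \<le> e2" "\<And>v. v \<in> {-e3<..<1+e3} \<Longrightarrow>
      indep4 (ctrl x 1 q m x v) (ctrl z l1 q m x v) (ctrl y2 l2 q m x v) (vertex q q' m m' v)"
    by (rule indep4_nhd[OF e2(1) cq(1) cq(1) cq(1) cq(2) q4]) (assumption, rule that)
  obtain e where e: "e > 0" "e \<le> e3" "\<And>u. u \<in> {-e<..<1+e} \<Longrightarrow>
      indep4 (ctrl x 1 p l x u) (ctrl z' m1 p l x u) (ctrl y' m2 p l x u) (vertex p p' l l' u)"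
    by (rule indep4_nhd[OF e3(1) cp(1) cp(1) cp(1) cp(2) p4]) (assumption, rule that)
  interpret smooth_tnet i j k p p' q q' l l' m m' x e
    by unfold_locales (auto simp: dist p_def q_def l_def m_def p'_def q'_def l'_def m'_def intro: sm bern_deriv)
  have i3: "indep3 (tnet p l q m x u v) (tnet p' l' q m x u v) (tnet p l q' m' x u v)"
    and sp: "span {tnet p l q m x u v, tnet p' l' q m x u v, tnet p l q' m' x u v}
      = span {tnet p l q m x u v, tnet p' l' q m x u v, vertex q q' m m' v}"
    and sp': "span {tnet p l q m x u v, tnet p' l' q m x u v, tnet p l q' m' x u v}
      = span {tnet p l q m x u v, tnet p l q' m' x u v, vertex p p' l l' u}"
    if uv: "u \<in> {-e<..<1+e}" "v \<in> {-e<..<1+e}" for u v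
  proof -
    have v3: "v \<in> {-e3<..<1+e3}" using uv e(2) by auto
    have u1: "l u \<noteq> 0" using uv e e1 e2 e3 by auto
    have v1: "m v \<noteq> 0" using uv e e2 e3 by auto
    show "indep3 (tnet p l q m x u v) (tnet p' l' q m x u v) (tnet p l q' m' x u v)"
      "span {tnet p l q m x u v, tnet p' l' q m x u v, tnet p l q' m' x u v}
      = span {tnet p l q m x u v, tnet p' l' q m x u v, vertex q q' m m' v}"
      by (rule indep3_vertexI[OF e3(3)[OF v3] _ _ tnet_vertex[where p = p and l = l and u = u] u1 v1];
          simp add: p_def l_def p'_def l'_def tnet_bern tnet_dbern)+
    have "span {tnet q m p l x v u, tnet q' m' p l x v u, tnet q m p' l' x v u}
      = span {tnet q m p l x v u, tnet q' m' p l x v u, vertex p p' l l' u}"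
      by (rule indep3_vertexI(2)[OF e(3)[OF uv(1)] _ _ tnet_vertex[where p = q and l = m and u = v] v1 u1];
          simp add: q_def m_def q'_def m'_def tnet_bern tnet_dbern)
    then show "span {tnet p l q m x u v, tnet p' l' q m x u v, tnet p l q' m' x u v}
      = span {tnet p l q m x u v, tnet p l q' m' x u v, vertex p p' l l' u}"
      unfolding tnet_swap[of q] tnet_swap[of q'] by (simp add: insert_commute)
  qed
  have "conj_param i (cube_nhd e) F"
    by (rule conj_param_F) (use e e1 e2 e3 i3 in auto)
  moreover have "(\<exists>K. is_conic K \<and> (\<forall>y\<in>cube_nhd e \<inter> line_at r w. span {F y} \<in> K)) \<and>
    (\<exists>M. quadratic_cone M \<and> (\<forall>y\<in>cube_nhd e \<inter> line_at r w. F y \<bullet> (M *v F y) = 0 \<and> M *v F y \<noteq> 0 \<and>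
       tangent_plane i F y = cone_tangent_plane M (F y)))" if w: "w \<in> cube_nhd e" and r: "r \<noteq> i" for w r
  proof -
    consider "r = j" | "r = k" using r distinct3_cases[OF dist] by metis
    then show ?thesis
    proof cases
      case 1
      have "w $ k \<in> {-e3<..<1+e3}" using nhd_nth[OF w, of k] e(2) by auto
      note q4w = e3(3)[OF this]
      show ?thesis
      proof (rule cone_along[OF q4w])
        fix y assume y: "y \<in> cube_nhd e \<inter> line_at r w"
        then have yk: "y $ k = w $ k" using line_at_other[OF dist, of y w] 1 by simp
        have "tangent_plane i F y = span {F y, tnet p' l' q m x (y $ j) (y $ k), vertex q q' m m' (w $ k)}"
          using tangent_plane_F[of y] sp[OF nhd_nth nhd_nth, of y y j k] y yk by simp
        then show "\<exists>u. F y = bern (ctrl x 1 q m x (w $ k)) (ctrl z l1 q m x (w $ k)) (ctrl y2 l2 q m x (w $ k)) u \<and>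
           tangent_plane i F y = span {F y, dbern (ctrl x 1 q m x (w $ k)) (ctrl z l1 q m x (w $ k)) (ctrl y2 l2 q m x (w $ k)) u,
              vertex q q' m m' (w $ k)}"
          unfolding p_def l_def p'_def l'_def tnet_bern tnet_dbern yk by blast
      qed
    next
      case 2
      have "w $ j \<in> {-e<..<1+e}" using nhd_nth[OF w, of j] by auto
      note p4w = e(3)[OF this]
      show ?thesis
      proof (rule cone_along[OF p4w])
        fix y assume y: "y \<in> cube_nhd e \<inter> line_at r w"
        have "y $ j = w $ j"
          using y 2 ne by (auto simp: line_at_def)
        moreover have "tangent_plane i F y = span {F y, tnet p l q' m' x (y $ j) (y $ k), vertex p p' l l' (y $ j)}"
          using tangent_plane_F[of y] sp'[OF nhd_nth nhd_nth, of y y j k] y by simp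
        ultimately show "\<exists>u. F y = bern (ctrl x 1 p l x (w $ j)) (ctrl z' m1 p l x (w $ j)) (ctrl y' m2 p l x (w $ j)) u \<and>
           tangent_plane i F y = span {F y, dbern (ctrl x 1 p l x (w $ j)) (ctrl z' m1 p l x (w $ j)) (ctrl y' m2 p l x (w $ j)) u,
              vertex p p' l l' (w $ j)}"
          unfolding tnet_swap[of p l q] tnet_swap[of p l q']
          unfolding q_def m_def q'_def m'_def tnet_bern tnet_dbern by auto
      qed
    qed
  qed
  ultimately have "char_param i (cube_nhd e) F" unfolding char_param_def by blast
  moreover have "y = w" if w: "w \<in> cube" and y: "y \<in> cube" "y \<in> line_at r w" and r: "r \<noteq> i"
    and eq: "span {F y} = span {F w}" for w y r
  proof -
    consider "r = j" | "r = k" using r distinct3_cases[OF dist] by metis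
    then have "y $ r = w $ r"
    proof cases
      case 1
      then have yk: "y $ k = w $ k" using line_at_other[OF dist] y by blast
      note I = indep4_D(2)[OF q4[OF cube_nth[OF w, of k]]]
      obtain c where "F y = c *\<^sub>R F w" using eq by (auto simp: span1_eq)
      then show ?thesis unfolding yk p_def l_def tnet_bern 1 using bern_parallel(1)[OF I] by blast
    next
      case 2
      then have yj: "y $ j = w $ j" using y(2) ne by (auto simp: line_at_def)
      note I = indep4_D(2)[OF p4[OF cube_nth[OF w, of j]]]
      obtain c where "F y = c *\<^sub>R F w" using eq by (auto simp: span1_eq)
      then show ?thesis unfolding yj tnet_swap[of p] unfolding q_def m_def tnet_bern 2
        using bern_parallel(1)[OF I] by blast
    qed
    then show ?thesis using y(2) by (auto simp: line_at_def vec_eq_iff)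
  qed
  ultimately show ?thesis unfolding sc_patch_def using e(1) by blast
qed

section \<open>Parameter arcs and tangent lines of patches\<close>

lemma upd_nth: "upd w r s $ r = s" "t \<noteq> r \<Longrightarrow> upd w r s $ t = w $ t"
  by (simp_all add: upd_def)

lemma upd_cube: "w \<in> cube \<Longrightarrow> s \<in> {0..1} \<Longrightarrow> upd w r s \<in> cube"
  by (simp add: cube_def upd_def)

lemma upd_line: "upd w r s \<in> line_at r w"
  by (simp add: line_at_def upd_def)

lemma line_at_upd: "y \<in> line_at r w \<Longrightarrow> y = upd w r (y $ r)"
  by (auto simp: line_at_def upd_def vec_eq_iff)

lemma param_arc_upd:
  assumes "w \<in> cube" shows "param_arc r f w = (\<lambda>s. f (upd w r s)) ` {0..1}"
proof -
  have "cube \<inter> line_at r w = upd w r ` {0..1}"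
  proof (intro set_eqI iffI)
    fix y assume "y \<in> cube \<inter> line_at r w"
    then show "y \<in> upd w r ` {0..1}" using line_at_upd[of y r w] cube_nth[of y r] by blast
  next
    fix y assume "y \<in> upd w r ` {0..1}"
    then show "y \<in> cube \<inter> line_at r w" using upd_cube[OF assms] upd_line by blast
  qed
  then show ?thesis by (simp add: param_arc_def image_image)
qed

lemma sc_patch_smooth_lift:
  assumes "sc_patch i f" shows "\<exists>F. smooth_lift f F"
proof -
  obtain e F where F: "e > 0" "char_param i (cube_nhd e) F" "\<forall>x\<in>cube. f x = span {F x}"
    using assms unfolding sc_patch_def by blast
  have c: "conj_param i (cube_nhd e) F" using F(2) unfolding char_param_def by blast
  obtain j where "j \<noteq> i" by (metis (full_types) exhaust_3 one_neq_zero zero_neq_one num1_eq1 distinct3_def distinct3_ex)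
  then obtain k where d: "distinct3 i j k" using distinct3_ex by blast
  have "F x \<noteq> 0" if "x \<in> cube_nhd e" for x
  proof -
    have "dim (tangent_plane i F x) = 3" using c that unfolding conj_param_def by blast
    then have "indep3 (F x) (pd j F x) (pd k F x)"
      unfolding tangent_plane_eq[OF d] by (rule indep3_spanI)
    then show ?thesis unfolding indep3_def by (metis add.right_neutral scaleR_zero_left scaleR_zero_right zero_neq_one)
  qed
  moreover have "smooth_on (cube_nhd e) F" using c unfolding conj_param_def by blast
  ultimately show ?thesis unfolding smooth_lift_def using F by blast
qed

text \<open>\<open>tangent_line\<close> refers to an unspecified lift. Any lift \<open>c\<close> of
  the parameter line differs from it by a nonvanishing scalar factor, and the product rule changes
  the derivative only by a multiple of the point.\<close>

lemma tangent_line_curve: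
  assumes lift: "\<exists>F. smooth_lift f F" and w: "w \<in> cube"
    and c: "\<And>s. s \<in> {0..1} \<Longrightarrow> f (upd w r s) = span {c s}"
    and c': "(c has_vector_derivative c') (at (w $ r) within {0..1})"
  shows "tangent_line r f w = span {c (w $ r), c'}"
proof -
  define F where "F = (SOME F. smooth_lift f F)"
  have "smooth_lift f F" unfolding F_def using lift by (rule someI_ex)
  then obtain e where e: "e > 0" "smooth_on (cube_nhd e) F" "\<forall>x\<in>cube_nhd e. F x \<noteq> 0"
    "\<forall>x\<in>cube. f x = span {F x}" unfolding smooth_lift_def by blast
  define s0 where "s0 = w $ r"
  have s0: "s0 \<in> {0..1}" using cube_nth[OF w] by (simp add: s0_def)
  define g where "g s = F (upd w r s)" for s
  have ug: "upd w r s = w + (s - s0) *\<^sub>R axis r 1" for s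
    by (auto simp: vec_eq_iff upd_def axis_def s0_def)
  have us0: "upd w r s0 = w" by (simp add: ug)
  have g: "(g has_vector_derivative pd r F w) (at s0 within {0..1})"
  proof -
    have w': "w \<in> cube_nhd e" using cube_subset_nhd[OF e(1)] w by blast
    have D: "(F has_derivative frechet_derivative F (at w)) (at (upd w r s0))"
      using smooth_on_has_derivative[OF e(2) w'] us0 by simp
    have "((\<lambda>s. upd w r s) has_derivative (\<lambda>h. h *\<^sub>R axis r 1)) (at s0 within {0..1})"
      unfolding ug by (auto intro!: derivative_eq_intros)
    from has_derivative_compose[OF this D]
    have "(g has_derivative (\<lambda>h. frechet_derivative F (at w) (h *\<^sub>R axis r 1))) (at s0 within {0..1})"
      unfolding g_def .
    moreover have "frechet_derivative F (at w) (h *\<^sub>R axis r 1) = h *\<^sub>R pd r F w" for h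
      unfolding pd_def using linear_scale[OF has_derivative_linear[OF D]] by blast
    ultimately show ?thesis unfolding has_vector_derivative_def by simp
  qed
  have gnz: "g s \<noteq> 0" and gc: "span {g s} = span {c s}" if "s \<in> {0..1}" for s
    using e(3,4) upd_cube[OF w that] c[OF that] subsetD[OF cube_subset_nhd[OF e(1)] upd_cube[OF w that]]
    unfolding g_def by (blast, metis)
  have cnz: "c s \<noteq> 0" if "s \<in> {0..1}" for s
    using gc[OF that] gnz[OF that] by (metis mem_span1 scaleR_zero_right span_base singletonI)
  \<comment> \<open>The scalar factor, written as a quotient of inner products to make its
    differentiability evident.\<close>
  define \<phi> where "\<phi> s = (g s \<bullet> c s) / (c s \<bullet> c s)" for s
  have gphi: "g s = \<phi> s *\<^sub>R c s" if st: "s \<in> {0..1}" for s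
  proof -
    obtain t where "g s = t *\<^sub>R c s" using gc[OF st] by (auto simp: span1_eq)
    then show ?thesis using cnz[OF st] by (simp add: \<phi>_def)
  qed
  have c'': "(c has_derivative (\<lambda>h. h *\<^sub>R c')) (at s0 within {0..1})"
    using c' by (simp add: has_vector_derivative_def s0_def)
  have g'': "(g has_derivative (\<lambda>h. h *\<^sub>R pd r F w)) (at s0 within {0..1})"
    using g by (simp add: has_vector_derivative_def)
  have "\<exists>d. (\<phi> has_derivative d) (at s0 within {0..1})"
    unfolding \<phi>_def using cnz[OF s0]
    by (intro exI) (rule has_derivative_divide[OF has_derivative_inner[OF g'' c''] has_derivative_inner[OF c'' c'']], simp)
  then obtain d where d: "(\<phi> has_derivative d) (at s0 within {0..1})" by blast
  have "((\<lambda>s. \<phi> s *\<^sub>R c s) has_vector_derivative (\<phi> s0 *\<^sub>R c' + d 1 *\<^sub>R c s0)) (at s0 within {0..1})"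
  proof -
    have "d h = h * d 1" for h using linear_scale[OF has_derivative_linear[OF d], of h 1] by simp
    then have "(\<lambda>h. \<phi> s0 *\<^sub>R (h *\<^sub>R c') + d h *\<^sub>R c s0) = (\<lambda>h. h *\<^sub>R (\<phi> s0 *\<^sub>R c' + d 1 *\<^sub>R c s0))"
      by (metis (no_types, opaque_lifting) scaleR_add_right scaleR_left_commute scaleR_scaleR)
    then show ?thesis using has_derivative_scaleR[OF d c''] by (simp add: has_vector_derivative_def)
  qed
  then have "(g has_vector_derivative (\<phi> s0 *\<^sub>R c' + d 1 *\<^sub>R c s0)) (at s0 within {0..1})"
    by (rule has_vector_derivative_transform[OF s0, rotated]) (simp add: gphi)
  then have pd: "pd r F w = \<phi> s0 *\<^sub>R c' + d 1 *\<^sub>R c s0"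
    using vector_derivative_unique_within_closed_interval[of 0 1 s0 g] g s0 by (metis cbox_interval zero_less_one)
  have Fw: "F w = \<phi> s0 *\<^sub>R c s0" using gphi[OF s0] by (simp add: g_def us0)
  have nz: "\<phi> s0 \<noteq> 0" using gnz[OF s0] gphi[OF s0] by auto
  have "span {F w, pd r F w} = span {c s0, c'}"
  proof (rule antisym)
    show "span {F w, pd r F w} \<subseteq> span {c s0, c'}"
      unfolding pd Fw by (intro span_minimal) (auto intro!: span_add span_scale intro: span_base)
    have 1: "c s0 = inverse (\<phi> s0) *\<^sub>R F w" unfolding Fw using nz by simp
    have 2: "c' = inverse (\<phi> s0) *\<^sub>R (pd r F w - d 1 *\<^sub>R (inverse (\<phi> s0) *\<^sub>R F w))"
      unfolding 1[symmetric] pd using nz by simp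
    have "c s0 \<in> span {F w, pd r F w}" by (subst 1) (intro span_scale span_base, simp)
    moreover have "c' \<in> span {F w, pd r F w}" by (subst 2) (intro span_scale span_diff span_base; simp)
    ultimately show "span {c s0, c'} \<subseteq> span {F w, pd r F w}" by (intro span_minimal) auto
  qed
  then show ?thesis by (simp add: tangent_line_def Let_def F_def[symmetric] s0_def)
qed

section \<open>Conic arcs and their parametrizations\<close>

text \<open>The parameter changes that arise when a patch is compared with Bernstein curves.
  Smoothness past the end points together with a nonzero derivative keeps reparametrized nets
  regular on an open neighbourhood of the cube.\<close>

definition regular_param :: "(real \<Rightarrow> real) \<Rightarrow> bool" where
  "regular_param \<sigma> \<longleftrightarrow> \<sigma> 0 = 0 \<and> \<sigma> 1 = 1 \<and> strict_mono_on {0..1} \<sigma> \<and>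
     (\<exists>d>0. smooth_on {-d<..<1+d} \<sigma>) \<and>
     (\<forall>s\<in>{0..1}. \<exists>D. D \<noteq> 0 \<and> (\<sigma> has_vector_derivative D) (at s))"

lemma regular_param_continuous:
  assumes "regular_param \<sigma>" shows "continuous_on {0..1} \<sigma>"
proof -
  obtain d where d: "d > 0" "smooth_on {-d<..<1+d} \<sigma>" using assms unfolding regular_param_def by blast
  have "{0..1} \<subseteq> {-d<..<1+d}" using d(1) by auto
  then show ?thesis using smooth_on_continuous[OF d(2)] continuous_on_subset by blast
qed

lemma regular_param_image:
  assumes "regular_param \<sigma>" shows "\<sigma> ` {0..1} = {0..1}"
proof
  have m: "\<sigma> 0 = 0" "\<sigma> 1 = 1" "strict_mono_on {0..1} \<sigma>" using assms by (auto simp: regular_param_def)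
  show "\<sigma> ` {0..1} \<subseteq> {0..1}"
  proof
    fix t assume "t \<in> \<sigma> ` {0..1}"
    then obtain s where s: "s \<in> {0..1}" "t = \<sigma> s" by blast
    then have "\<sigma> 0 \<le> \<sigma> s" "\<sigma> s \<le> \<sigma> 1" using strict_mono_on_leD[OF m(3)] by auto
    then show "t \<in> {0..1}" using s m by simp
  qed
  show "{0..1} \<subseteq> \<sigma> ` {0..1}"
  proof
    fix t :: real assume "t \<in> {0..1}"
    then have "\<exists>s\<ge>0. s \<le> 1 \<and> \<sigma> s = t"
      using m regular_param_continuous[OF assms] by (intro IVT') auto
    then show "t \<in> \<sigma> ` {0..1}" by auto
  qed
qed

lemma regular_param_in: "regular_param \<sigma> \<Longrightarrow> s \<in> {0..1} \<Longrightarrow> \<sigma> s \<in> {0..1}"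
  using regular_param_image by blast

lemma const_sign:
  fixes h :: "'a::topological_space \<Rightarrow> real"
  assumes "connected S" "continuous_on S h" "\<And>x. x \<in> S \<Longrightarrow> h x \<noteq> 0"
  shows "(\<forall>x\<in>S. h x > 0) \<or> (\<forall>x\<in>S. h x < 0)"
proof (rule ccontr)
  assume "\<not> ?thesis"
  then obtain a b where ab: "a \<in> S" "b \<in> S" "h a \<le> 0" "h b \<ge> 0" by (auto simp: not_less)
  have "connected (h ` S)" by (rule connected_continuous_image[OF assms(2,1)])
  then have "0 \<in> h ` S" using connectedD_interval[of "h ` S" "h a" "h b" 0] ab by blast
  then show False using assms(3) by auto
qed

lemma form_symmetric:
  fixes M :: "real^4^4"
  assumes "transpose M = M" shows "v \<bullet> (M *v w) = w \<bullet> (M *v v)"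
proof -
  have "v \<bullet> (M *v w) = (v v* M) \<bullet> w" by (rule dot_lmul_matrix[symmetric])
  also have "v v* M = M *v v" using transpose_matrix_vector[of M v] assms by simp
  also have "(M *v v) \<bullet> w = w \<bullet> (M *v v)" by (rule inner_commute)
  finally show ?thesis .
qed

lemma form_linear:
  fixes M :: "real^4^4"
  shows "v \<bullet> (M *v (a + b)) = v \<bullet> (M *v a) + v \<bullet> (M *v b)" "v \<bullet> (M *v (c *\<^sub>R a)) = c * (v \<bullet> (M *v a))"
  by (simp_all only: matrix_vector_right_distrib inner_add_right matrix_vector_mult_scaleR inner_scaleR_right)

lemma conic_arc_scale:
  assumes "t \<noteq> 0" shows "conic_arc (t *\<^sub>R x) (t *\<^sub>R z) (t *\<^sub>R y) = conic_arc x z y"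
proof -
  have "span {bern (t *\<^sub>R x) (t *\<^sub>R z) (t *\<^sub>R y) u} = span {bern x z y u}" for u
    unfolding span1_eq using assms bern_scale[of t x z y u] by (intro exI[of _ t]) simp
  then show ?thesis by (simp add: conic_arc_def)
qed

text \<open>
  In coordinates with respect to the end points and the intersection of the tangents there, suitably
  scaled, the conic is \<open>\<alpha> * \<beta> = \<zeta>\<^sup>2\<close>; on the arc \<open>\<alpha>\<close>, \<open>\<beta>\<close> and \<open>\<zeta>\<close> have a common sign.
\<close>

lemma conic_arc_exists:
  fixes c :: "real \<Rightarrow> real^4"
  assumes K: "is_conic K" and cont: "continuous_on {0..1} c"
    and c: "\<And>u. u \<in> {0..1} \<Longrightarrow> c u \<noteq> 0 \<and> span {c u} \<in> K"
    and inj: "\<And>u u'. u \<in> {0..1} \<Longrightarrow> u' \<in> {0..1} \<Longrightarrow> span {c u} = span {c u'} \<Longrightarrow> u = u'"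
  obtains z y where "indep3 (c 0) z y" "(\<lambda>u. span {c u}) ` {0..1} = conic_arc (c 0) z y"
    "span {c 1} = span {y}"
proof -
  obtain E M where E: "subspace E" "dim E = 3" and tr: "transpose M = M"
    and nd: "\<forall>v\<in>E. (\<forall>w\<in>E. v \<bullet> (M *v w) = 0) \<longrightarrow> v = 0"
    and Ke: "K = {p\<in>rp3. p \<subseteq> E \<and> (\<forall>v\<in>p. v \<bullet> (M *v v) = 0)}"
    using K unfolding is_conic_def by (elim exE conjE) (rule that)
  define B where "B v w = v \<bullet> (M *v w)" for v w
  have Bs: "B v w = B w v" for v w unfolding B_def by (rule form_symmetric[OF tr])
  have Ba: "B v (a + b) = B v a + B v b" "B v (t *\<^sub>R a) = t * B v a" for v a b t
    unfolding B_def by (rule form_linear)+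
  have Bl: "B (a + b) v = B a v + B b v" "B (t *\<^sub>R a) v = t * B a v" for v a b t
    using Ba Bs by metis+
  have Bd: "B v (a - b) = B v a - B v b" "B (a - b) v = B a v - B b v" for v a b
    unfolding B_def by (simp_all only: matrix_vector_mult_diff_distrib inner_diff_right inner_diff_left)
  have cE: "c u \<in> E" "B (c u) (c u) = 0" if "u \<in> {0..1}" for u
    using c[OF that] span_base[of "c u" "{c u}"] unfolding Ke B_def by auto
  define x y0 where "x = c 0" and "y0 = c 1"
  have xy: "x \<in> E" "y0 \<in> E" "B x x = 0" "B y0 y0 = 0" using cE[of 0] cE[of 1] by (auto simp: x_def y0_def)
  have xnz: "x \<noteq> 0" "y0 \<noteq> 0" using c[of 0] c[of 1] by (auto simp: x_def y0_def)
  have i2: "indep2 x y0"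
    unfolding indep2_def
  proof (intro allI impI)
    fix \<alpha> \<beta> assume 0: "\<alpha> *\<^sub>R x + \<beta> *\<^sub>R y0 = 0"
    have "\<alpha> = 0"
    proof (rule ccontr)
      assume a: "\<alpha> \<noteq> 0"
      have "\<alpha> *\<^sub>R x = (-\<beta>) *\<^sub>R y0" using 0 by (simp add: add_eq_0_iff)
      then have "inverse \<alpha> *\<^sub>R (\<alpha> *\<^sub>R x) = inverse \<alpha> *\<^sub>R ((-\<beta>) *\<^sub>R y0)" by simp
      then have xe: "x = (- \<beta> / \<alpha>) *\<^sub>R y0" using a by (simp add: divide_inverse mult.commute)
      then have "- \<beta> / \<alpha> \<noteq> 0" using xnz by auto
      then have "span {x} = span {y0}" unfolding span1_eq using xe by blast
      then show False using inj[of 0 1] by (simp add: x_def y0_def)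
    qed
    then show "\<alpha> = 0 \<and> \<beta> = 0" using 0 xnz by simp
  qed
  obtain w where w: "w \<in> E" "w \<notin> span {x, y0}"
  proof -
    have "E \<noteq> span {x, y0}" using dim_span2[OF i2] E(2) by auto
    moreover have "span {x, y0} \<subseteq> E" using xy E(1) by (intro span_minimal) auto
    ultimately show ?thesis using that by blast
  qed
  have i3: "indep3 x w y0" unfolding indep3_def
  proof (intro allI impI)
    fix \<alpha> \<beta> \<gamma> assume 0: "\<alpha> *\<^sub>R x + \<beta> *\<^sub>R w + \<gamma> *\<^sub>R y0 = 0"
    have "\<beta> = 0"
    proof (rule ccontr)
      assume b: "\<beta> \<noteq> 0"
      have "\<beta> *\<^sub>R w = (-\<alpha>) *\<^sub>R x + (-\<gamma>) *\<^sub>R y0" using 0 by (simp add: algebra_simps add_eq_0_iff)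
      then have "\<beta> *\<^sub>R w \<in> span {x, y0}" unfolding mem_span2 by blast
      then have "inverse \<beta> *\<^sub>R (\<beta> *\<^sub>R w) \<in> span {x, y0}" by (rule span_scale)
      then show False using b w(2) by simp
    qed
    then show "\<alpha> = 0 \<and> \<beta> = 0 \<and> \<gamma> = 0" using 0 i2 by (simp add: indep2_def)
  qed
  have Ee: "E = span {x, w, y0}" by (rule span3_eqI[OF i3 xy(1) w(1) xy(2) E])
  have orth: "v = 0" if v: "v \<in> E" "B v x = 0" "B v w = 0" "B v y0 = 0" for v
  proof -
    have "B v a = 0" if "a \<in> E" for a
    proof -
      obtain \<alpha> \<beta> \<gamma> where "a = \<alpha> *\<^sub>R x + \<beta> *\<^sub>R w + \<gamma> *\<^sub>R y0"
        using \<open>a \<in> E\<close> unfolding Ee mem_span3 by blast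
      then show ?thesis using v by (simp add: Ba)
    qed
    then show ?thesis using nd v(1) unfolding B_def by blast
  qed
  have bxy: "B x y0 \<noteq> 0"
  proof
    assume b: "B x y0 = 0"
    let ?v = "(B y0 w) *\<^sub>R x + (- B x w) *\<^sub>R y0"
    have "?v = 0"
    proof (rule orth)
      show "?v \<in> E" using xy E(1) by (intro subspace_add subspace_scale)
    qed (use b xy Bs[of y0 x] in \<open>simp_all add: Bl Bd\<close>)
    then have "B y0 w = 0" "B x w = 0" using i2 unfolding indep2_def by fastforce+
    then have "x = 0" using orth[OF xy(1)] b xy by simp
    then show False using xnz by simp
  qed
  \<comment> \<open>The correction terms make \<open>z0\<close> orthogonal to both end points with
    respect to \<open>B\<close>, hence the pole of the chord.\<close>
  define z0 where "z0 = w + (- B w y0 / B x y0) *\<^sub>R x + (- B w x / B x y0) *\<^sub>R y0"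
  have z0E: "z0 \<in> E" unfolding z0_def using xy w(1) E(1) by (intro subspace_add subspace_scale)
  have z0: "B z0 x = 0" "B z0 y0 = 0" "B x z0 = 0" "B y0 z0 = 0"
    using bxy xy Bs[of y0 x] Bs[of z0] unfolding z0_def by (simp_all add: Bl Ba Bd Bs[of _ w])
  have i3': "indep3 x z0 y0" unfolding indep3_def
  proof (intro allI impI)
    fix \<alpha> \<beta> \<gamma> assume 0: "\<alpha> *\<^sub>R x + \<beta> *\<^sub>R z0 + \<gamma> *\<^sub>R y0 = 0"
    have "(\<alpha> - \<beta> * B w y0 / B x y0) *\<^sub>R x + \<beta> *\<^sub>R w + (\<gamma> - \<beta> * B w x / B x y0) *\<^sub>R y0 = 0"
      using 0 by (simp add: z0_def algebra_simps)
    then have "\<beta> = 0" "\<alpha> - \<beta> * B w y0 / B x y0 = 0" "\<gamma> - \<beta> * B w x / B x y0 = 0"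
      using i3 unfolding indep3_def by blast+
    then show "\<alpha> = 0 \<and> \<beta> = 0 \<and> \<gamma> = 0" by simp
  qed
  have bz: "B z0 z0 \<noteq> 0"
  proof
    assume "B z0 z0 = 0"
    moreover have "w = z0 + (B w y0 / B x y0) *\<^sub>R x + (B w x / B x y0) *\<^sub>R y0" by (simp add: z0_def)
    then have "B z0 w = B z0 z0" using z0 by (metis Ba(1) Ba(2) add.right_neutral mult_zero_right)
    ultimately have "z0 = 0" using orth[OF z0E] z0 by simp
    then show False using i3' unfolding indep3_def
      by (metis add.right_neutral scaleR_zero_left scaleR_zero_right zero_neq_one)
  qed
  \<comment> \<open>Chosen so that \<open>B x y = - B z0 z0 / 2\<close>, which turns the equation of
    the conic into \<alpha> * \<beta> = \<zeta>^2.\<close>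
  define t where "t = - B z0 z0 / (2 * B x y0)"
  have t: "t \<noteq> 0" using bz bxy by (simp add: t_def)
  define y where "y = t *\<^sub>R y0"
  have i3y: "indep3 x z0 y" unfolding indep3_def
  proof (intro allI impI)
    fix \<alpha> \<beta> \<gamma> assume "\<alpha> *\<^sub>R x + \<beta> *\<^sub>R z0 + \<gamma> *\<^sub>R y = 0"
    then have "\<alpha> *\<^sub>R x + \<beta> *\<^sub>R z0 + (\<gamma> * t) *\<^sub>R y0 = 0" by (simp add: y_def)
    then show "\<alpha> = 0 \<and> \<beta> = 0 \<and> \<gamma> = 0" using i3' t unfolding indep3_def by fastforce
  qed
  have "B x y = t * B x y0" by (simp only: y_def Ba)
  then have Bxy: "B x y = - B z0 z0 / 2" using bxy by (simp add: t_def)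
  obtain d where "indep4 x z0 y d" by (rule indep3_extend[OF i3y])
  then obtain g0 g1 g2 :: "real^4" where
    g0: "g0 \<bullet> x = 1" "g0 \<bullet> z0 = 0" "g0 \<bullet> y = 0" and g1: "g1 \<bullet> x = 0" "g1 \<bullet> z0 = 1" "g1 \<bullet> y = 0"
    and g2: "g2 \<bullet> x = 0" "g2 \<bullet> z0 = 0" "g2 \<bullet> y = 1"
    by (rule dual4) (rule that)
  define \<alpha> \<zeta> \<beta> where "\<alpha> u = g0 \<bullet> c u" and "\<zeta> u = g1 \<bullet> c u" and "\<beta> u = g2 \<bullet> c u" for u
  have Eey: "E = span {x, z0, y}"
    by (rule span3_eqI[OF i3y xy(1) z0E _ E]) (use xy(2) E(1) in \<open>simp add: y_def subspace_scale\<close>)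
  have dec: "c u = \<alpha> u *\<^sub>R x + \<zeta> u *\<^sub>R z0 + \<beta> u *\<^sub>R y" if u: "u \<in> {0..1}" for u
  proof -
    obtain p q r where e: "c u = p *\<^sub>R x + q *\<^sub>R z0 + r *\<^sub>R y" using cE(1)[OF u] unfolding Eey mem_span3 by blast
    then show ?thesis using g0 g1 g2 by (simp add: \<alpha>_def \<zeta>_def \<beta>_def inner_add_right)
  qed
  have rel: "\<alpha> u * \<beta> u = (\<zeta> u)\<^sup>2" if u: "u \<in> {0..1}" for u
  proof -
    have Byy: "B y y = 0" "B z0 y = 0" "B y z0 = 0" using xy z0 by (simp_all add: y_def Ba Bl)
    have "0 = B (c u) (c u)" using cE(2)[OF u] by simp
    also have "\<dots> = 2 * (\<alpha> u * \<beta> u) * B x y + (\<zeta> u)\<^sup>2 * B z0 z0"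
      unfolding dec[OF u] using xy z0 Byy Bs[of y x] by (simp add: Ba Bl power2_eq_square algebra_simps)
    also have "\<dots> = ((\<zeta> u)\<^sup>2 - \<alpha> u * \<beta> u) * B z0 z0" unfolding Bxy by (simp add: algebra_simps)
    finally show ?thesis using bz by simp
  qed
  have cts: "continuous_on {0..1} \<alpha>" "continuous_on {0..1} \<zeta>" "continuous_on {0..1} \<beta>"
    unfolding \<alpha>_def \<zeta>_def \<beta>_def by (intro continuous_intros cont)+
  have end0: "\<alpha> 0 = 1" "\<zeta> 0 = 0" "\<beta> 0 = 0" using g0 g1 g2 by (simp_all add: \<alpha>_def \<zeta>_def \<beta>_def x_def)
  have "c 1 = inverse t *\<^sub>R y" using t by (simp add: y_def y0_def)
  then have end1: "\<alpha> 1 = 0" "\<zeta> 1 = 0" "\<beta> 1 \<noteq> 0" using g0 g1 g2 t by (simp_all add: \<alpha>_def \<zeta>_def \<beta>_def)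
  have mid: "\<zeta> u \<noteq> 0" if u: "u \<in> {0<..<1}" for u
  proof
    assume z: "\<zeta> u = 0"
    have u': "u \<in> {0..1}" using u by simp
    have nz: "c u \<noteq> 0" using c[OF u'] by blast
    from rel[OF u'] z have "\<alpha> u = 0 \<or> \<beta> u = 0" by simp
    then show False
    proof
      assume "\<alpha> u = 0"
      then have "c u = (\<beta> u * t) *\<^sub>R c 1" using dec[OF u'] z by (simp add: y_def y0_def)
      then have "span {c u} = span {c 1}" unfolding span1_eq using nz by (metis scaleR_zero_left)
      then show False using inj[OF u', of 1] u by simp
    next
      assume "\<beta> u = 0"
      then have "c u = \<alpha> u *\<^sub>R c 0" using dec[OF u'] z by (simp add: x_def)
      then have "span {c u} = span {c 0}" unfolding span1_eq using nz by (metis scaleR_zero_left)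
      then show False using inj[OF u', of 0] u by simp
    qed
  qed
  have prod: "\<alpha> u * \<zeta> u \<noteq> 0" if u: "u \<in> {0<..<1}" for u
    using mid[OF u] rel[of u] u by (auto simp: power2_eq_square)
  have "(\<forall>u\<in>{0<..<1}. \<alpha> u * \<zeta> u > 0) \<or> (\<forall>u\<in>{0<..<1}. \<alpha> u * \<zeta> u < 0)"
  proof (rule const_sign)
    show "continuous_on {0<..<1} (\<lambda>u. \<alpha> u * \<zeta> u)"
      by (intro continuous_on_mult continuous_on_subset[OF cts(1)] continuous_on_subset[OF cts(2)]) auto
  qed (use prod in auto)
  then obtain \<epsilon> :: real where eps: "\<epsilon> = 1 \<or> \<epsilon> = -1" "\<And>u. u \<in> {0<..<1} \<Longrightarrow> \<alpha> u * (\<epsilon> * \<zeta> u) > 0"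
    by (elim disjE) (auto intro: that[of 1] that[of "-1"])
  have e2: "\<epsilon> * \<epsilon> = 1" using eps(1) by auto
  define z where "z = \<epsilon> *\<^sub>R z0"
  define \<eta> where "\<eta> u = \<epsilon> * \<zeta> u" for u
  define \<phi> where "\<phi> u = \<alpha> u + 2 * \<eta> u + \<beta> u" for u
  have dec': "c u = \<alpha> u *\<^sub>R x + \<eta> u *\<^sub>R z + \<beta> u *\<^sub>R y" if u: "u \<in> {0..1}" for u
    using dec[OF u] e2 by (simp add: z_def \<eta>_def algebra_simps)
  have rel': "\<alpha> u * \<beta> u = \<eta> u * \<eta> u" if u: "u \<in> {0..1}" for u
    using rel[OF u] e2 by (simp add: \<eta>_def power2_eq_square algebra_simps)
  have signs: "(\<alpha> u \<ge> 0 \<and> \<eta> u \<ge> 0 \<and> \<beta> u \<ge> 0 \<and> \<phi> u > 0) \<or> (\<alpha> u \<le> 0 \<and> \<eta> u \<le> 0 \<and> \<beta> u \<le> 0 \<and> \<phi> u < 0)"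
    if u: "u \<in> {0..1}" for u
  proof -
    consider "u = 0" | "u = 1" | "u \<in> {0<..<1}" using u by fastforce
    then show ?thesis
    proof cases
      case 1 then show ?thesis using end0 by (simp add: \<phi>_def \<eta>_def)
    next
      case 2 then show ?thesis using end1 by (simp add: \<phi>_def \<eta>_def) linarith
    next
      case 3
      have p: "\<alpha> u * \<eta> u > 0" using eps(2)[OF 3] by (simp add: \<eta>_def)
      have "\<alpha> u * \<beta> u > 0" using rel'[OF u] p by (metis mult_zero_right not_real_square_gt_zero order_less_irrefl)
      then show ?thesis using p unfolding \<phi>_def by (auto simp: zero_less_mult_iff)
    qed
  qed
  \<comment> \<open>On a multiple of \<open>bern x z y s\<close> the weighted sum \<phi> is the
    factor and \<eta> + \<beta> is s times the factor, so the quotient is the Bernstein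
    parameter.\<close>
  define \<sigma> where "\<sigma> u = (\<eta> u + \<beta> u) / \<phi> u" for u
  have ctse: "continuous_on {0..1} \<eta>" unfolding \<eta>_def by (intro continuous_intros cts)
  have \<phi>nz: "\<phi> u \<noteq> 0" if "u \<in> {0..1}" for u using signs[OF that] by auto
  have c\<sigma>: "continuous_on {0..1} \<sigma>"
    unfolding \<sigma>_def using \<phi>nz unfolding \<phi>_def by (intro continuous_intros cts ctse) auto
  have \<sigma>01: "\<sigma> 0 = 0" "\<sigma> 1 = 1" using end0 end1 by (simp_all add: \<sigma>_def \<phi>_def \<eta>_def)
  have \<sigma>r: "\<sigma> u \<in> {0..1}" if u: "u \<in> {0..1}" for u
    using signs[OF u] unfolding \<sigma>_def by (auto simp: field_simps \<phi>_def)
  have cb: "c u = \<phi> u *\<^sub>R bern x z y (\<sigma> u)" if u: "u \<in> {0..1}" for u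
  proof -
    have n: "\<phi> u \<noteq> 0" by (rule \<phi>nz[OF u])
    have s1: "1 - \<sigma> u = (\<alpha> u + \<eta> u) / \<phi> u" using n by (simp add: \<sigma>_def \<phi>_def field_simps)
    have r: "\<alpha> u * \<beta> u = \<eta> u * \<eta> u" by (rule rel'[OF u])
    have "\<phi> u * (1 - \<sigma> u)\<^sup>2 = (\<alpha> u + \<eta> u) * (\<alpha> u + \<eta> u) / \<phi> u"
      unfolding s1 using n by (simp add: power2_eq_square)
    also have "(\<alpha> u + \<eta> u) * (\<alpha> u + \<eta> u) = \<alpha> u * \<phi> u" using r by (simp add: \<phi>_def algebra_simps)
    finally have 1: "\<phi> u * (1 - \<sigma> u)\<^sup>2 = \<alpha> u" using n by simp
    have "\<phi> u * (\<sigma> u * (1 - \<sigma> u)) = (\<eta> u + \<beta> u) * (\<alpha> u + \<eta> u) / \<phi> u"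
      unfolding s1 using n by (simp add: \<sigma>_def)
    also have "(\<eta> u + \<beta> u) * (\<alpha> u + \<eta> u) = \<eta> u * \<phi> u" using r by (simp add: \<phi>_def algebra_simps)
    finally have 2: "\<phi> u * (\<sigma> u * (1 - \<sigma> u)) = \<eta> u" using n by simp
    have "\<phi> u * (\<sigma> u)\<^sup>2 = (\<eta> u + \<beta> u) * (\<eta> u + \<beta> u) / \<phi> u"
      using n by (simp add: \<sigma>_def power2_eq_square)
    also have "(\<eta> u + \<beta> u) * (\<eta> u + \<beta> u) = \<beta> u * \<phi> u" using r by (simp add: \<phi>_def algebra_simps)
    finally have 3: "\<phi> u * (\<sigma> u)\<^sup>2 = \<beta> u" using n by simp
    show ?thesis unfolding dec'[OF u] by (simp add: bern_def scaleR_add_right 1 2 3)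
  qed
  have "indep3 x z y" unfolding indep3_def
  proof (intro allI impI)
    fix a b d assume "a *\<^sub>R x + b *\<^sub>R z + d *\<^sub>R y = 0"
    then have "a *\<^sub>R x + (b * \<epsilon>) *\<^sub>R z0 + d *\<^sub>R y = 0" by (simp add: z_def)
    then have "a = 0" "b * \<epsilon> = 0" "d = 0" using i3y unfolding indep3_def by blast+
    then show "a = 0 \<and> b = 0 \<and> d = 0" using eps(1) by auto
  qed
  moreover have "(\<lambda>u. span {c u}) ` {0..1} = conic_arc x z y"
  proof -
    have s: "span {c u} = span {bern x z y (\<sigma> u)}" if "u \<in> {0..1}" for u
      unfolding span1_eq using cb[OF that] \<phi>nz[OF that] by blast
    have im: "\<sigma> ` {0..1} = {0..1}"
    proof
      show "\<sigma> ` {0..1} \<subseteq> {0..1}" using \<sigma>r by blast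
      show "{0..1} \<subseteq> \<sigma> ` {0..1}"
      proof
        fix v :: real assume "v \<in> {0..1}"
        then have "\<exists>u\<ge>0. u \<le> 1 \<and> \<sigma> u = v" using \<sigma>01 c\<sigma> by (intro IVT') auto
        then show "v \<in> \<sigma> ` {0..1}" by auto
      qed
    qed
    have "(\<lambda>u. span {c u}) ` {0..1} = (\<lambda>s. span {bern x z y s}) ` (\<sigma> ` {0..1})"
      unfolding image_image using s by (rule image_cong[OF refl])
    then show ?thesis unfolding im conic_arc_def .
  qed
  moreover have "span {c 1} = span {y}"
    unfolding span1_eq using t by (intro exI[of _ "inverse t"]) (simp add: y_def y0_def)
  ultimately show ?thesis by (rule that[unfolded x_def[symmetric]])
qed

text \<open>The Bernstein parameter is a quotient of two linear forms evaluated on the curve and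
  hence smooth. At a critical point of it, \<open>c'\<close> would be a multiple of
  \<open>c\<close>.\<close>

lemma regular_param_of_curve:
  fixes c :: "real \<Rightarrow> real^4"
  assumes e: "e > 0" and sm: "smooth_on {-e<..<1+e} c" and I: "indep3 x z y"
    and arc: "\<And>u. u \<in> {0..1} \<Longrightarrow> c u \<noteq> 0 \<and> span {c u} \<in> conic_arc x z y"
    and inj: "\<And>u u'. u \<in> {0..1} \<Longrightarrow> u' \<in> {0..1} \<Longrightarrow> span {c u} = span {c u'} \<Longrightarrow> u = u'"
    and ends: "span {c 0} = span {x}" "span {c 1} = span {y}"
    and dc: "\<And>u. u \<in> {0..1} \<Longrightarrow> (c has_vector_derivative c' u) (at u)"
    and reg: "\<And>u. u \<in> {0..1} \<Longrightarrow> indep2 (c u) (c' u)"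
  obtains \<sigma> \<phi> where "regular_param \<sigma>" "\<And>u. u \<in> {0..1} \<Longrightarrow> \<phi> u \<noteq> 0 \<and> c u = \<phi> u *\<^sub>R bern x z y (\<sigma> u)"
proof -
  obtain d where "indep4 x z y d" by (rule indep3_extend[OF I])
  then obtain g0 g1 g2 :: "real^4" where
    g0: "g0 \<bullet> x = 1" "g0 \<bullet> z = 0" "g0 \<bullet> y = 0" and g1: "g1 \<bullet> x = 0" "g1 \<bullet> z = 1" "g1 \<bullet> y = 0"
    and g2: "g2 \<bullet> x = 0" "g2 \<bullet> z = 0" "g2 \<bullet> y = 1"
    by (rule dual4) (rule that)
  \<comment> \<open>On \<open>bern x z y s\<close> the form \<open>h\<close> takes the value (1-s)^2
    + 2 s (1-s) + s^2 = 1 and \<open>k\<close> takes the value s (1-s) + s^2 = s.\<close>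
  define h where "h = g0 + 2 *\<^sub>R g1 + g2"
  define k where "k = g1 + g2"
  have hb: "h \<bullet> bern x z y s = 1" "k \<bullet> bern x z y s = s" for s
    using g0 g1 g2 by (simp_all add: h_def k_def bern_def inner_add_right inner_add_left power2_eq_square algebra_simps)
  define \<phi> where "\<phi> u = h \<bullet> c u" for u
  define \<sigma> where "\<sigma> u = (k \<bullet> c u) / \<phi> u" for u
  have s\<phi>: "smooth_on {-e<..<1+e} \<phi>" unfolding \<phi>_def by (rule smooth_on_inner[OF sm])
  have cb: "\<phi> u \<noteq> 0 \<and> c u = \<phi> u *\<^sub>R bern x z y (\<sigma> u) \<and> \<sigma> u \<in> {0..1}" if u: "u \<in> {0..1}" for u
  proof -
    obtain s t where s: "s \<in> {0..1}" "t \<noteq> 0" "c u = t *\<^sub>R bern x z y s"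
      using arc[OF u] by (auto simp: conic_arc_def span1_eq)
    then have "\<phi> u = t" "\<sigma> u = s" using hb by (simp_all add: \<phi>_def \<sigma>_def)
    then show ?thesis using s by simp
  qed
  obtain d where d: "d > 0" "d \<le> e" "\<And>u. u \<in> {-d<..<1+d} \<Longrightarrow> \<phi> u \<noteq> 0"
    using nonzero_on_unit_nhd[OF e smooth_on_continuous[OF s\<phi>]] cb by blast
  have sub: "{-d<..<1+d} \<subseteq> {-e<..<1+e}" using d(2) by auto
  have s\<sigma>: "smooth_on {-d<..<1+d} \<sigma>"
    unfolding \<sigma>_def using d(3)
    by (intro smooth_on_divide smooth_on_inner smooth_on_subset[OF sm sub] smooth_on_subset[OF s\<phi> sub])
  have c\<sigma>: "continuous_on {0..1} \<sigma>"
    using smooth_on_continuous[OF s\<sigma>] by (rule continuous_on_subset) (use d(1) in auto)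
  have inj\<sigma>: "u = u'" if "u \<in> {0..1}" "u' \<in> {0..1}" "\<sigma> u = \<sigma> u'" for u u'
  proof -
    have "c u = (\<phi> u / \<phi> u') *\<^sub>R c u'"
    proof -
      have "c u = \<phi> u *\<^sub>R bern x z y (\<sigma> u')" using cb[OF that(1)] that(3) by simp
      also have "\<dots> = (\<phi> u / \<phi> u') *\<^sub>R (\<phi> u' *\<^sub>R bern x z y (\<sigma> u'))" using cb[OF that(2)] by simp
      finally show ?thesis using cb[OF that(2)] by simp
    qed
    moreover have "\<phi> u / \<phi> u' \<noteq> 0" using cb that by simp
    ultimately have "span {c u} = span {c u'}" unfolding span1_eq by blast
    then show ?thesis using inj that by blast
  qed
  have \<sigma>01: "\<sigma> 0 = 0" "\<sigma> 1 = 1"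
  proof -
    obtain t where "t \<noteq> 0" "c 0 = t *\<^sub>R x" using ends(1) by (auto simp: span1_eq)
    then show "\<sigma> 0 = 0" using hb[of 0] by (simp add: \<sigma>_def \<phi>_def)
    obtain t where "t \<noteq> 0" "c 1 = t *\<^sub>R y" using ends(2) by (auto simp: span1_eq)
    then show "\<sigma> 1 = 1" using hb[of 1] by (simp add: \<sigma>_def \<phi>_def)
  qed
  have io: "inj_on \<sigma> {0..1}" using inj\<sigma> by (intro inj_onI) blast
  have m1: "\<sigma> u < \<sigma> u'" if "0 < u" "u < u'" "u' \<le> 1" for u u'
  proof -
    have "(\<sigma> 0 < \<sigma> u \<and> \<sigma> u < \<sigma> u') \<or> (\<sigma> u' < \<sigma> u \<and> \<sigma> u < \<sigma> 0)"
      by (rule continuous_inj_imp_mono[OF that(1,2)])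
        (use that continuous_on_subset[OF c\<sigma>] inj_on_subset[OF io] in auto)
    moreover have "\<sigma> u \<ge> 0" using cb[of u] that by auto
    ultimately show ?thesis using \<sigma>01 by auto
  qed
  have "strict_mono_on {0..1} \<sigma>"
  proof (rule strict_mono_onI)
    fix u u' :: real assume u: "u \<in> {0..1}" "u' \<in> {0..1}" "u < u'"
    show "\<sigma> u < \<sigma> u'"
    proof (cases "u = 0")
      case True
      have "\<sigma> u' \<noteq> \<sigma> 0" using inj\<sigma>[OF u(2), of 0] u True by auto
      moreover have "\<sigma> u' \<ge> 0" using cb[OF u(2)] by simp
      ultimately show ?thesis using True \<sigma>01 by simp
    next
      case False
      then show ?thesis using m1 u by auto
    qed
  qed
  moreover have "\<exists>D. D \<noteq> 0 \<and> (\<sigma> has_vector_derivative D) (at s)" if s: "s \<in> {0..1}" for s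
  proof -
    have sd: "s \<in> {-d<..<1+d}" "s \<in> {-e<..<1+e}" using s d(1) e by auto
    obtain \<sigma>' where \<sigma>': "\<And>u. u \<in> {-d<..<1+d} \<Longrightarrow> (\<sigma> has_vector_derivative \<sigma>' u) (at u)"
      using smooth_on_real_deriv[OF _ s\<sigma>] by auto
    obtain \<phi>' where \<phi>': "\<And>u. u \<in> {-e<..<1+e} \<Longrightarrow> (\<phi> has_vector_derivative \<phi>' u) (at u)"
      using smooth_on_real_deriv[OF _ s\<phi>] by auto
    have "\<sigma>' s \<noteq> 0"
    proof
      assume z: "\<sigma>' s = 0"
      have b: "((\<lambda>u. bern x z y (\<sigma> u)) has_vector_derivative (\<sigma>' s *\<^sub>R dbern x z y (\<sigma> s))) (at s)"
        using vector_diff_chain_at[OF \<sigma>'[OF sd(1)] bern_deriv] by (simp add: o_def)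
      have "((\<lambda>u. \<phi> u *\<^sub>R bern x z y (\<sigma> u)) has_vector_derivative
          (\<phi> s *\<^sub>R (\<sigma>' s *\<^sub>R dbern x z y (\<sigma> s)) + \<phi>' s *\<^sub>R bern x z y (\<sigma> s))) (at s)"
        using has_vector_derivative_scaleR[OF _ b] \<phi>'[OF sd(2)]
        by (simp add: has_real_derivative_iff_has_vector_derivative)
      then have "((\<lambda>u. \<phi> u *\<^sub>R bern x z y (\<sigma> u)) has_vector_derivative (\<phi>' s *\<^sub>R bern x z y (\<sigma> s))) (at s within {0..1})"
        using z has_vector_derivative_at_within by fastforce
      then have "(c has_vector_derivative (\<phi>' s *\<^sub>R bern x z y (\<sigma> s))) (at s within {0..1})"
        by (rule has_vector_derivative_transform[OF s, rotated]) (use cb in auto)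
      moreover have "(c has_vector_derivative c' s) (at s within {0..1})"
        using dc[OF s] by (rule has_vector_derivative_at_within)
      ultimately have c's: "c' s = \<phi>' s *\<^sub>R bern x z y (\<sigma> s)"
        using vector_derivative_unique_within_closed_interval[of 0 1 s c] s by (metis cbox_interval zero_less_one)
      have cs: "c s = \<phi> s *\<^sub>R bern x z y (\<sigma> s)" using cb[OF s] by blast
      have "(\<phi>' s) *\<^sub>R c s + (- \<phi> s) *\<^sub>R c' s = 0" unfolding c's by (subst cs) (simp add: mult.commute)
      then have "\<phi> s = 0" using reg[OF s] unfolding indep2_def by fastforce
      then show False using cb[OF s] by simp
    qed
    then show ?thesis using \<sigma>'[OF sd(1)] by blast
  qed
  ultimately have "regular_param \<sigma>"
    unfolding regular_param_def using \<sigma>01 d(1) s\<sigma> by blast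
  then show ?thesis using that cb by blast
qed

text \<open>The form of the cone restricts to the plane as a multiple b of the form of the conic. If
  b were 0, the restriction would vanish, and all vectors of the plane orthogonal to one further
  vector \<open>n\<close> would lie in the kernel, which would then have dimension at least
  2.\<close>

lemma quadratic_cone_conic:
  assumes M: "quadratic_cone M" and I: "indep3 x z y"
    and 0: "\<And>s. s \<in> {0..1} \<Longrightarrow> bern x z y s \<bullet> (M *v bern x z y s) = 0"
  obtains b where "b \<noteq> 0" "x \<bullet> (M *v x) = 0" "y \<bullet> (M *v y) = 0" "x \<bullet> (M *v z) = 0" "z \<bullet> (M *v y) = 0"
    "x \<bullet> (M *v y) = b" "z \<bullet> (M *v z) = - 2 * b"
    "\<And>w. w \<in> span {x, z, y} \<Longrightarrow> M *v w = 0 \<Longrightarrow> w = 0"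
proof -
  have tr: "transpose M = M" and dk: "dim {v. M *v v = 0} = 1" using M by (auto simp: quadratic_cone_def)
  define B where "B v w = v \<bullet> (M *v w)" for v w
  have Bs: "B v w = B w v" for v w unfolding B_def by (rule form_symmetric[OF tr])
  have Ba: "B v (a + b) = B v a + B v b" "B v (t *\<^sub>R a) = t * B v a" for v a b t
    unfolding B_def by (rule form_linear)+
  have Bl: "B (a + b) v = B a v + B b v" "B (t *\<^sub>R a) v = t * B a v" for v a b t
    using Ba Bs by metis+
  have ex: "(1-s)^4 * B x x + 2 * (1-s)^3 * s * B x z + (1-s)\<^sup>2 * s\<^sup>2 * (2 * B x y + B z z)
      + 2 * (1-s) * s^3 * B z y + s^4 * B y y = B (bern x z y s) (bern x z y s)" for s
    unfolding bern_def Ba Bl Bs[of z x] Bs[of y x] Bs[of y z]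
    by (simp add: power2_eq_square power3_eq_cube power4_eq_xxxx algebra_simps)
  \<comment> \<open>A quartic in s with five zeros vanishes identically; the zeros used are 0, 1,
    1/2, 1/3 and 2/3.\<close>
  have e0: "B x x = 0" using ex[of 0] 0[of 0] by (simp add: B_def)
  have e1: "B y y = 0" using ex[of 1] 0[of 1] by (simp add: B_def)
  have h2: "B x z + (2 * B x y + B z z) / 2 + B z y = 0" using ex[of "1/2"] 0[of "1/2"] e0 e1
    by (simp add: B_def[symmetric] power2_eq_square power3_eq_cube field_simps)
  have h3: "8 * B x z + 2 * (2 * B x y + B z z) + 2 * B z y = 0" using ex[of "1/3"] 0[of "1/3"] e0 e1
    by (simp add: B_def[symmetric] power2_eq_square power3_eq_cube field_simps)
  have h4: "2 * B x z + 2 * (2 * B x y + B z z) + 8 * B z y = 0" using ex[of "2/3"] 0[of "2/3"] e0 e1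
    by (simp add: B_def[symmetric] power2_eq_square power3_eq_cube field_simps)
  have e2': "B x z = 0" "B z y = 0" using h2 h3 h4 by linarith+
  have "B z z = - (2 * B x y)" using h3 unfolding e2' by simp
  then have e2: "B x z = 0" "B z y = 0" "B z z = - 2 * B x y" using e2' by simp_all
  have b: "B x y \<noteq> 0"
  proof
    assume b0: "B x y = 0"
    obtain n where n4: "indep4 x z y n" by (rule indep3_extend[OF I])
    then obtain g0 g1 g2 g3 :: "real^4" where
      dec: "\<And>w. w = (g0 \<bullet> w) *\<^sub>R x + (g1 \<bullet> w) *\<^sub>R z + (g2 \<bullet> w) *\<^sub>R y + (g3 \<bullet> w) *\<^sub>R n"
      by (rule dual4) (rule that)
    have ker: "M *v v = 0" if v: "B x v = 0" "B z v = 0" "B y v = 0" "B n v = 0" for v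
    proof -
      have "B w v = 0" for w
      proof -
        have "B w v = B ((g0 \<bullet> w) *\<^sub>R x + (g1 \<bullet> w) *\<^sub>R z + (g2 \<bullet> w) *\<^sub>R y + (g3 \<bullet> w) *\<^sub>R n) v"
          using dec[of w] by simp
        also have "\<dots> = 0" unfolding Bl using v by simp
        finally show ?thesis .
      qed
      then have "(M *v v) \<bullet> (M *v v) = 0" unfolding B_def by blast
      then show ?thesis by simp
    qed
    have two: False if "indep2 u v" "M *v u = 0" "M *v v = 0" for u v
    proof -
      have "span {u, v} \<subseteq> {v. M *v v = 0}"
        using that(2,3) by (auto simp: mem_span2 matrix_vector_right_distrib matrix_vector_mult_scaleR)
      then have "dim (span {u, v}) \<le> dim {v. M *v v = 0}" by (rule dim_subset)
      then show False using dim_span2[OF that(1)] dk by simp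
    qed
    have z: "B z x = 0" "B y x = 0" "B y z = 0" using Bs e2 b0 by metis+
    have kl: "M *v (p *\<^sub>R x + q *\<^sub>R z + r *\<^sub>R y) = 0" if "p * B n x + q * B n z + r * B n y = 0" for p q r
      using that e0 e1 e2 b0 z by (intro ker) (simp_all add: Ba)
    have i2: "indep2 (p *\<^sub>R x + q *\<^sub>R z + r *\<^sub>R y) (p' *\<^sub>R x + q' *\<^sub>R z + r' *\<^sub>R y)"
      if "p * q' - q * p' \<noteq> 0 \<or> p * r' - r * p' \<noteq> 0 \<or> q * r' - r * q' \<noteq> 0" for p q r p' q' r'
      unfolding indep2_def
    proof (intro allI impI)
      fix \<alpha> \<beta> assume "\<alpha> *\<^sub>R (p *\<^sub>R x + q *\<^sub>R z + r *\<^sub>R y) + \<beta> *\<^sub>R (p' *\<^sub>R x + q' *\<^sub>R z + r' *\<^sub>R y) = 0"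
      then have "(\<alpha> * p + \<beta> * p') *\<^sub>R x + (\<alpha> * q + \<beta> * q') *\<^sub>R z + (\<alpha> * r + \<beta> * r') *\<^sub>R y = 0"
        by (simp add: algebra_simps)
      then have e: "\<alpha> * p + \<beta> * p' = 0" "\<alpha> * q + \<beta> * q' = 0" "\<alpha> * r + \<beta> * r' = 0"
        using I unfolding indep3_def by blast+
      have "\<alpha> * (p * q' - q * p') = 0" "\<beta> * (p * q' - q * p') = 0" "\<alpha> * (p * r' - r * p') = 0"
        "\<beta> * (p * r' - r * p') = 0" "\<alpha> * (q * r' - r * q') = 0" "\<beta> * (q * r' - r * q') = 0"
        using e by algebra+
      then show "\<alpha> = 0 \<and> \<beta> = 0" using that by auto
    qed
    have two': False
      if "p * B n x + q * B n z + r * B n y = 0" "p' * B n x + q' * B n z + r' * B n y = 0"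
        "p * q' - q * p' \<noteq> 0 \<or> p * r' - r * p' \<noteq> 0 \<or> q * r' - r * q' \<noteq> 0" for p q r p' q' r'
      by (rule two[OF i2[OF that(3)] kl[OF that(1)] kl[OF that(2)]])
    \<comment> \<open>Two independent solutions of one linear equation in three unknowns, written
      down according to which coefficient is nonzero.\<close>
    show False
    proof (cases "B n x = 0")
      case True
      show False
        using two'[of 1 0 0 0 1 0] two'[of 1 0 0 0 "- B n y" "B n z"] True by (cases "B n z = 0") simp_all
    next
      case False
      show False using two'[of "B n z" "- B n x" 0 "B n y" 0 "- B n x"] False by simp
    qed
  qed
  have "w = 0" if w: "w \<in> span {x, z, y}" "M *v w = 0" for w
  proof -
    obtain \<alpha> \<zeta> \<beta> where we: "w = \<alpha> *\<^sub>R x + \<zeta> *\<^sub>R z + \<beta> *\<^sub>R y" using w(1) by (auto simp: mem_span3)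
    have "B x w = 0" "B z w = 0" "B y w = 0" using w(2) by (simp_all add: B_def)
    then have "\<beta> = 0" "\<zeta> = 0" "\<alpha> = 0"
      unfolding we Ba using e0 e1 e2 b Bs[of z x] Bs[of y z] Bs[of y x] by simp_all
    then show ?thesis by (simp add: we)
  qed
  then show ?thesis using that[OF b] e0 e1 e2 unfolding B_def by simp
qed

section \<open>Normal form of a generic patch\<close>

lemma line_deriv:
  assumes "open U" "smooth_on U H" "w + s *\<^sub>R axis r 1 \<in> U"
  shows "((\<lambda>s. H (w + s *\<^sub>R axis r 1)) has_vector_derivative pd r H (w + s *\<^sub>R axis r 1)) (at s)"
proof -
  note D = smooth_on_has_derivative[OF assms(2,3)]
  have "((\<lambda>s. w + s *\<^sub>R axis r 1) has_derivative (\<lambda>h. h *\<^sub>R axis r 1)) (at s)"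
    by (auto intro!: derivative_eq_intros)
  from has_derivative_compose[OF this D]
  have "((\<lambda>s. H (w + s *\<^sub>R axis r 1)) has_derivative
      (\<lambda>h. frechet_derivative H (at (w + s *\<^sub>R axis r 1)) (h *\<^sub>R axis r 1))) (at s)" .
  moreover have "frechet_derivative H (at (w + s *\<^sub>R axis r 1)) (h *\<^sub>R axis r 1) = h *\<^sub>R pd r H (w + s *\<^sub>R axis r 1)" for h
    unfolding pd_def using linear_scale[OF has_derivative_linear[OF D]] by blast
  ultimately show ?thesis unfolding has_vector_derivative_def by simp
qed

lemma pt3_swap: "j \<noteq> k \<Longrightarrow> pt3 j k u v c = pt3 k j v u c"
  by (auto simp: pt3_def vec_eq_iff)

lemma pt3_line:
  "pt3 j k u v c = pt3 j k 0 v c + u *\<^sub>R axis j 1"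
  "j \<noteq> k \<Longrightarrow> pt3 j k u v c = pt3 j k u 0 c + v *\<^sub>R axis k 1"
  by (auto simp: pt3_def axis_def vec_eq_iff)

lemma indep2_of_minors:
  assumes "\<alpha> * \<zeta>' = \<alpha>' * \<zeta>" "\<alpha> * \<beta>' = \<alpha>' * \<beta>" "\<zeta> * \<beta>' = \<zeta>' * \<beta>"
    and g: "g = \<alpha> *\<^sub>R x + \<zeta> *\<^sub>R z + \<beta> *\<^sub>R y" and h: "h = \<alpha>' *\<^sub>R x + \<zeta>' *\<^sub>R z + \<beta>' *\<^sub>R y"
  shows "\<not> indep2 g h"
proof
  assume i: "indep2 g h"
  have D: "\<And>p q. p *\<^sub>R g + q *\<^sub>R h = 0 \<Longrightarrow> p = 0 \<and> q = 0" using i unfolding indep2_def by blast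
  have "\<alpha>' *\<^sub>R g + (-\<alpha>) *\<^sub>R h = (\<alpha>' * \<zeta> - \<alpha> * \<zeta>') *\<^sub>R z + (\<alpha>' * \<beta> - \<alpha> * \<beta>') *\<^sub>R y"
    unfolding g h by (simp add: algebra_simps)
  then have "\<alpha>' *\<^sub>R g + (-\<alpha>) *\<^sub>R h = 0" using assms(1,2) by simp
  from D[OF this] have 1: "\<alpha> = 0" by simp
  have "\<zeta>' *\<^sub>R g + (-\<zeta>) *\<^sub>R h = (\<zeta>' * \<alpha> - \<zeta> * \<alpha>') *\<^sub>R x + (\<zeta>' * \<beta> - \<zeta> * \<beta>') *\<^sub>R y"
    unfolding g h by (simp add: algebra_simps)
  then have "\<zeta>' *\<^sub>R g + (-\<zeta>) *\<^sub>R h = 0" using assms(1,3) by (simp add: mult.commute)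
  from D[OF this] have 2: "\<zeta> = 0" by simp
  have "\<beta>' *\<^sub>R g + (-\<beta>) *\<^sub>R h = (\<beta>' * \<alpha> - \<beta> * \<alpha>') *\<^sub>R x + (\<beta>' * \<zeta> - \<beta> * \<zeta>') *\<^sub>R z"
    unfolding g h by (simp add: algebra_simps)
  then have "\<beta>' *\<^sub>R g + (-\<beta>) *\<^sub>R h = 0" using assms(2,3) by (simp add: mult.commute)
  from D[OF this] have 3: "\<beta> = 0" by simp
  have "1 *\<^sub>R g + 0 *\<^sub>R h = 0" using 1 2 3 g by simp
  from D[OF this] show False by simp
qed

section \<open>A supercyclidic patch in local coordinates\<close>

locale char_patch =
  fixes i j k :: 3 and f :: patch and F :: "real^3 \<Rightarrow> real^4" and e :: real
  assumes dist: "distinct3 i j k" and e: "e > 0" and cp: "char_param i (cube_nhd e) F"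
    and rep: "\<And>x. x \<in> cube \<Longrightarrow> f x = span {F x}"
    and inj: "\<And>r x y. r \<noteq> i \<Longrightarrow> x \<in> cube \<Longrightarrow> y \<in> cube \<Longrightarrow> y \<in> line_at r x \<Longrightarrow> f y = f x \<Longrightarrow> y = x"
begin

text \<open>The coordinate of the direction \<open>i\<close> is frozen at 0. In what follows a row
  is a parameter line of direction \<open>j\<close>, with v fixed, and a column one of direction
  \<open>k\<close>.\<close>

definition G :: "real \<Rightarrow> real \<Rightarrow> real^4" where "G u v = F (pt3 j k u v 0)"
definition Gu :: "real \<Rightarrow> real \<Rightarrow> real^4" where "Gu u v = pd j F (pt3 j k u v 0)"
definition Gv :: "real \<Rightarrow> real \<Rightarrow> real^4" where "Gv u v = pd k F (pt3 j k u v 0)"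

abbreviation "I \<equiv> {-e<..<1+e}"

lemma ne: "i \<noteq> j" "i \<noteq> k" "j \<noteq> k" "j \<noteq> i" "k \<noteq> i" "k \<noteq> j"
  using dist by (auto simp: distinct3_def)

lemma unit_I: "u \<in> {0..1} \<Longrightarrow> u \<in> I" and zero_I: "0 \<in> I"
  using e by auto

lemma pt_nhd: "u \<in> I \<Longrightarrow> v \<in> I \<Longrightarrow> pt3 j k u v 0 \<in> cube_nhd e"
  by (rule pt3_cube_nhd) (use zero_I in auto)

lemma cj: "conj_param i (cube_nhd e) F" and sm: "smooth_on (cube_nhd e) F"
  using cp unfolding char_param_def conj_param_def by blast+

lemma dG: "u \<in> I \<Longrightarrow> v \<in> I \<Longrightarrow> ((\<lambda>u. G u v) has_vector_derivative Gu u v) (at u)"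
  "u \<in> I \<Longrightarrow> v \<in> I \<Longrightarrow> ((\<lambda>v. G u v) has_vector_derivative Gv u v) (at v)"
  using line_deriv[OF cube_nhd_open sm, of "pt3 j k 0 v 0" u j] line_deriv[OF cube_nhd_open sm, of "pt3 j k u 0 0" v k]
    pt_nhd[of u v] unfolding G_def Gu_def Gv_def pt3_line(1)[of j k u v] pt3_line(2)[OF ne(3), of u v]
  by (simp_all flip: pt3_line(1) pt3_line(2)[OF ne(3)])

lemma tp: "u \<in> I \<Longrightarrow> v \<in> I \<Longrightarrow> tangent_plane i F (pt3 j k u v 0) = span {G u v, Gu u v, Gv u v}"
  unfolding G_def Gu_def Gv_def by (rule tangent_plane_eq[OF dist])

lemma i3: "u \<in> I \<Longrightarrow> v \<in> I \<Longrightarrow> indep3 (G u v) (Gu u v) (Gv u v)"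
  using cj pt_nhd[of u v] tp[of u v] unfolding conj_param_def by (metis indep3_spanI)

lemma G_nz: "u \<in> I \<Longrightarrow> v \<in> I \<Longrightarrow> G u v \<noteq> 0"
  using i3[of u v] unfolding indep3_def by (metis add.right_neutral scaleR_zero_left scaleR_zero_right zero_neq_one)

lemma f_G: "u \<in> {0..1} \<Longrightarrow> v \<in> {0..1} \<Longrightarrow> f (pt3 j k u v 0) = span {G u v}"
  unfolding G_def by (rule rep, rule pt3_cube) auto

lemma f_G': "w \<in> cube \<Longrightarrow> f w = span {G (w $ j) (w $ k)}"
proof -
  assume w: "w \<in> cube"
  have "pt3 j k (w $ j) (w $ k) 0 \<in> line_at i w"
    unfolding line_at_def mem_Collect_eq distinct3_all[OF dist] using ne by (simp add: pt3_def)
  moreover have "pt3 j k (w $ j) (w $ k) 0 \<in> cube" by (rule pt3_cube) (use cube_nth[OF w] in auto)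
  ultimately have "F (pt3 j k (w $ j) (w $ k) 0) = F w"
    using cj w cube_subset_nhd[OF e] unfolding conj_param_def by blast
  then show ?thesis using rep[OF w] by (simp add: G_def)
qed

lemma inj_row: "u \<in> {0..1} \<Longrightarrow> u' \<in> {0..1} \<Longrightarrow> v \<in> {0..1} \<Longrightarrow> span {G u v} = span {G u' v} \<Longrightarrow> u = u'"
proof -
  assume u: "u \<in> {0..1}" "u' \<in> {0..1}" "v \<in> {0..1}" and s: "span {G u v} = span {G u' v}"
  have "pt3 j k u v 0 = pt3 j k u' v 0"
  proof (rule inj[OF ne(4)])
    show "pt3 j k u v 0 \<in> line_at j (pt3 j k u' v 0)" by (auto simp: line_at_def pt3_def)
    show "f (pt3 j k u v 0) = f (pt3 j k u' v 0)" using s u by (simp only: f_G)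
  qed (rule pt3_cube; use u in simp)+
  then show "u = u'" by (metis pt3_nth(1))
qed

text \<open>\<open>n\<close> is the normal of the plane of the row and \<open>w0\<close> the vertex
  of the cone touching along it. By conjugacy the v-tangent is polar to the tangent of the row with
  respect to the cone, so it passes through the vertex; this is the stated form of
  \<open>Gv\<close>.\<close>

lemma row:
  assumes v: "v \<in> {0..1}"
  obtains n w0 u1 u2 u3 where "n \<bullet> w0 \<noteq> 0" "\<And>u. u \<in> {0..1} \<Longrightarrow> n \<bullet> G u v = 0"
    "\<And>a. a \<in> char_line j f \<Longrightarrow> n \<bullet> a = 0"
    "\<And>u. u \<in> {0..1} \<Longrightarrow> \<exists>\<kappa> \<mu>. \<mu> \<noteq> 0 \<and> Gv u v = \<kappa> *\<^sub>R G u v + \<mu> *\<^sub>R w0"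
    "u1 \<in> {0..1}" "u2 \<in> {0..1}" "u3 \<in> {0..1}" "indep3 (G u1 v) (G u2 v) (G u3 v)"
proof -
  have vI: "v \<in> I" by (rule unit_I[OF v])
  define x0 where "x0 = pt3 j k 0 v 0"
  have x0: "x0 \<in> cube" "x0 \<in> cube_nhd e"
    using pt3_cube[of 0 v 0 j k] v pt_nhd[OF zero_I vI] by (auto simp: x0_def)
  obtain K where K: "is_conic K" "\<And>y. y \<in> cube_nhd e \<inter> line_at j x0 \<Longrightarrow> span {F y} \<in> K"
    using cp x0(2) ne unfolding char_param_def by meson
  obtain M where M: "quadratic_cone M" "\<And>y. y \<in> cube_nhd e \<inter> line_at j x0 \<Longrightarrow>
      F y \<bullet> (M *v F y) = 0 \<and> M *v F y \<noteq> 0 \<and> tangent_plane i F y = cone_tangent_plane M (F y)"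
    using cp x0(2) ne unfolding char_param_def by meson
  have on: "pt3 j k u v 0 \<in> cube_nhd e \<inter> line_at j x0" if "u \<in> I" for u
    using pt_nhd[OF that vI] by (auto simp: line_at_def x0_def pt3_def)
  have GK: "span {G u v} \<in> K" and GM: "G u v \<bullet> (M *v G u v) = 0"
    and GT: "span {G u v, Gu u v, Gv u v} = {w. w \<bullet> (M *v G u v) = 0}" if "u \<in> I" for u
    using K(2)[OF on[OF that]] M(2)[OF on[OF that]] tp[OF that vI]
    by (auto simp: G_def cone_tangent_plane_def)
  have tr: "transpose M = M" and dk: "dim {v. M *v v = 0} = 1" using M(1) by (auto simp: quadratic_cone_def)
  have cont: "continuous_on {0..1} (\<lambda>u. G u v)"
    using dG(1)[OF unit_I vI] by (intro continuous_at_imp_continuous_on ballI) (metis has_vector_derivative_continuous)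
  obtain z y where zy: "indep3 (G 0 v) z y" "(\<lambda>u. span {G u v}) ` {0..1} = conic_arc (G 0 v) z y"
  proof (rule conic_arc_exists[OF K(1) cont])
    show "G u v \<noteq> 0 \<and> span {G u v} \<in> K" if "u \<in> {0..1}" for u
      using GK[OF unit_I[OF that]] G_nz[OF unit_I[OF that] vI] by blast
    show "u = u'" if "u \<in> {0..1}" "u' \<in> {0..1}" "span {G u v} = span {G u' v}" for u u'
      by (rule inj_row[OF that(1,2) v that(3)])
  qed (rule that)
  define x where "x = G 0 v"
  obtain E where E: "subspace E" "dim E = 3" "\<And>p. p \<in> K \<Longrightarrow> p \<subseteq> E"
    using K(1) unfolding is_conic_def by blast
  have GE: "G u v \<in> E" if "u \<in> I" for u using E(3)[OF GK[OF that]] span_base[of "G u v" "{G u v}"] by auto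
  have onarc: "\<exists>u t. u \<in> {0..1} \<and> t \<noteq> 0 \<and> bern x z y s = t *\<^sub>R G u v" if s: "s \<in> {0..1}" for s
  proof -
    have "span {bern x z y s} \<in> (\<lambda>u. span {G u v}) ` {0..1}"
      unfolding zy(2) x_def conic_arc_def using s by blast
    then show ?thesis by (auto simp: span1_eq)
  qed
  have bE: "bern x z y s \<in> E" if s: "s \<in> {0..1}" for s
    using onarc[OF s] GE[OF unit_I] E(1) by (metis subspace_scale)
  have xE: "x \<in> E" "y \<in> E" using bE[of 0] bE[of 1] by auto
  have "4 *\<^sub>R bern x z y (1/2) - x - y \<in> E" using bE[of "1/2"] xE E(1) by (intro subspace_diff subspace_scale) auto
  then have zE: "z \<in> E" by (simp add: bern_half)
  have I3: "indep3 x z y" using zy(1) by (simp add: x_def)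
  have Ee: "E = span {x, z, y}" by (rule span3_eqI[OF I3 xE(1) zE xE(2) E(1,2)])
  have form0: "bern x z y s \<bullet> (M *v bern x z y s) = 0" if s: "s \<in> {0..1}" for s
  proof -
    obtain u t where "u \<in> {0..1}" "bern x z y s = t *\<^sub>R G u v" using onarc[OF s] by blast
    then show ?thesis using GM[OF unit_I] by (simp add: matrix_vector_mult_scaleR)
  qed
  obtain b where b: "b \<noteq> 0" "x \<bullet> (M *v x) = 0" "y \<bullet> (M *v y) = 0" "x \<bullet> (M *v z) = 0" "z \<bullet> (M *v y) = 0"
    "x \<bullet> (M *v y) = b" "z \<bullet> (M *v z) = - 2 * b"
    "\<And>w. w \<in> span {x, z, y} \<Longrightarrow> M *v w = 0 \<Longrightarrow> w = 0"
    by (rule quadratic_cone_conic[OF M(1) I3 form0]) (assumption, rule that)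
  obtain n where n: "n \<noteq> 0" "E = {w. n \<bullet> w = 0}" by (rule hyperplane_normal[OF E(1,2)])
  have "subspace {v. M *v v = 0}"
    by (auto simp: subspace_def matrix_vector_right_distrib matrix_vector_mult_scaleR)
  then obtain w0 where w0: "w0 \<noteq> 0" "{v. M *v v = 0} = span {w0}" using subspace_dim1 dk by blast
  have Mw0: "M *v w0 = 0" using w0(2) span_base[of w0 "{w0}"] by auto
  have nw0: "n \<bullet> w0 \<noteq> 0" using b(8)[of w0] Mw0 w0(1) unfolding Ee[symmetric] n(2) by auto
  have nG: "n \<bullet> G u v = 0" if "u \<in> I" for u using GE[OF that] n(2) by blast
  have nGu: "n \<bullet> Gu u v = 0" if u: "u \<in> I" for u
  proof -
    have "((\<lambda>u. n \<bullet> G u v) has_vector_derivative n \<bullet> Gu u v) (at u)"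
      by (rule bounded_linear.has_vector_derivative[OF bounded_linear_inner_right dG(1)[OF u vI]])
    moreover have "((\<lambda>u. n \<bullet> G u v) has_vector_derivative 0) (at u)"
      by (rule has_vector_derivative_transform_within_open[of "\<lambda>_. 0" _ _ I]) (use u nG in auto)
    ultimately show ?thesis by (rule vector_derivative_unique_at)
  qed
  have Gvdec: "\<exists>\<kappa> \<mu>. \<mu> \<noteq> 0 \<and> Gv u v = \<kappa> *\<^sub>R G u v + \<mu> *\<^sub>R w0" if u01: "u \<in> {0..1}" for u
  proof -
    have u: "u \<in> I" by (rule unit_I[OF u01])
    note T = GT[OF u]
    have "w0 \<bullet> (M *v G u v) = 0" using form_symmetric[OF tr, of w0 "G u v"] Mw0 by simp
    then have "w0 \<in> span {G u v, Gu u v, Gv u v}" unfolding T by simp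
    then obtain c d g where w0e: "w0 = c *\<^sub>R G u v + d *\<^sub>R Gu u v + g *\<^sub>R Gv u v" by (auto simp: mem_span3)
    have "n \<bullet> w0 = g * (n \<bullet> Gv u v)" unfolding w0e using nG[OF u] nGu[OF u] by (simp add: inner_add_right)
    then have g: "g \<noteq> 0" using nw0 by auto
    have "g *\<^sub>R Gv u v = w0 - c *\<^sub>R G u v - d *\<^sub>R Gu u v" unfolding w0e by simp
    then have "inverse g *\<^sub>R (g *\<^sub>R Gv u v) = inverse g *\<^sub>R (w0 - c *\<^sub>R G u v - d *\<^sub>R Gu u v)" by simp
    then have Gve: "Gv u v = (- c / g) *\<^sub>R G u v + (- d / g) *\<^sub>R Gu u v + (1 / g) *\<^sub>R w0"
      using g by (simp add: scaleR_diff_right divide_inverse mult.commute)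
    have in_T: "G u v \<in> span {G u v, Gu u v, Gv u v}" "Gu u v \<in> span {G u v, Gu u v, Gv u v}"
      "Gv u v \<in> span {G u v, Gu u v, Gv u v}" by (auto intro: span_base)
    have GuM: "Gu u v \<bullet> (M *v G u v) = 0" using in_T(2) unfolding T by simp
    have "pd j (pd k F) (pt3 j k u v 0) \<in> tangent_plane i F (pt3 j k u v 0)"
      using cj pt_nhd[OF u vI] dist unfolding conj_param_def by blast
    then have GvuM: "pd j (pd k F) (pt3 j k u v 0) \<bullet> (M *v G u v) = 0" unfolding tp[OF u vI] T by simp
    have dGv: "((\<lambda>u. Gv u v) has_vector_derivative pd j (pd k F) (pt3 j k u v 0)) (at u)"
      using line_deriv[OF cube_nhd_open smooth_on_pd[OF cube_nhd_open sm], of "pt3 j k 0 v 0" u j k] pt_nhd[OF u vI]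
      unfolding Gv_def by (simp flip: pt3_line(1))
    have dMG: "((\<lambda>u. M *v G u v) has_vector_derivative M *v Gu u v) (at u)"
      by (rule bounded_linear.has_vector_derivative[OF matrix_vector_mul_bounded_linear dG(1)[OF u vI]])
    \<comment> \<open>\<open>Gv\<close> stays in the tangent plane along the row. In the derivative
      of this incidence the mixed second derivative drops out by conjugacy, which leaves
      \<open>Gv\<close> orthogonal to \<open>Gu\<close>.\<close>
    have "((\<lambda>u. Gv u v \<bullet> (M *v G u v)) has_vector_derivative
        (Gv u v \<bullet> (M *v Gu u v) + pd j (pd k F) (pt3 j k u v 0) \<bullet> (M *v G u v))) (at u)"
      using has_derivative_inner[OF dGv[unfolded has_vector_derivative_def] dMG[unfolded has_vector_derivative_def]]
      unfolding has_vector_derivative_def by (simp add: algebra_simps)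
    moreover have "((\<lambda>u. Gv u v \<bullet> (M *v G u v)) has_vector_derivative 0) (at u)"
    proof (rule has_vector_derivative_transform_within_open[of "\<lambda>_. 0" _ _ I])
      fix u' assume u': "u' \<in> I"
      have "Gv u' v \<in> span {G u' v, Gu u' v, Gv u' v}" by (auto intro: span_base)
      then show "0 = Gv u' v \<bullet> (M *v G u' v)" unfolding GT[OF u'] by simp
    qed (use u in auto)
    ultimately have "Gv u v \<bullet> (M *v Gu u v) + pd j (pd k F) (pt3 j k u v 0) \<bullet> (M *v G u v) = 0"
      by (rule vector_derivative_unique_at)
    then have "Gv u v \<bullet> (M *v Gu u v) = 0" using GvuM by simp
    then have z1: "Gu u v \<bullet> (M *v Gv u v) = 0" using form_symmetric[OF tr] by metis
    have "Gu u v \<bullet> (M *v Gv u v)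
        = Gu u v \<bullet> (M *v ((- c / g) *\<^sub>R G u v + (- d / g) *\<^sub>R Gu u v + (1 / g) *\<^sub>R w0))"
      by (rule arg_cong[OF Gve])
    also have "\<dots> = (- d / g) * (Gu u v \<bullet> (M *v Gu u v))"
      unfolding form_linear using GuM Mw0 by simp
    finally have "Gu u v \<bullet> (M *v Gv u v) = (- d / g) * (Gu u v \<bullet> (M *v Gu u v))" .
    then have prod0: "d = 0 \<or> Gu u v \<bullet> (M *v Gu u v) = 0" using z1 g by auto
    have i2: "indep2 (G u v) (Gu u v)" by (rule indep3_D(2)[OF i3[OF u vI]])
    \<comment> \<open>Otherwise the whole tangent line would satisfy the equation of the conic; then
      the squares of all 2 x 2 minors vanish and \<open>G\<close>, \<open>Gu\<close> are
      dependent.\<close>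
    have nz: "Gu u v \<bullet> (M *v Gu u v) \<noteq> 0"
    proof
      assume z: "Gu u v \<bullet> (M *v Gu u v) = 0"
      obtain \<alpha> \<zeta> \<beta> where g': "G u v = \<alpha> *\<^sub>R x + \<zeta> *\<^sub>R z + \<beta> *\<^sub>R y"
        using GE[OF u] unfolding Ee mem_span3 by blast
      have "Gu u v \<in> E" using nGu[OF u] n(2) by blast
      then obtain \<alpha>' \<zeta>' \<beta>' where h': "Gu u v = \<alpha>' *\<^sub>R x + \<zeta>' *\<^sub>R z + \<beta>' *\<^sub>R y"
        unfolding Ee mem_span3 by blast
      have bf: "(p *\<^sub>R x + q *\<^sub>R z + r *\<^sub>R y) \<bullet> (M *v (p' *\<^sub>R x + q' *\<^sub>R z + r' *\<^sub>R y)) = b * (p * r' + r * p' - 2 * q * q')"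
        for p q r p' q' r'
        unfolding form_linear inner_add_left inner_scaleR_left
        using b form_symmetric[OF tr, of z x] form_symmetric[OF tr, of y x] form_symmetric[OF tr, of y z]
        by (simp add: algebra_simps)
      have e1: "\<alpha> * \<beta> = \<zeta> * \<zeta>" using GM[OF u] b(1) unfolding g' bf by simp
      have e2: "\<alpha>' * \<beta>' = \<zeta>' * \<zeta>'" using z b(1) unfolding h' bf by simp
      have e3: "\<alpha>' * \<beta> + \<beta>' * \<alpha> = 2 * \<zeta>' * \<zeta>" using GuM b(1) unfolding g' h' bf by simp
      have "(\<alpha> * \<beta>' - \<alpha>' * \<beta>)\<^sup>2 = 0" using e1 e2 e3 by algebra
      then have m1: "\<alpha> * \<beta>' = \<alpha>' * \<beta>" by simp
      have "(\<alpha> * \<zeta>' - \<alpha>' * \<zeta>)\<^sup>2 = 0" using e1 e2 e3 by algebra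
      then have m2: "\<alpha> * \<zeta>' = \<alpha>' * \<zeta>" by simp
      have "(\<zeta> * \<beta>' - \<zeta>' * \<beta>)\<^sup>2 = 0" using e1 e2 e3 by algebra
      then have m3: "\<zeta> * \<beta>' = \<zeta>' * \<beta>" by simp
      show False using indep2_of_minors[OF m2 m1 m3 g' h'] i2 by blast
    qed
    then have "d = 0" using prod0 by blast
    then have "Gv u v = (- c / g) *\<^sub>R G u v + (1 / g) *\<^sub>R w0" using Gve by simp
    then show ?thesis using g by (metis divide_eq_0_iff zero_neq_one)
  qed
  have cl: "n \<bullet> a = 0" if "a \<in> char_line j f" for a
  proof -
    have "char_line j f \<subseteq> join (param_arc j f x0)" unfolding char_line_def using x0(1) by blast
    also have "\<dots> \<subseteq> E" unfolding join_def
    proof (rule span_minimal[OF _ E(1)])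
      show "\<Union>(param_arc j f x0) \<subseteq> E"
        unfolding param_arc_def using rep K(2) cube_subset_nhd[OF e] E(3) by blast
    qed
    finally show ?thesis using that n(2) by blast
  qed
  \<comment> \<open>Three points, at the Bernstein parameters 0, 1/2 and 1, witness that the row is
    not contained in a line.\<close>
  obtain u2 t2 where u2: "u2 \<in> {0..1}" "t2 \<noteq> 0" "bern x z y (1/2) = t2 *\<^sub>R G u2 v" using onarc[of "1/2"] by auto
  obtain u3 t3 where u3: "u3 \<in> {0..1}" "t3 \<noteq> 0" "y = t3 *\<^sub>R G u3 v" using onarc[of 1] by auto
  have "indep3 (G 0 v) (G u2 v) (G u3 v)" unfolding indep3_def
  proof (intro allI impI)
    fix \<alpha> \<beta> \<gamma> assume 0: "\<alpha> *\<^sub>R G 0 v + \<beta> *\<^sub>R G u2 v + \<gamma> *\<^sub>R G u3 v = 0"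
    have "G u2 v = (1 / (4 * t2)) *\<^sub>R (x + z + y)"
      using u2(2,3) by (simp add: bern_half) (metis (no_types, lifting) divideR_right mult.commute scaleR_scaleR divide_inverse inverse_mult_distrib mult_1 inverse_eq_divide)
    moreover have "G u3 v = (1 / t3) *\<^sub>R y" using u3(2,3) by simp
    ultimately have "(\<alpha> + \<beta> / (4 * t2)) *\<^sub>R x + (\<beta> / (4 * t2)) *\<^sub>R z + (\<beta> / (4 * t2) + \<gamma> / t3) *\<^sub>R y = 0"
      using 0 by (simp add: x_def algebra_simps)
    then have "\<alpha> + \<beta> / (4 * t2) = 0" "\<beta> / (4 * t2) = 0" "\<beta> / (4 * t2) + \<gamma> / t3 = 0"
      using I3 unfolding indep3_def by blast+
    then show "\<alpha> = 0 \<and> \<beta> = 0 \<and> \<gamma> = 0" using u2(2) u3(2) by auto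
  qed
  then show ?thesis by (intro that[OF nw0 nG[OF unit_I] cl Gvdec _ u2(1) u3(1)]) auto
qed

end

lemma indep3_not_span2:
  fixes a b c p q :: "real^4"
  assumes "a \<in> span {p, q}" "b \<in> span {p, q}" "c \<in> span {p, q}" shows "\<not> indep3 a b c"
proof
  assume "indep3 a b c"
  then have "3 = dim (span {a, b, c})" by (rule dim_span3[symmetric])
  also have "\<dots> \<le> dim (span {p, q})" using assms by (intro dim_subset span_minimal) auto
  also have "\<dots> \<le> card {p, q}" by (simp add: dim_le_card')
  also have "\<dots> \<le> 2" by (simp add: card_insert_if)
  finally show False by simp
qed

lemma det2_zero:
  fixes p q :: real
  assumes "p * a + q * b = 0" "p * c + q * d = 0" "p \<noteq> 0 \<or> q \<noteq> 0" shows "a * d = b * c"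
proof -
  have "p * (a * d - b * c) = 0" "q * (a * d - b * c) = 0" using assms(1,2) by algebra+
  then show ?thesis using assms(3) by auto
qed

lemma det2_kernel:
  fixes a b :: real
  assumes "a * d = b * c" "p * a + q * b = 0" "a \<noteq> 0 \<or> b \<noteq> 0" shows "p * c + q * d = 0"
proof -
  have "a * (p * c + q * d) = 0" "b * (p * c + q * d) = 0" using assms(1,2) by algebra+
  then show ?thesis using assms(3) by auto
qed

lemma proportional2:
  fixes a b c d :: real
  assumes "a * d = b * c" "a \<noteq> 0 \<or> b \<noteq> 0" defines "t \<equiv> (a * c + b * d) / (a\<^sup>2 + b\<^sup>2)"
  shows "c = t * a" "d = t * b"
proof -
  have n: "a\<^sup>2 + b\<^sup>2 \<noteq> 0" using assms(2) by (simp add: sum_power2_eq_zero_iff)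
  have "(a * c + b * d) * a = c * (a\<^sup>2 + b\<^sup>2)" "(a * c + b * d) * b = d * (a\<^sup>2 + b\<^sup>2)" using assms(1) by algebra+
  then show "c = t * a" "d = t * b" using n by (simp_all add: t_def field_simps)
qed

section \<open>Separation of variables with respect to the characteristic lines\<close>

locale gen_patch = char_patch +
  fixes e1 e2 e3 e4 g1 g2 g3 g4 :: "real^4"
  assumes V1: "e1 \<in> char_line j f" "e2 \<in> char_line j f" and V2: "e3 \<in> char_line k f" "e4 \<in> char_line k f"
    and dual: "g1 \<bullet> e1 = 1" "g1 \<bullet> e2 = 0" "g1 \<bullet> e3 = 0" "g1 \<bullet> e4 = 0"
      "g2 \<bullet> e1 = 0" "g2 \<bullet> e2 = 1" "g2 \<bullet> e3 = 0" "g2 \<bullet> e4 = 0"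
      "g3 \<bullet> e1 = 0" "g3 \<bullet> e2 = 0" "g3 \<bullet> e3 = 1" "g3 \<bullet> e4 = 0"
      "g4 \<bullet> e1 = 0" "g4 \<bullet> e2 = 0" "g4 \<bullet> e3 = 0" "g4 \<bullet> e4 = 1"
    and dec: "\<And>w. w = (g1 \<bullet> w) *\<^sub>R e1 + (g2 \<bullet> w) *\<^sub>R e2 + (g3 \<bullet> w) *\<^sub>R e3 + (g4 \<bullet> w) *\<^sub>R e4"
begin

lemma dg: "u \<in> {0..1} \<Longrightarrow> v \<in> {0..1} \<Longrightarrow> ((\<lambda>v. g \<bullet> G u v) has_real_derivative g \<bullet> Gv u v) (at v within S)"
proof -
  assume "u \<in> {0..1}" "v \<in> {0..1}"
  then have "((\<lambda>v. g \<bullet> G u v) has_vector_derivative g \<bullet> Gv u v) (at v)"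
    by (intro bounded_linear.has_vector_derivative[OF bounded_linear_inner_right] dG unit_I)
  then show ?thesis
    by (simp add: has_real_derivative_iff_has_vector_derivative has_vector_derivative_at_within)
qed

lemma zero_deriv:
  assumes "v \<in> {0..1}" "(h has_real_derivative D) (at v within {0..1})" "\<And>v. v \<in> {0..1} \<Longrightarrow> h v = 0"
  shows "D = (0::real)"
proof -
  have "(h has_vector_derivative 0) (at v within {0..1})"
    by (rule has_vector_derivative_transform[OF assms(1), of h "\<lambda>_. 0"]) (use assms(3) in auto)
  then show ?thesis
    using vector_derivative_unique_within_closed_interval[of 0 1 v h D 0] assms(1,2)
    by (simp add: has_real_derivative_iff_has_vector_derivative cbox_interval)
qed

text \<open>The plane of a row contains \<open>e1\<close> and \<open>e2\<close>, so its equation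
  involves only the coordinates \<open>g3\<close> and \<open>g4\<close>.\<close>

lemma row_rel:
  assumes v: "v \<in> {0..1}"
  obtains n3 n4 w0 u1 u2 u3 where "n3 * (g3 \<bullet> w0) + n4 * (g4 \<bullet> w0) \<noteq> 0"
    "\<And>u. u \<in> {0..1} \<Longrightarrow> n3 * (g3 \<bullet> G u v) + n4 * (g4 \<bullet> G u v) = 0"
    "\<And>u. u \<in> {0..1} \<Longrightarrow> \<exists>\<kappa> \<mu>. \<mu> \<noteq> 0 \<and> Gv u v = \<kappa> *\<^sub>R G u v + \<mu> *\<^sub>R w0"
    "u1 \<in> {0..1}" "u2 \<in> {0..1}" "u3 \<in> {0..1}" "indep3 (G u1 v) (G u2 v) (G u3 v)"
proof -
  obtain n w0 u1 u2 u3 where n: "n \<bullet> w0 \<noteq> 0" "\<And>u. u \<in> {0..1} \<Longrightarrow> n \<bullet> G u v = 0"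
    "\<And>a. a \<in> char_line j f \<Longrightarrow> n \<bullet> a = 0"
    "\<And>u. u \<in> {0..1} \<Longrightarrow> \<exists>\<kappa> \<mu>. \<mu> \<noteq> 0 \<and> Gv u v = \<kappa> *\<^sub>R G u v + \<mu> *\<^sub>R w0"
    "u1 \<in> {0..1}" "u2 \<in> {0..1}" "u3 \<in> {0..1}" "indep3 (G u1 v) (G u2 v) (G u3 v)"
    by (rule row[OF v]) (rule that)
  have nw: "n \<bullet> w = (n \<bullet> e3) * (g3 \<bullet> w) + (n \<bullet> e4) * (g4 \<bullet> w)" for w
  proof -
    have "n \<bullet> w = n \<bullet> ((g1 \<bullet> w) *\<^sub>R e1 + (g2 \<bullet> w) *\<^sub>R e2 + (g3 \<bullet> w) *\<^sub>R e3 + (g4 \<bullet> w) *\<^sub>R e4)"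
      using dec[of w] by (rule arg_cong)
    then show ?thesis using n(3)[OF V1(1)] n(3)[OF V1(2)] by (simp add: inner_add_right mult.commute)
  qed
  have 1: "(n \<bullet> e3) * (g3 \<bullet> w0) + (n \<bullet> e4) * (g4 \<bullet> w0) \<noteq> 0" using n(1) unfolding nw[of w0] .
  have 2: "(n \<bullet> e3) * (g3 \<bullet> G u v) + (n \<bullet> e4) * (g4 \<bullet> G u v) = 0" if "u \<in> {0..1}" for u
    using n(2)[OF that] unfolding nw[of "G u v"] .
  show ?thesis by (rule that[OF 1 2 n(4-8)])
qed

lemma row_par:
  assumes "u \<in> {0..1}" "u' \<in> {0..1}" "v \<in> {0..1}"
  shows "(g3 \<bullet> G u v) * (g4 \<bullet> G u' v) = (g4 \<bullet> G u v) * (g3 \<bullet> G u' v)"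
proof -
  obtain n3 n4 w0 where n: "n3 * (g3 \<bullet> w0) + n4 * (g4 \<bullet> w0) \<noteq> 0"
    "\<And>u. u \<in> {0..1} \<Longrightarrow> n3 * (g3 \<bullet> G u v) + n4 * (g4 \<bullet> G u v) = 0"
    by (rule row_rel[OF assms(3)]) (rule that, assumption, assumption)
  have "n3 \<noteq> 0 \<or> n4 \<noteq> 0" using n(1) by auto
  from det2_zero[OF n(2)[OF assms(1)] n(2)[OF assms(2)] this] show ?thesis .
qed

text \<open>If a point of the row lay in the span of \<open>e1\<close> and \<open>e2\<close>,
  differentiating \<open>row_par\<close> in v there would put \<open>Gv u v\<close> into the plane
  of the row. But \<open>Gv u v\<close> has a nonzero component along the vertex \<open>w0\<close>,
  which is off this plane.\<close>

lemma B_nz: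
  assumes u: "u \<in> {0..1}" and v: "v \<in> {0..1}" shows "g3 \<bullet> G u v \<noteq> 0 \<or> g4 \<bullet> G u v \<noteq> 0"
proof (rule ccontr)
  assume "\<not> ?thesis"
  then have z: "g3 \<bullet> G u v = 0" "g4 \<bullet> G u v = 0" by auto
  obtain n3 n4 w0 u1 u2 u3 where n: "n3 * (g3 \<bullet> w0) + n4 * (g4 \<bullet> w0) \<noteq> 0"
    "\<And>u. u \<in> {0..1} \<Longrightarrow> n3 * (g3 \<bullet> G u v) + n4 * (g4 \<bullet> G u v) = 0"
    "\<And>u. u \<in> {0..1} \<Longrightarrow> \<exists>\<kappa> \<mu>. \<mu> \<noteq> 0 \<and> Gv u v = \<kappa> *\<^sub>R G u v + \<mu> *\<^sub>R w0"
    "u1 \<in> {0..1}" "u2 \<in> {0..1}" "u3 \<in> {0..1}" "indep3 (G u1 v) (G u2 v) (G u3 v)"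
    by (rule row_rel[OF v]) (rule that)
  have "\<exists>u'\<in>{0..1}. g3 \<bullet> G u' v \<noteq> 0 \<or> g4 \<bullet> G u' v \<noteq> 0"
  proof (rule ccontr)
    assume "\<not> ?thesis"
    then have a: "g3 \<bullet> G u' v = 0" "g4 \<bullet> G u' v = 0" if "u' \<in> {0..1}" for u' using that by auto
    have "G u' v \<in> span {e1, e2}" if "u' \<in> {0..1}" for u'
      using dec[of "G u' v"] a[OF that] unfolding mem_span2 by (metis add.right_neutral scaleR_zero_left)
    then show False using indep3_not_span2[of _ e1 e2] n(4-7) by blast
  qed
  then obtain u' where u': "u' \<in> {0..1}" "g3 \<bullet> G u' v \<noteq> 0 \<or> g4 \<bullet> G u' v \<noteq> 0" by blast
  have "((\<lambda>v. (g3 \<bullet> G u' v) * (g4 \<bullet> G u v) - (g4 \<bullet> G u' v) * (g3 \<bullet> G u v)) has_real_derivative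
     ((g3 \<bullet> Gv u' v) * (g4 \<bullet> G u v) + (g4 \<bullet> Gv u v) * (g3 \<bullet> G u' v)
     - ((g4 \<bullet> Gv u' v) * (g3 \<bullet> G u v) + (g3 \<bullet> Gv u v) * (g4 \<bullet> G u' v)))) (at v within {0..1})"
    by (intro DERIV_diff DERIV_mult dg u u'(1) v)
  from zero_deriv[OF v this] have "(g3 \<bullet> G u' v) * (g4 \<bullet> Gv u v) = (g4 \<bullet> G u' v) * (g3 \<bullet> Gv u v)"
    using row_par[OF u'(1) u] z by (simp add: mult.commute)
  from det2_kernel[OF this n(2)[OF u'(1)] u'(2)]
  have "n3 * (g3 \<bullet> Gv u v) + n4 * (g4 \<bullet> Gv u v) = 0" .
  moreover obtain \<kappa> \<mu> where "\<mu> \<noteq> 0" "Gv u v = \<kappa> *\<^sub>R G u v + \<mu> *\<^sub>R w0" using n(3)[OF u] by blast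
  then have "n3 * (g3 \<bullet> Gv u v) + n4 * (g4 \<bullet> Gv u v) = \<mu> * (n3 * (g3 \<bullet> w0) + n4 * (g4 \<bullet> w0))"
    using z by (simp add: inner_add_right algebra_simps)
  ultimately show False using n(1) \<open>\<mu> \<noteq> 0\<close> by simp
qed

lemma swap: "gen_patch i k j f F e e3 e4 e1 e2 g3 g4 g1 g2"
proof
  show "distinct3 i k j" using dist by (auto simp: distinct3_def)
  show "w = (g3 \<bullet> w) *\<^sub>R e3 + (g4 \<bullet> w) *\<^sub>R e4 + (g1 \<bullet> w) *\<^sub>R e1 + (g2 \<bullet> w) *\<^sub>R e2" for w
    using dec[of w] by (simp add: algebra_simps)
qed (use e cp rep inj V1 V2 dual in auto)

lemma swap_G: "char_patch.G k j F v u = G u v" "char_patch.Gv k j F v u = Gu u v"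
proof -
  interpret col: gen_patch i k j f F e e3 e4 e1 e2 g3 g4 g1 g2 by (rule swap)
  show "col.G v u = G u v" "col.Gv v u = Gu u v"
    by (simp_all add: col.G_def G_def col.Gv_def Gu_def pt3_swap[OF ne(3)])
qed

lemma col_par:
  assumes "u \<in> {0..1}" "v \<in> {0..1}" "v' \<in> {0..1}"
  shows "(g1 \<bullet> G u v) * (g2 \<bullet> G u v') = (g2 \<bullet> G u v) * (g1 \<bullet> G u v')"
  using gen_patch.row_par[OF swap assms(2,3,1)] unfolding swap_G .

lemma A_nz: "u \<in> {0..1} \<Longrightarrow> v \<in> {0..1} \<Longrightarrow> g1 \<bullet> G u v \<noteq> 0 \<or> g2 \<bullet> G u v \<noteq> 0"
  using gen_patch.B_nz[OF swap, of v u] unfolding swap_G .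

text \<open>The vertex of the cone along a row lies on the characteristic line of the columns.
  Differentiating the plane equation of a column shows that a nonzero part of \<open>w0\<close>
  along \<open>e1\<close>, \<open>e2\<close> would be parallel to that of every point of the row,
  and the row would be contained in a line.\<close>

lemma row_V2:
  assumes v: "v \<in> {0..1}"
  obtains w0 where "g1 \<bullet> w0 = 0" "g2 \<bullet> w0 = 0"
    "\<And>u. u \<in> {0..1} \<Longrightarrow> \<exists>\<kappa> \<mu>. \<mu> \<noteq> 0 \<and> Gv u v = \<kappa> *\<^sub>R G u v + \<mu> *\<^sub>R w0"
    "\<And>u. u \<in> {0..1} \<Longrightarrow> (g3 \<bullet> w0) * (g4 \<bullet> G u v) \<noteq> (g4 \<bullet> w0) * (g3 \<bullet> G u v)"
proof -
  obtain n3 n4 w0 u1 u2 u3 where n: "n3 * (g3 \<bullet> w0) + n4 * (g4 \<bullet> w0) \<noteq> 0"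
    "\<And>u. u \<in> {0..1} \<Longrightarrow> n3 * (g3 \<bullet> G u v) + n4 * (g4 \<bullet> G u v) = 0"
    "\<And>u. u \<in> {0..1} \<Longrightarrow> \<exists>\<kappa> \<mu>. \<mu> \<noteq> 0 \<and> Gv u v = \<kappa> *\<^sub>R G u v + \<mu> *\<^sub>R w0"
    "u1 \<in> {0..1}" "u2 \<in> {0..1}" "u3 \<in> {0..1}" "indep3 (G u1 v) (G u2 v) (G u3 v)"
    by (rule row_rel[OF v]) (rule that)
  have par: "(g1 \<bullet> w0) * (g2 \<bullet> G u v) = (g2 \<bullet> w0) * (g1 \<bullet> G u v)" if u: "u \<in> {0..1}" for u
  proof -
    obtain n1 n2 w' where n': "n1 * (g1 \<bullet> w') + n2 * (g2 \<bullet> w') \<noteq> 0"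
      "\<And>v'. v' \<in> {0..1} \<Longrightarrow> n1 * (g1 \<bullet> G u v') + n2 * (g2 \<bullet> G u v') = 0"
      by (rule gen_patch.row_rel[OF swap u]) (rule that, assumption, simp only: swap_G)
    have "((\<lambda>v. n1 * (g1 \<bullet> G u v) + n2 * (g2 \<bullet> G u v)) has_real_derivative
        n1 * (g1 \<bullet> Gv u v) + n2 * (g2 \<bullet> Gv u v)) (at v within {0..1})"
      by (intro DERIV_add DERIV_cmult dg u v)
    from zero_deriv[OF v this n'(2)] have z: "n1 * (g1 \<bullet> Gv u v) + n2 * (g2 \<bullet> Gv u v) = 0" .
    obtain \<kappa> \<mu> where k: "\<mu> \<noteq> 0" "Gv u v = \<kappa> *\<^sub>R G u v + \<mu> *\<^sub>R w0" using n(3)[OF u] by blast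
    have "n1 * (g1 \<bullet> Gv u v) + n2 * (g2 \<bullet> Gv u v) = \<kappa> * (n1 * (g1 \<bullet> G u v) + n2 * (g2 \<bullet> G u v))
        + \<mu> * (n1 * (g1 \<bullet> w0) + n2 * (g2 \<bullet> w0))"
      unfolding k(2) by (simp add: inner_add_right algebra_simps)
    then have "n1 * (g1 \<bullet> w0) + n2 * (g2 \<bullet> w0) = 0" using z n'(2)[OF v] k(1) by simp
    from det2_zero[OF this n'(2)[OF v]] n'(1) show ?thesis by fastforce
  qed
  have V2: "g1 \<bullet> w0 = 0 \<and> g2 \<bullet> w0 = 0"
  proof (rule ccontr)
    assume "\<not> ?thesis"
    then have nz: "g1 \<bullet> w0 \<noteq> 0 \<or> g2 \<bullet> w0 \<noteq> 0" by blast
    have "G u v \<in> span {(g1 \<bullet> w0) *\<^sub>R e1 + (g2 \<bullet> w0) *\<^sub>R e2, (g3 \<bullet> G u1 v) *\<^sub>R e3 + (g4 \<bullet> G u1 v) *\<^sub>R e4}"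
      if u: "u \<in> {0..1}" for u
    proof -
      obtain t where t: "g1 \<bullet> G u v = t * (g1 \<bullet> w0)" "g2 \<bullet> G u v = t * (g2 \<bullet> w0)"
        using proportional2[OF par[OF u] nz] by blast
      obtain s where s: "g3 \<bullet> G u v = s * (g3 \<bullet> G u1 v)" "g4 \<bullet> G u v = s * (g4 \<bullet> G u1 v)"
        using proportional2[OF row_par[OF n(4) u v] B_nz[OF n(4) v]] by blast
      have "G u v = t *\<^sub>R ((g1 \<bullet> w0) *\<^sub>R e1 + (g2 \<bullet> w0) *\<^sub>R e2) + s *\<^sub>R ((g3 \<bullet> G u1 v) *\<^sub>R e3 + (g4 \<bullet> G u1 v) *\<^sub>R e4)"
        using dec[of "G u v"] unfolding t s by (simp add: scaleR_add_right add.assoc)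
      then show ?thesis unfolding mem_span2 by blast
    qed
    from indep3_not_span2[OF this[OF n(4)] this[OF n(5)] this[OF n(6)]] n(7) show False by blast
  qed
  have "(g3 \<bullet> w0) * (g4 \<bullet> G u v) \<noteq> (g4 \<bullet> w0) * (g3 \<bullet> G u v)" if u: "u \<in> {0..1}" for u
  proof
    assume "(g3 \<bullet> w0) * (g4 \<bullet> G u v) = (g4 \<bullet> w0) * (g3 \<bullet> G u v)"
    then have "(g3 \<bullet> G u v) * (g4 \<bullet> w0) = (g4 \<bullet> G u v) * (g3 \<bullet> w0)" by (simp add: mult.commute)
    from det2_kernel[OF this n(2)[OF u] B_nz[OF u v]] n(1) show False by simp
  qed
  then show ?thesis using that V2 n(3) by blast
qed

text \<open>The part of \<open>G u v\<close> along \<open>e1\<close>, \<open>e2\<close> is a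
  multiple of that of \<open>G u 0\<close>, and the part along \<open>e3\<close>, \<open>e4\<close>
  is a multiple of that of \<open>G 0 v\<close>. By \<open>const\<close> the quotient of the two
  factors is a function of u times a function of v, which is what the translational formula
  expresses.\<close>

lemma translational:
  obtains a b :: "real^4" where "a \<bullet> G 0 0 = 1" "b \<bullet> G 0 0 = 1"
    "\<And>u. u \<in> {0..1} \<Longrightarrow> a \<bullet> G u 0 \<noteq> 0" "\<And>v. v \<in> {0..1} \<Longrightarrow> b \<bullet> G 0 v \<noteq> 0"
    "\<And>u v. u \<in> {0..1} \<Longrightarrow> v \<in> {0..1} \<Longrightarrow> \<exists>t. t \<noteq> 0 \<and>
       G u v = t *\<^sub>R ((b \<bullet> G 0 v) *\<^sub>R G u 0 + (a \<bullet> G u 0) *\<^sub>R G 0 v - ((a \<bullet> G u 0) * (b \<bullet> G 0 v)) *\<^sub>R G 0 0)"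
proof -
  \<comment> \<open>Inner product with \<open>fA u\<close> measures the part along
    \<open>e1\<close>, \<open>e2\<close> in units of that of \<open>G u 0\<close>; \<open>a\<close>
    measures the part along \<open>e3\<close>, \<open>e4\<close> in units of that of
    \<open>G 0 0\<close>.\<close>
  define fA where "fA u = (1 / ((g1 \<bullet> G u 0)\<^sup>2 + (g2 \<bullet> G u 0)\<^sup>2)) *\<^sub>R ((g1 \<bullet> G u 0) *\<^sub>R g1 + (g2 \<bullet> G u 0) *\<^sub>R g2)" for u
  define a where "a = (1 / ((g3 \<bullet> G 0 0)\<^sup>2 + (g4 \<bullet> G 0 0)\<^sup>2)) *\<^sub>R ((g3 \<bullet> G 0 0) *\<^sub>R g3 + (g4 \<bullet> G 0 0) *\<^sub>R g4)"
  have z01: "(0::real) \<in> {0..1}" by simp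
  have fAe: "fA u \<bullet> w = ((g1 \<bullet> G u 0) * (g1 \<bullet> w) + (g2 \<bullet> G u 0) * (g2 \<bullet> w)) / ((g1 \<bullet> G u 0)\<^sup>2 + (g2 \<bullet> G u 0)\<^sup>2)" for u w
    by (simp add: fA_def inner_add_left add_divide_distrib)
  have ae: "a \<bullet> w = ((g3 \<bullet> G 0 0) * (g3 \<bullet> w) + (g4 \<bullet> G 0 0) * (g4 \<bullet> w)) / ((g3 \<bullet> G 0 0)\<^sup>2 + (g4 \<bullet> G 0 0)\<^sup>2)" for w
    by (simp add: a_def inner_add_left add_divide_distrib)
  have fA0: "fA u \<bullet> G u 0 = 1" if u: "u \<in> {0..1}" for u
    unfolding fAe using A_nz[OF u z01] by (simp add: power2_eq_square sum_squares_eq_zero_iff)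
  have a0: "a \<bullet> G 0 0 = 1"
    unfolding ae using B_nz[OF z01 z01] by (simp add: power2_eq_square sum_squares_eq_zero_iff)
  have Aprop: "g1 \<bullet> G u v = (fA u \<bullet> G u v) * (g1 \<bullet> G u 0)" "g2 \<bullet> G u v = (fA u \<bullet> G u v) * (g2 \<bullet> G u 0)"
    if "u \<in> {0..1}" "v \<in> {0..1}" for u v
    unfolding fAe using proportional2[OF col_par[OF that(1) z01 that(2)] A_nz[OF that(1) z01]] by blast+
  have Lprop: "g3 \<bullet> G u 0 = (a \<bullet> G u 0) * (g3 \<bullet> G 0 0)" "g4 \<bullet> G u 0 = (a \<bullet> G u 0) * (g4 \<bullet> G 0 0)"
    if "u \<in> {0..1}" for u
    unfolding ae using proportional2[OF row_par[OF z01 that z01] B_nz[OF z01 z01]] by blast+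
  have fAnz: "fA u \<bullet> G u v \<noteq> 0" if "u \<in> {0..1}" "v \<in> {0..1}" for u v
    using A_nz[OF that] Aprop[OF that] by auto
  have Lnz: "a \<bullet> G u 0 \<noteq> 0" if "u \<in> {0..1}" for u
    using B_nz[OF that z01] Lprop[OF that] by auto
  define \<beta> where "\<beta> u v = ((g3 \<bullet> G 0 v) * (g3 \<bullet> G u v) + (g4 \<bullet> G 0 v) * (g4 \<bullet> G u v)) / ((g3 \<bullet> G 0 v)\<^sup>2 + (g4 \<bullet> G 0 v)\<^sup>2)" for u v
  have Bprop: "g3 \<bullet> G u v = \<beta> u v * (g3 \<bullet> G 0 v)" "g4 \<bullet> G u v = \<beta> u v * (g4 \<bullet> G 0 v)"
    if "u \<in> {0..1}" "v \<in> {0..1}" for u v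
    unfolding \<beta>_def using proportional2[OF row_par[OF z01 that] B_nz[OF z01 that(2)]] by blast+
  have \<beta>nz: "\<beta> u v \<noteq> 0" if "u \<in> {0..1}" "v \<in> {0..1}" for u v
    using B_nz[OF that] Bprop[OF that] by auto
  have const: "(fA u \<bullet> G u v) * (a \<bullet> G u 0) = \<beta> u v * (fA 0 \<bullet> G 0 v)" if u: "u \<in> {0..1}" and v: "v \<in> {0..1}" for u v
  proof -
    \<comment> \<open>Constant in v, because the logarithmic derivatives of the three factors are
      \<kappa>, \<kappa> - \<kappa>0 and \<kappa>0 and cancel.\<close>
    define \<psi> where "\<psi> v = (fA u \<bullet> G u v) / (\<beta> u v * (fA 0 \<bullet> G 0 v))" for v
    have "(\<psi> has_real_derivative 0) (at v within {0..1})" if v: "v \<in> {0..1}" for v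
    proof -
      obtain w0 where w: "g1 \<bullet> w0 = 0" "g2 \<bullet> w0 = 0"
        "\<And>u. u \<in> {0..1} \<Longrightarrow> \<exists>\<kappa> \<mu>. \<mu> \<noteq> 0 \<and> Gv u v = \<kappa> *\<^sub>R G u v + \<mu> *\<^sub>R w0"
        "\<And>u. u \<in> {0..1} \<Longrightarrow> (g3 \<bullet> w0) * (g4 \<bullet> G u v) \<noteq> (g4 \<bullet> w0) * (g3 \<bullet> G u v)"
        by (rule row_V2[OF v]) (rule that)
      obtain \<kappa> \<mu> where k: "Gv u v = \<kappa> *\<^sub>R G u v + \<mu> *\<^sub>R w0" using w(3)[OF u] by blast
      obtain \<kappa>0 \<mu>0 where k0: "Gv 0 v = \<kappa>0 *\<^sub>R G 0 v + \<mu>0 *\<^sub>R w0" using w(3)[OF z01] by blast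
      have fw: "fA u' \<bullet> w0 = 0" for u' unfolding fAe using w(1,2) by simp
      have d\<alpha>: "((\<lambda>v. fA u \<bullet> G u v) has_real_derivative \<kappa> * (fA u \<bullet> G u v)) (at v within {0..1})"
        using dg[OF u v, of "fA u"] fw unfolding k by (simp add: inner_add_right)
      have dm: "((\<lambda>v. fA 0 \<bullet> G 0 v) has_real_derivative \<kappa>0 * (fA 0 \<bullet> G 0 v)) (at v within {0..1})"
        using dg[OF z01 v, of "fA 0"] fw unfolding k0 by (simp add: inner_add_right)
      have nzd: "(g3 \<bullet> G 0 v) * (g3 \<bullet> G 0 v) + (g4 \<bullet> G 0 v) * (g4 \<bullet> G 0 v) \<noteq> 0"
        using B_nz[OF z01 v] by (simp add: sum_squares_eq_zero_iff)
      obtain \<beta>' where d\<beta>: "((\<lambda>v. \<beta> u v) has_real_derivative \<beta>') (at v within {0..1})"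
        unfolding \<beta>_def power2_eq_square
        using DERIV_divide[OF DERIV_add[OF DERIV_mult[OF dg[OF z01 v] dg[OF u v]] DERIV_mult[OF dg[OF z01 v] dg[OF u v]]]
           DERIV_add[OF DERIV_mult[OF dg[OF z01 v] dg[OF z01 v]] DERIV_mult[OF dg[OF z01 v] dg[OF z01 v]]] nzd]
        by blast
      have rel: "\<kappa> * (\<beta> u v * (g \<bullet> G 0 v)) + \<mu> * (g \<bullet> w0) - \<beta>' * (g \<bullet> G 0 v) - \<beta> u v * (\<kappa>0 * (g \<bullet> G 0 v) + \<mu>0 * (g \<bullet> w0)) = 0"
        if g: "\<And>v. v \<in> {0..1} \<Longrightarrow> g \<bullet> G u v = \<beta> u v * (g \<bullet> G 0 v)" for g
      proof -
        have "((\<lambda>v. g \<bullet> G u v - \<beta> u v * (g \<bullet> G 0 v)) has_real_derivative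
            g \<bullet> Gv u v - (\<beta>' * (g \<bullet> G 0 v) + (g \<bullet> Gv 0 v) * \<beta> u v)) (at v within {0..1})"
          by (intro DERIV_diff DERIV_mult dg u v z01 d\<beta>)
        from zero_deriv[OF v this] g have "g \<bullet> Gv u v - (\<beta>' * (g \<bullet> G 0 v) + (g \<bullet> Gv 0 v) * \<beta> u v) = 0" by simp
        then show ?thesis unfolding k k0 using g[OF v] by (simp add: inner_add_right algebra_simps)
      qed
      note r3 = rel[of g3, OF Bprop(1)[OF u]] and r4 = rel[of g4, OF Bprop(2)[OF u]]
      \<comment> \<open>Eliminates \<mu> and \<mu>0, that is, the contribution of \<open>w0\<close>,
        which by \<open>row_V2\<close> is not parallel to the corresponding part of
        \<open>G 0 v\<close>.\<close>
      have "(\<kappa> * \<beta> u v - \<beta>' - \<beta> u v * \<kappa>0) * ((g3 \<bullet> w0) * (g4 \<bullet> G 0 v) - (g4 \<bullet> w0) * (g3 \<bullet> G 0 v)) = 0"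
        using r3 r4 by algebra
      then have "\<kappa> * \<beta> u v - \<beta>' - \<beta> u v * \<kappa>0 = 0" using w(4)[OF z01] by simp
      then have \<beta>': "\<beta>' = \<beta> u v * (\<kappa> - \<kappa>0)" by (simp add: algebra_simps)
      have nz: "\<beta> u v * (fA 0 \<bullet> G 0 v) \<noteq> 0" using \<beta>nz[OF u v] fAnz[OF z01 v] by simp
      have "(\<psi> has_real_derivative
         ((\<kappa> * (fA u \<bullet> G u v)) * (\<beta> u v * (fA 0 \<bullet> G 0 v)) - (fA u \<bullet> G u v) *
           (\<beta>' * (fA 0 \<bullet> G 0 v) + (\<kappa>0 * (fA 0 \<bullet> G 0 v)) * \<beta> u v)) / ((\<beta> u v * (fA 0 \<bullet> G 0 v)) * (\<beta> u v * (fA 0 \<bullet> G 0 v)))) (at v within {0..1})"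
        unfolding \<psi>_def by (intro DERIV_divide d\<alpha> DERIV_mult d\<beta> dm nz)
      moreover have "(\<kappa> * (fA u \<bullet> G u v)) * (\<beta> u v * (fA 0 \<bullet> G 0 v)) - (fA u \<bullet> G u v) *
           (\<beta>' * (fA 0 \<bullet> G 0 v) + (\<kappa>0 * (fA 0 \<bullet> G 0 v)) * \<beta> u v) = 0"
        unfolding \<beta>' by (simp add: algebra_simps)
      ultimately show ?thesis by simp
    qed
    then obtain c where c: "\<forall>v\<in>{0..1}. \<psi> v = c"
      using has_field_derivative_zero_constant[of "{0..1::real}" \<psi>] by auto
    have "\<beta> u 0 = a \<bullet> G u 0" by (simp add: \<beta>_def ae)
    then have "\<psi> 0 = 1 / (a \<bullet> G u 0)" using fA0[OF u] fA0[OF z01] by (simp add: \<psi>_def)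
    then have "\<psi> v = 1 / (a \<bullet> G u 0)" using c v z01 by metis
    then show ?thesis using Lnz[OF u] \<beta>nz[OF u v] fAnz[OF z01 v] by (simp add: \<psi>_def field_simps)
  qed
  show ?thesis
  proof (rule that[of a "fA 0"])
    fix u v :: real assume u: "u \<in> {0..1}" and v: "v \<in> {0..1}"
    define t where "t = \<beta> u v / (a \<bullet> G u 0)"
    let ?T = "(fA 0 \<bullet> G 0 v) *\<^sub>R G u 0 + (a \<bullet> G u 0) *\<^sub>R G 0 v - ((a \<bullet> G u 0) * (fA 0 \<bullet> G 0 v)) *\<^sub>R G 0 0"
    have tL: "t * (a \<bullet> G u 0) = \<beta> u v" using Lnz[OF u] by (simp add: t_def)
    have tm: "t * (fA 0 \<bullet> G 0 v) = fA u \<bullet> G u v" using const[OF u v] Lnz[OF u] by (simp add: t_def field_simps)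
    have gA: "g \<bullet> (t *\<^sub>R ?T) = g \<bullet> G u v"
      if "g \<bullet> G 0 v = (fA 0 \<bullet> G 0 v) * (g \<bullet> G 0 0)" "g \<bullet> G u v = (fA u \<bullet> G u v) * (g \<bullet> G u 0)" for g
      unfolding that(2) tm[symmetric] using that(1) by (simp add: inner_add_right inner_diff_right algebra_simps)
    have gB: "g \<bullet> (t *\<^sub>R ?T) = g \<bullet> G u v"
      if "g \<bullet> G u 0 = (a \<bullet> G u 0) * (g \<bullet> G 0 0)" "g \<bullet> G u v = \<beta> u v * (g \<bullet> G 0 v)" for g
      unfolding that(2) tL[symmetric] using that(1) by (simp add: inner_add_right inner_diff_right algebra_simps)
    have "t *\<^sub>R ?T = G u v"
      using dec[of "t *\<^sub>R ?T"] dec[of "G u v"] gA[OF Aprop(1)[OF z01 v] Aprop(1)[OF u v]]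
        gA[OF Aprop(2)[OF z01 v] Aprop(2)[OF u v]] gB[OF Lprop(1)[OF u] Bprop(1)[OF u v]]
        gB[OF Lprop(2)[OF u] Bprop(2)[OF u v]] by metis
    then show "\<exists>t. t \<noteq> 0 \<and> G u v = t *\<^sub>R ?T"
      using \<beta>nz[OF u v] Lnz[OF u] by (intro exI[of _ t]) (simp add: t_def)
  qed (use a0 fA0[OF z01] Lnz fAnz[OF z01] in auto)
qed

end

section \<open>Boundary arcs of a patch and its normal form\<close>

context char_patch
begin

lemma row_arc:
  assumes v: "v \<in> {0..1}"
  obtains z y where "indep3 (G 0 v) z y" "(\<lambda>u. span {G u v}) ` {0..1} = conic_arc (G 0 v) z y"
    "span {G 1 v} = span {y}"
proof -
  have vI: "v \<in> I" by (rule unit_I[OF v])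
  have "pt3 j k 0 v 0 \<in> cube_nhd e" by (rule pt_nhd[OF zero_I vI])
  then obtain K where K: "is_conic K" "\<And>y. y \<in> cube_nhd e \<inter> line_at j (pt3 j k 0 v 0) \<Longrightarrow> span {F y} \<in> K"
    using cp ne unfolding char_param_def by meson
  have GK: "span {G u v} \<in> K" if "u \<in> I" for u
    using K(2)[of "pt3 j k u v 0"] pt_nhd[OF that vI] by (auto simp: G_def line_at_def pt3_def)
  have cont: "continuous_on {0..1} (\<lambda>u. G u v)"
    using dG(1)[OF unit_I vI] by (intro continuous_at_imp_continuous_on ballI) (metis has_vector_derivative_continuous)
  show ?thesis
  proof (rule conic_arc_exists[OF K(1) cont])
    show "G u v \<noteq> 0 \<and> span {G u v} \<in> K" if "u \<in> {0..1}" for u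
      using GK[OF unit_I[OF that]] G_nz[OF unit_I[OF that] vI] by blast
    show "u = u'" if "u \<in> {0..1}" "u' \<in> {0..1}" "span {G u v} = span {G u' v}" for u u'
      by (rule inj_row[OF that(1,2) v that(3)])
  qed (rule that)
qed

lemma smooth_row:
  assumes v: "v \<in> {0..1}" shows "smooth_on I (\<lambda>u. G u v)"
proof -
  have "smooth_on I (\<lambda>u. F (pt3 j k 0 v 0 + u *\<^sub>R axis j 1))"
  proof (rule smooth_on_affine[OF sm bounded_linear_scaleR_left])
    show "pt3 j k 0 v 0 + u *\<^sub>R axis j 1 \<in> cube_nhd e" if "u \<in> I" for u
      using pt_nhd[OF that unit_I[OF v]] unfolding pt3_line(1)[of j k u v] .
  qed
  moreover have "F (pt3 j k 0 v 0 + u *\<^sub>R axis j 1) = G u v" for u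
    unfolding G_def pt3_line(1)[of j k u v] ..
  ultimately show ?thesis by simp
qed

lemma param_arc_row: "w \<in> cube \<Longrightarrow> param_arc j f w = (\<lambda>u. span {G u (w $ k)}) ` {0..1}"
  using f_G'[OF upd_cube, of w _ j] ne unfolding param_arc_upd
  by (intro image_cong refl) (simp add: upd_nth)

end

lemma sc_patch_char_patch:
  assumes "distinct3 i j k" "sc_patch i f" obtains F e where "char_patch i j k f F e"
proof -
  obtain e F where "e > 0" "char_param i (cube_nhd e) F" "\<forall>x\<in>cube. f x = span {F x}"
    using assms(2) unfolding sc_patch_def by blast
  moreover have "\<forall>r. r \<noteq> i \<longrightarrow> (\<forall>x\<in>cube. \<forall>y\<in>cube. y \<in> line_at r x \<and> f y = f x \<longrightarrow> y = x)"
    using assms(2) unfolding sc_patch_def by blast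
  ultimately have "char_patch i j k f F e" by unfold_locales (use assms(1) in auto)
  then show ?thesis by (rule that)
qed

text \<open>The control points are scaled so that the arc starts at a prescribed vector: arcs of
  different patches can be compared only relative to a common first vector.\<close>

lemma sc_patch_conic_arc:
  assumes s: "sc_patch i f" and r: "r \<noteq> i" and w: "w \<in> cube" and x: "f (upd w r 0) = span {x}"
  obtains z y where "indep3 x z y" "param_arc r f w = conic_arc x z y" "f (upd w r 1) = span {y}"
proof -
  obtain k where d: "distinct3 i r k" using distinct3_ex[OF r] by blast
  obtain F e where "char_patch i r k f F e" by (rule sc_patch_char_patch[OF d s])
  then interpret char_patch i r k f F e .
  obtain z y where zy: "indep3 (G 0 (w $ k)) z y" "(\<lambda>u. span {G u (w $ k)}) ` {0..1} = conic_arc (G 0 (w $ k)) z y"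
    "span {G 1 (w $ k)} = span {y}"
    by (rule row_arc[OF cube_nth[OF w]]) (rule that)
  have "span {x} = span {G 0 (w $ k)}" using f_G'[OF upd_cube[OF w], of 0 r] x ne by (simp add: upd_nth)
  then obtain t where t: "t \<noteq> 0" "x = t *\<^sub>R G 0 (w $ k)" by (auto simp: span1_eq)
  have "indep3 x (t *\<^sub>R z) (t *\<^sub>R y)"
    unfolding indep3_def
  proof (intro allI impI)
    fix \<alpha> \<beta> \<gamma> assume "\<alpha> *\<^sub>R x + \<beta> *\<^sub>R t *\<^sub>R z + \<gamma> *\<^sub>R t *\<^sub>R y = 0"
    then have "(\<alpha> * t) *\<^sub>R G 0 (w $ k) + (\<beta> * t) *\<^sub>R z + (\<gamma> * t) *\<^sub>R y = 0" by (simp add: t(2))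
    then have "\<alpha> * t = 0" "\<beta> * t = 0" "\<gamma> * t = 0" using zy(1) unfolding indep3_def by blast+
    then show "\<alpha> = 0 \<and> \<beta> = 0 \<and> \<gamma> = 0" using t(1) by simp
  qed
  moreover have "param_arc r f w = conic_arc x (t *\<^sub>R z) (t *\<^sub>R y)"
    unfolding param_arc_row[OF w] zy(2) t(2) conic_arc_scale[OF t(1)] ..
  moreover have "f (upd w r 1) = span {t *\<^sub>R y}"
  proof -
    have "f (upd w r 1) = span {G 1 (w $ k)}" using f_G'[OF upd_cube[OF w], of 1 r] ne by (simp add: upd_nth)
    also have "\<dots> = span {t *\<^sub>R y}" unfolding zy(3) span1_eq using t(1) by (intro exI[of _ "inverse t"]) simp
    finally show ?thesis .
  qed
  ultimately show ?thesis by (rule that)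
qed

lemma upd_0_pt3: "upd 0 r s = pt3 r k s 0 0" "j \<noteq> k \<Longrightarrow> upd 0 k s = pt3 j k 0 s 0"
  by (auto simp: upd_def pt3_def vec_eq_iff)

lemma zero_cube: "0 \<in> cube"
  by (simp add: cube_def)

text \<open>Up to the factor of the lift, a linear form along a conic is a quadratic polynomial in
  the Bernstein parameter. In this way the factors \<open>a \<bullet> G u 0\<close> and
  \<open>b \<bullet> G 0 v\<close> of \<open>translational\<close> become \<open>l\<close> and
  \<open>m\<close>. The scalar \<open>t0\<close> turns \<open>G 0 0\<close> into \<open>x\<close>
  and normalizes both polynomials to 1 at parameter 0.\<close>

lemma normal_form:
  assumes dist: "distinct3 i j k" and gen: "generic_sc_patch i f"
    and I3: "indep3 x z y" "indep3 x z' y'"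
    and arcs: "param_arc j f 0 = conic_arc x z y" "param_arc k f 0 = conic_arc x z' y'"
    and ends: "f 0 = span {x}" "f (upd 0 j 1) = span {y}" "f (upd 0 k 1) = span {y'}"
  obtains l1 l2 m1 m2 \<sigma> \<tau> where "regular_param \<sigma>" "regular_param \<tau>"
    "\<And>u. u \<in> {0..1} \<Longrightarrow> bern (1::real) l1 l2 u \<noteq> 0" "\<And>u. u \<in> {0..1} \<Longrightarrow> bern (1::real) m1 m2 u \<noteq> 0"
    "\<And>w. w \<in> cube \<Longrightarrow> f w = span {tnet (bern x z y) (bern 1 l1 l2) (bern x z' y') (bern 1 m1 m2) x
       (\<sigma> (w $ j)) (\<tau> (w $ k))}"
proof -
  have sc: "sc_patch i f" using gen by (simp add: generic_sc_patch_def)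
  have ne: "i \<noteq> j" "i \<noteq> k" "j \<noteq> k" using dist by (auto simp: distinct3_def)
  obtain F e where "char_patch i j k f F e" by (rule sc_patch_char_patch[OF dist sc])
  then interpret char_patch i j k f F e .
  have d2: "dim (char_line j f) = 2" "dim (char_line k f) = 2" "char_line j f \<inter> char_line k f = {0}"
    using gen dist ne by (auto simp: generic_sc_patch_def)
  have sub: "subspace (char_line r f)" for r
    unfolding char_line_def join_def by (rule subspace_Inter) auto
  obtain e1 e2 where V1: "indep2 e1 e2" "char_line j f = span {e1, e2}" by (rule plane_basis[OF sub d2(1)])
  obtain e3 e4 where V2: "indep2 e3 e4" "char_line k f = span {e3, e4}" by (rule plane_basis[OF sub d2(2)])
  have i4: "indep4 e1 e2 e3 e4" unfolding indep4_def
  proof (intro allI impI)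
    fix \<alpha> \<beta> \<gamma> \<delta> assume 0: "\<alpha> *\<^sub>R e1 + \<beta> *\<^sub>R e2 + \<gamma> *\<^sub>R e3 + \<delta> *\<^sub>R e4 = 0"
    have "\<alpha> *\<^sub>R e1 + \<beta> *\<^sub>R e2 = (-\<gamma>) *\<^sub>R e3 + (-\<delta>) *\<^sub>R e4"
      using 0 eq_neg_iff_add_eq_0[of "\<alpha> *\<^sub>R e1 + \<beta> *\<^sub>R e2" "\<gamma> *\<^sub>R e3 + \<delta> *\<^sub>R e4"] by (simp add: algebra_simps)
    moreover have "\<alpha> *\<^sub>R e1 + \<beta> *\<^sub>R e2 \<in> char_line j f" unfolding V1(2) mem_span2 by blast
    moreover have "(-\<gamma>) *\<^sub>R e3 + (-\<delta>) *\<^sub>R e4 \<in> char_line k f" unfolding V2(2) mem_span2 by blast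
    ultimately have "\<alpha> *\<^sub>R e1 + \<beta> *\<^sub>R e2 \<in> {0}" "(-\<gamma>) *\<^sub>R e3 + (-\<delta>) *\<^sub>R e4 \<in> {0}"
      unfolding d2(3)[symmetric] by simp_all
    then have "\<alpha> *\<^sub>R e1 + \<beta> *\<^sub>R e2 = 0" "(-\<gamma>) *\<^sub>R e3 + (-\<delta>) *\<^sub>R e4 = 0" by simp_all
    then have "\<alpha> = 0 \<and> \<beta> = 0" "-\<gamma> = 0 \<and> -\<delta> = 0" using V1(1) V2(1) unfolding indep2_def by blast+
    then show "\<alpha> = 0 \<and> \<beta> = 0 \<and> \<gamma> = 0 \<and> \<delta> = 0" by simp
  qed
  obtain g1 g2 g3 g4 :: "real^4" where "gen_patch i j k f F e e1 e2 e3 e4 g1 g2 g3 g4"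
  proof (rule dual4[OF i4])
    fix p q r s :: "real^4"
    assume d: "p \<bullet> e1 = 1" "p \<bullet> e2 = 0" "p \<bullet> e3 = 0" "p \<bullet> e4 = 0" "q \<bullet> e1 = 0" "q \<bullet> e2 = 1" "q \<bullet> e3 = 0"
      "q \<bullet> e4 = 0" "r \<bullet> e1 = 0" "r \<bullet> e2 = 0" "r \<bullet> e3 = 1" "r \<bullet> e4 = 0" "s \<bullet> e1 = 0" "s \<bullet> e2 = 0"
      "s \<bullet> e3 = 0" "s \<bullet> e4 = 1" "\<And>w. w = (p \<bullet> w) *\<^sub>R e1 + (q \<bullet> w) *\<^sub>R e2 + (r \<bullet> w) *\<^sub>R e3 + (s \<bullet> w) *\<^sub>R e4"
    have "gen_patch i j k f F e e1 e2 e3 e4 p q r s"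
    proof (intro gen_patch.intro gen_patch_axioms.intro)
      show "char_patch i j k f F e" by (rule char_patch_axioms)
      show "e1 \<in> char_line j f" "e2 \<in> char_line j f" "e3 \<in> char_line k f" "e4 \<in> char_line k f"
        unfolding V1(2) V2(2) by (auto intro: span_base)
    qed (fact d)+
    then show thesis by (rule that)
  qed
  then interpret gen_patch i j k f F e e1 e2 e3 e4 g1 g2 g3 g4 .
  interpret col: gen_patch i k j f F e e3 e4 e1 e2 g3 g4 g1 g2 by (rule swap)
  have cG: "col.G v u = G u v" "col.Gu v u = Gv u v" for u v
    by (simp_all add: col.G_def G_def col.Gu_def Gv_def pt3_swap[OF ne(3)])
  have z01: "(0::real) \<in> {0..1}" "(1::real) \<in> {0..1}" by auto
  have r0: "f (upd 0 j u) = span {G u 0}" if "u \<in> {0..1}" for u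
    using f_G[OF that z01(1)] upd_0_pt3(1)[of j u k] by simp
  have c0: "f (upd 0 k v) = span {G 0 v}" if "v \<in> {0..1}" for v
    using f_G[OF z01(1) that] upd_0_pt3(2)[OF ne(3), of v] by simp
  have sr: "smooth_on I (\<lambda>u. G u 0)" by (rule smooth_row[OF z01(1)])
  have sc0: "smooth_on I (\<lambda>v. G 0 v)" using col.smooth_row[OF z01(1)] unfolding cG .
  have u0: "upd 0 r 0 = 0" for r by (simp add: upd_def vec_eq_iff)
  obtain \<sigma> \<phi> where \<sigma>: "regular_param \<sigma>" "\<And>u. u \<in> {0..1} \<Longrightarrow> \<phi> u \<noteq> 0 \<and> G u 0 = \<phi> u *\<^sub>R bern x z y (\<sigma> u)"
  proof (rule regular_param_of_curve[OF e sr I3(1), where c' = "\<lambda>u. Gu u 0"])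
    show "G u 0 \<noteq> 0 \<and> span {G u 0} \<in> conic_arc x z y" if u: "u \<in> {0..1}" for u
      using G_nz[OF unit_I[OF u] zero_I] r0[OF u] u unfolding arcs(1)[symmetric] param_arc_upd[OF zero_cube] by auto
    show "u = u'" if "u \<in> {0..1}" "u' \<in> {0..1}" "span {G u 0} = span {G u' 0}" for u u'
      by (rule inj_row[OF that(1,2) z01(1) that(3)])
    show "span {G 0 0} = span {x}" using r0[OF z01(1)] ends(1) u0 by simp
    show "span {G 1 0} = span {y}" using r0[OF z01(2)] ends(2) by simp
    show "((\<lambda>u. G u 0) has_vector_derivative Gu u 0) (at u)" if "u \<in> {0..1}" for u
      by (rule dG(1)[OF unit_I[OF that] zero_I])
    show "indep2 (G u 0) (Gu u 0)" if "u \<in> {0..1}" for u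
      by (rule indep3_D(2)[OF i3[OF unit_I[OF that] zero_I]])
  qed (rule that)
  obtain \<tau> \<omega> where \<tau>: "regular_param \<tau>" "\<And>v. v \<in> {0..1} \<Longrightarrow> \<omega> v \<noteq> 0 \<and> G 0 v = \<omega> v *\<^sub>R bern x z' y' (\<tau> v)"
  proof (rule regular_param_of_curve[OF e sc0 I3(2), where c' = "\<lambda>v. Gv 0 v"])
    show "G 0 v \<noteq> 0 \<and> span {G 0 v} \<in> conic_arc x z' y'" if v: "v \<in> {0..1}" for v
      using G_nz[OF zero_I unit_I[OF v]] c0[OF v] v unfolding arcs(2)[symmetric] param_arc_upd[OF zero_cube] by auto
    show "u = u'" if "u \<in> {0..1}" "u' \<in> {0..1}" "span {G 0 u} = span {G 0 u'}" for u u'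
      using col.inj_row[OF that(1,2) z01(1)] that(3) unfolding cG by blast
    show "span {G 0 0} = span {x}" using r0[OF z01(1)] ends(1) u0 by simp
    show "span {G 0 1} = span {y'}" using c0[OF z01(2)] ends(3) by simp
    show "((\<lambda>v. G 0 v) has_vector_derivative Gv 0 v) (at v)" if "v \<in> {0..1}" for v
      by (rule dG(2)[OF zero_I unit_I[OF that]])
    show "indep2 (G 0 v) (Gv 0 v)" if "v \<in> {0..1}" for v
      by (rule indep3_D(3)[OF i3[OF zero_I unit_I[OF that]]])
  qed (rule that)
  obtain a b :: "real^4" where ab: "a \<bullet> G 0 0 = 1" "b \<bullet> G 0 0 = 1"
    "\<And>u. u \<in> {0..1} \<Longrightarrow> a \<bullet> G u 0 \<noteq> 0" "\<And>v. v \<in> {0..1} \<Longrightarrow> b \<bullet> G 0 v \<noteq> 0"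
    "\<And>u v. u \<in> {0..1} \<Longrightarrow> v \<in> {0..1} \<Longrightarrow> \<exists>t. t \<noteq> 0 \<and>
       G u v = t *\<^sub>R ((b \<bullet> G 0 v) *\<^sub>R G u 0 + (a \<bullet> G u 0) *\<^sub>R G 0 v - ((a \<bullet> G u 0) * (b \<bullet> G 0 v)) *\<^sub>R G 0 0)"
    by (rule translational) (rule that)
  define t0 where "t0 = \<phi> 0"
  have t0: "t0 \<noteq> 0" "G 0 0 = t0 *\<^sub>R x" using \<sigma>(2)[OF z01(1)] \<sigma>(1) by (auto simp: t0_def regular_param_def)
  have ax: "t0 * (a \<bullet> x) = 1" "t0 * (b \<bullet> x) = 1" using ab(1,2) unfolding t0(2) by simp_all
  define l where "l = bern (1::real) (t0 * (a \<bullet> z)) (t0 * (a \<bullet> y))"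
  define m where "m = bern (1::real) (t0 * (b \<bullet> z')) (t0 * (b \<bullet> y'))"
  have la: "t0 * (a \<bullet> bern x z y s) = l s" for s
    by (simp add: l_def bern_def inner_add_right algebra_simps flip: ax(1))
  have mb: "t0 * (b \<bullet> bern x z' y' s) = m s" for s
    by (simp add: m_def bern_def inner_add_right algebra_simps flip: ax(2))
  have aG: "a \<bullet> G u 0 = \<phi> u / t0 * l (\<sigma> u)" if "u \<in> {0..1}" for u
    unfolding la[symmetric] using \<sigma>(2)[OF that] t0(1) by simp
  have bG: "b \<bullet> G 0 v = \<omega> v / t0 * m (\<tau> v)" if "v \<in> {0..1}" for v
    unfolding mb[symmetric] using \<tau>(2)[OF that] t0(1) by simp
  have lnz: "l s \<noteq> 0" if s: "s \<in> {0..1}" for s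
  proof -
    obtain u where "u \<in> {0..1}" "s = \<sigma> u" using regular_param_image[OF \<sigma>(1)] s by blast
    then show ?thesis using aG ab(3) by fastforce
  qed
  have mnz: "m s \<noteq> 0" if s: "s \<in> {0..1}" for s
  proof -
    obtain u where "u \<in> {0..1}" "s = \<tau> u" using regular_param_image[OF \<tau>(1)] s by blast
    then show ?thesis using bG ab(4) by fastforce
  qed
  show ?thesis
  proof (rule that[OF \<sigma>(1) \<tau>(1) lnz[unfolded l_def] mnz[unfolded m_def]])
    fix w assume w: "w \<in> cube"
    let ?u = "w $ j" and ?v = "w $ k"
    have uv: "?u \<in> {0..1}" "?v \<in> {0..1}" using cube_nth[OF w] by auto
    obtain t where t: "t \<noteq> 0" "G ?u ?v = t *\<^sub>R ((b \<bullet> G 0 ?v) *\<^sub>R G ?u 0 + (a \<bullet> G ?u 0) *\<^sub>R G 0 ?v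
        - ((a \<bullet> G ?u 0) * (b \<bullet> G 0 ?v)) *\<^sub>R G 0 0)"
      using ab(5)[OF uv] by blast
    have "(b \<bullet> G 0 ?v) *\<^sub>R G ?u 0 + (a \<bullet> G ?u 0) *\<^sub>R G 0 ?v - ((a \<bullet> G ?u 0) * (b \<bullet> G 0 ?v)) *\<^sub>R G 0 0
       = (\<phi> ?u * \<omega> ?v / t0) *\<^sub>R tnet (bern x z y) l (bern x z' y') m x (\<sigma> ?u) (\<tau> ?v)"
      unfolding aG[OF uv(1)] bG[OF uv(2)] t0(2) tnet_def using \<sigma>(2)[OF uv(1)] \<tau>(2)[OF uv(2)] t0(1)
      by (simp add: scaleR_diff_right scaleR_add_right mult.commute mult.left_commute)
    moreover have "\<phi> ?u * \<omega> ?v / t0 \<noteq> 0" using \<sigma>(2)[OF uv(1)] \<tau>(2)[OF uv(2)] t0(1) by simp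
    ultimately have "span {G ?u ?v} = span {tnet (bern x z y) l (bern x z' y') m x (\<sigma> ?u) (\<tau> ?v)}"
      unfolding span1_eq using t by (intro exI[of _ "t * (\<phi> ?u * \<omega> ?v / t0)"]) simp
    then show "f w = span {tnet (bern x z y) (bern 1 (t0 * (a \<bullet> z)) (t0 * (a \<bullet> y))) (bern x z' y')
        (bern 1 (t0 * (b \<bullet> z')) (t0 * (b \<bullet> y'))) x (\<sigma> ?u) (\<tau> ?v)}"
      using f_G'[OF w] by (simp add: l_def m_def)
  qed
qed

lemma tangent_line_bern:
  assumes lift: "\<exists>F. smooth_lift f F" and w: "w \<in> cube" and \<sigma>: "regular_param \<sigma>"
    and f: "\<And>s. s \<in> {0..1} \<Longrightarrow> f (upd w r s) = span {bern A B C (\<sigma> s)}"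
  shows "tangent_line r f w = span {bern A B C (\<sigma> (w $ r)), dbern A B C (\<sigma> (w $ r))}"
proof -
  obtain D where D: "D \<noteq> 0" "(\<sigma> has_vector_derivative D) (at (w $ r))"
    using \<sigma> cube_nth[OF w] unfolding regular_param_def by blast
  have "((\<lambda>u. bern A B C (\<sigma> u)) has_vector_derivative (D *\<^sub>R dbern A B C (\<sigma> (w $ r)))) (at (w $ r))"
    using vector_diff_chain_at[OF D(2) bern_deriv] by (simp add: o_def)
  then have "tangent_line r f w = span {bern A B C (\<sigma> (w $ r)), D *\<^sub>R dbern A B C (\<sigma> (w $ r))}"
    by (intro tangent_line_curve[OF lift w f]) (auto intro: has_vector_derivative_at_within)
  also have "\<dots> = span {bern A B C (\<sigma> (w $ r)), dbern A B C (\<sigma> (w $ r))}"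
  proof (rule antisym)
    let ?b = "bern A B C (\<sigma> (w $ r))" and ?d = "dbern A B C (\<sigma> (w $ r))"
    have "inverse D *\<^sub>R (D *\<^sub>R ?d) \<in> span {?b, D *\<^sub>R ?d}" by (intro span_scale span_base) simp
    then have "?d \<in> span {?b, D *\<^sub>R ?d}" using D(1) by simp
    moreover have "?b \<in> span {?b, D *\<^sub>R ?d}" by (rule span_base) simp
    ultimately show "span {?b, ?d} \<subseteq> span {?b, D *\<^sub>R ?d}" by (intro span_minimal) auto
    have "D *\<^sub>R ?d \<in> span {?b, ?d}" by (intro span_scale span_base) simp
    moreover have "?b \<in> span {?b, ?d}" by (rule span_base) simp
    ultimately show "span {?b, D *\<^sub>R ?d} \<subseteq> span {?b, ?d}" by (intro span_minimal) auto
  qed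
  finally show ?thesis .
qed

section \<open>Supercyclidic nets in three directions\<close>

text \<open>The coefficient of \<open>Xc i\<close> in \<open>slice\<close>, computed in two ways;
  after multiplication by \<open>\<alpha> * \<beta>\<close> it follows from the two defining
  equations of \<open>l\<close> and \<open>m\<close>.\<close>

lemma tnet_identity:
  fixes \<alpha> \<beta> l m p q r s :: real
  assumes "l * \<alpha> = \<beta> * p + s * (\<alpha> - \<beta>)" "m * \<beta> = \<alpha> * q + r * (\<beta> - \<alpha>)" "\<alpha> \<noteq> 0" "\<beta> \<noteq> 0"
  shows "m * s + l * r - l * m = p * r + q * s - p * q"
proof -
  have "\<alpha> * \<beta> * (m * s + l * r - l * m - (p * r + q * s - p * q)) = 0" using assms(1,2) by algebra
  then show ?thesis using assms(3,4) by simp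
qed

locale net_data =
  fixes x :: "real^4" and zz yy :: "3 \<Rightarrow> real^4" and a1 a2 :: "3 \<Rightarrow> 3 \<Rightarrow> real"
begin

definition Xc :: "3 \<Rightarrow> real \<Rightarrow> real^4" where "Xc p = bern x (zz p) (yy p)"
definition R :: "3 \<Rightarrow> 3 \<Rightarrow> real \<Rightarrow> real" where "R i p = bern 1 (a1 i p) (a2 i p)"

text \<open>
  \<open>Xc j u / R i j u + Xc k v / R i k v - x\<close> is the face of directions \<open>j, k\<close> at the corner \<open>x\<close>. The
  coefficients below are the maximal minors of the three equations for a point \<open>y\<close> saying that \<open>y\<close>
  lies in the planes of the three elementary quadrilaterals opposite to \<open>x\<close>.
\<close>

definition NET :: "3 \<Rightarrow> 3 \<Rightarrow> 3 \<Rightarrow> real \<Rightarrow> real \<Rightarrow> real \<Rightarrow> real^4" where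
  "NET i j k a b c =
     (R i j b * R j k c + R i k c * R k j b - R i j b * R i k c) *\<^sub>R Xc i a +
     (R j k c * R k i a + R j i a * R i k c - R j k c * R j i a) *\<^sub>R Xc j b +
     (R k i a * R i j b + R k j b * R j i a - R k i a * R k j b) *\<^sub>R Xc k c -
     (R k i a * R i j b * R j k c + R j i a * R i k c * R k j b) *\<^sub>R x"

definition Net :: "real^3 \<Rightarrow> real^4" where
  "Net w = NET 1 2 3 (w $ 1) (w $ 2) (w $ 3)"

lemma NET_rot: "NET i j k a b c = NET j k i b c a"
  by (simp add: NET_def algebra_simps)

lemma NET_swap: "NET i j k a b c = NET i k j a c b"
  by (simp add: NET_def algebra_simps)

lemma Net_eq:
  assumes d: "distinct3 i j k" shows "Net w = NET i j k (w $ i) (w $ j) (w $ k)"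
proof -
  have *: "NET i0 j0 k0 (w $ i0) (w $ j0) (w $ k0) = NET i j k (w $ i) (w $ j) (w $ k)"
    if d0: "distinct3 i0 j0 k0" for i0 j0 k0
  proof -
    have "(i = i0 \<and> j = j0 \<and> k = k0) \<or> (i = i0 \<and> j = k0 \<and> k = j0) \<or> (i = j0 \<and> j = k0 \<and> k = i0) \<or>
      (i = j0 \<and> j = i0 \<and> k = k0) \<or> (i = k0 \<and> j = i0 \<and> k = j0) \<or> (i = k0 \<and> j = j0 \<and> k = i0)"
      by (rule distinct3_cases[OF d0, of i]; rule distinct3_cases[OF d0, of j]; rule distinct3_cases[OF d0, of k];
          use d d0 in \<open>auto simp: distinct3_def\<close>)
    then show ?thesis
      using NET_rot[of i0 j0 k0] NET_rot[of j0 k0 i0] NET_swap[of i0 j0 k0] NET_swap[of j0 k0 i0] NET_swap[of k0 i0 j0]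
      by (elim disjE conjE) simp_all
  qed
  have "distinct3 1 2 3" by (simp add: distinct3_def)
  from *[OF this] show ?thesis by (simp add: Net_def)
qed

lemma smooth_Net: "smooth_on U Net"
proof -
  have n: "smooth_on U (\<lambda>w::real^3. w $ r)" for r by (rule smooth_on_linear[OF bounded_linear_vec_nth])
  show ?thesis unfolding Net_def[abs_def] NET_def R_def Xc_def
    by (intro smooth_intros smooth_on_bern n)
qed

lemma R_0 [simp]: "R i p 0 = 1" and Xc_0 [simp]: "Xc p 0 = x" and R_1 [simp]: "R i p 1 = a2 i p" and Xc_1 [simp]: "Xc p 1 = yy p"
  by (simp_all add: R_def Xc_def)

text \<open>\<open>A1\<close> and \<open>A2\<close> are the middle and last control points of the
  conic of direction \<open>j\<close> that starts at \<open>Xc i t\<close> on the face u_k =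
  0.\<close>

definition A1 where "A1 i j k t = ctrl (zz j) (a1 k j) (Xc i) (R k i) x t"
definition A2 where "A2 i j k t = ctrl (yy j) (a2 k j) (Xc i) (R k i) x t"
text \<open>Coefficients of the denominator \<open>Lam\<close> that makes the coordinate surface u_i
  = t a net of the form \<open>tnet\<close> at the corner \<open>Xc i t\<close>. They come from
  equating the coefficients of \<open>Xc j\<close> and \<open>Xc k\<close> with those in
  \<open>NET\<close>.\<close>

definition L1 where "L1 i j k t = (R k i t * a1 i j + a1 k j * (R j i t - R k i t)) / R j i t"
definition L2 where "L2 i j k t = (R k i t * a2 i j + a2 k j * (R j i t - R k i t)) / R j i t"
definition Y where "Y i j k t = bern (Xc i t) (A1 i j k t) (A2 i j k t)"
definition Lam :: "3 \<Rightarrow> 3 \<Rightarrow> 3 \<Rightarrow> real \<Rightarrow> real \<Rightarrow> real" where "Lam i j k t = bern 1 (L1 i j k t) (L2 i j k t)"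

lemma Y_eq: "Y i j k t u = R k j u *\<^sub>R Xc i t + R k i t *\<^sub>R (Xc j u - R k j u *\<^sub>R x)"
proof -
  have "tnet (Xc j) (R k j) (Xc i) (R k i) x u t
      = bern (ctrl x 1 (Xc i) (R k i) x t) (A1 i j k t) (A2 i j k t) u"
    unfolding Xc_def[of j] R_def[of k j] tnet_bern A1_def A2_def ..
  moreover have "ctrl x 1 (Xc i) (R k i) x t = Xc i t" by (simp add: ctrl_def)
  ultimately show ?thesis by (simp add: Y_def tnet_def algebra_simps)
qed

text \<open>The right-hand side is the coefficient of \<open>Xc k\<close> in
  \<open>NET i j k t u v\<close>. This reading allows the same coefficient to be compared between
  slices in different directions.\<close>

lemma Lam_eq:
  assumes "R j i t \<noteq> 0"
  shows "Lam i j k t u * R j i t = R k i t * R i j u + R k j u * (R j i t - R k i t)"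
proof -
  have 1: "L1 i j k t * R j i t = R k i t * a1 i j + a1 k j * (R j i t - R k i t)"
    and 2: "L2 i j k t * R j i t = R k i t * a2 i j + a2 k j * (R j i t - R k i t)"
    using assms by (simp_all add: L1_def L2_def)
  have "Lam i j k t u * R j i t = (1-u)\<^sup>2 * R j i t + u * (1-u) * (L1 i j k t * R j i t) + u\<^sup>2 * (L2 i j k t * R j i t)"
    by (simp add: Lam_def bern_real algebra_simps)
  also have "\<dots> = R k i t * R i j u + R k j u * (R j i t - R k i t)"
    unfolding 1 2 R_def[of i j] R_def[of k j] bern_real by (simp add: algebra_simps)
  finally show ?thesis .
qed

lemma slice:
  assumes "R j i t \<noteq> 0" "R k i t \<noteq> 0"
  shows "NET i j k t u v = tnet (Y i j k t) (Lam i j k t) (Y i k j t) (Lam i k j t) (Xc i t) u v"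
proof -
  define l where "l = Lam i j k t u"
  define m where "m = Lam i k j t v"
  define \<alpha> \<beta> p q r s where "\<alpha> = R j i t" and "\<beta> = R k i t" and "p = R i j u" and "q = R i k v" and "r = R j k v" and "s = R k j u"
  have l: "l * \<alpha> = \<beta> * p + s * (\<alpha> - \<beta>)"
    unfolding l_def \<alpha>_def \<beta>_def p_def s_def by (rule Lam_eq[OF assms(1)])
  have m: "m * \<beta> = \<alpha> * q + r * (\<beta> - \<alpha>)"
    unfolding m_def \<alpha>_def \<beta>_def q_def r_def by (rule Lam_eq[OF assms(2)])
  have i: "m * s + l * r - l * m = p * r + q * s - p * q"
    by (rule tnet_identity[OF l m]) (use assms in \<open>simp_all add: \<alpha>_def \<beta>_def\<close>)
  have cx: "m * \<beta> * s + l * \<alpha> * r = \<beta> * p * r + \<alpha> * q * s" unfolding l m by (simp add: algebra_simps)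
  have "tnet (Y i j k t) (Lam i j k t) (Y i k j t) (Lam i k j t) (Xc i t) u v
     = (m * s + l * r - l * m) *\<^sub>R Xc i t + (m * \<beta>) *\<^sub>R Xc j u + (l * \<alpha>) *\<^sub>R Xc k v - (m * \<beta> * s + l * \<alpha> * r) *\<^sub>R x"
    unfolding tnet_def Y_eq l_def[symmetric] m_def[symmetric] \<alpha>_def[symmetric] \<beta>_def[symmetric] r_def[symmetric] s_def[symmetric]
    by (simp add: algebra_simps)
  also have "\<dots> = NET i j k t u v"
    unfolding i cx l m unfolding NET_def \<alpha>_def \<beta>_def p_def q_def r_def s_def by (simp add: algebra_simps)
  finally show ?thesis by simp
qed

end

section \<open>The faces opposite to a corner\<close>

lemma indep4_spanI:
  fixes a b c d :: "real^4"
  assumes "span {a, b, c, d} = UNIV" shows "indep4 a b c d"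
  unfolding indep4_def
proof (intro allI impI)
  have c4: "card {a, b, c, d} \<le> 4" by (simp add: card_insert_if)
  have D: "dim (UNIV :: (real^4) set) = 4" by (simp only: dim_UNIV) simp
  then have "4 \<le> card {a, b, c, d}" using dim_le_card'[of "{a, b, c, d}"] assms
    by (metis dim_span finite.emptyI finite.insertI)
  with c4 have c: "card {a, b, c, d} = 4" by simp
  then have ne: "a \<noteq> b" "a \<noteq> c" "a \<noteq> d" "b \<noteq> c" "b \<noteq> d" "c \<noteq> d"
    by (auto simp: card_insert_if split: if_splits)
  have i: "independent {a, b, c, d}"
    by (rule card_le_dim_spanning[of _ UNIV]) (use assms c D in auto)
  fix \<alpha> \<beta> \<gamma> \<delta> assume 0: "\<alpha> *\<^sub>R a + \<beta> *\<^sub>R b + \<gamma> *\<^sub>R c + \<delta> *\<^sub>R d = 0"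
  define u where "u v = (if v = a then \<alpha> else if v = b then \<beta> else if v = c then \<gamma> else \<delta>)" for v
  have "(\<Sum>v\<in>{a, b, c, d}. u v *\<^sub>R v) = 0" using 0 ne by (simp add: u_def add.assoc)
  then have "\<forall>v\<in>{a, b, c, d}. u v = 0" using independentD[OF i, of "{a,b,c,d}" u] by auto
  then show "\<alpha> = 0 \<and> \<beta> = 0 \<and> \<gamma> = 0 \<and> \<delta> = 0" using ne by (auto simp: u_def split: if_splits)
qed

text \<open>
  Two opposite faces share the arc from \<open>P\<close>. Modulo the line of the Laplace points of direction \<open>j\<close>
  both descriptions of it are the same multiple of the arc \<open>(x, zj, xj)\<close>, so they agree without
  any reparametrization, and the coefficients can be compared.
\<close>

lemma far_edge:
  fixes x xi xj xk zj P :: "real^4" and rij rik rki rkj p1 p2 q1 q2 m1 m2 n1 n2 \<mu> \<nu> :: real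
  assumes I4: "indep4 x xi xj xk"
    and nz: "rij \<noteq> 0" "rik \<noteq> 0" "rki \<noteq> 0" "rkj \<noteq> 0" "\<mu> \<noteq> 0" "\<nu> \<noteq> 0" "m2 \<noteq> 0" "n2 \<noteq> 0"
    and P: "P = rki *\<^sub>R xi + rik *\<^sub>R xk - (rik * rki) *\<^sub>R x"
    and R1: "R1 = \<mu> *\<^sub>R (p1 *\<^sub>R xi + rij *\<^sub>R (zj - p1 *\<^sub>R x)) + m1 *\<^sub>R (P - \<mu> *\<^sub>R xi)"
    and R2: "R2 = \<mu> *\<^sub>R (p2 *\<^sub>R xi + rij *\<^sub>R (xj - p2 *\<^sub>R x)) + m2 *\<^sub>R (P - \<mu> *\<^sub>R xi)"
    and R1': "R1' = \<nu> *\<^sub>R (q1 *\<^sub>R xk + rkj *\<^sub>R (zj - q1 *\<^sub>R x)) + n1 *\<^sub>R (P - \<nu> *\<^sub>R xk)"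
    and R2': "R2' = \<nu> *\<^sub>R (q2 *\<^sub>R xk + rkj *\<^sub>R (xj - q2 *\<^sub>R x)) + n2 *\<^sub>R (P - \<nu> *\<^sub>R xk)"
    and I3: "indep3 P R1 R2" and arcs: "conic_arc P R1 R2 = conic_arc P R1' R2'" and ends: "R2' = \<gamma> *\<^sub>R R2"
    and top: "R2 \<in> span {xj, p2 *\<^sub>R xi + rij *\<^sub>R (xj - p2 *\<^sub>R x), q2 *\<^sub>R xk + rkj *\<^sub>R (xj - q2 *\<^sub>R x)}"
  shows "m1 * rik = rij * q1 + p1 * (rik - rij)" "m2 * rik = rij * q2 + p2 * (rik - rij)"
proof -
  obtain gx gi gj gk :: "real^4" where
    d: "gx \<bullet> x = 1" "gx \<bullet> xi = 0" "gx \<bullet> xj = 0" "gx \<bullet> xk = 0" "gi \<bullet> x = 0" "gi \<bullet> xi = 1" "gi \<bullet> xj = 0" "gi \<bullet> xk = 0"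
      "gj \<bullet> x = 0" "gj \<bullet> xi = 0" "gj \<bullet> xj = 1" "gj \<bullet> xk = 0" "gk \<bullet> x = 0" "gk \<bullet> xi = 0" "gk \<bullet> xj = 0" "gk \<bullet> xk = 1"
    by (rule dual4[OF I4]) (rule that)
  \<comment> \<open>The equation of the plane of the face u_j = 1: it vanishes on the three vectors
    in \<open>top\<close>.\<close>
  define \<theta> where "\<theta> = gx + rij *\<^sub>R gi + rkj *\<^sub>R gk"
  have th: "\<theta> \<bullet> x = 1" "\<theta> \<bullet> xi = rij" "\<theta> \<bullet> xj = 0" "\<theta> \<bullet> xk = rkj"
    using d by (simp_all add: \<theta>_def inner_add_left)
  define c where "c = rki * rij + rik * rkj - rik * rki"
  have thP: "\<theta> \<bullet> P = c" unfolding P c_def by (simp add: inner_add_right inner_diff_right th)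
  have "\<theta> \<bullet> R2 = 0" using top unfolding mem_span3
    by (elim exE) (simp add: inner_add_right inner_diff_right th)
  then have "m2 * (c - \<mu> * rij) = 0" unfolding R2 by (simp add: inner_add_right inner_diff_right th thP)
  then have c1: "\<mu> * rij = c" using nz by simp
  have "\<theta> \<bullet> R2' = 0" unfolding ends using \<open>\<theta> \<bullet> R2 = 0\<close> by simp
  then have "n2 * (c - \<nu> * rkj) = 0" unfolding R2' by (simp add: inner_add_right inner_diff_right th thP)
  then have c2: "\<nu> * rkj = c" using nz by simp
  have cnz: "c \<noteq> 0" using c1 nz by auto
  \<comment> \<open>Only the factor r is undetermined, and it is 1 because both end vectors have the
    same coordinate \<open>c\<close> along \<open>xj\<close>.\<close>
  obtain r where r: "r > 0" "R1' = r *\<^sub>R R1" "R2' = r\<^sup>2 *\<^sub>R R2" by (rule conic_arc_rep_unique[OF I3 arcs ends])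
  have gjP: "gj \<bullet> P = 0" unfolding P using d by (simp add: inner_add_right inner_diff_right)
  have "gj \<bullet> R2 = c" unfolding R2 using d gjP c1 by (simp add: inner_add_right inner_diff_right)
  moreover have "gj \<bullet> R2' = c" unfolding R2' using d gjP c2 by (simp add: inner_add_right inner_diff_right)
  ultimately have "r\<^sup>2 = 1" using cnz unfolding r(3) by simp
  then have "r = 1" using r(1) by (simp add: power2_eq_1_iff)
  then have e1: "R1' = R1" and e2: "R2' = R2" using r by simp_all
  have giP: "gi \<bullet> P = rki" "gk \<bullet> P = rik" unfolding P using d by (simp_all add: inner_add_right inner_diff_right)
  have solve: "m * rik = rij * q + p * (rik - rij)"
    if 1: "\<mu> * p + m * (rki - \<mu>) = n * rki" and 2: "m * rik = \<nu> * q + n * (rik - \<nu>)" for m n p q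
  proof -
    have "c * rki * (m * rik - (rij * q + p * (rik - rij))) = 0"
      using 1 2 c1 c2 unfolding c_def by algebra
    then show ?thesis using cnz nz by simp
  qed
  note ips = inner_add_right inner_diff_right
  have "gi \<bullet> R1 = \<mu> * (p1 + rij * (gi \<bullet> zj)) + m1 * (rki - \<mu>)" "gk \<bullet> R1 = \<mu> * (rij * (gk \<bullet> zj)) + m1 * rik"
    "gi \<bullet> R1' = \<nu> * (rkj * (gi \<bullet> zj)) + n1 * rki" "gk \<bullet> R1' = \<nu> * (q1 + rkj * (gk \<bullet> zj)) + n1 * (rik - \<nu>)"
    unfolding R1 R1' using d giP by (simp_all add: ips)
  then have "\<mu> * p1 + m1 * (rki - \<mu>) = n1 * rki" "m1 * rik = \<nu> * q1 + n1 * (rik - \<nu>)"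
    unfolding e1 using c1 c2 by algebra+
  then show "m1 * rik = rij * q1 + p1 * (rik - rij)" by (rule solve)
  have "gi \<bullet> R2 = \<mu> * p2 + m2 * (rki - \<mu>)" "gk \<bullet> R2 = m2 * rik"
    "gi \<bullet> R2' = n2 * rki" "gk \<bullet> R2' = \<nu> * q2 + n2 * (rik - \<nu>)"
    unfolding R2 R2' using d giP by (simp_all add: ips)
  then have "\<mu> * p2 + m2 * (rki - \<mu>) = n2 * rki" "m2 * rik = \<nu> * q2 + n2 * (rik - \<nu>)"
    unfolding e2 by simp_all
  then show "m2 * rik = rij * q2 + p2 * (rik - rij)" by (rule solve)
qed

lemma param_arc_tnet:
  assumes f: "\<And>w. w \<in> cube \<Longrightarrow> f w = span {tnet (bern A B C) (bern 1 l1 l2) q m A (\<sigma> (w $ j)) (\<tau> (w $ k))}"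
    and \<sigma>: "regular_param \<sigma>" and w: "w \<in> cube" and jk: "j \<noteq> k"
  shows "param_arc j f w = conic_arc (ctrl A 1 q m A (\<tau> (w $ k))) (ctrl B l1 q m A (\<tau> (w $ k))) (ctrl C l2 q m A (\<tau> (w $ k)))"
proof -
  have "f (upd w j s) = span {bern (ctrl A 1 q m A (\<tau> (w $ k))) (ctrl B l1 q m A (\<tau> (w $ k))) (ctrl C l2 q m A (\<tau> (w $ k))) (\<sigma> s)}"
    if "s \<in> {0..1}" for s
    using f[OF upd_cube[OF w that]] jk by (simp add: upd_nth tnet_bern)
  then have "param_arc j f w = (\<lambda>u. span {bern (ctrl A 1 q m A (\<tau> (w $ k))) (ctrl B l1 q m A (\<tau> (w $ k))) (ctrl C l2 q m A (\<tau> (w $ k))) u}) ` (\<sigma> ` {0..1})"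
    unfolding param_arc_upd[OF w] image_image by (rule image_cong[OF refl])
  then show ?thesis unfolding regular_param_image[OF \<sigma>] conic_arc_def .
qed

lemma regular_param_ends: "regular_param \<sigma> \<Longrightarrow> \<sigma> 0 = 0 \<and> \<sigma> 1 = 1"
  by (simp add: regular_param_def)

text \<open>Fixes vectors for the corner and its three edge arcs. \<open>near\<close> and
  \<open>Rnz\<close> record the outcome of \<open>normal_form\<close> on the three faces at this
  corner, with one pair of coefficients for each face and direction.\<close>

locale gen_cube = net_data x zz yy a1 a2
  for x :: "real^4" and zz yy :: "3 \<Rightarrow> real^4" and a1 a2 :: "3 \<Rightarrow> 3 \<Rightarrow> real" +
  fixes X :: "real^3 \<Rightarrow> pt" and S :: "3 \<Rightarrow> real \<Rightarrow> patch"
  assumes sc: "sc_cube X S" and gc: "generic_cube X S"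
    and X0: "X 0 = span {x}" and I3: "\<And>p. indep3 x (zz p) (yy p)"
    and edge: "\<And>p q. p \<noteq> q \<Longrightarrow> param_arc p (S q 0) 0 = conic_arc x (zz p) (yy p)"
    and X1: "\<And>p. X (upd 0 p 1) = span {yy p}"
    and near: "\<And>i j k. distinct3 i j k \<Longrightarrow> \<exists>\<sigma> \<tau>. regular_param \<sigma> \<and> regular_param \<tau> \<and>
       (\<forall>w\<in>cube. S i 0 w = span {tnet (Xc j) (R i j) (Xc k) (R i k) x (\<sigma> (w $ j)) (\<tau> (w $ k))})"
    and Rnz: "\<And>i j u. i \<noteq> j \<Longrightarrow> u \<in> {0..1} \<Longrightarrow> R i j u \<noteq> 0"
begin

lemma S_X: "v \<in> verts \<Longrightarrow> v $ i = e \<Longrightarrow> e \<in> {0, 1} \<Longrightarrow> S i e v = X v"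
  using sc unfolding sc_cube_def by blast

lemma S_gen: "e \<in> {0, 1} \<Longrightarrow> generic_sc_patch i (S i e)"
  using sc unfolding sc_cube_def by blast

lemma S_edge: "v \<in> verts \<Longrightarrow> distinct3 i j k \<Longrightarrow> param_arc k (S i (v $ i)) v = param_arc k (S j (v $ j)) v"
  using sc unfolding sc_cube_def by blast

text \<open>Bridges two conventions: edges are compared at vertices, whose i-th coordinate may be 1,
  whereas the normal form is taken at the origin of the parameter cube.\<close>

lemma S_indep_coord:
  assumes "e \<in> {0, 1}" "w \<in> cube" "t \<in> {0..1}" shows "S i e (upd w i t) = S i e w"
proof -
  obtain d F where F: "d > 0" "char_param i (cube_nhd d) F" "\<forall>x\<in>cube. S i e x = span {F x}"
    using S_gen[OF assms(1)] unfolding generic_sc_patch_def sc_patch_def by blast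
  have "F (upd w i t) = F w"
    using F(2) upd_line[of w i t] upd_cube[OF assms(2,3), of i] assms(2) cube_subset_nhd[OF F(1)]
    unfolding char_param_def conj_param_def by blast
  then show ?thesis using F(3) upd_cube[OF assms(2,3)] assms(2) by metis
qed

lemma verts_cube: "verts \<subseteq> cube"
  by (auto simp: verts_def cube_def) (metis order_refl zero_le_one)+

lemma upd_verts: "v \<in> verts \<Longrightarrow> t \<in> {0, 1} \<Longrightarrow> upd v i t \<in> verts"
  by (auto simp: verts_def upd_def)

lemma zero_verts: "0 \<in> verts"
  by (simp add: verts_def)

lemma Y_1: "Y i j k 1 = bern (yy i) (A1 i j k 1) (A2 i j k 1)"
  by (simp add: Y_def)

text \<open>Two boundary arcs of the far face are also arcs of near faces, whose normal forms supply
  the control points \<open>A1\<close> and \<open>A2\<close>. What remains unknown here are the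
  coefficients \<open>m1\<close>, \<open>m2\<close>, \<open>n1\<close>, \<open>n2\<close>.\<close>

lemma far_nf:
  assumes d: "distinct3 i j k"
  obtains m1 m2 n1 n2 \<sigma> \<tau> where "regular_param \<sigma>" "regular_param \<tau>"
    "\<And>u. u \<in> {0..1} \<Longrightarrow> bern (1::real) m1 m2 u \<noteq> 0" "\<And>u. u \<in> {0..1} \<Longrightarrow> bern (1::real) n1 n2 u \<noteq> 0"
    "\<And>w. w \<in> cube \<Longrightarrow> S i 1 w = span {tnet (Y i j k 1) (bern 1 m1 m2) (Y i k j 1) (bern 1 n1 n2) (yy i)
       (\<sigma> (w $ j)) (\<tau> (w $ k))}"
proof -
  have ne: "i \<noteq> j" "i \<noteq> k" "j \<noteq> k" "j \<noteq> i" "k \<noteq> i" "k \<noteq> j" using d by (auto simp: distinct3_def)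
  have arc: "param_arc j (S i 1) 0 = conic_arc (yy i) (A1 i j k 1) (A2 i j k 1) \<and> S i 1 (upd 0 j 1) = span {A2 i j k 1}
      \<and> indep3 (yy i) (A1 i j k 1) (A2 i j k 1)"
    if d: "distinct3 i j k" for j k
  proof -
    have ne: "i \<noteq> j" "i \<noteq> k" "j \<noteq> k" "j \<noteq> i" "k \<noteq> i" "k \<noteq> j" using d by (auto simp: distinct3_def)
    define v where "v = upd 0 i (1::real)"
    have v: "v \<in> verts" "v \<in> cube" "v $ i = 1" "v $ j = 0" "v $ k = 0"
      using upd_verts[OF zero_verts, of 1 i] verts_cube ne by (auto simp: v_def upd_nth)
    have "distinct3 k j i" using d by (auto simp: distinct3_def)
    then obtain \<sigma> \<tau> where st: "regular_param \<sigma>" "regular_param \<tau>"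
      "\<And>w. w \<in> cube \<Longrightarrow> S k 0 w = span {tnet (Xc j) (R k j) (Xc i) (R k i) x (\<sigma> (w $ j)) (\<tau> (w $ i))}"
      using near by blast
    note e = regular_param_ends[OF st(1)] regular_param_ends[OF st(2)]
    have cx: "ctrl x 1 (Xc i) (R k i) x 1 = yy i" by (simp add: ctrl_def)
    have "param_arc j (S k 0) v = conic_arc (yy i) (A1 i j k 1) (A2 i j k 1)"
      using param_arc_tnet[OF st(3)[unfolded Xc_def[of j] R_def[of k j]] st(1) v(2) ne(4)] e v(3)
      by (simp add: A1_def A2_def cx)
    moreover have "distinct3 i k j" using d by (auto simp: distinct3_def)
    then have "param_arc j (S i 1) v = param_arc j (S k 0) v" using S_edge[OF v(1), of i k j] v by simp
    moreover have "param_arc j (S i 1) v = param_arc j (S i 1) 0"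
    proof -
      have "S i 1 (upd v j s) = S i 1 (upd 0 j s)" if "s \<in> {0..1}" for s
      proof -
        have "upd v j s = upd (upd 0 j s) i 1" using ne by (auto simp: v_def upd_def vec_eq_iff)
        then show ?thesis using S_indep_coord[OF _ upd_cube[OF zero_cube that], of 1 1 i j] by simp
      qed
      then show ?thesis unfolding param_arc_upd[OF v(2)] param_arc_upd[OF zero_cube] by (intro image_cong refl) auto
    qed
    ultimately have pa: "param_arc j (S i 1) 0 = conic_arc (yy i) (A1 i j k 1) (A2 i j k 1)" by simp
    have X1e: "S i 1 0 = span {yy i}"
      using S_indep_coord[OF _ zero_cube, of 1 1 i] S_X[OF upd_verts[OF zero_verts], of 1 i i 1] X1[of i] by (simp add: upd_nth)
    have u0: "upd 0 j 0 = (0::real^3)" by (simp add: upd_def vec_eq_iff)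
    have scp: "sc_patch i (S i 1)" using S_gen[of 1 i] unfolding generic_sc_patch_def by simp
    have "S i 1 (upd 0 j 0) = span {yy i}" using u0 X1e by simp
    then obtain z' y' where "indep3 (yy i) z' y'" "param_arc j (S i 1) 0 = conic_arc (yy i) z' y'"
      by (rule sc_patch_conic_arc[OF scp ne(4) zero_cube]) (rule that, assumption, assumption)
    then have i3: "indep3 (yy i) (A1 i j k 1) (A2 i j k 1)" using conic_arc_indep pa by metis
    have "S i 1 (upd 0 j 1) = S k 0 (upd v j 1)"
    proof -
      have "upd v j 1 = upd (upd 0 j 1) i 1" using ne by (auto simp: v_def upd_def vec_eq_iff)
      then have "S i 1 (upd 0 j 1) = S i 1 (upd v j 1)"
        using S_indep_coord[OF _ upd_cube[OF zero_cube], of 1 1 1 i j] by simp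
      also have "\<dots> = X (upd v j 1)" using S_X[OF upd_verts[OF v(1)], of 1 j i 1] v ne by (simp add: upd_nth)
      also have "\<dots> = S k 0 (upd v j 1)" using S_X[OF upd_verts[OF v(1)], of 1 j k 0] v ne by (simp add: upd_nth)
      finally show ?thesis .
    qed
    also have "\<dots> = span {A2 i j k 1}"
      using st(3)[OF upd_cube[OF v(2)], of 1 j] e v ne by (simp add: upd_nth tnet_def A2_def ctrl_def algebra_simps)
    finally show ?thesis using pa i3 by blast
  qed
  have d': "distinct3 i k j" using d by (auto simp: distinct3_def)
  have X1e: "S i 1 0 = span {yy i}"
    using S_indep_coord[OF _ zero_cube, of 1 1 i] S_X[OF upd_verts[OF zero_verts], of 1 i i 1] X1[of i] by (simp add: upd_nth)
  note a = arc[OF d] arc[OF d']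
  show ?thesis
  proof (rule normal_form[OF d S_gen, of 1 "yy i" "A1 i j k 1" "A2 i j k 1" "A1 i k j 1" "A2 i k j 1"])
    fix l1 l2 m1 m2 \<sigma> \<tau>
    assume h: "regular_param \<sigma>" "regular_param \<tau>" "\<And>u. u \<in> {0..1} \<Longrightarrow> bern (1::real) l1 l2 u \<noteq> 0"
      "\<And>u. u \<in> {0..1} \<Longrightarrow> bern (1::real) m1 m2 u \<noteq> 0"
      "\<And>w. w \<in> cube \<Longrightarrow> S i 1 w = span {tnet (bern (yy i) (A1 i j k 1) (A2 i j k 1)) (bern 1 l1 l2)
         (bern (yy i) (A1 i k j 1) (A2 i k j 1)) (bern 1 m1 m2) (yy i) (\<sigma> (w $ j)) (\<tau> (w $ k))}"
    show thesis by (rule that[OF h(1-4)], assumption, assumption, unfold Y_1, rule h(5), assumption)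
  qed (use a X1e in auto)
qed

lemma A2_1: "A2 i j k 1 = a2 k j *\<^sub>R yy i + a2 k i *\<^sub>R (yy j - a2 k j *\<^sub>R x)"
  and A1_1: "A1 i j k 1 = a1 k j *\<^sub>R yy i + a2 k i *\<^sub>R (zz j - a1 k j *\<^sub>R x)"
  by (simp_all add: A1_def A2_def ctrl_def algebra_simps)

text \<open>All eight vertices lie in the span: seven of them are on near faces, and the eighth is
  on a far face whose normal form combines the same vectors. Since the cube is not planar, the span
  is the whole space.\<close>

lemma basis4:
  assumes d: "distinct3 i j k" shows "indep4 x (yy i) (yy j) (yy k)"
proof (rule indep4_spanI)
  let ?s = "span {x, yy i, yy j, yy k}"
  have m: "x \<in> ?s" "yy p \<in> ?s" for p
    using distinct3_cases[OF d, of p] by (auto intro: span_base)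
  note sp = span_add span_diff span_scale m
  have Xs: "X v \<subseteq> ?s" if v: "v \<in> verts" for v
  proof (cases "\<exists>p. v $ p = 0")
    case True
    then obtain p where p: "v $ p = 0" by blast
    obtain q r where pqr: "distinct3 p q r" by (rule dist_ex)
    obtain \<sigma> \<tau> where st: "regular_param \<sigma>" "regular_param \<tau>"
      "\<And>w. w \<in> cube \<Longrightarrow> S p 0 w = span {tnet (Xc q) (R p q) (Xc r) (R p r) x (\<sigma> (w $ q)) (\<tau> (w $ r))}"
      using near[OF pqr] by blast
    have "Xc q (\<sigma> (v $ q)) \<in> {x, yy q}" "Xc r (\<tau> (v $ r)) \<in> {x, yy r}"
      using v regular_param_ends[OF st(1)] regular_param_ends[OF st(2)] by (auto simp: verts_def) (metis Xc_0 Xc_1)+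
    then have "Xc q (\<sigma> (v $ q)) \<in> ?s" "Xc r (\<tau> (v $ r)) \<in> ?s" using m by auto
    then have "tnet (Xc q) (R p q) (Xc r) (R p r) x (\<sigma> (v $ q)) (\<tau> (v $ r)) \<in> ?s"
      unfolding tnet_def by (intro sp)
    moreover have "X v = span {tnet (Xc q) (R p q) (Xc r) (R p r) x (\<sigma> (v $ q)) (\<tau> (v $ r))}"
      using S_X[OF v p] st(3)[OF subsetD[OF verts_cube v]] by simp
    ultimately show ?thesis by (simp add: span_minimal)
  next
    case False
    then have v1: "v $ p = 1" for p using v by (auto simp: verts_def)
    obtain m1 m2 n1 n2 \<sigma> \<tau> where nf: "regular_param \<sigma>" "regular_param \<tau>"
      "\<And>w. w \<in> cube \<Longrightarrow> S i 1 w = span {tnet (Y i j k 1) (bern 1 m1 m2) (Y i k j 1) (bern 1 n1 n2) (yy i)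
       (\<sigma> (w $ j)) (\<tau> (w $ k))}"
      by (rule far_nf[OF d]) (rule that, assumption, assumption, assumption)
    have "X v = span {tnet (Y i j k 1) (bern 1 m1 m2) (Y i k j 1) (bern 1 n1 n2) (yy i) 1 1}"
      using S_X[OF v v1, of i] nf(3)[OF subsetD[OF verts_cube v]] v1 regular_param_ends[OF nf(1)] regular_param_ends[OF nf(2)]
      by simp
    moreover have "tnet (Y i j k 1) (bern 1 m1 m2) (Y i k j 1) (bern 1 n1 n2) (yy i) 1 1 \<in> ?s"
      unfolding tnet_def Y_1 bern_1 A2_1 by (intro sp)
    ultimately show ?thesis by (simp add: span_minimal)
  qed
  have "join (X ` verts) = UNIV" using gc unfolding generic_cube_def by blast
  moreover have "join (X ` verts) \<subseteq> ?s" unfolding join_def using Xs by (intro span_minimal) auto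
  ultimately show "?s = UNIV" by blast
qed

text \<open>The far faces \<open>S i 1\<close> and \<open>S k 1\<close> share the edge of direction
  \<open>j\<close> at \<open>v\<close>, to which \<open>far_edge\<close> is applied. The third far
  face \<open>S j 1\<close> enters through its plane, which contains the end point \<open>o1\<close>
  of this edge.\<close>

lemma far_coeff:
  assumes d: "distinct3 i j k" and st: "regular_param \<sigma>" "regular_param \<tau>"
    and mnz: "\<And>u. u \<in> {0..1} \<Longrightarrow> bern (1::real) m1 m2 u \<noteq> 0" and nnz: "\<And>u. u \<in> {0..1} \<Longrightarrow> bern (1::real) n1 n2 u \<noteq> 0"
    and nf: "\<And>w. w \<in> cube \<Longrightarrow> S i 1 w = span {tnet (Y i j k 1) (bern 1 m1 m2) (Y i k j 1) (bern 1 n1 n2) (yy i)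
       (\<sigma> (w $ j)) (\<tau> (w $ k))}"
  shows "m1 = L1 i j k 1" "m2 = L2 i j k 1"
proof -
  have ne: "i \<noteq> j" "i \<noteq> k" "j \<noteq> k" "j \<noteq> i" "k \<noteq> i" "k \<noteq> j" using d by (auto simp: distinct3_def)
  have d2: "distinct3 k j i" "distinct3 j i k" "distinct3 i k j" using d by (auto simp: distinct3_def)
  define v where "v = upd (upd 0 i (1::real)) k 1"
  have v: "v \<in> verts" "v \<in> cube" "v $ i = 1" "v $ k = 1" "v $ j = 0"
    using upd_verts[OF upd_verts[OF zero_verts], of 1 1 i k] verts_cube ne by (auto simp: v_def upd_nth)
  define o1 :: "real^3" where "o1 = (\<chi> r. 1)"
  have o1: "o1 \<in> verts" "o1 \<in> cube" "o1 $ r = 1" for r by (auto simp: o1_def verts_def cube_def)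
  obtain m1' m2' n1' n2' \<sigma>' \<tau>' where k: "regular_param \<sigma>'" "regular_param \<tau>'"
    "\<And>u. u \<in> {0..1} \<Longrightarrow> bern (1::real) m1' m2' u \<noteq> 0" "\<And>u. u \<in> {0..1} \<Longrightarrow> bern (1::real) n1' n2' u \<noteq> 0"
    "\<And>w. w \<in> cube \<Longrightarrow> S k 1 w = span {tnet (Y k j i 1) (bern 1 m1' m2') (Y k i j 1) (bern 1 n1' n2') (yy k)
       (\<sigma>' (w $ j)) (\<tau>' (w $ i))}"
    by (rule far_nf[OF d2(1)]) (rule that)
  obtain m1'' m2'' n1'' n2'' \<sigma>'' \<tau>'' where jn: "regular_param \<sigma>''" "regular_param \<tau>''"
    "\<And>w. w \<in> cube \<Longrightarrow> S j 1 w = span {tnet (Y j i k 1) (bern 1 m1'' m2'') (Y j k i 1) (bern 1 n1'' n2'') (yy j)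
       (\<sigma>'' (w $ i)) (\<tau>'' (w $ k))}"
    by (rule far_nf[OF d2(2)]) (rule that, assumption, assumption, assumption)
  note ends = regular_param_ends[OF st(1)] regular_param_ends[OF st(2)] regular_param_ends[OF k(1)]
    regular_param_ends[OF k(2)] regular_param_ends[OF jn(1)] regular_param_ends[OF jn(2)]
  let ?R1 = "ctrl (A1 i j k 1) m1 (Y i k j 1) (bern 1 n1 n2) (yy i) 1"
  let ?R2 = "ctrl (A2 i j k 1) m2 (Y i k j 1) (bern 1 n1 n2) (yy i) 1"
  let ?Q1 = "ctrl (A1 k j i 1) m1' (Y k i j 1) (bern 1 n1' n2') (yy k) 1"
  let ?Q2 = "ctrl (A2 k j i 1) m2' (Y k i j 1) (bern 1 n1' n2') (yy k) 1"
  let ?P = "A2 i k j 1"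
  have Pe: "A2 k i j 1 = ?P" unfolding A2_1 by (simp add: algebra_simps)
  have c0: "ctrl (yy i) 1 (Y i k j 1) (bern 1 n1 n2) (yy i) 1 = ?P" "ctrl (yy k) 1 (Y k i j 1) (bern 1 n1' n2') (yy k) 1 = ?P"
    unfolding Pe[symmetric] by (simp_all add: ctrl_def Y_1) (simp add: Pe)
  have pa: "param_arc j (S i 1) v = conic_arc ?P ?R1 ?R2"
    using param_arc_tnet[OF nf[unfolded Y_1[of i j k]] st(1) v(2) ne(3)] ends v(4) by (simp add: c0)
  have pk: "param_arc j (S k 1) v = conic_arc ?P ?Q1 ?Q2"
    using param_arc_tnet[OF k(5)[unfolded Y_1[of k j i]] k(1) v(2) ne(4)] ends v(3) by (simp add: c0)
  have arcs: "conic_arc ?P ?R1 ?R2 = conic_arc ?P ?Q1 ?Q2"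
    using S_edge[OF v(1) d2(3)] v(3,4) pa pk by simp
  have "S i 1 (upd v j 0) = span {?P}"
    using nf[OF upd_cube[OF v(2)], of 0 j] ends v ne unfolding Y_1[of i j k] by (simp add: upd_nth tnet_bern c0)
  moreover have "sc_patch i (S i 1)" using S_gen[of 1 i] unfolding generic_sc_patch_def by simp
  ultimately obtain z' y' where "indep3 ?P z' y'" "param_arc j (S i 1) v = conic_arc ?P z' y'"
    using sc_patch_conic_arc[OF _ ne(4) v(2)] by metis
  then have i3: "indep3 ?P ?R1 ?R2" using conic_arc_indep[of ?P z' y' ?P ?R1 ?R2] pa by simp
  have XR: "X o1 = span {?R2}"
    using S_X[OF o1(1) o1(3), of i] nf[OF o1(2)] ends unfolding Y_1[of i j k] by (simp add: o1(3) tnet_bern)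
  have XQ: "X o1 = span {?Q2}"
    using S_X[OF o1(1) o1(3), of k] k(5)[OF o1(2)] ends unfolding Y_1[of k j i] by (simp add: o1(3) tnet_bern)
  obtain \<gamma> where g: "?Q2 = \<gamma> *\<^sub>R ?R2" using XR XQ span1_eq[of ?Q2 ?R2] by auto
  have XT: "X o1 = span {tnet (Y j i k 1) (bern 1 m1'' m2'') (Y j k i 1) (bern 1 n1'' n2'') (yy j) 1 1}"
    using S_X[OF o1(1) o1(3), of j] jn(3)[OF o1(2)] ends by (simp add: o1(3))
  have "tnet (Y j i k 1) (bern 1 m1'' m2'') (Y j k i 1) (bern 1 n1'' n2'') (yy j) 1 1
      \<in> span {yy j, A2 j i k 1, A2 j k i 1}"
    unfolding tnet_def Y_1 bern_1 by (intro span_add span_diff span_scale span_base) auto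
  then have "X o1 \<subseteq> span {yy j, A2 j i k 1, A2 j k i 1}" unfolding XT by (intro span_minimal) auto
  then have "?R2 \<in> span {yy j, A2 j i k 1, A2 j k i 1}" unfolding XR using span_base[of ?R2 "{?R2}"] by auto
  then have top: "?R2 \<in> span {yy j, a2 k j *\<^sub>R yy i + a2 k i *\<^sub>R (yy j - a2 k j *\<^sub>R x),
      a2 i j *\<^sub>R yy k + a2 i k *\<^sub>R (yy j - a2 i j *\<^sub>R x)}"
    unfolding A2_1 by (simp add: algebra_simps)
  have nz: "a2 p q \<noteq> 0" if "p \<noteq> q" for p q using Rnz[OF that, of 1] by simp
  have nz2: "n2 \<noteq> 0" "n2' \<noteq> 0" "m2 \<noteq> 0" "m2' \<noteq> 0" using nnz[of 1] k(4)[of 1] mnz[of 1] k(3)[of 1] by auto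
  \<comment> \<open>In \<open>far_edge\<close>, \<open>rij\<close> is the end value of the
    denominator of direction i on the near face of directions i and j, which is
    \<open>a2 k i\<close> here; the other indices are read likewise. The roles of \<mu> and \<nu>
    are played by \<open>n2\<close> and \<open>n2'\<close>.\<close>
  note fe = far_edge[OF basis4[OF d] nz[OF ne(5)] nz[OF ne(4)] nz[OF ne(3)] nz[OF ne(2)] nz2(1,2,3,4) _ _ _ _ _ i3 arcs g top]
  have 1: "?P = a2 j k *\<^sub>R yy i + a2 j i *\<^sub>R yy k - (a2 j i * a2 j k) *\<^sub>R x" unfolding A2_1 by (simp add: algebra_simps)
  have 2: "?R1 = n2 *\<^sub>R (a1 k j *\<^sub>R yy i + a2 k i *\<^sub>R (zz j - a1 k j *\<^sub>R x)) + m1 *\<^sub>R (?P - n2 *\<^sub>R yy i)"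
    "?R2 = n2 *\<^sub>R (a2 k j *\<^sub>R yy i + a2 k i *\<^sub>R (yy j - a2 k j *\<^sub>R x)) + m2 *\<^sub>R (?P - n2 *\<^sub>R yy i)"
    unfolding A1_1[of i j k, symmetric] A2_1[of i j k, symmetric] by (simp_all add: ctrl_def Y_1)
  have 3: "?Q1 = n2' *\<^sub>R (a1 i j *\<^sub>R yy k + a2 i k *\<^sub>R (zz j - a1 i j *\<^sub>R x)) + m1' *\<^sub>R (?P - n2' *\<^sub>R yy k)"
    "?Q2 = n2' *\<^sub>R (a2 i j *\<^sub>R yy k + a2 i k *\<^sub>R (yy j - a2 i j *\<^sub>R x)) + m2' *\<^sub>R (?P - n2' *\<^sub>R yy k)"
    unfolding A1_1[of k j i, symmetric] A2_1[of k j i, symmetric] by (simp_all add: ctrl_def Y_1 Pe)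
  show "m1 = L1 i j k 1" "m2 = L2 i j k 1"
    using fe[OF 1 2 3] nz[OF ne(4)] unfolding L1_def L2_def R_1 by (simp_all add: field_simps)
qed

definition rp :: "(3 \<Rightarrow> real \<Rightarrow> real) \<Rightarrow> real^3 \<Rightarrow> real^3" where
  "rp \<tau> w = (\<chi> r. \<tau> r (w $ r))"

lemma rp_nth [simp]: "rp \<tau> w $ r = \<tau> r (w $ r)"
  by (simp add: rp_def)

lemma Net_upd:
  assumes d: "distinct3 i j k" shows "Net (upd w i t) = NET i j k t (w $ j) (w $ k)"
proof -
  have "j \<noteq> i" "k \<noteq> i" using d by (auto simp: distinct3_def)
  then show ?thesis unfolding Net_eq[OF d] by (simp add: upd_nth)
qed

lemma slice_0: "NET i j k 0 u v = tnet (Xc j) (R i j) (Xc k) (R i k) x u v"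
proof -
  have "Y i j k 0 = Xc j" "Lam i j k 0 = R i j" for j k
    by (simp_all add: Y_def Lam_def A1_def A2_def L1_def L2_def ctrl_def Xc_def R_def)
  then show ?thesis using slice[of j i 0 k u v] by simp
qed

lemma face_NET:
  assumes d: "distinct3 i j k" and st: "regular_param \<sigma>" "regular_param \<tau>"
    and f: "\<And>w. w \<in> cube \<Longrightarrow> f w = span {NET i j k e (\<sigma> (w $ j)) (\<tau> (w $ k))}"
  shows "\<exists>\<tau>. (\<forall>r. regular_param (\<tau> r)) \<and> (\<forall>w\<in>cube. f w = span {Net (upd (rp \<tau> w) i e)})"
proof (intro exI conjI allI ballI)
  let ?t = "\<lambda>r. if r = j then \<sigma> else \<tau>"
  show "regular_param (?t r)" for r using st by simp
  fix w assume w: "w \<in> cube"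
  have "k \<noteq> j" using d by (auto simp: distinct3_def)
  then show "f w = span {Net (upd (rp ?t w) i e)}"
    using f[OF w] unfolding Net_upd[OF d] by simp
qed

lemma Rnz': "i \<noteq> j \<Longrightarrow> a2 i j \<noteq> 0"
  using Rnz[of i j 1] by simp

text \<open>\<open>far_coeff\<close> is applied to both orders of the two directions of the face.
  Once the coefficients are identified, \<open>Lam\<close> at level 1 inherits its nonvanishing from
  the normal form of the far face.\<close>

lemma face_far: "\<exists>\<tau>. (\<forall>r. regular_param (\<tau> r)) \<and> (\<forall>w\<in>cube. S i 1 w = span {Net (upd (rp \<tau> w) i 1)})"
  and Lam_1: "distinct3 i j k \<Longrightarrow> u \<in> {0..1} \<Longrightarrow> Lam i j k 1 u \<noteq> 0"
proof -
  have *: "(\<exists>\<tau>. (\<forall>r. regular_param (\<tau> r)) \<and> (\<forall>w\<in>cube. S i 1 w = span {Net (upd (rp \<tau> w) i 1)}))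
     \<and> (\<forall>u\<in>{0..1}. Lam i j k 1 u \<noteq> 0)" if d: "distinct3 i j k" for j k
  proof -
    have ne: "i \<noteq> j" "i \<noteq> k" "j \<noteq> k" "j \<noteq> i" "k \<noteq> i" "k \<noteq> j" using d by (auto simp: distinct3_def)
    have d': "distinct3 i k j" using d by (auto simp: distinct3_def)
    obtain m1 m2 n1 n2 \<sigma> \<tau> where nf: "regular_param \<sigma>" "regular_param \<tau>"
      "\<And>u. u \<in> {0..1} \<Longrightarrow> bern (1::real) m1 m2 u \<noteq> 0" "\<And>u. u \<in> {0..1} \<Longrightarrow> bern (1::real) n1 n2 u \<noteq> 0"
      "\<And>w. w \<in> cube \<Longrightarrow> S i 1 w = span {tnet (Y i j k 1) (bern 1 m1 m2) (Y i k j 1) (bern 1 n1 n2) (yy i)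
       (\<sigma> (w $ j)) (\<tau> (w $ k))}"
      by (rule far_nf[OF d]) (rule that)
    have c1: "m1 = L1 i j k 1" "m2 = L2 i j k 1" by (rule far_coeff[OF d nf]; assumption)+
    have nf': "\<And>w. w \<in> cube \<Longrightarrow> S i 1 w = span {tnet (Y i k j 1) (bern 1 n1 n2) (Y i j k 1) (bern 1 m1 m2) (yy i)
       (\<tau> (w $ k)) (\<sigma> (w $ j))}" using nf(5) by (simp add: tnet_swap[of "Y i k j 1"])
    have c2: "n1 = L1 i k j 1" "n2 = L2 i k j 1" by (rule far_coeff[OF d' nf(2,1,4,3) nf']; assumption)+
    have "S i 1 w = span {NET i j k 1 (\<sigma> (w $ j)) (\<tau> (w $ k))}" if "w \<in> cube" for w
    proof -
      have "NET i j k 1 (\<sigma> (w $ j)) (\<tau> (w $ k)) = tnet (Y i j k 1) (bern 1 m1 m2) (Y i k j 1) (bern 1 n1 n2) (yy i)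
         (\<sigma> (w $ j)) (\<tau> (w $ k))"
        unfolding c1 c2 Lam_def[symmetric] by (subst slice) (use Rnz'[OF ne(4)] Rnz'[OF ne(5)] in simp_all)
      then show ?thesis using nf(5)[OF that] by simp
    qed
    from face_NET[OF d nf(1,2) this] nf(3) show ?thesis unfolding Lam_def c1[symmetric] by blast
  qed
  obtain j' k' where "distinct3 i j' k'" by (rule dist_ex)
  from *[OF this] show "\<exists>\<tau>. (\<forall>r. regular_param (\<tau> r)) \<and> (\<forall>w\<in>cube. S i 1 w = span {Net (upd (rp \<tau> w) i 1)})" by blast
  show "distinct3 i j k \<Longrightarrow> u \<in> {0..1} \<Longrightarrow> Lam i j k 1 u \<noteq> 0" using * by blast
qed

lemma face:
  assumes "e \<in> {0, 1}"
  obtains \<tau> where "\<And>r. regular_param (\<tau> r)" "\<And>w. w \<in> cube \<Longrightarrow> S i e w = span {Net (upd (rp \<tau> w) i e)}"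
proof (cases "e = 0")
  case True
  obtain j k where d: "distinct3 i j k" by (rule dist_ex)
  obtain \<sigma> \<tau> where st: "regular_param \<sigma>" "regular_param \<tau>"
      "\<And>w. w \<in> cube \<Longrightarrow> S i 0 w = span {tnet (Xc j) (R i j) (Xc k) (R i k) x (\<sigma> (w $ j)) (\<tau> (w $ k))}"
    using near[OF d] by blast
  from face_NET[OF d st(1,2), of "S i 0" 0] st(3) True show ?thesis using that unfolding slice_0 by blast
next
  case False
  then show ?thesis using face_far[of i] assms that by auto
qed

end

section \<open>Choice of homogeneous coordinates at a corner\<close>

lemma gen_cube_ex:
  assumes sc: "sc_cube X S" and gc: "generic_cube X S"
  shows "\<exists>x zz yy a1 a2. gen_cube x zz yy a1 a2 X S"
proof -
  have zv: "0 \<in> verts" by (simp add: verts_def)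
  have uv: "upd 0 p 1 \<in> verts" for p by (auto simp: verts_def upd_def)
  have u0: "upd 0 p 0 = (0::real^3)" for p by (simp add: upd_def vec_eq_iff)
  have SX: "S i e v = X v" if "v \<in> verts" "v $ i = e" "e \<in> {0,1}" for i e v using sc that unfolding sc_cube_def by blast
  have SG: "generic_sc_patch i (S i e)" if "e \<in> {0,1}" for i e using sc that unfolding sc_cube_def by blast
  have scp: "sc_patch i (S i 0)" for i using SG[of 0 i] unfolding generic_sc_patch_def by simp
  have "X 0 \<in> rp3" using sc zv unfolding sc_cube_def q_cube_def by blast
  then obtain x where x: "x \<noteq> 0" "X 0 = span {x}" using subspace_dim1[of "X 0"] unfolding rp3_def by blast
  have S0: "S q 0 0 = span {x}" for q using SX[OF zv, of q 0] x by simp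
  have Sq: "S q 0 (upd 0 p 1) = X (upd 0 p 1)" if "q \<noteq> p" for p q
    using SX[OF uv, of p q 0] that by (simp add: upd_nth)
  have "\<exists>z y. indep3 x z y \<and> (\<forall>q. p \<noteq> q \<longrightarrow> param_arc p (S q 0) 0 = conic_arc x z y) \<and> X (upd 0 p 1) = span {y}" for p
  proof -
    obtain q r where d: "distinct3 p q r" by (rule dist_ex)
    then have ne: "p \<noteq> q" "q \<noteq> p" "distinct3 q r p" by (auto simp: distinct3_def)
    have "S q 0 (upd 0 p 0) = span {x}" using S0 u0 by simp
    then obtain z y where zy: "indep3 x z y" "param_arc p (S q 0) 0 = conic_arc x z y" "S q 0 (upd 0 p 1) = span {y}"
      by (rule sc_patch_conic_arc[OF scp ne(1) zero_cube]) (rule that)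
    have "\<forall>v\<in>verts. \<forall>i j k. distinct3 i j k \<longrightarrow>
        param_arc k (S i (v $ i)) v = param_arc k (S j (v $ j)) v" using sc unfolding sc_cube_def by blast
    with zv ne(3) have "param_arc p (S q (0 $ q)) 0 = param_arc p (S r (0 $ r)) 0" by blast
    then have "param_arc p (S q 0) 0 = param_arc p (S r 0) 0" by simp
    then have "param_arc p (S q' 0) 0 = conic_arc x z y" if "p \<noteq> q'" for q'
      using distinct3_cases[OF d, of q'] that zy(2) by metis
    then show ?thesis using zy Sq[OF ne(2)] by blast
  qed
  then obtain zz yy where zy: "\<And>p. indep3 x (zz p) (yy p)" "\<And>p q. p \<noteq> q \<Longrightarrow> param_arc p (S q 0) 0 = conic_arc x (zz p) (yy p)"
    "\<And>p. X (upd 0 p 1) = span {yy p}" by metis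
  define P where "P i j k l1 l2 m1 m2 \<longleftrightarrow> (\<exists>\<sigma> \<tau>. regular_param \<sigma> \<and> regular_param \<tau> \<and>
      (\<forall>w\<in>cube. S i 0 w = span {tnet (bern x (zz j) (yy j)) (bern 1 l1 l2) (bern x (zz k) (yy k)) (bern 1 m1 m2) x (\<sigma> (w $ j)) (\<tau> (w $ k))}))"
    for i j k l1 l2 m1 m2
  have Psw: "P i k j m1 m2 l1 l2" if "P i j k l1 l2 m1 m2" for i j k l1 l2 m1 m2
    using that unfolding P_def by (subst tnet_swap) blast
  have "\<exists>l1 l2. (\<forall>j k. distinct3 i j k \<longrightarrow> P i j k (l1 j) (l2 j) (l1 k) (l2 k)) \<and>
      (\<forall>j u. j \<noteq> i \<longrightarrow> u \<in> {0..1} \<longrightarrow> bern (1::real) (l1 j) (l2 j) u \<noteq> 0)" for i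
  proof -
    obtain j k where d: "distinct3 i j k" by (rule dist_ex)
    have ne: "j \<noteq> i" "k \<noteq> i" "j \<noteq> k" using d by (auto simp: distinct3_def)
    have a: "param_arc j (S i 0) 0 = conic_arc x (zz j) (yy j)" "param_arc k (S i 0) 0 = conic_arc x (zz k) (yy k)"
      using zy(2) ne by simp_all
    have ends: "S i 0 (upd 0 j 1) = span {yy j}" "S i 0 (upd 0 k 1) = span {yy k}"
      using Sq[of i j] Sq[of i k] ne zy(3) by auto
    have g0: "generic_sc_patch i (S i 0)" using SG by simp
    obtain l1 l2 m1 m2 \<sigma> \<tau> where nf: "regular_param \<sigma>" "regular_param \<tau>"
      "\<And>u. u \<in> {0..1} \<Longrightarrow> bern (1::real) l1 l2 u \<noteq> 0" "\<And>u. u \<in> {0..1} \<Longrightarrow> bern (1::real) m1 m2 u \<noteq> 0"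
      "\<And>w. w \<in> cube \<Longrightarrow> S i 0 w = span {tnet (bern x (zz j) (yy j)) (bern 1 l1 l2) (bern x (zz k) (yy k)) (bern 1 m1 m2) x
       (\<sigma> (w $ j)) (\<tau> (w $ k))}"
      by (rule normal_form[OF d g0 zy(1) zy(1) a S0 ends]) (rule that)
    then have p: "P i j k l1 l2 m1 m2" unfolding P_def by blast
    \<comment> \<open>\<open>normal_form\<close> is used for one order of the two directions.
      Attaching the coefficients to the directions makes both orders instances of the same
      functions.\<close>
    define u1 u2 where "u1 r = (if r = j then l1 else m1)" and "u2 r = (if r = j then l2 else m2)" for r
    have "P i j' k' (u1 j') (u2 j') (u1 k') (u2 k')" if d': "distinct3 i j' k'" for j' k'
    proof -
      have "(j' = j \<and> k' = k) \<or> (j' = k \<and> k' = j)" using d d' distinct3_cases[OF d, of j'] distinct3_cases[OF d, of k']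
        unfolding distinct3_def by metis
      then show ?thesis
      proof
        assume "j' = j \<and> k' = k" with p ne show ?thesis by (simp add: u1_def u2_def)
      next
        assume "j' = k \<and> k' = j" with Psw[OF p] ne show ?thesis by (simp add: u1_def u2_def)
      qed
    qed
    moreover have "bern (1::real) (u1 r) (u2 r) u \<noteq> 0" if "u \<in> {0..1}" for r u
      using nf(3,4)[OF that] by (auto simp: u1_def u2_def)
    ultimately show ?thesis by blast
  qed
  then obtain a1 a2 where a: "\<And>i j k. distinct3 i j k \<Longrightarrow> P i j k (a1 i j) (a2 i j) (a1 i k) (a2 i k)"
    "\<And>i j u. j \<noteq> i \<Longrightarrow> u \<in> {0..1} \<Longrightarrow> bern (1::real) (a1 i j) (a2 i j) u \<noteq> 0" by metis
  have "gen_cube x zz yy a1 a2 X S"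
  proof
    show "sc_cube X S" "generic_cube X S" "X 0 = span {x}" by fact+
    show "\<exists>\<sigma> \<tau>. regular_param \<sigma> \<and> regular_param \<tau> \<and> (\<forall>w\<in>cube. S i 0 w =
      span {tnet (net_data.Xc x zz yy j) (net_data.R a1 a2 i j) (net_data.Xc x zz yy k) (net_data.R a1 a2 i k) x (\<sigma> (w $ j)) (\<tau> (w $ k))})"
      if "distinct3 i j k" for i j k
      using a(1)[OF that] unfolding P_def net_data.Xc_def net_data.R_def .
    show "net_data.R a1 a2 i j u \<noteq> 0" if "i \<noteq> j" "u \<in> {0..1}" for i j u
      using a(2)[of j i u] that unfolding net_data.R_def by simp
  qed (use zy in auto)
  then show ?thesis by blast
qed

section \<open>Chains of conics around the cube\<close>

lemma regular_param_inj: "regular_param \<sigma> \<Longrightarrow> s \<in> {0..1} \<Longrightarrow> s' \<in> {0..1} \<Longrightarrow> \<sigma> s = \<sigma> s' \<Longrightarrow> s = s'"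
  unfolding regular_param_def using strict_mono_on_imp_inj_on[of "{0..1}" \<sigma>] by (auto dest: inj_onD)

lemma regular_param_onto: "regular_param \<sigma> \<Longrightarrow> t \<in> {0..1} \<Longrightarrow> \<exists>s\<in>{0..1}. \<sigma> s = t"
  using regular_param_image[of \<sigma>] by (metis imageE)

context gen_cube
begin

definition FT :: "3 \<Rightarrow> real \<Rightarrow> 3 \<Rightarrow> real \<Rightarrow> real" where
  "FT i e = (SOME \<tau>. (\<forall>r. regular_param (\<tau> r)) \<and> (\<forall>w\<in>cube. S i e w = span {Net (upd (rp \<tau> w) i e)}))"

lemma FT:
  assumes "e \<in> {0, 1}"
  shows FT_regular: "regular_param (FT i e r)"
    and S_Net: "w \<in> cube \<Longrightarrow> S i e w = span {Net (upd (rp (FT i e) w) i e)}"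
proof -
  have "\<exists>\<tau>. (\<forall>r. regular_param (\<tau> r)) \<and> (\<forall>w\<in>cube. S i e w = span {Net (upd (rp \<tau> w) i e)})"
    by (rule face[OF assms]) blast
  from someI_ex[OF this] show "regular_param (FT i e r)" "w \<in> cube \<Longrightarrow> S i e w = span {Net (upd (rp (FT i e) w) i e)}"
    unfolding FT_def[symmetric] by blast+
qed

lemma FT_in: "e \<in> {0, 1} \<Longrightarrow> s \<in> {0..1} \<Longrightarrow> FT i e r s \<in> {0..1}"
  by (rule regular_param_in[OF FT_regular])

lemma FT_ends: "e \<in> {0, 1} \<Longrightarrow> FT i e r 0 = 0" "e \<in> {0, 1} \<Longrightarrow> FT i e r 1 = 1"
  using regular_param_ends[OF FT_regular] by blast+

lemma S_NET: "distinct3 i j k \<Longrightarrow> e \<in> {0, 1} \<Longrightarrow> w \<in> cube \<Longrightarrow> S i e w = span {NET i j k e (FT i e j (w $ j)) (FT i e k (w $ k))}"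
  by (simp add: S_Net Net_upd)

lemma NET_flip: "NET i j k a b c = NET j i k b a c"
  by (simp add: NET_rot[of i] NET_swap[of j])

lemma S_NET_j: "distinct3 i j k \<Longrightarrow> e \<in> {0, 1} \<Longrightarrow> w \<in> cube \<Longrightarrow> S j e w = span {NET i j k (FT j e i (w $ i)) e (FT j e k (w $ k))}"
  unfolding NET_flip[of i j k] by (rule S_NET) (auto simp: distinct3_def)

lemma S_NET_k: "distinct3 i j k \<Longrightarrow> e \<in> {0, 1} \<Longrightarrow> w \<in> cube \<Longrightarrow> S k e w = span {NET i j k (FT k e i (w $ i)) (FT k e j (w $ j)) e}"
  unfolding NET_swap[of i j k] by (rule S_NET_j) (auto simp: distinct3_def)

lemma param_arc_NET:
  assumes w: "w \<in> cube" and g: "\<And>s. s \<in> {0..1} \<Longrightarrow> f (upd w r s) = g (\<sigma> s)" and \<sigma>: "regular_param \<sigma>"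
  shows "param_arc r f w = g ` {0..1}"
proof -
  have "param_arc r f w = (\<lambda>s. g (\<sigma> s)) ` {0..1}" unfolding param_arc_upd[OF w] by (rule image_cong[OF refl g])
  also have "\<dots> = g ` {0..1}" using regular_param_image[OF \<sigma>] by (metis image_image)
  finally show ?thesis .
qed

lemma param_arc_S_k:
  assumes d: "distinct3 i j k" and e: "e \<in> {0, 1}" and w: "w \<in> cube"
  shows "param_arc j (S k e) w = (\<lambda>s. span {NET i j k (FT k e i (w $ i)) s e}) ` {0..1}"
    and "param_arc i (S k e) w = (\<lambda>s. span {NET i j k s (FT k e j (w $ j)) e}) ` {0..1}"
proof -
  have ne: "i \<noteq> j" "j \<noteq> i" using d by (auto simp: distinct3_def)
  show "param_arc j (S k e) w = (\<lambda>s. span {NET i j k (FT k e i (w $ i)) s e}) ` {0..1}"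
    by (rule param_arc_NET[OF w _ FT_regular[OF e]]) (use S_NET_k[OF d e upd_cube[OF w]] ne in \<open>simp add: upd_nth\<close>)
  show "param_arc i (S k e) w = (\<lambda>s. span {NET i j k s (FT k e j (w $ j)) e}) ` {0..1}"
    by (rule param_arc_NET[OF w _ FT_regular[OF e]]) (use S_NET_k[OF d e upd_cube[OF w]] ne in \<open>simp add: upd_nth\<close>)
qed

lemma param_arc_S_j:
  assumes d: "distinct3 i j k" and e: "e \<in> {0, 1}" and w: "w \<in> cube"
  shows "param_arc k (S j e) w = (\<lambda>s. span {NET i j k (FT j e i (w $ i)) e s}) ` {0..1}"
    and "param_arc i (S j e) w = (\<lambda>s. span {NET i j k s e (FT j e k (w $ k))}) ` {0..1}"
proof -
  have d': "distinct3 i k j" using d by (auto simp: distinct3_def)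
  show "param_arc k (S j e) w = (\<lambda>s. span {NET i j k (FT j e i (w $ i)) e s}) ` {0..1}"
    "param_arc i (S j e) w = (\<lambda>s. span {NET i j k s e (FT j e k (w $ k))}) ` {0..1}"
    using param_arc_S_k[OF d' e w] by (simp_all add: NET_swap[of i k j])
qed

text \<open>Parameter lines of the face \<open>S j b\<close> are traversed injectively, and this
  passes to the net because the parameter changes \<open>FT\<close> are bijections of the unit
  interval.\<close>

lemma edge_inj:
  assumes d: "distinct3 i j k" and b: "b \<in> {0, 1}" and c: "c \<in> {0..1}" and t: "t \<in> {0..1}" "t' \<in> {0..1}"
    and eq: "span {NET i j k t b c} = span {NET i j k t' b c}"
  shows "t = t'"
proof -
  have ne: "i \<noteq> j" "i \<noteq> k" "j \<noteq> k" "j \<noteq> i" "k \<noteq> i" "k \<noteq> j" using d by (auto simp: distinct3_def)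
  obtain s s' r where s: "s \<in> {0..1}" "s' \<in> {0..1}" "r \<in> {0..1}" "FT j b i s = t" "FT j b i s' = t'" "FT j b k r = c"
    using regular_param_onto[OF FT_regular[OF b]] t c by metis
  define w w' where "w = pt3 i k s r 0" and "w' = pt3 i k s' r 0"
  have w: "w \<in> cube" "w' \<in> cube" unfolding w_def w'_def using s by (intro pt3_cube; simp)+
  have n: "w $ i = s" "w' $ i = s'" "w $ k = r" "w' $ k = r" using ne by (simp_all add: w_def w'_def pt3_nth)
  have "S j b w' = S j b w" using eq by (simp add: S_NET_j[OF d b] w n s)
  moreover have "w' \<in> line_at i w" using ne by (auto simp: line_at_def w_def w'_def pt3_def)
  moreover have "sc_patch j (S j b)" using S_gen[OF b] unfolding generic_sc_patch_def by blast
  ultimately have "w' = w" using w ne(1) unfolding sc_patch_def by blast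
  then show ?thesis using n s by metis
qed

text \<open>A chain expressed in net coordinates: the boundary of the square u_i = t, traversed in
  the cyclic order of \<open>strip_face\<close>.\<close>

definition loop :: "3 \<Rightarrow> 3 \<Rightarrow> 3 \<Rightarrow> real \<Rightarrow> (nat \<Rightarrow> real^3) \<Rightarrow> bool" where
  "loop i j k t y \<longleftrightarrow>
     chain_point S j k y 0 = span {NET i j k t 0 0} \<and> chain_point S j k y 1 = span {NET i j k t 1 0} \<and>
     chain_point S j k y 2 = span {NET i j k t 1 1} \<and> chain_point S j k y 3 = span {NET i j k t 0 1} \<and>
     chain_arc S j k y 0 = (\<lambda>s. span {NET i j k t s 0}) ` {0..1} \<and> chain_arc S j k y 1 = (\<lambda>s. span {NET i j k t 1 s}) ` {0..1} \<and>
     chain_arc S j k y 2 = (\<lambda>s. span {NET i j k t s 1}) ` {0..1} \<and> chain_arc S j k y 3 = (\<lambda>s. span {NET i j k t 0 s}) ` {0..1} \<and>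
     chain_end S j k y 3 = span {NET i j k t 0 0}"

lemma flip_cube: "w \<in> cube \<Longrightarrow> flip r w \<in> cube"
  unfolding flip_def by (rule upd_cube) (use cube_nth[of w r] in auto)

lemma strip_simps:
  "strip_face S j k 0 = S k 0" "strip_face S j k (Suc 0) = S j 1" "strip_face S j k 2 = S k 1" "strip_face S j k 3 = S j 0"
  "strip_dir j k 0 = j" "strip_dir j k (Suc 0) = k" "strip_dir j k 2 = j" "strip_dir j k 3 = k"
  "strip_level 0 = 0" "strip_level (Suc 0) = 0" "strip_level 2 = 1" "strip_level 3 = 1"
  by (simp_all add: strip_face_def strip_dir_def strip_level_def)

lemma all_less_4: "(\<forall>n<4. Q n) \<longleftrightarrow> Q 0 \<and> Q (Suc 0) \<and> Q 2 \<and> Q (3::nat)"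
  by (auto simp: numeral_eq_Suc less_Suc_eq)

text \<open>Each arc is described through its own face and its own parameter change, so at this
  stage the four arcs carry four unrelated levels of u_i.\<close>

lemma chain_values:
  assumes d: "distinct3 i j k" and y: "\<And>n. n < 4 \<Longrightarrow> y n \<in> cube \<and> y n $ strip_dir j k n = strip_level n"
  defines "t0 \<equiv> FT k 0 i (y 0 $ i)" and "t1 \<equiv> FT j 1 i (y (Suc 0) $ i)" and "t2 \<equiv> FT k 1 i (y 2 $ i)" and "t3 \<equiv> FT j 0 i (y 3 $ i)"
  shows "chain_point S j k y 0 = span {NET i j k t0 0 0}" "chain_point S j k y (Suc 0) = span {NET i j k t1 1 0}"
    "chain_point S j k y 2 = span {NET i j k t2 1 1}" "chain_point S j k y 3 = span {NET i j k t3 0 1}"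
    "chain_end S j k y 0 = span {NET i j k t0 1 0}" "chain_end S j k y (Suc 0) = span {NET i j k t1 1 1}"
    "chain_end S j k y 2 = span {NET i j k t2 0 1}" "chain_end S j k y 3 = span {NET i j k t3 0 0}"
    "chain_arc S j k y 0 = (\<lambda>s. span {NET i j k t0 s 0}) ` {0..1}"
    "chain_arc S j k y (Suc 0) = (\<lambda>s. span {NET i j k t1 1 s}) ` {0..1}"
    "chain_arc S j k y 2 = (\<lambda>s. span {NET i j k t2 s 1}) ` {0..1}"
    "chain_arc S j k y 3 = (\<lambda>s. span {NET i j k t3 0 s}) ` {0..1}"
    "t0 \<in> {0..1}" "t1 \<in> {0..1}" "t2 \<in> {0..1}" "t3 \<in> {0..1}"
proof -
  have ne: "i \<noteq> j" "i \<noteq> k" "j \<noteq> k" "j \<noteq> i" "k \<noteq> i" "k \<noteq> j" using d by (auto simp: distinct3_def)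
  have Y: "y 0 \<in> cube" "y (Suc 0) \<in> cube" "y 2 \<in> cube" "y 3 \<in> cube" "y 0 $ j = 0" "y (Suc 0) $ k = 0" "y 2 $ j = 1" "y 3 $ k = 1"
    using y[of 0] y[of "Suc 0"] y[of 2] y[of 3] by (simp_all add: strip_simps)
  note fl = flip_cube[OF Y(1)] flip_cube[OF Y(2)] flip_cube[OF Y(3)] flip_cube[OF Y(4)]
  note si = S_NET_k[OF d] S_NET_j[OF d] Y fl ne upd_nth FT_ends
  show "chain_point S j k y 0 = span {NET i j k t0 0 0}" "chain_point S j k y (Suc 0) = span {NET i j k t1 1 0}"
    "chain_point S j k y 2 = span {NET i j k t2 1 1}" "chain_point S j k y 3 = span {NET i j k t3 0 1}"
    unfolding chain_point_def strip_simps t0_def t1_def t2_def t3_def by (simp_all add: si)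
  show "chain_end S j k y 0 = span {NET i j k t0 1 0}" "chain_end S j k y (Suc 0) = span {NET i j k t1 1 1}"
    "chain_end S j k y 2 = span {NET i j k t2 0 1}" "chain_end S j k y 3 = span {NET i j k t3 0 0}"
    unfolding chain_end_def strip_simps t0_def t1_def t2_def t3_def by (simp_all add: si) (simp_all add: flip_def si)
  show "chain_arc S j k y 0 = (\<lambda>s. span {NET i j k t0 s 0}) ` {0..1}"
    "chain_arc S j k y (Suc 0) = (\<lambda>s. span {NET i j k t1 1 s}) ` {0..1}"
    "chain_arc S j k y 2 = (\<lambda>s. span {NET i j k t2 s 1}) ` {0..1}"
    "chain_arc S j k y 3 = (\<lambda>s. span {NET i j k t3 0 s}) ` {0..1}"
    unfolding chain_arc_def strip_simps t0_def t1_def t2_def t3_def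
    by (rule param_arc_S_k(1)[OF d _ Y(1)] param_arc_S_j(1)[OF d _ Y(2)] param_arc_S_k(1)[OF d _ Y(3)] param_arc_S_j(1)[OF d _ Y(4)]; simp)+
  show "t0 \<in> {0..1}" "t1 \<in> {0..1}" "t2 \<in> {0..1}" "t3 \<in> {0..1}"
    unfolding t0_def t1_def t2_def t3_def by (intro FT_in cube_nth Y; simp)+
qed

text \<open>Consecutive arcs meet on edges, where u_i is a faithful parameter, so the three
  junctions of the chain make all four levels equal. The return of the fourth arc to the starting
  point is then a consequence.\<close>

lemma conic_chain_loop:
  assumes d: "distinct3 i j k" and y: "conic_chain S j k y"
  obtains t where "t \<in> {0..1}" "loop i j k t y"
proof -
  define t0 t1 t2 t3 where "t0 = FT k 0 i (y 0 $ i)" and "t1 = FT j 1 i (y (Suc 0) $ i)" and "t2 = FT k 1 i (y 2 $ i)" and "t3 = FT j 0 i (y 3 $ i)"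
  have yy: "\<And>n. n < 4 \<Longrightarrow> y n \<in> cube \<and> y n $ strip_dir j k n = strip_level n" using y unfolding conic_chain_def by blast
  note v = chain_values[OF d yy, folded t0_def t1_def t2_def t3_def]
  have "chain_end S j k y 0 = chain_point S j k y (Suc 0)" "chain_end S j k y (Suc 0) = chain_point S j k y 2"
    "chain_end S j k y 2 = chain_point S j k y 3"
    using y unfolding conic_chain_def by (force simp: numeral_eq_Suc)+
  then have "span {NET i j k t0 1 0} = span {NET i j k t1 1 0}" "span {NET i j k t1 1 1} = span {NET i j k t2 1 1}"
    "span {NET i j k t2 0 1} = span {NET i j k t3 0 1}" using v by simp_all
  then have "t0 = t1" "t1 = t2" "t2 = t3"
    using v(13-16) by (auto intro: edge_inj[OF d, of 1 0 t0 t1] edge_inj[OF d, of 1 1 t1 t2] edge_inj[OF d, of 0 1 t2 t3])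
  then have "loop i j k t0 y" unfolding loop_def One_nat_def using v by simp
  with v(13) show ?thesis by (rule that)
qed

lemma loop_ex:
  assumes d: "distinct3 i j k" and t: "t \<in> {0..1}"
  obtains y where "conic_chain S j k y" "loop i j k t y"
proof -
  have ne: "i \<noteq> j" "i \<noteq> k" "j \<noteq> k" "j \<noteq> i" "k \<noteq> i" "k \<noteq> j" using d by (auto simp: distinct3_def)
  obtain s0 s1 s2 s3 where s: "s0 \<in> {0..1}" "s1 \<in> {0..1}" "s2 \<in> {0..1}" "s3 \<in> {0..1}"
    "FT k 0 i s0 = t" "FT j 1 i s1 = t" "FT k 1 i s2 = t" "FT j 0 i s3 = t"
    using regular_param_onto[OF FT_regular t] by (metis insertCI)
  define y :: "nat \<Rightarrow> real^3" where "y n = (if n = 0 then pt3 i j s0 0 0 else if n = Suc 0 then pt3 i k s1 0 0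
     else if n = 2 then pt3 i j s2 1 0 else pt3 i k s3 1 0)" for n
  have yn: "y 0 = pt3 i j s0 0 0" "y (Suc 0) = pt3 i k s1 0 0" "y 2 = pt3 i j s2 1 0" "y 3 = pt3 i k s3 1 0" by (simp_all add: y_def)
  have "\<forall>n<4. y n \<in> cube \<and> y n $ strip_dir j k n = strip_level n"
    unfolding all_less_4 strip_simps yn using s ne by (auto simp: pt3_nth intro!: pt3_cube)
  then have yy: "\<And>n. n < 4 \<Longrightarrow> y n \<in> cube \<and> y n $ strip_dir j k n = strip_level n" by blast
  note v = chain_values[OF d yy, unfolded yn pt3_nth s]
  have c: "conic_chain S j k y" unfolding conic_chain_def
  proof (intro conjI allI impI)
    fix n :: nat assume "n < 3"
    then consider "n = 0" | "n = Suc 0" | "n = 2" by linarith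
    then show "chain_end S j k y n = chain_point S j k y (Suc n)"
      by cases (use v in \<open>simp_all add: numeral_2_eq_2[symmetric] numeral_3_eq_3[symmetric] One_nat_def\<close>)
  qed (use yy in auto)
  have l: "loop i j k t y" unfolding loop_def One_nat_def using v by simp
  show ?thesis by (rule that[OF c l])
qed

lemma boundary_arc_NET:
  assumes d: "distinct3 i j k" and v: "v \<in> verts"
  shows "boundary_arc S i v = (\<lambda>s. span {NET i j k s (v $ j) (v $ k)}) ` {0..1}"
proof -
  have ne: "i \<noteq> j" "i \<noteq> k" "j \<noteq> k" "j \<noteq> i" "k \<noteq> i" "k \<noteq> j" using d by (auto simp: distinct3_def)
  have vv: "v $ r \<in> {0, 1}" for r using v by (auto simp: verts_def)
  have "- {i} = {j, k}" using distinct3_other[OF d] by auto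
  then have "boundary_arc S i v = param_arc i (S j (v $ j)) v \<union> param_arc i (S k (v $ k)) v"
    unfolding boundary_arc_def by simp
  moreover have "v $ r = 0 \<or> v $ r = 1" for r using vv[of r] by simp
  then have "FT a (v $ b) c (v $ r) = v $ r" for a b c r using FT_ends[OF vv, of a b c] by metis
  moreover have "v \<in> cube" using v verts_cube by blast
  ultimately show ?thesis
    using param_arc_S_j(2)[OF d vv, of v j] param_arc_S_k(2)[OF d vv, of v k] by simp
qed

end

section \<open>Coordinate surfaces of the net\<close>

text \<open>On these vectors the linear map from the first conic to the conic at \<open>v\<close> is
  multiplication by \<open>m v\<close>, so they belong to its image as soon as \<open>m v\<close> is
  nonzero.\<close>

lemma char_plane_subset:
  assumes "m v \<noteq> 0"
  shows "char_plane x z y l1 l2 \<subseteq> span {ctrl x 1 q m x v, ctrl z l1 q m x v, ctrl y l2 q m x v}"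
proof
  fix w assume "w \<in> char_plane x z y l1 l2"
  then obtain \<alpha> \<zeta> \<beta> where w: "w = \<alpha> *\<^sub>R x + \<zeta> *\<^sub>R z + \<beta> *\<^sub>R y" "\<alpha> + \<zeta> * l1 + \<beta> * l2 = 0" unfolding char_plane_def by blast
  have "m v *\<^sub>R w \<in> span {ctrl x 1 q m x v, ctrl z l1 q m x v, ctrl y l2 q m x v}"
    using ctrl_linear[OF w(2), of x q m v z y] unfolding mem_span3 w(1) by (intro exI[of _ \<alpha>] exI[of _ \<zeta>] exI[of _ \<beta>]) simp
  from span_scale[OF this, of "inverse (m v)"] show "w \<in> span {ctrl x 1 q m x v, ctrl z l1 q m x v, ctrl y l2 q m x v}"
    using assms by simp
qed

lemma dim_char_plane:
  fixes V :: "(real^4) set"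
  assumes "indep3 x z y" "char_plane x z y l1 l2 \<subseteq> V" shows "dim V \<ge> 2"
proof -
  have "indep2 (z - l1 *\<^sub>R x) (y - l2 *\<^sub>R x)" unfolding indep2_def
  proof (intro allI impI)
    fix \<alpha> \<beta> assume "\<alpha> *\<^sub>R (z - l1 *\<^sub>R x) + \<beta> *\<^sub>R (y - l2 *\<^sub>R x) = 0"
    then have "(- (\<alpha> * l1) - \<beta> * l2) *\<^sub>R x + \<alpha> *\<^sub>R z + \<beta> *\<^sub>R y = 0" by (simp add: algebra_simps)
    then show "\<alpha> = 0 \<and> \<beta> = 0" using assms(1) unfolding indep3_def by blast
  qed
  then have "dim (span {z - l1 *\<^sub>R x, y - l2 *\<^sub>R x}) = 2" by (rule dim_span2)
  moreover have "{z - l1 *\<^sub>R x, y - l2 *\<^sub>R x} \<subseteq> char_plane x z y l1 l2" unfolding char_plane_def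
  proof -
    have "z - l1 *\<^sub>R x = (-l1) *\<^sub>R x + 1 *\<^sub>R z + 0 *\<^sub>R y" "y - l2 *\<^sub>R x = (-l2) *\<^sub>R x + 0 *\<^sub>R z + 1 *\<^sub>R y" by simp_all
    moreover have "-l1 + 1 * l1 + 0 * l2 = 0" "-l2 + 0 * l1 + 1 * l2 = 0" by simp_all
    ultimately show "{z - l1 *\<^sub>R x, y - l2 *\<^sub>R x} \<subseteq> {\<alpha> *\<^sub>R x + \<zeta> *\<^sub>R z + \<beta> *\<^sub>R y | \<alpha> \<zeta> \<beta>. \<alpha> + \<zeta> * l1 + \<beta> * l2 = 0}" by blast
  qed
  then have "dim {z - l1 *\<^sub>R x, y - l2 *\<^sub>R x} \<le> dim V" using assms(2) by (intro dim_subset) blast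
  ultimately show ?thesis by simp
qed

text \<open>Modulo \<open>Q\<close> the first plane is spanned by \<open>A - l1 *\<^sub>R X\<close>
  and \<open>B - l2 *\<^sub>R X\<close>, whatever the nonzero value of \<open>m\<close>. Such a
  plane determines both coefficients.\<close>

lemma ctrl_coeff_unique:
  fixes Q X A B :: "real^4"
  assumes I: "indep4 Q X A B" and m: "m \<noteq> 0"
    and sub: "span {Q, m *\<^sub>R A + l1 *\<^sub>R (Q - m *\<^sub>R X), m *\<^sub>R B + l2 *\<^sub>R (Q - m *\<^sub>R X)}
       \<subseteq> span {Q, M *\<^sub>R A + L1 *\<^sub>R (Q - M *\<^sub>R X), M *\<^sub>R B + L2 *\<^sub>R (Q - M *\<^sub>R X)}"
  shows "l1 = L1" "l2 = L2"
proof -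
  have a: "m *\<^sub>R A + l1 *\<^sub>R (Q - m *\<^sub>R X) \<in> span {Q, m *\<^sub>R A + l1 *\<^sub>R (Q - m *\<^sub>R X), m *\<^sub>R B + l2 *\<^sub>R (Q - m *\<^sub>R X)}"
    and b: "m *\<^sub>R B + l2 *\<^sub>R (Q - m *\<^sub>R X) \<in> span {Q, m *\<^sub>R A + l1 *\<^sub>R (Q - m *\<^sub>R X), m *\<^sub>R B + l2 *\<^sub>R (Q - m *\<^sub>R X)}"
    by (auto intro!: span_base)
  obtain \<alpha> \<beta> \<gamma> where "m *\<^sub>R A + l1 *\<^sub>R (Q - m *\<^sub>R X) = \<alpha> *\<^sub>R Q + \<beta> *\<^sub>R (M *\<^sub>R A + L1 *\<^sub>R (Q - M *\<^sub>R X)) + \<gamma> *\<^sub>R (M *\<^sub>R B + L2 *\<^sub>R (Q - M *\<^sub>R X))"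
    using subsetD[OF sub a] unfolding mem_span3 by blast
  then have "(l1 - \<alpha> - \<beta> * L1 - \<gamma> * L2) *\<^sub>R Q + (\<beta> * L1 * M + \<gamma> * L2 * M - l1 * m) *\<^sub>R X + (m - \<beta> * M) *\<^sub>R A + (- \<gamma> * M) *\<^sub>R B = 0"
    by (simp add: algebra_simps)
  then have e: "\<beta> * L1 * M + \<gamma> * L2 * M - l1 * m = 0" "m - \<beta> * M = 0" "- \<gamma> * M = 0" using I unfolding indep4_def by blast+
  then have "l1 * m = L1 * m" by algebra
  then show "l1 = L1" using m by simp
  obtain \<alpha> \<beta> \<gamma> where "m *\<^sub>R B + l2 *\<^sub>R (Q - m *\<^sub>R X) = \<alpha> *\<^sub>R Q + \<beta> *\<^sub>R (M *\<^sub>R A + L1 *\<^sub>R (Q - M *\<^sub>R X)) + \<gamma> *\<^sub>R (M *\<^sub>R B + L2 *\<^sub>R (Q - M *\<^sub>R X))"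
    using subsetD[OF sub b] unfolding mem_span3 by blast
  then have "(l2 - \<alpha> - \<beta> * L1 - \<gamma> * L2) *\<^sub>R Q + (\<beta> * L1 * M + \<gamma> * L2 * M - l2 * m) *\<^sub>R X + (- \<beta> * M) *\<^sub>R A + (m - \<gamma> * M) *\<^sub>R B = 0"
    by (simp add: algebra_simps)
  then have "\<beta> * L1 * M + \<gamma> * L2 * M - l2 * m = 0" "- \<beta> * M = 0" "m - \<gamma> * M = 0" using I unfolding indep4_def by blast+
  then have "l2 * m = L2 * m" by algebra
  then show "l2 = L2" using m by simp
qed

lemma distinct3_two: "distinct3 i j k \<Longrightarrow> distinct3 i j' k' \<Longrightarrow> (j' = j \<and> k' = k) \<or> (j' = k \<and> k' = j)"
  by (rule distinct3_cases[of i j k j']; assumption?; rule distinct3_cases[of i j k k']; assumption?; auto simp: distinct3_def)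

lemma span3_same:
  fixes a b c :: "real^4"
  assumes "indep3 a b c" "{a, b, c} \<subseteq> span {x, y, z}" shows "span {a, b, c} = span {x, y, z}"
proof -
  have "dim (span {a, b, c}) = 3" by (rule dim_span3) fact
  moreover have "dim {x, y, z} \<le> 3"
    by (rule order_trans[OF dim_le_card']) (auto simp: card_insert_if)
  moreover have "span {a, b, c} \<subseteq> span {x, y, z}" using assms(2) by (simp add: span_minimal)
  ultimately show ?thesis by (intro subspace_dim_equal) (auto simp del: span_insert_0)
qed

context gen_cube
begin

definition C0 where "C0 i j k t v = ctrl (Xc i t) 1 (Y i k j t) (Lam i k j t) (Xc i t) v"
definition C1 where "C1 i j k t v = ctrl (A1 i j k t) (L1 i j k t) (Y i k j t) (Lam i k j t) (Xc i t) v"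
definition C2 where "C2 i j k t v = ctrl (A2 i j k t) (L2 i j k t) (Y i k j t) (Lam i k j t) (Xc i t) v"
definition dY where "dY i j k t = dbern (Xc i t) (A1 i j k t) (A2 i j k t)"
definition dLam :: "3 \<Rightarrow> 3 \<Rightarrow> 3 \<Rightarrow> real \<Rightarrow> real \<Rightarrow> real" where "dLam i j k t = dbern 1 (L1 i j k t) (L2 i j k t)"

lemma Lam_0 [simp]: "Lam i j k t 0 = 1" and Y_0 [simp]: "Y i j k t 0 = Xc i t"
  by (simp_all add: Lam_def Y_def)

lemma NET_tnet:
  assumes d: "distinct3 i j k" and t: "t \<in> {0..1}"
  shows "NET i j k t u v = tnet (Y i j k t) (Lam i j k t) (Y i k j t) (Lam i k j t) (Xc i t) u v"
  proof (rule slice)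
  have ne: "j \<noteq> i" "k \<noteq> i" using d by (auto simp: distinct3_def)
  show "R j i t \<noteq> 0" "R k i t \<noteq> 0" by (rule Rnz[OF ne(1) t] Rnz[OF ne(2) t])+
qed

lemma NET_bern:
  assumes d: "distinct3 i j k" and t: "t \<in> {0..1}"
  shows "NET i j k t u v = bern (C0 i j k t v) (C1 i j k t v) (C2 i j k t v) u"
  unfolding NET_tnet[OF assms] C0_def C1_def C2_def tnet_bern[symmetric] Y_def[symmetric] Lam_def[symmetric] ..

lemma C_0 [simp]: "C0 i j k t 0 = Xc i t" "C1 i j k t 0 = A1 i j k t" "C2 i j k t 0 = A2 i j k t"
  by (simp_all add: C0_def C1_def C2_def ctrl_def)

lemma dist_swap: "distinct3 i j k \<Longrightarrow> distinct3 i k j"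
  by (auto simp: distinct3_def)

lemma net_arc:
  assumes d: "distinct3 i j k" and t: "t \<in> {0..1}"
  shows "(\<lambda>s. span {NET i j k t s v}) ` {0..1} = conic_arc (C0 i j k t v) (C1 i j k t v) (C2 i j k t v)"
    and "(\<lambda>s. span {NET i j k t v s}) ` {0..1} = conic_arc (C0 i k j t v) (C1 i k j t v) (C2 i k j t v)"
proof -
  show "(\<lambda>s. span {NET i j k t s v}) ` {0..1} = conic_arc (C0 i j k t v) (C1 i j k t v) (C2 i j k t v)"
    unfolding conic_arc_def NET_bern[OF d t] ..
  have "NET i j k t v s = bern (C0 i k j t v) (C1 i k j t v) (C2 i k j t v) s" for s
    unfolding NET_swap[of i j k t v s] by (rule NET_bern[OF dist_swap[OF d] t])
  then show "(\<lambda>s. span {NET i j k t v s}) ` {0..1} = conic_arc (C0 i k j t v) (C1 i k j t v) (C2 i k j t v)"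
    unfolding conic_arc_def by simp
qed

lemma loopD:
  assumes "loop i j k t y"
  shows "chain_point S j k y 0 = span {NET i j k t 0 0}" "chain_point S j k y 1 = span {NET i j k t 1 0}"
    "chain_point S j k y 2 = span {NET i j k t 1 1}" "chain_point S j k y 3 = span {NET i j k t 0 1}"
    "chain_arc S j k y 0 = (\<lambda>s. span {NET i j k t s 0}) ` {0..1}" "chain_arc S j k y 1 = (\<lambda>s. span {NET i j k t 1 s}) ` {0..1}"
    "chain_arc S j k y 2 = (\<lambda>s. span {NET i j k t s 1}) ` {0..1}" "chain_arc S j k y 3 = (\<lambda>s. span {NET i j k t 0 s}) ` {0..1}"
  using assms unfolding loop_def by simp_all

text \<open>Inherited from the near face \<open>S k 0\<close>, on which these are control points of
  a parameter line and hence of an arc of a nondegenerate conic.\<close>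

lemma A_indep:
  assumes d: "distinct3 i j k" and t: "t \<in> {0..1}"
  shows "indep3 (Xc i t) (A1 i j k t) (A2 i j k t)"
proof -
  have ne: "i \<noteq> j" "i \<noteq> k" "j \<noteq> k" "j \<noteq> i" "k \<noteq> i" "k \<noteq> j" using d by (auto simp: distinct3_def)
  obtain s where s: "s \<in> {0..1}" "FT k 0 i s = t" using regular_param_onto[OF FT_regular t] by (metis insertCI)
  define w where "w = pt3 i j s 0 0"
  have w: "w \<in> cube" unfolding w_def using s by (intro pt3_cube) auto
  have wi: "w $ i = s" by (simp add: w_def pt3_nth)
  have e0: "(0::real) \<in> {0, 1}" by simp
  have scp: "sc_patch k (S k 0)" using S_gen[OF e0] unfolding generic_sc_patch_def by blast
  have "S k 0 (upd w j 0) = span {NET i j k t 0 0}"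
    using S_NET_k[OF d e0 upd_cube[OF w, of 0 j]] ne s wi FT_ends[OF e0] by (simp add: upd_nth)
  then obtain z y where "indep3 (NET i j k t 0 0) z y" "param_arc j (S k 0) w = conic_arc (NET i j k t 0 0) z y"
    by (rule sc_patch_conic_arc[OF scp ne(3) w]) (rule that)
  moreover have "param_arc j (S k 0) w = conic_arc (Xc i t) (A1 i j k t) (A2 i j k t)"
    unfolding param_arc_S_k(1)[OF d e0 w] wi s(2) net_arc(1)[OF d t] by simp
  ultimately show ?thesis using conic_arc_indep by metis
qed

lemma generic_chain_of: "distinct3 i j k \<Longrightarrow> conic_chain S j k y \<Longrightarrow> generic_chain S i j k y"
  using gc unfolding generic_cube_def by blast

text \<open>The coefficient of \<open>Xc j\<close> at u_i = t, u_k = 1 is read in two ways: from the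
  slice u_i = t, and from the slice u_k = 1. The latter is a far face, where \<open>Lam_1\<close>
  provides nonvanishing.\<close>

lemma Lam_corner:
  assumes d: "distinct3 i j k" and t: "t \<in> {0..1}" shows "Lam i k j t 1 \<noteq> 0"
proof -
  have ne: "i \<noteq> k" "k \<noteq> i" using d by (auto simp: distinct3_def)
  have d': "distinct3 k i j" using d by (auto simp: distinct3_def)
  have nz: "R k i t \<noteq> 0" "R i k 1 \<noteq> 0" using Rnz[OF ne(2) t] Rnz[OF ne(1), of 1] by auto
  have "Lam i k j t 1 * R k i t = Lam k i j 1 t * R i k 1"
    unfolding Lam_eq[OF nz(1)] Lam_eq[OF nz(2)] by (simp add: algebra_simps)
  then show ?thesis using Lam_1[OF d' t] nz by auto
qed

text \<open>At a zero of this denominator the points of the slice with parameters (u, 0) and (u, 1)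
  coincide, so two opposite arcs of the chain would meet.\<close>

lemma Lam_nz:
  assumes d: "distinct3 i j k" and t: "t \<in> {0..1}" and u: "u \<in> {0..1}" shows "Lam i j k t u \<noteq> 0"
proof
  assume z: "Lam i j k t u = 0"
  obtain y where y: "conic_chain S j k y" "loop i j k t y" by (rule loop_ex[OF d t])
  have "\<forall>n<2. chain_arc S j k y n \<inter> chain_arc S j k y (n + 2) = {}"
    using generic_chain_of[OF d y(1)] unfolding generic_chain_def by blast
  from this[rule_format, of 0] have "chain_arc S j k y 0 \<inter> chain_arc S j k y 2 = {}" unfolding add_0 by simp
  then have dj: "(\<lambda>s. span {NET i j k t s 0}) ` {0..1} \<inter> (\<lambda>s. span {NET i j k t s 1}) ` {0..1} = {}"
    unfolding loopD[OF y(2)] .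
  have "span {NET i j k t u 0} \<in> (\<lambda>s. span {NET i j k t s 0}) ` {0..1}" by (rule imageI[OF u])
  moreover have "span {NET i j k t u 1} \<in> (\<lambda>s. span {NET i j k t s 1}) ` {0..1}" by (rule imageI[OF u])
  ultimately have "span {NET i j k t u 0} \<noteq> span {NET i j k t u 1}" using dj by (metis disjoint_iff)
  moreover have "NET i j k t u 1 = Lam i k j t 1 *\<^sub>R NET i j k t u 0" unfolding NET_tnet[OF d t] tnet_def z by simp
  ultimately show False using span1_eq[of "NET i j k t u 1" "NET i j k t u 0"] Lam_corner[OF d t] by metis
qed

text \<open>The \<open>char_plane\<close> of direction \<open>k\<close> lies in the planes of both
  arcs of direction \<open>k\<close> of the chain. By genericity of the chain, a tangent of the arc
  of direction \<open>j\<close> does not meet the intersection of these two planes.\<close>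

lemma tangent_general:
  assumes d: "distinct3 i j k" and t: "t \<in> {0..1}" and u: "u \<in> {0..1}"
  shows "span {Y i j k t u, dY i j k t u} \<inter>
    char_plane (Xc i t) (A1 i k j t) (A2 i k j t) (L1 i k j t) (L2 i k j t) \<subseteq> {0}"
proof -
  have ne: "i \<noteq> j" "i \<noteq> k" "j \<noteq> k" "j \<noteq> i" "k \<noteq> i" "k \<noteq> j" using d by (auto simp: distinct3_def)
  have e0: "(0::real) \<in> {0, 1}" by simp
  obtain y where y: "conic_chain S j k y" "loop i j k t y" by (rule loop_ex[OF d t])
  have y0: "y 0 \<in> cube" "y 0 $ j = 0"
    using y(1) unfolding conic_chain_def by (force simp: strip_simps all_less_4)+
  \<comment> \<open>The parameter of the chain on the face \<open>S k 0\<close> is matched with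
    \<open>t\<close> by injectivity along the edge.\<close>
  have "chain_point S j k y 0 = span {NET i j k (FT k 0 i (y 0 $ i)) 0 0}"
    unfolding chain_point_def strip_simps using S_NET_k[OF d e0 y0(1)] y0(2) FT_ends[OF e0] by simp
  then have eq: "span {NET i j k (FT k 0 i (y 0 $ i)) 0 0} = span {NET i j k t 0 0}" unfolding loopD(1)[OF y(2)] by (rule sym)
  have "(0::real) \<in> {0..1}" by simp
  from edge_inj[OF d e0 this FT_in[OF e0 cube_nth[OF y0(1)]] t eq] have ti: "FT k 0 i (y 0 $ i) = t" .
  obtain s where s: "s \<in> {0..1}" "FT k 0 j s = u" using regular_param_onto[OF FT_regular[OF e0] u] by blast
  define z where "z = upd (y 0) j s"
  have z: "z \<in> cube" "z \<in> line_at j (y 0)" "z $ i = y 0 $ i" "z $ j = s"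
    using upd_cube[OF y0(1) s(1)] upd_line ne by (auto simp: z_def upd_nth)
  have "\<forall>n<4. \<forall>z\<in>cube \<inter> line_at (strip_dir j k n) (y n).
        tangent_line (strip_dir j k n) (strip_face S j k n) z \<inter>
        join (chain_arc S j k y ((n + 1) mod 4)) \<inter> join (chain_arc S j k y ((n + 3) mod 4)) = {0}"
    using generic_chain_of[OF d y(1)] unfolding generic_chain_def by blast
  from this[rule_format, of 0 z] have g: "tangent_line j (S k 0) z \<inter> join (chain_arc S j k y 1) \<inter> join (chain_arc S j k y 3) = {0}"
    using z(1,2) by (simp add: strip_simps)
  have lift: "\<exists>F. smooth_lift (S k 0) F"
    using S_gen[OF e0] unfolding generic_sc_patch_def by (blast intro: sc_patch_smooth_lift)
  have "S k 0 (upd z j s) = span {bern (Xc i t) (A1 i j k t) (A2 i j k t) (FT k 0 j s)}" if "s \<in> {0..1}" for s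
    using S_NET_k[OF d e0 upd_cube[OF z(1) that, of j]] ne ti z(3) NET_bern[OF d t, of _ 0] by (simp add: upd_nth)
  from tangent_line_bern[OF lift z(1) FT_regular[OF e0] this]
  have tl: "tangent_line j (S k 0) z = span {Y i j k t u, dY i j k t u}"
    unfolding Y_def dY_def z(4) s(2) by this
  have j: "join (chain_arc S j k y 1) = span {C0 i k j t 1, C1 i k j t 1, C2 i k j t 1}"
    "join (chain_arc S j k y 3) = span {C0 i k j t 0, C1 i k j t 0, C2 i k j t 0}"
    unfolding loopD[OF y(2)] net_arc[OF d t] by (rule conic_arc_join)+
  have "char_plane (Xc i t) (A1 i k j t) (A2 i k j t) (L1 i k j t) (L2 i k j t) \<subseteq> span {C0 i k j t v, C1 i k j t v, C2 i k j t v}"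
    if "v \<in> {0..1}" for v
    unfolding C0_def C1_def C2_def by (rule char_plane_subset) (rule Lam_nz[OF d t that])
  from this[of 0] this[of 1] show ?thesis using g unfolding tl j by auto
qed

lemma tangent_indep:
  assumes d: "distinct3 i j k" and t: "t \<in> {0..1}" and v: "v \<in> {0..1}"
  shows "indep4 (C0 i j k t v) (C1 i j k t v) (C2 i j k t v) (vertex (Y i k j t) (dY i k j t) (Lam i k j t) (dLam i k j t) v)"
  unfolding C0_def C1_def C2_def
proof (rule ctrl_indep4)
  note d' = dist_swap[OF d]
  show "indep3 (Xc i t) (A1 i j k t) (A2 i j k t)" by (rule A_indep[OF d t])
  show "Lam i k j t v \<noteq> 0" by (rule Lam_nz[OF d' t v])
  show "indep2 (Y i k j t v) (dY i k j t v)" unfolding Y_def dY_def by (rule bern_indep_tangent[OF A_indep[OF d' t]])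
  show "span {Y i k j t v, dY i k j t v} \<inter> char_plane (Xc i t) (A1 i j k t) (A2 i j k t) (L1 i j k t) (L2 i j k t) \<subseteq> {0}"
    by (rule tangent_general[OF d' t v])
qed

lemma slice_sc_patch:
  assumes d: "distinct3 i j k" and t: "t \<in> {0..1}"
  shows "sc_patch i (\<lambda>w. span {NET i j k t (w $ j) (w $ k)})"
proof -
  note d' = dist_swap[OF d]
  note D = Y_def[symmetric] dY_def[symmetric] Lam_def[symmetric] dLam_def[symmetric]
  show ?thesis unfolding NET_tnet[OF d t] unfolding Y_def Lam_def
  proof (rule tnet_sc_patch[OF d], unfold D, unfold C0_def[symmetric] C1_def[symmetric] C2_def[symmetric])
    show "Lam i j k t u \<noteq> 0" "Lam i k j t u \<noteq> 0" if "u \<in> {0..1}" for u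
      using Lam_nz[OF d t that] Lam_nz[OF d' t that] by blast+
    show "indep4 (C0 i j k t v) (C1 i j k t v) (C2 i j k t v) (vertex (Y i k j t) (dY i k j t) (Lam i k j t) (dLam i k j t) v)"
      if "v \<in> {0..1}" for v by (rule tangent_indep[OF d t that])
    show "indep4 (C0 i k j t v) (C1 i k j t v) (C2 i k j t v) (vertex (Y i j k t) (dY i j k t) (Lam i j k t) (dLam i j k t) v)"
      if "v \<in> {0..1}" for v by (rule tangent_indep[OF d' t that])
  qed
qed

lemma param_arc_of_NET:
  assumes d: "distinct3 i j k" and f: "\<And>w. w \<in> cube \<Longrightarrow> f w = span {NET i j k t (\<sigma> (w $ j)) (\<tau> (w $ k))}"
    and st: "regular_param \<sigma>" "regular_param \<tau>" and w: "w \<in> cube"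
  shows "param_arc j f w = (\<lambda>s. span {NET i j k t s (\<tau> (w $ k))}) ` {0..1}"
    and "param_arc k f w = (\<lambda>s. span {NET i j k t (\<sigma> (w $ j)) s}) ` {0..1}"
proof -
  have ne: "k \<noteq> j" "j \<noteq> k" using d by (auto simp: distinct3_def)
  show "param_arc j f w = (\<lambda>s. span {NET i j k t s (\<tau> (w $ k))}) ` {0..1}"
    by (rule param_arc_NET[OF w _ st(1)]) (use f[OF upd_cube[OF w]] ne in \<open>simp add: upd_nth\<close>)
  show "param_arc k f w = (\<lambda>s. span {NET i j k t (\<sigma> (w $ j)) s}) ` {0..1}"
    by (rule param_arc_NET[OF w _ st(2)]) (use f[OF upd_cube[OF w]] ne in \<open>simp add: upd_nth\<close>)
qed

lemma corner_cube: "corner j k n \<in> cube"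
  by (simp add: corner_def cube_def)

lemma corner_nth:
  assumes "j \<noteq> k"
  shows "corner j k 0 $ j = 0" "corner j k 0 $ k = 0" "corner j k (Suc 0) $ j = 1" "corner j k (Suc 0) $ k = 0"
    "corner j k 2 $ j = 1" "corner j k 2 $ k = 1" "corner j k 3 $ j = 0" "corner j k 3 $ k = 1"
  using assms by (simp_all add: corner_def)

lemma bounded_by_loop:
  assumes d: "distinct3 i j k" and f: "\<And>w. w \<in> cube \<Longrightarrow> f w = span {NET i j k t (\<sigma> (w $ j)) (\<tau> (w $ k))}"
    and st: "regular_param \<sigma>" "regular_param \<tau>" and y: "loop i j k t y"
  shows "bounded_by_chain S j k y f"
proof -
  have jk: "j \<noteq> k" using d by (auto simp: distinct3_def)
  note e = regular_param_ends[OF st(1)] regular_param_ends[OF st(2)]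
  have c: "f (corner j k n) = span {NET i j k t (\<sigma> (corner j k n $ j)) (\<tau> (corner j k n $ k))}" for n
    by (rule f[OF corner_cube])
  have a: "param_arc j f (corner j k n) = (\<lambda>s. span {NET i j k t s (\<tau> (corner j k n $ k))}) ` {0..1}"
    "param_arc k f (corner j k n) = (\<lambda>s. span {NET i j k t (\<sigma> (corner j k n $ j)) s}) ` {0..1}" for n
    by (rule param_arc_of_NET[OF d f st corner_cube]; assumption)+
  show ?thesis unfolding bounded_by_chain_def all_less_4 strip_simps a c corner_nth[OF jk]
    using y e unfolding loop_def One_nat_def by simp
qed

text \<open>Each characteristic line contains a \<open>char_plane\<close>, hence has dimension at
  least 2. Their intersection lies in the planes of all four arcs of the chain and is therefore
  trivial, so that in dimension 4 both dimensions are exactly 2. The degree is part of the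
  genericity of the chain.\<close>

lemma generic_slice:
  assumes d: "distinct3 i j k" and t: "t \<in> {0..1}"
  shows "generic_sc_patch i (\<lambda>w. span {NET i j k t (w $ j) (w $ k)})" (is "generic_sc_patch i ?f")
proof -
  have jk: "j \<noteq> k" using d by (auto simp: distinct3_def)
  note d' = dist_swap[OF d]
  obtain y where y: "conic_chain S j k y" "loop i j k t y" by (rule loop_ex[OF d t])
  note gcy = generic_chain_of[OF d y(1), unfolded generic_chain_def]
  have scp: "sc_patch i ?f" by (rule slice_sc_patch[OF d t])
  have id: "regular_param (\<lambda>s. s)" unfolding regular_param_def strict_mono_on_def
    by (auto intro!: exI[of _ "1::real"] smooth_on_ident derivative_eq_intros)
  have b: "bounded_by_chain S j k y ?f" by (rule bounded_by_loop[OF d _ id id y(2)]) simp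
  have deg: "has_degree (?f ` cube) 4" using gcy scp b by blast
  have aj: "param_arc j ?f w = (\<lambda>s. span {NET i j k t s (w $ k)}) ` {0..1}"
    and ak: "param_arc k ?f w = (\<lambda>s. span {NET i j k t (w $ j) s}) ` {0..1}" if "w \<in> cube" for w
    by (rule param_arc_of_NET[OF d _ id id that]; simp)+
  have jj: "join (param_arc j ?f w) = span {C0 i j k t (w $ k), C1 i j k t (w $ k), C2 i j k t (w $ k)}"
    and jk': "join (param_arc k ?f w) = span {C0 i k j t (w $ j), C1 i k j t (w $ j), C2 i k j t (w $ j)}"
    if "w \<in> cube" for w
    unfolding aj[OF that] ak[OF that] net_arc[OF d t] conic_arc_join by (rule refl)+
  have cp: "char_plane (Xc i t) (A1 i j k t) (A2 i j k t) (L1 i j k t) (L2 i j k t) \<subseteq> span {C0 i j k t v, C1 i j k t v, C2 i j k t v}"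
    if "v \<in> {0..1}" "distinct3 i j k" for v j k
    unfolding C0_def C1_def C2_def by (rule char_plane_subset) (rule Lam_nz[OF dist_swap[OF that(2)] t that(1)])
  have "char_plane (Xc i t) (A1 i j k t) (A2 i j k t) (L1 i j k t) (L2 i j k t) \<subseteq> char_line j ?f"
    unfolding char_line_def using cp[OF cube_nth d] jj by blast
  then have dj: "dim (char_line j ?f) \<ge> 2" by (rule dim_char_plane[OF A_indep[OF d t]])
  have "char_plane (Xc i t) (A1 i k j t) (A2 i k j t) (L1 i k j t) (L2 i k j t) \<subseteq> char_line k ?f"
    unfolding char_line_def using cp[OF cube_nth d'] jk' by blast
  then have dk: "dim (char_line k ?f) \<ge> 2" by (rule dim_char_plane[OF A_indep[OF d' t]])
  have su: "subspace (char_line r ?f)" for r unfolding char_line_def join_def by (rule subspace_Inter) auto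
  have c: "join (chain_arc S j k y 0) = join (param_arc j ?f (corner j k 0))"
    "join (chain_arc S j k y (Suc 0)) = join (param_arc k ?f (corner j k (Suc 0)))"
    "join (chain_arc S j k y 2) = join (param_arc j ?f (corner j k 2))"
    "join (chain_arc S j k y 3) = join (param_arc k ?f (corner j k 3))"
    using b unfolding bounded_by_chain_def all_less_4 strip_simps by simp_all
  have lj: "char_line j ?f \<subseteq> join (param_arc j ?f (corner j k n))" and lk: "char_line k ?f \<subseteq> join (param_arc k ?f (corner j k n))" for n
    unfolding char_line_def using corner_cube by blast+
  have "char_line j ?f \<inter> char_line k ?f \<subseteq> (\<Inter>n\<in>{..<4}. join (chain_arc S j k y n))"
  proof
    fix w assume "w \<in> char_line j ?f \<inter> char_line k ?f"
    then have "\<forall>n<4. w \<in> join (chain_arc S j k y n)" unfolding all_less_4 c using lj lk by blast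
    then show "w \<in> (\<Inter>n\<in>{..<4}. join (chain_arc S j k y n))" by blast
  qed
  then have "char_line j ?f \<inter> char_line k ?f \<subseteq> {0}" using gcy by simp
  then have sk: "char_line j ?f \<inter> char_line k ?f = {0}" using subspace_0[OF su] by blast
  have "dim {x + y |x y. x \<in> char_line j ?f \<and> y \<in> char_line k ?f} + dim (char_line j ?f \<inter> char_line k ?f)
      = dim (char_line j ?f) + dim (char_line k ?f)" by (rule dim_sums_Int[OF su su])
  moreover have "dim {x + y |x y. x \<in> char_line j ?f \<and> y \<in> char_line k ?f} \<le> DIM(real^4)" by (rule dim_subset_UNIV)
  ultimately have d2: "dim (char_line j ?f) = 2" "dim (char_line k ?f) = 2" using dj dk unfolding sk by simp_all
  have "dim (char_line r ?f) = 2" if "r \<noteq> i" for r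
    by (rule distinct3_cases[OF d, of r]) (use that in blast, simp_all only: d2)
  moreover have "char_line j' ?f \<inter> char_line k' ?f = {0}" if dd: "distinct3 i j' k'" for j' k'
  proof -
    have "(j' = j \<and> k' = k) \<or> (j' = k \<and> k' = j)" by (rule distinct3_two[OF d dd])
    then show ?thesis
    proof
      assume "j' = j \<and> k' = k" then show ?thesis by (simp only: sk)
    next
      assume "j' = k \<and> k' = j" then show ?thesis by (simp only: Int_commute[of "char_line k ?f"] sk)
    qed
  qed
  ultimately show ?thesis unfolding generic_sc_patch_def using scp deg by blast
qed

end

section \<open>Reparametrized coordinate surfaces\<close>

lemma regular_param_deriv:
  assumes "regular_param \<sigma>"
  obtains e \<sigma>' where "e > 0" "smooth_on {-e<..<1+e} \<sigma>" "smooth_on {-e<..<1+e} \<sigma>'"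
    "\<And>u. u \<in> {-e<..<1+e} \<Longrightarrow> (\<sigma> has_vector_derivative \<sigma>' u) (at u)" "\<And>u. u \<in> {-e<..<1+e} \<Longrightarrow> \<sigma>' u \<noteq> 0"
proof -
  obtain d where d: "d > 0" "smooth_on {-d<..<1+d} \<sigma>" using assms unfolding regular_param_def by blast
  obtain \<sigma>' where s: "smooth_on {-d<..<1+d} \<sigma>'" "\<And>u. u \<in> {-d<..<1+d} \<Longrightarrow> (\<sigma> has_vector_derivative \<sigma>' u) (at u)"
    by (rule smooth_on_real_deriv[OF open_greaterThanLessThan d(2)]) (rule that)
  have nz: "\<sigma>' u \<noteq> 0" if u: "u \<in> {0..1}" for u
  proof -
    obtain D where D: "D \<noteq> 0" "(\<sigma> has_vector_derivative D) (at u)" using assms u unfolding regular_param_def by blast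
    have "u \<in> {-d<..<1+d}" using u d(1) by auto
    from vector_derivative_unique_at[OF s(2)[OF this] D(2)] show ?thesis using D(1) by simp
  qed
  obtain e where e: "e > 0" "e \<le> d" "\<And>u. u \<in> {-e<..<1+e} \<Longrightarrow> \<sigma>' u \<noteq> 0"
    by (rule nonzero_on_unit_nhd[OF d(1) smooth_on_continuous[OF s(1)] nz]) (assumption, rule that)
  have sub: "{-e<..<1+e} \<subseteq> {-d<..<1+d}" using e(2) by auto
  show ?thesis
    by (rule that[OF e(1) smooth_on_subset[OF d(2) sub] smooth_on_subset[OF s(1) sub]]) (use s(2) sub e(3) in blast)+
qed

lemma indep3_scale:
  assumes "indep3 a b c" "s \<noteq> 0" "t \<noteq> 0" shows "indep3 a (s *\<^sub>R b) (t *\<^sub>R c)"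
  unfolding indep3_def
proof (intro allI impI)
  fix \<alpha> \<beta> \<gamma> assume "\<alpha> *\<^sub>R a + \<beta> *\<^sub>R s *\<^sub>R b + \<gamma> *\<^sub>R t *\<^sub>R c = 0"
  then have "\<alpha> *\<^sub>R a + (\<beta> * s) *\<^sub>R b + (\<gamma> * t) *\<^sub>R c = 0" by simp
  then have "\<alpha> = 0 \<and> \<beta> * s = 0 \<and> \<gamma> * t = 0" using assms(1) unfolding indep3_def by blast
  then show "\<alpha> = 0 \<and> \<beta> = 0 \<and> \<gamma> = 0" using assms(2,3) by simp
qed

text \<open>A reparametrized boundary curve is no longer in Bernstein form, but the computations in
  \<open>smooth_tnet\<close> still apply: the derivatives only acquire the nonzero factors \<sigma>'
  and \<tau>'.\<close>

lemma tnet_conjugate_net: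
  fixes z y2 z' y' x :: "real^4" and l1 l2 m1 m2 :: real
  defines "p \<equiv> bern x z y2" and "q \<equiv> bern x z' y'" and "l \<equiv> bern 1 l1 l2" and "m \<equiv> bern 1 m1 m2"
    and "p' \<equiv> dbern x z y2" and "q' \<equiv> dbern x z' y'" and "l' \<equiv> dbern 1 l1 l2" and "m' \<equiv> dbern 1 m1 m2"
  assumes dist: "distinct3 i j k"
    and l: "\<And>u. u \<in> {0..1} \<Longrightarrow> l u \<noteq> 0" and m: "\<And>v. v \<in> {0..1} \<Longrightarrow> m v \<noteq> 0"
    and q4: "\<And>v. v \<in> {0..1} \<Longrightarrow>
      indep4 (ctrl x 1 q m x v) (ctrl z l1 q m x v) (ctrl y2 l2 q m x v) (vertex q q' m m' v)"
    and st: "regular_param \<sigma>" "regular_param \<tau>"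
  shows "conjugate_net i (\<lambda>w. span {tnet p l q m x (\<sigma> (w $ j)) (\<tau> (w $ k))})"
proof -
  obtain d1 \<sigma>' where s: "d1 > 0" "smooth_on {-d1<..<1+d1} \<sigma>" "smooth_on {-d1<..<1+d1} \<sigma>'"
    "\<And>u. u \<in> {-d1<..<1+d1} \<Longrightarrow> (\<sigma> has_vector_derivative \<sigma>' u) (at u)" "\<And>u. u \<in> {-d1<..<1+d1} \<Longrightarrow> \<sigma>' u \<noteq> 0"
    by (rule regular_param_deriv[OF st(1)]) (rule that)
  obtain d2 \<tau>' where t: "d2 > 0" "smooth_on {-d2<..<1+d2} \<tau>" "smooth_on {-d2<..<1+d2} \<tau>'"
    "\<And>u. u \<in> {-d2<..<1+d2} \<Longrightarrow> (\<tau> has_vector_derivative \<tau>' u) (at u)" "\<And>u. u \<in> {-d2<..<1+d2} \<Longrightarrow> \<tau>' u \<noteq> 0"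
    by (rule regular_param_deriv[OF st(2)]) (rule that)
  have sb: "smooth_on U (\<lambda>u. bern A B C (f u))" "smooth_on U (\<lambda>u. g u *\<^sub>R dbern A B C (f u))"
    "smooth_on U (\<lambda>u. dbern A B C (f u))"
    if "smooth_on U f" "smooth_on U g" for U and f g :: "real \<Rightarrow> real" and A B C :: "'v::real_normed_vector"
    using smooth_on_bern[OF that(1)] unfolding dbern_def by (assumption, intro smooth_intros that, intro smooth_intros that)
  let ?d = "min d1 d2"
  have d: "?d > 0" using s(1) t(1) by simp
  have sub: "{-?d<..<1+?d} \<subseteq> {-d1<..<1+d1}" "{-?d<..<1+?d} \<subseteq> {-d2<..<1+d2}" by auto
  note S = smooth_on_subset[OF s(2) sub(1)] and T = smooth_on_subset[OF t(2) sub(2)]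
  have cl: "continuous_on {-?d<..<1+?d} (\<lambda>u. l (\<sigma> u))" "continuous_on {-?d<..<1+?d} (\<lambda>u. m (\<tau> u))"
    unfolding l_def m_def by (intro smooth_on_continuous smooth_on_bern S T)+
  have cs: "smooth_on {-?d<..<1+?d} (\<lambda>v. ctrl P a q m x (\<tau> v))" "smooth_on {-?d<..<1+?d} (\<lambda>v. vertex q q' m m' (\<tau> v))" for P a
    unfolding ctrl_def vertex_def q_def m_def q'_def m'_def by (intro smooth_intros sb[OF T T])+
  have cq: "continuous_on {-?d<..<1+?d} (\<lambda>v. ctrl P a q m x (\<tau> v))" "continuous_on {-?d<..<1+?d} (\<lambda>v. vertex q q' m m' (\<tau> v))" for P a
    by (rule smooth_on_continuous[OF cs(1)] smooth_on_continuous[OF cs(2)])+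
  note ri = regular_param_in[OF st(1)] regular_param_in[OF st(2)]
  obtain e1 where e1: "e1 > 0" "e1 \<le> ?d" "\<And>u. u \<in> {-e1<..<1+e1} \<Longrightarrow> l (\<sigma> u) \<noteq> 0"
    by (rule nonzero_on_unit_nhd[OF d cl(1) l[OF ri(1)]]) (assumption, rule that)
  have sub1: "{-e1<..<1+e1} \<subseteq> {-?d<..<1+?d}" using e1(2) by (auto simp: min_def split: if_splits)
  obtain e2 where e2: "e2 > 0" "e2 \<le> e1" "\<And>u. u \<in> {-e2<..<1+e2} \<Longrightarrow> m (\<tau> u) \<noteq> 0"
    by (rule nonzero_on_unit_nhd[OF e1(1) continuous_on_subset[OF cl(2) sub1] m[OF ri(2)]]) (assumption, rule that)
  have sub2: "{-e2<..<1+e2} \<subseteq> {-e1<..<1+e1}" using e2(2) by auto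
  note cq2 = cq[THEN continuous_on_subset, OF order_trans[OF sub2 sub1]]
  obtain e where e: "e > 0" "e \<le> e2" "\<And>v. v \<in> {-e<..<1+e} \<Longrightarrow>
      indep4 (ctrl x 1 q m x (\<tau> v)) (ctrl z l1 q m x (\<tau> v)) (ctrl y2 l2 q m x (\<tau> v)) (vertex q q' m m' (\<tau> v))"
    by (rule indep4_nhd[OF e2(1) cq2(1) cq2(1) cq2(1) cq2(2) q4[OF ri(2)]]) (assumption, rule that)
  let ?I = "{-e<..<1+e}"
  have sub3: "?I \<subseteq> {-e2<..<1+e2}" using e(2) by auto
  have subs: "?I \<subseteq> {-d1<..<1+d1}" and subt: "?I \<subseteq> {-d2<..<1+d2}"
    using order_trans[OF sub3 order_trans[OF sub2 sub1]] sub by (blast intro: order_trans)+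
  note S = smooth_on_subset[OF s(2) subs] smooth_on_subset[OF s(3) subs]
  note T = smooth_on_subset[OF t(2) subt] smooth_on_subset[OF t(3) subt]
  define P where "P u = p (\<sigma> u)" for u
  define P' where "P' u = \<sigma>' u *\<^sub>R p' (\<sigma> u)" for u
  define L where "L u = l (\<sigma> u)" for u
  define L' where "L' u = \<sigma>' u *\<^sub>R l' (\<sigma> u)" for u
  define Q where "Q u = q (\<tau> u)" for u
  define Q' where "Q' u = \<tau>' u *\<^sub>R q' (\<tau> u)" for u
  define M where "M u = m (\<tau> u)" for u
  define M' where "M' u = \<tau>' u *\<^sub>R m' (\<tau> u)" for u
  have chain: "((\<lambda>u. bern A B C (f u)) has_vector_derivative D *\<^sub>R dbern A B C (f u)) (at u)"
    if "(f has_vector_derivative D) (at u)" for f u D and A B C :: "'v::real_normed_vector"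
    using vector_diff_chain_at[OF that, of "bern A B C" "dbern A B C (f u)"] bern_deriv[of A B C "f u" UNIV] by (simp add: o_def)
  interpret smooth_tnet i j k P P' Q Q' L L' M M' x e
  proof
    show "smooth_on ?I P" "smooth_on ?I L" "smooth_on ?I Q" "smooth_on ?I M" "smooth_on ?I P'" "smooth_on ?I L'" "smooth_on ?I Q'" "smooth_on ?I M'"
      unfolding P_def L_def Q_def M_def P'_def L'_def Q'_def M'_def p_def l_def q_def m_def p'_def l'_def q'_def m'_def
      by (rule sb(1,2)[OF S] sb(1,2)[OF T])+
    show "(P has_vector_derivative P' u) (at u)" "(L has_vector_derivative L' u) (at u)" if "u \<in> ?I" for u
      unfolding P_def[abs_def] L_def[abs_def] P'_def L'_def p_def l_def p'_def l'_def
      by (rule chain[OF s(4)], use that subs in blast)+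
    show "(Q has_vector_derivative Q' u) (at u)" "(M has_vector_derivative M' u) (at u)" if "u \<in> ?I" for u
      unfolding Q_def[abs_def] M_def[abs_def] Q'_def M'_def q_def m_def q'_def m'_def
      by (rule chain[OF t(4)], use that subt in blast)+
  qed (rule dist)
  have nzl: "L u \<noteq> 0" "M u \<noteq> 0" if "u \<in> ?I" for u
    unfolding L_def M_def by (rule e1(3)[OF subsetD[OF order_trans[OF sub3 sub2] that]], rule e2(3)[OF subsetD[OF sub3 that]])
  have "indep3 (tnet P L Q M x u v) (tnet P' L' Q M x u v) (tnet P L Q' M' x u v)"
    if uv: "u \<in> ?I" "v \<in> ?I" for u v
  proof -
    have i3: "indep3 (tnet p l q m x (\<sigma> u) (\<tau> v)) (tnet p' l' q m x (\<sigma> u) (\<tau> v)) (tnet p l q' m' x (\<sigma> u) (\<tau> v))"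
      by (rule indep3_vertexI(1)[OF e(3)[OF uv(2)] _ _ tnet_vertex[where p = p and l = l and u = "\<sigma> u"]
            nzl(1)[OF uv(1), unfolded L_def] nzl(2)[OF uv(2), unfolded M_def]])
         (simp_all add: p_def l_def p'_def l'_def tnet_bern tnet_dbern)
    have "tnet P L Q M x u v = tnet p l q m x (\<sigma> u) (\<tau> v)" "tnet P' L' Q M x u v = \<sigma>' u *\<^sub>R tnet p' l' q m x (\<sigma> u) (\<tau> v)"
      "tnet P L Q' M' x u v = \<tau>' v *\<^sub>R tnet p l q' m' x (\<sigma> u) (\<tau> v)"
      by (simp_all add: tnet_def P_def L_def Q_def M_def P'_def L'_def Q'_def M'_def algebra_simps)
    moreover have "\<sigma>' u \<noteq> 0" "\<tau>' v \<noteq> 0" using s(5)[OF subsetD[OF subs uv(1)]] t(5)[OF subsetD[OF subt uv(2)]] .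
    ultimately show ?thesis using indep3_scale[OF i3] by simp
  qed
  then have "conj_param i (cube_nhd e) F" by (intro conj_param_F nzl)
  then show ?thesis unfolding conjugate_net_def
    by (intro exI[of _ e] exI[of _ F] conjI e(1)) (simp_all add: P_def L_def Q_def M_def tnet_def)
qed

lemma conjugate_net_smooth_lift:
  assumes "conjugate_net i f" shows "\<exists>F. smooth_lift f F"
proof -
  obtain e F where F: "e > 0" "conj_param i (cube_nhd e) F" "\<forall>x\<in>cube. f x = span {F x}"
    using assms unfolding conjugate_net_def by blast
  obtain j k where d: "distinct3 i j k" by (rule dist_ex)
  have "F w \<noteq> 0" if "w \<in> cube_nhd e" for w
  proof -
    have "dim (tangent_plane i F w) = 3" using F(2) that unfolding conj_param_def by blast
    then have "indep3 (F w) (pd j F w) (pd k F w)" unfolding tangent_plane_eq[OF d] by (rule indep3_spanI)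
    then show ?thesis unfolding indep3_def by (metis add_0 scaleR_zero_left scaleR_one zero_neq_one scaleR_zero_right)
  qed
  moreover have "smooth_on (cube_nhd e) F" using F(2) unfolding conj_param_def by blast
  ultimately show ?thesis unfolding smooth_lift_def using F(1,3) by blast
qed

lemma indep4_insert:
  fixes q :: "real^4"
  assumes "indep3 a b c" "q \<notin> span {a, b, c}" shows "indep4 q a b c"
  unfolding indep4_def
proof (intro allI impI)
  fix \<alpha> \<beta> \<gamma> \<delta> assume z: "\<alpha> *\<^sub>R q + \<beta> *\<^sub>R a + \<gamma> *\<^sub>R b + \<delta> *\<^sub>R c = 0"
  have "\<alpha> = 0"
  proof (rule ccontr)
    assume a: "\<alpha> \<noteq> 0"
    have "\<alpha> *\<^sub>R q - ((-\<beta>) *\<^sub>R a + (-\<gamma>) *\<^sub>R b + (-\<delta>) *\<^sub>R c) = 0" using z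
      by (simp add: algebra_simps)
    then have "\<alpha> *\<^sub>R q = (-\<beta>) *\<^sub>R a + (-\<gamma>) *\<^sub>R b + (-\<delta>) *\<^sub>R c" unfolding right_minus_eq .
    then have "\<alpha> *\<^sub>R q \<in> span {a, b, c}" unfolding mem_span3 by blast
    from span_scale[OF this, of "inverse \<alpha>"] show False using a assms(2) by simp
  qed
  then show "\<alpha> = 0 \<and> \<beta> = 0 \<and> \<gamma> = 0 \<and> \<delta> = 0" using z assms(1) unfolding indep3_def by simp
qed

lemma kernel2:
  fixes A B C D :: real
  obtains \<alpha> \<zeta> \<beta> where "\<alpha> + \<zeta> * A + \<beta> * B = 0" "\<alpha> + \<zeta> * C + \<beta> * D = 0" "\<alpha> \<noteq> 0 \<or> \<zeta> \<noteq> 0 \<or> \<beta> \<noteq> 0"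
proof (cases "B = D \<and> C = A")
  case True
  then show ?thesis using that[of "-A" 1 0] by simp
next
  case False
  \<comment> \<open>The cross product of (1, A, B) and (1, C, D).\<close>
  then show ?thesis using that[of "A * D - B * C" "B - D" "C - A"] by (auto simp: algebra_simps)
qed

lemma regular_param_id: "regular_param (\<lambda>s. s)"
  unfolding regular_param_def strict_mono_on_def
  by (auto intro!: exI[of _ "1::real"] smooth_on_ident derivative_eq_intros)

context gen_cube
begin

text \<open>If the end point of the column arc lay in the plane of the row v = 0, this would also be
  the plane of the row v = 1. The vector \<open>?W\<close>, which lies in the
  \<open>char_plane\<close> of direction \<open>k\<close>, would then belong to the planes of all
  four arcs of the chain and vanish, which contradicts the independence of the control points of the
  column arc.\<close>

lemma corner_indep:
  assumes d: "distinct3 i j k" and t: "t \<in> {0..1}"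
  shows "indep4 (A2 i k j t) (Xc i t) (A1 i j k t) (A2 i j k t)"
proof (rule indep4_insert[OF A_indep[OF d t]])
  note d' = dist_swap[OF d]
  let ?E = "span {Xc i t, A1 i j k t, A2 i j k t}" and ?Q = "A2 i k j t"
  let ?W = "?Q - L2 i k j t *\<^sub>R Xc i t"
  have one: "(1::real) \<in> {0..1}" and zero: "(0::real) \<in> {0..1}" by simp_all
  obtain y where y: "conic_chain S j k y" "loop i j k t y" by (rule loop_ex[OF d t])
  show "?Q \<notin> ?E"
  proof
    assume Q: "?Q \<in> ?E"
    have X: "Xc i t \<in> ?E" "A1 i j k t \<in> ?E" "A2 i j k t \<in> ?E" by (auto intro: span_base)
    have Y1: "Y i k j t 1 = ?Q" by (simp add: Y_def)
    have "ctrl P a (Y i k j t) (Lam i k j t) (Xc i t) 1 \<in> ?E" if "P \<in> ?E" for P a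
      unfolding ctrl_def Y1 by (intro span_add span_diff span_scale Q X that)
    then have "{C0 i j k t 1, C1 i j k t 1, C2 i j k t 1} \<subseteq> ?E" unfolding C0_def C1_def C2_def using X by simp
    moreover have "indep3 (C0 i j k t 1) (C1 i j k t 1) (C2 i j k t 1)" by (rule indep4_D(2)[OF tangent_indep[OF d t one]])
    ultimately have E: "span {C0 i j k t 1, C1 i j k t 1, C2 i j k t 1} = ?E" by (intro span3_same)
    have WE: "?W \<in> ?E" by (intro span_diff span_scale Q X)
    have "?W = (- L2 i k j t) *\<^sub>R Xc i t + 0 *\<^sub>R A1 i k j t + 1 *\<^sub>R ?Q" by simp
    moreover have "- L2 i k j t + 0 * L1 i k j t + 1 * L2 i k j t = 0" by simp
    ultimately have Wc: "?W \<in> char_plane (Xc i t) (A1 i k j t) (A2 i k j t) (L1 i k j t) (L2 i k j t)"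
      unfolding char_plane_def by blast
    have "char_plane (Xc i t) (A1 i k j t) (A2 i k j t) (L1 i k j t) (L2 i k j t) \<subseteq> span {C0 i k j t u, C1 i k j t u, C2 i k j t u}"
      if "u \<in> {0..1}" for u
      unfolding C0_def C1_def C2_def by (rule char_plane_subset) (rule Lam_nz[OF d t that])
    from subsetD[OF this Wc] have Wk: "?W \<in> span {C0 i k j t u, C1 i k j t u, C2 i k j t u}" if "u \<in> {0..1}" for u using that .
    have "\<forall>n<4. ?W \<in> join (chain_arc S j k y n)"
      unfolding all_less_4 One_nat_def[symmetric] loopD[OF y(2)] net_arc[OF d t] conic_arc_join
      using WE E Wk[OF zero] Wk[OF one] by simp
    then have "?W \<in> (\<Inter>n\<in>{..<4}. join (chain_arc S j k y n))" by blast
    moreover have "(\<Inter>n\<in>{..<4}. join (chain_arc S j k y n)) = {0}"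
      using generic_chain_of[OF d y(1)] unfolding generic_chain_def by blast
    ultimately have "(- L2 i k j t) *\<^sub>R Xc i t + 0 *\<^sub>R A1 i k j t + 1 *\<^sub>R ?Q = 0" by simp
    then have "(1::real) = 0" using A_indep[OF d' t] unfolding indep3_def by blast
    then show False by simp
  qed
qed

text \<open>The plane of the arc opposite to the first one determines the coefficients: this plane
  has the shape treated in \<open>ctrl_coeff_unique\<close>, with the corner opposite to
  \<open>A2 i j k t\<close> as \<open>Q\<close>.\<close>

lemma normal_form_coeff:
  assumes d: "distinct3 i j k" and t: "t \<in> {0..1}" and st: "regular_param \<sigma>" "regular_param \<tau>" and m2: "m2 \<noteq> 0"
    and h: "\<And>w. w \<in> cube \<Longrightarrow> h w = span {tnet (bern (Xc i t) (A1 i j k t) (A2 i j k t)) (bern 1 l1 l2)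
       (bern (Xc i t) (A1 i k j t) (A2 i k j t)) (bern 1 m1 m2) (Xc i t) (\<sigma> (w $ j)) (\<tau> (w $ k))}"
    and w: "w \<in> cube" "w $ k = 1" and arc: "param_arc j h w = (\<lambda>s. span {NET i j k t s 1}) ` {0..1}"
  shows "l1 = L1 i j k t" "l2 = L2 i j k t"
proof -
  have jk: "j \<noteq> k" using d by (auto simp: distinct3_def)
  have "\<tau> 1 = 1" using regular_param_ends[OF st(2)] by simp
  let ?q = "bern (Xc i t) (A1 i k j t) (A2 i k j t)" and ?m = "bern 1 m1 m2"
  have "conic_arc (ctrl (Xc i t) 1 ?q ?m (Xc i t) 1) (ctrl (A1 i j k t) l1 ?q ?m (Xc i t) 1) (ctrl (A2 i j k t) l2 ?q ?m (Xc i t) 1)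
    = conic_arc (C0 i j k t 1) (C1 i j k t 1) (C2 i j k t 1)"
    using param_arc_tnet[OF h st(1) w(1) jk] unfolding w(2) \<open>\<tau> 1 = 1\<close> arc net_arc(1)[OF d t] by simp
  then have "join (conic_arc (ctrl (Xc i t) 1 ?q ?m (Xc i t) 1) (ctrl (A1 i j k t) l1 ?q ?m (Xc i t) 1) (ctrl (A2 i j k t) l2 ?q ?m (Xc i t) 1))
    = join (conic_arc (C0 i j k t 1) (C1 i j k t 1) (C2 i j k t 1))" by (rule arg_cong)
  then have "span {A2 i k j t, m2 *\<^sub>R A1 i j k t + l1 *\<^sub>R (A2 i k j t - m2 *\<^sub>R Xc i t), m2 *\<^sub>R A2 i j k t + l2 *\<^sub>R (A2 i k j t - m2 *\<^sub>R Xc i t)}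
    \<subseteq> span {A2 i k j t, L2 i k j t *\<^sub>R A1 i j k t + L1 i j k t *\<^sub>R (A2 i k j t - L2 i k j t *\<^sub>R Xc i t),
        L2 i k j t *\<^sub>R A2 i j k t + L2 i j k t *\<^sub>R (A2 i k j t - L2 i k j t *\<^sub>R Xc i t)}"
    unfolding conic_arc_join by (simp add: C0_def C1_def C2_def ctrl_def Y_def Lam_def)
  then show "l1 = L1 i j k t" "l2 = L2 i j k t" by (rule ctrl_coeff_unique[OF corner_indep[OF d t] m2])+
qed

section \<open>Members of the families as coordinate surfaces\<close>

definition net_patch :: "3 \<Rightarrow> real \<Rightarrow> (3 \<Rightarrow> real \<Rightarrow> real) \<Rightarrow> patch \<Rightarrow> bool" where
  "net_patch i t \<tau> h \<longleftrightarrow> (\<forall>r. regular_param (\<tau> r)) \<and> (\<forall>w\<in>cube. h w = span {Net (upd (rp \<tau> w) i t)})"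

lemma net_patchD:
  assumes "net_patch i t \<tau> h" "distinct3 i j k"
  shows "w \<in> cube \<Longrightarrow> h w = span {NET i j k t (\<tau> j (w $ j)) (\<tau> k (w $ k))}" "regular_param (\<tau> r)"
  using assms unfolding net_patch_def by (simp_all add: Net_upd)

text \<open>The two arcs at the first corner prescribe the control points in
  \<open>normal_form\<close>, and the planes of the two opposite arcs prescribe its coefficients.
  Thus the boundary determines the patch up to parametrization.\<close>

lemma bounded_net_patch:
  assumes d: "distinct3 i j k" and t: "t \<in> {0..1}" and y: "loop i j k t y"
    and g: "generic_sc_patch i h" and b: "bounded_by_chain S j k y h"
  obtains \<tau> where "net_patch i t \<tau> h"
proof -
  note d' = dist_swap[OF d]
  have ne: "i \<noteq> j" "i \<noteq> k" "j \<noteq> k" "j \<noteq> i" "k \<noteq> i" "k \<noteq> j" using d by (auto simp: distinct3_def)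
  have B: "\<forall>n<4. h (corner j k n) = chain_point S j k y n \<and> param_arc (strip_dir j k n) h (corner j k n) = chain_arc S j k y n"
    using b unfolding bounded_by_chain_def .
  have b0: "h (corner j k 0) = span {NET i j k t 0 0}" "h (corner j k 1) = span {NET i j k t 1 0}" "h (corner j k 3) = span {NET i j k t 0 1}"
    "param_arc j h (corner j k 0) = (\<lambda>s. span {NET i j k t s 0}) ` {0..1}"
    "param_arc k h (corner j k 1) = (\<lambda>s. span {NET i j k t 1 s}) ` {0..1}"
    "param_arc j h (corner j k 2) = (\<lambda>s. span {NET i j k t s 1}) ` {0..1}"
    "param_arc k h (corner j k 3) = (\<lambda>s. span {NET i j k t 0 s}) ` {0..1}"
    using B[rule_format, of 0] B[rule_format, of 1] B[rule_format, of 2] B[rule_format, of 3] unfolding loopD[OF y]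
    by (simp_all add: strip_simps)
  have co: "corner j k 0 = 0" "corner j k 1 = upd 0 j 1" "corner j k 3 = upd 0 k 1"
    using ne by (auto simp: corner_def upd_def vec_eq_iff)
  have u0: "upd (upd 0 k 1) k s = upd (0::real^3) k s" for s by (simp add: upd_def vec_eq_iff)
  \<comment> \<open>The chain lists its last arc at corner 3; as a set it is the parameter arc of
    direction \<open>k\<close> through corner 0, where \<open>normal_form\<close> expects
    it.\<close>
  have pk: "param_arc k h 0 = param_arc k h (corner j k 3)"
    unfolding co param_arc_upd[OF zero_cube] using param_arc_upd[OF corner_cube, of k h j k 3] unfolding co u0 by simp
  have NY: "NET i j k t u 0 = Y i j k t u" "NET i j k t 0 u = Y i k j t u" for u
    unfolding NET_tnet[OF d t] tnet_def by simp_all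
  have ends: "h 0 = span {Xc i t}" "h (upd 0 j 1) = span {A2 i j k t}" "h (upd 0 k 1) = span {A2 i k j t}"
    using b0(1-3) unfolding co NY by (simp_all add: Y_def)
  have arcs: "param_arc j h 0 = conic_arc (Xc i t) (A1 i j k t) (A2 i j k t)" "param_arc k h 0 = conic_arc (Xc i t) (A1 i k j t) (A2 i k j t)"
    unfolding pk b0(7) using b0(4) unfolding co(1) net_arc[OF d t] C_0 by assumption (rule refl)
  obtain l1 l2 m1 m2 \<sigma> \<tau> where nf: "regular_param \<sigma>" "regular_param \<tau>"
    "\<And>u. u \<in> {0..1} \<Longrightarrow> bern (1::real) l1 l2 u \<noteq> 0" "\<And>u. u \<in> {0..1} \<Longrightarrow> bern (1::real) m1 m2 u \<noteq> 0"
    "\<And>w. w \<in> cube \<Longrightarrow> h w = span {tnet (bern (Xc i t) (A1 i j k t) (A2 i j k t)) (bern 1 l1 l2)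
       (bern (Xc i t) (A1 i k j t) (A2 i k j t)) (bern 1 m1 m2) (Xc i t) (\<sigma> (w $ j)) (\<tau> (w $ k))}"
    by (rule normal_form[OF d g A_indep[OF d t] A_indep[OF d' t] arcs ends]) (rule that)
  have nz: "l2 \<noteq> 0" "m2 \<noteq> 0" using nf(3,4)[of 1] by simp_all
  have a': "param_arc k h (corner j k 1) = (\<lambda>s. span {NET i k j t s 1}) ` {0..1}" using b0(5) unfolding NET_swap[of i j k] .
  have c1: "corner j k 1 $ j = 1" "corner j k 2 $ k = 1" using corner_nth[OF ne(3)] by simp_all
  have l: "l1 = L1 i j k t" "l2 = L2 i j k t"
    by (rule normal_form_coeff[OF d t nf(1,2) nz(2) nf(5) corner_cube c1(2) b0(6)]; assumption)+
  have h': "h w = span {tnet (bern (Xc i t) (A1 i k j t) (A2 i k j t)) (bern 1 m1 m2)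
       (bern (Xc i t) (A1 i j k t) (A2 i j k t)) (bern 1 l1 l2) (Xc i t) (\<tau> (w $ k)) (\<sigma> (w $ j))}" if "w \<in> cube" for w
    unfolding nf(5)[OF that] by (subst tnet_swap) (rule refl)
  have m: "m1 = L1 i k j t" "m2 = L2 i k j t"
    by (rule normal_form_coeff[OF d' t nf(2,1) nz(1) h' corner_cube c1(1) a']; assumption)+
  have "h w = span {NET i j k t (\<sigma> (w $ j)) (\<tau> (w $ k))}" if "w \<in> cube" for w
    unfolding NET_tnet[OF d t] using nf(5)[OF that] unfolding l m Y_def Lam_def .
  from face_NET[OF d nf(1,2) this] show ?thesis using that unfolding net_patch_def by blast
qed

lemma family_net_patch:
  assumes "g \<in> family S i" obtains t \<tau> where "t \<in> {0..1}" "net_patch i t \<tau> g" "generic_sc_patch i g"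
proof -
  obtain j k y where f: "generic_sc_patch i g" "distinct3 i j k" "conic_chain S j k y" "bounded_by_chain S j k y g"
    using assms unfolding family_def by blast
  obtain t where t: "t \<in> {0..1}" "loop i j k t y" by (rule conic_chain_loop[OF f(2,3)])
  obtain \<tau> where "net_patch i t \<tau> g" by (rule bounded_net_patch[OF f(2) t f(1,4)])
  with t(1) show ?thesis using f(1) by (rule that)
qed

lemma net_patch_family:
  assumes g: "generic_sc_patch i g" and n: "net_patch i t \<tau> g" and t: "t \<in> {0..1}"
  shows "g \<in> family S i"
proof -
  obtain j k where d: "distinct3 i j k" by (rule dist_ex)
  obtain y where y: "conic_chain S j k y" "loop i j k t y" by (rule loop_ex[OF d t])
  have "bounded_by_chain S j k y g" by (rule bounded_by_loop[OF d net_patchD(1)[OF n d] net_patchD(2)[OF n d] net_patchD(2)[OF n d] y(2)])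
  then show ?thesis unfolding family_def using g d y(1) by blast
qed

lemma face_family: "e \<in> {0, 1} \<Longrightarrow> S i e \<in> family S i"
  and face_net_patch: "e \<in> {0, 1} \<Longrightarrow> net_patch i e (FT i e) (S i e)"
proof -
  show n: "net_patch i e (FT i e) (S i e)" if "e \<in> {0, 1}" for e
    unfolding net_patch_def using FT_regular[OF that] S_Net[OF that] by blast
  show "S i e \<in> family S i" if "e \<in> {0, 1}"
    by (rule net_patch_family[OF S_gen[OF that] n[OF that]]) (use that in auto)
qed

lemma slice_net_patch: "net_patch i t (\<lambda>_ s. s) (\<lambda>w. span {Net (upd w i t)})"
  unfolding net_patch_def by (simp add: regular_param_id rp_def)

lemma slice_generic:
  assumes t: "t \<in> {0..1}" shows "generic_sc_patch i (\<lambda>w. span {Net (upd w i t)})"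
proof -
  obtain j k where d: "distinct3 i j k" by (rule dist_ex)
  show ?thesis unfolding Net_upd[OF d] by (rule generic_slice[OF d t])
qed

lemma slice_family: "t \<in> {0..1} \<Longrightarrow> (\<lambda>w. span {Net (upd w i t)}) \<in> family S i"
  by (rule net_patch_family[OF slice_generic slice_net_patch])

text \<open>The parameter change in each direction is the inverse of the one of \<open>f\<close>
  composed with the one of \<open>g\<close>; both are increasing bijections of the unit
  interval.\<close>

lemma net_patch_reparam:
  assumes f: "net_patch i t \<sigma> f" and g: "net_patch i t \<tau> g" shows "reparam f g"
proof -
  have rs: "regular_param (\<sigma> r)" and rt: "regular_param (\<tau> r)" for r using f g unfolding net_patch_def by blast+
  define \<rho> where "\<rho> r s = inv_into {0..1} (\<sigma> r) (\<tau> r s)" for r s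
  have im: "\<tau> r s \<in> \<sigma> r ` {0..1}" if "s \<in> {0..1}" for r s
    unfolding regular_param_image[OF rs] by (rule regular_param_in[OF rt that])
  have \<rho>: "\<rho> r s \<in> {0..1}" "\<sigma> r (\<rho> r s) = \<tau> r s" if "s \<in> {0..1}" for r s
    unfolding \<rho>_def by (rule inv_into_into[OF im[OF that]], rule f_inv_into_f[OF im[OF that]])
  have mono: "strict_mono_on {0..1} (\<rho> r)" for r
  proof (rule strict_mono_onI)
    fix s s' :: real assume s: "s \<in> {0..1}" "s' \<in> {0..1}" "s < s'"
    have "\<tau> r s < \<tau> r s'" using rt[of r] s unfolding regular_param_def strict_mono_on_def by blast
    then have "\<sigma> r (\<rho> r s) < \<sigma> r (\<rho> r s')" using \<rho> s by simp
    moreover have "\<sigma> r (\<rho> r s') \<le> \<sigma> r (\<rho> r s)" if "\<rho> r s' \<le> \<rho> r s"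
    proof (cases "\<rho> r s' = \<rho> r s")
      case False
      then have "\<rho> r s' < \<rho> r s" using that by simp
      then show ?thesis using rs[of r] \<rho>(1) s unfolding regular_param_def strict_mono_on_def by (meson less_imp_le)
    qed simp
    ultimately show "\<rho> r s < \<rho> r s'" by force
  qed
  have onto: "\<rho> r ` {0..1} = {0..1}" for r
  proof
    show "\<rho> r ` {0..1} \<subseteq> {0..1}" using \<rho>(1) by blast
    show "{0..1} \<subseteq> \<rho> r ` {0..1}"
    proof
      fix u :: real assume u: "u \<in> {0..1}"
      obtain s where s: "s \<in> {0..1}" "\<tau> r s = \<sigma> r u" using regular_param_onto[OF rt regular_param_in[OF rs u]] by blast
      have "\<rho> r s = u" by (rule regular_param_inj[OF rs[of r] \<rho>(1)[OF s(1)] u]) (simp add: \<rho>(2)[OF s(1)] s(2))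
      then show "u \<in> \<rho> r ` {0..1}" using s(1) by blast
    qed
  qed
  have "g w = f (\<chi> r. \<rho> r (w $ r))" if w: "w \<in> cube" for w
  proof -
    have "(\<chi> r. \<rho> r (w $ r)) \<in> cube" using \<rho>(1)[OF cube_nth[OF w]] by (simp add: cube_def)
    moreover have "rp \<sigma> (\<chi> r. \<rho> r (w $ r)) = rp \<tau> w" by (simp add: vec_eq_iff \<rho>(2)[OF cube_nth[OF w]])
    ultimately show ?thesis using f g w unfolding net_patch_def by simp
  qed
  then show ?thesis unfolding reparam_def using mono onto by blast
qed

lemma net_patch_arc:
  assumes d: "distinct3 i j k" and n: "net_patch i t \<tau> f" and w: "w \<in> cube"
  shows "param_arc k f w = (\<lambda>s. span {NET i j k t (\<tau> j (w $ j)) s}) ` {0..1}"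
proof -
  have f: "f w = span {NET i j k t (\<tau> j (w $ j)) (\<tau> k (w $ k))}" if "w \<in> cube" for w by (rule net_patchD(1)[OF n d that])
  show ?thesis by (rule param_arc_of_NET(2)[OF d f net_patchD(2)[OF n d, of j] net_patchD(2)[OF n d, of k] w])
qed

lemma NET_rev: "NET i j k a b c = NET k j i c b a"
  by (metis NET_rot NET_swap)


section \<open>Common points of the characteristic lines of one direction\<close>

definition axis_pt :: "3 \<Rightarrow> real^4 \<Rightarrow> bool" where
  "axis_pt i q \<longleftrightarrow> (\<exists>\<alpha> \<zeta> \<beta>. q = \<alpha> *\<^sub>R x + \<zeta> *\<^sub>R zz i + \<beta> *\<^sub>R yy i \<and>
     (\<forall>j. j \<noteq> i \<longrightarrow> \<alpha> + \<zeta> * a1 j i + \<beta> * a2 j i = 0))"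

lemma axis_pt_ex: obtains q where "q \<noteq> 0" "axis_pt i q"
proof -
  obtain j k where d: "distinct3 i j k" by (rule dist_ex)
  obtain \<alpha> \<zeta> \<beta> where k: "\<alpha> + \<zeta> * a1 j i + \<beta> * a2 j i = 0" "\<alpha> + \<zeta> * a1 k i + \<beta> * a2 k i = 0" "\<alpha> \<noteq> 0 \<or> \<zeta> \<noteq> 0 \<or> \<beta> \<noteq> 0"
    by (rule kernel2)
  have "\<alpha> *\<^sub>R x + \<zeta> *\<^sub>R zz i + \<beta> *\<^sub>R yy i \<noteq> 0" using I3[of i] k(3) unfolding indep3_def by blast
  moreover have "\<alpha> + \<zeta> * a1 r i + \<beta> * a2 r i = 0" if "r \<noteq> i" for r
    using that k(1,2) by (rule_tac distinct3_cases[OF d, of r]) simp_all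
  ultimately show ?thesis using that unfolding axis_pt_def by blast
qed

text \<open>
  At \<open>q\<close> all equations \<open>R j i\<close>, \<open>j \<noteq> i\<close>, vanish, so the linear extension of \<open>NET i j k \<cdot> b c\<close> to the
  plane of \<open>x, zz i, yy i\<close> maps \<open>q\<close> to a nonzero multiple of itself.
\<close>

lemma axis_pt_join:
  assumes d: "distinct3 i j k" and q: "axis_pt i q" and b: "b \<in> {0..1}" and c: "c \<in> {0..1}"
  shows "q \<in> join ((\<lambda>s. span {NET i j k s b c}) ` {0..1})"
proof -
  have ne: "i \<noteq> j" "i \<noteq> k" "j \<noteq> k" "j \<noteq> i" "k \<noteq> i" "k \<noteq> j" using d by (auto simp: distinct3_def)
  define ci where "ci = R i j b * R j k c + R i k c * R k j b - R i j b * R i k c"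
  define P where "P = R j k c *\<^sub>R Xc j b + R i j b *\<^sub>R Xc k c - R k j b *\<^sub>R Xc k c - (R i j b * R j k c) *\<^sub>R x"
  define Q where "Q = R i k c *\<^sub>R Xc j b - R j k c *\<^sub>R Xc j b + R k j b *\<^sub>R Xc k c - (R i k c * R k j b) *\<^sub>R x"
  define N0 where "N0 = ci *\<^sub>R x + P + Q"
  define N1 where "N1 = ci *\<^sub>R zz i + a1 k i *\<^sub>R P + a1 j i *\<^sub>R Q"
  define N2 where "N2 = ci *\<^sub>R yy i + a2 k i *\<^sub>R P + a2 j i *\<^sub>R Q"
  have "NET i j k s b c = ci *\<^sub>R Xc i s + R k i s *\<^sub>R P + R j i s *\<^sub>R Q" for s
    unfolding NET_def ci_def P_def Q_def by (simp add: algebra_simps)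
  also have "\<dots> s = bern N0 N1 N2 s" for s
    unfolding Xc_def[of i] R_def[of k i] R_def[of j i] bern_scale bern_scale_left bern_add N0_def N1_def N2_def by simp
  finally have "(\<lambda>s. span {NET i j k s b c}) ` {0..1} = conic_arc N0 N1 N2" unfolding conic_arc_def by simp
  then have J: "join ((\<lambda>s. span {NET i j k s b c}) ` {0..1}) = span {N0, N1, N2}" by (simp add: conic_arc_join)
  obtain \<alpha> \<zeta> \<beta> where e: "q = \<alpha> *\<^sub>R x + \<zeta> *\<^sub>R zz i + \<beta> *\<^sub>R yy i" "\<And>r. r \<noteq> i \<Longrightarrow> \<alpha> + \<zeta> * a1 r i + \<beta> * a2 r i = 0"
    using q unfolding axis_pt_def by blast
  have "\<alpha> *\<^sub>R N0 + \<zeta> *\<^sub>R N1 + \<beta> *\<^sub>R N2 = ci *\<^sub>R q + (\<alpha> + \<zeta> * a1 k i + \<beta> * a2 k i) *\<^sub>R P + (\<alpha> + \<zeta> * a1 j i + \<beta> * a2 j i) *\<^sub>R Q"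
    unfolding N0_def N1_def N2_def e(1) by (simp add: algebra_simps)
  also have "\<dots> = ci *\<^sub>R q" unfolding e(2)[OF ne(4)] e(2)[OF ne(5)] by simp
  finally have m: "ci *\<^sub>R q \<in> span {N0, N1, N2}" unfolding mem_span3 by metis
  have d': "distinct3 k j i" using d by (auto simp: distinct3_def)
  have nz: "R j k c \<noteq> 0" by (rule Rnz[OF ne(3) c])
  have "Lam k j i c b * R j k c = ci" unfolding Lam_eq[OF nz] ci_def by (simp add: algebra_simps)
  then have "ci \<noteq> 0" using Lam_nz[OF d' c b] nz by auto
  with span_scale[OF m, of "inverse ci"] show ?thesis unfolding J by simp
qed

lemma axis_pt_char_line:
  assumes q: "axis_pt i q" and r: "r \<noteq> i" and f: "f \<in> family S r" shows "span {q} \<subseteq> char_line i f"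
proof -
  obtain t \<tau> where t: "t \<in> {0..1}" "net_patch r t \<tau> f" "generic_sc_patch r f" by (rule family_net_patch[OF f])
  obtain k where d: "distinct3 i r k" using distinct3_ex[OF r] by blast
  then have d': "distinct3 r k i" by (auto simp: distinct3_def)
  have "span {q} \<subseteq> join (param_arc i f w)" if w: "w \<in> cube" for w
  proof -
    have c: "\<tau> k (w $ k) \<in> {0..1}" by (rule regular_param_in[OF net_patchD(2)[OF t(2) d'] cube_nth[OF w]])
    have "param_arc i f w = (\<lambda>s. span {NET i r k s t (\<tau> k (w $ k))}) ` {0..1}"
      unfolding net_patch_arc[OF d' t(2) w] NET_rot[of i r k] ..
    then have "q \<in> join (param_arc i f w)" using axis_pt_join[OF d q t(1) c] by simp
    then show ?thesis unfolding join_def by (simp add: span_minimal)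
  qed
  then show ?thesis unfolding char_line_def by blast
qed

text \<open>A common point lies in all four boundary planes of direction \<open>i\<close>, whose
  intersection has dimension at most 1 by genericity. The two faces of direction \<open>j\<close>
  already carry all four edges of direction \<open>i\<close>.\<close>

lemma common_point_unique:
  assumes "q \<in> rp3" "q' \<in> rp3"
    and q: "\<forall>r f. r \<noteq> i \<and> f \<in> family S r \<longrightarrow> q \<subseteq> char_line i f"
    and q': "\<forall>r f. r \<noteq> i \<and> f \<in> family S r \<longrightarrow> q' \<subseteq> char_line i f"
  shows "q = q'"
proof -
  obtain j k where d: "distinct3 i j k" by (rule dist_ex)
  have ne: "j \<noteq> i" using d by (auto simp: distinct3_def)
  let ?V = "\<Inter>v\<in>verts. join (boundary_arc S i v)"
  have V: "p \<subseteq> ?V" if p: "\<forall>r f. r \<noteq> i \<and> f \<in> family S r \<longrightarrow> p \<subseteq> char_line i f" for p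
  proof -
    have "p \<subseteq> join (boundary_arc S i v)" if v: "v \<in> verts" for v
    proof -
      have vv: "v $ j \<in> {0, 1}" using v by (auto simp: verts_def)
      have vc: "v \<in> cube" using v verts_cube by blast
      have "p \<subseteq> char_line i (S j (v $ j))" using p ne face_family[OF vv] by blast
      also have "\<dots> \<subseteq> join (param_arc i (S j (v $ j)) v)" unfolding char_line_def using vc by blast
      also have "\<dots> \<subseteq> join (boundary_arc S i v)" unfolding join_def boundary_arc_def
        by (intro span_mono Union_mono) (use ne in blast)
      finally show ?thesis .
    qed
    then show ?thesis by blast
  qed
  have "dim ?V \<le> 1" using gc unfolding generic_cube_def by blast
  moreover have "subspace ?V" unfolding join_def by (rule subspace_Inter) auto
  ultimately have "p = ?V" if "p \<in> rp3" "p \<subseteq> ?V" for p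
    using that unfolding rp3_def by (intro subspace_dim_equal) auto
  from this[OF assms(1) V[OF q]] this[OF assms(2) V[OF q']] show ?thesis by simp
qed

section \<open>Fundamental transforms between coordinate surfaces\<close>

lemma Net_nonzero:
  assumes w: "w \<in> cube" shows "Net w \<noteq> 0"
proof -
  have d: "distinct3 1 2 3" by (simp add: distinct3_def)
  have "NET 1 2 3 (w $ 1) (w $ 2) (w $ 3) \<noteq> 0"
    unfolding NET_bern[OF d cube_nth[OF w]] by (rule bern_nz[OF indep4_D(2)[OF tangent_indep[OF d cube_nth[OF w] cube_nth[OF w]]]])
  then show ?thesis unfolding Net_def .
qed

lemma smooth_lift_Net: "smooth_lift (\<lambda>w. span {Net w}) Net"
proof -
  obtain e where "e > 0" "\<And>u. u \<in> cube_nhd e \<Longrightarrow> Net u \<noteq> 0"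
    by (rule nonzero_on_cube_nhd[OF smooth_on_continuous[OF smooth_Net] Net_nonzero]) (assumption, rule that)
  then show ?thesis unfolding smooth_lift_def using smooth_Net by blast
qed

lemma net_patch_conjugate_net:
  assumes t: "t \<in> {0..1}" and n: "net_patch i t \<tau> f" shows "conjugate_net i f"
proof -
  obtain j k where d: "distinct3 i j k" by (rule dist_ex)
  let ?h = "\<lambda>w. span {tnet (Y i j k t) (Lam i j k t) (Y i k j t) (Lam i k j t) (Xc i t) (\<tau> j (w $ j)) (\<tau> k (w $ k))}"
  have "conjugate_net i ?h"
    unfolding Y_def Lam_def
  proof (rule tnet_conjugate_net[OF d], unfold Y_def[symmetric] dY_def[symmetric] Lam_def[symmetric] dLam_def[symmetric],
      unfold C0_def[symmetric] C1_def[symmetric] C2_def[symmetric])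
    show "Lam i j k t u \<noteq> 0" "Lam i k j t u \<noteq> 0" if "u \<in> {0..1}" for u
      using Lam_nz[OF d t that] Lam_nz[OF dist_swap[OF d] t that] by blast+
    show "indep4 (C0 i j k t v) (C1 i j k t v) (C2 i j k t v) (vertex (Y i k j t) (dY i k j t) (Lam i k j t) (dLam i k j t) v)"
      if "v \<in> {0..1}" for v by (rule tangent_indep[OF d t that])
    show "regular_param (\<tau> j)" "regular_param (\<tau> k)" by (rule net_patchD(2)[OF n d])+
  qed
  then obtain e F where F: "e > 0" "conj_param i (cube_nhd e) F" "\<forall>w\<in>cube. ?h w = span {F w}"
    unfolding conjugate_net_def by blast
  have "f w = span {F w}" if w: "w \<in> cube" for w
    using net_patchD(1)[OF n d w] F(3) w unfolding NET_tnet[OF d t] by simp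
  with F(1,2) show ?thesis unfolding conjugate_net_def by blast
qed

text \<open>
  The tangents of direction \<open>r\<close> at corresponding points pass through the vertex of the cone touching
  the patch \<open>u\<^sub>k = c\<close> along its conic of direction \<open>i\<close> through both points.
\<close>

lemma tangent_line_vertex:
  assumes d: "distinct3 i r k" and t: "t \<in> {0..1}" and n: "net_patch i t \<tau> f" and w: "w \<in> cube"
  defines "c \<equiv> \<tau> k (w $ k)" and "u \<equiv> \<tau> r (w $ r)"
  shows "vertex (Y k r i c) (dY k r i c) (Lam k r i c) (dLam k r i c) u \<in> tangent_line r f w"
proof -
  have ne: "i \<noteq> r" "i \<noteq> k" "r \<noteq> k" "r \<noteq> i" "k \<noteq> i" "k \<noteq> r" using d by (auto simp: distinct3_def)
  have d1: "distinct3 k r i" "distinct3 k i r" using d by (auto simp: distinct3_def)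
  have c: "c \<in> {0..1}" unfolding c_def by (rule regular_param_in[OF net_patchD(2)[OF n d] cube_nth[OF w]])
  have f: "f (upd w r s) = span {bern (C0 k r i c t) (C1 k r i c t) (C2 k r i c t) (\<tau> r s)}" if s: "s \<in> {0..1}" for s
    using net_patchD(1)[OF n d upd_cube[OF w s, of r]] ne unfolding NET_rev[of i r k] NET_bern[OF d1(1) c, symmetric] c_def
    by (simp add: upd_nth NET_bern[OF d1(1) c, unfolded c_def])
  have "tangent_line r f w = span {bern (C0 k r i c t) (C1 k r i c t) (C2 k r i c t) u, dbern (C0 k r i c t) (C1 k r i c t) (C2 k r i c t) u}"
    unfolding u_def
    by (rule tangent_line_bern[OF conjugate_net_smooth_lift[OF net_patch_conjugate_net[OF t n]] w net_patchD(2)[OF n d] f])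
  also have "bern (C0 k r i c t) (C1 k r i c t) (C2 k r i c t) u = tnet (Y k i r c) (Lam k i r c) (Y k r i c) (Lam k r i c) (Xc k c) t u"
    unfolding C0_def C1_def C2_def tnet_bern[symmetric] Y_def[symmetric] Lam_def[symmetric] by (rule tnet_swap)
  also have "dbern (C0 k r i c t) (C1 k r i c t) (C2 k r i c t) u = tnet (Y k i r c) (Lam k i r c) (dY k r i c) (dLam k r i c) (Xc k c) t u"
    unfolding C0_def C1_def C2_def tnet_dbern[symmetric] dY_def[symmetric] dLam_def[symmetric] by (rule tnet_swap)
  finally have tl: "tangent_line r f w = span {tnet (Y k i r c) (Lam k i r c) (Y k r i c) (Lam k r i c) (Xc k c) t u,
      tnet (Y k i r c) (Lam k i r c) (dY k r i c) (dLam k r i c) (Xc k c) t u}" (is "_ = span {?T, ?Tu}") .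
  have l: "Lam k i r c t \<noteq> 0" by (rule Lam_nz[OF d1(2) c t])
  let ?V = "vertex (Y k r i c) (dY k r i c) (Lam k r i c) (dLam k r i c) u"
  have "Lam k i r c t *\<^sub>R ?V = (- dLam k r i c u) *\<^sub>R ?T + Lam k r i c u *\<^sub>R ?Tu"
    using tnet_vertex[of "Lam k r i c" u "Y k i r c" "Lam k i r c" "dY k r i c" "dLam k r i c" "Xc k c" t "Y k r i c"] by simp
  then have "Lam k i r c t *\<^sub>R ?V \<in> span {?T, ?Tu}" unfolding mem_span2 by blast
  from span_scale[OF this, of "inverse (Lam k i r c t)"] show ?thesis unfolding tl using l by simp
qed

text \<open>The vertex in \<open>tangent_line_vertex\<close> depends on the two parameters other
  than u_i but not on the level \<open>t\<close>. Hence the tangents of both surfaces pass through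
  it, and it is nonzero by \<open>tangent_indep\<close>.\<close>

lemma net_patch_fundamental_transforms:
  assumes t: "t \<in> {0..1}" "t' \<in> {0..1}" and n: "net_patch i t \<tau> f" "net_patch i t' \<tau> g"
  shows "fundamental_transforms i f g"
  unfolding fundamental_transforms_def
proof (intro conjI ballI allI impI)
  show "conjugate_net i f" "conjugate_net i g"
    by (rule net_patch_conjugate_net[OF t(1) n(1)], rule net_patch_conjugate_net[OF t(2) n(2)])
  fix w r assume w: "w \<in> cube" and r: "r \<noteq> i"
  obtain k where d: "distinct3 i r k" using distinct3_ex[OF r] by blast
  then have d': "distinct3 k i r" by (auto simp: distinct3_def)
  have cu: "\<tau> k (w $ k) \<in> {0..1}" "\<tau> r (w $ r) \<in> {0..1}"
    by (rule regular_param_in[OF net_patchD(2)[OF n(1) d] cube_nth[OF w]])+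
  let ?c = "\<tau> k (w $ k)" and ?u = "\<tau> r (w $ r)"
  let ?V = "vertex (Y k r i ?c) (dY k r i ?c) (Lam k r i ?c) (dLam k r i ?c) ?u"
  have "?V \<noteq> 0"
  proof
    assume "?V = 0"
    with tangent_indep[OF d' cu] have "indep4 (C0 k i r ?c ?u) (C1 k i r ?c ?u) (C2 k i r ?c ?u) 0" by simp
    then have "(1::real) = 0" unfolding indep4_def by (metis add_0 scaleR_zero_left scaleR_zero_right)
    then show False by simp
  qed
  moreover have "?V \<in> tangent_line r f w \<inter> tangent_line r g w"
    using tangent_line_vertex[OF d t(1) n(1) w] tangent_line_vertex[OF d t(2) n(2) w] by blast
  ultimately show "tangent_line r f w \<inter> tangent_line r g w \<noteq> {0}" by blast
qed

text \<open>The joining conic is the u_i-line at the common parameters u_j = b, u_k = c. It lies on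
  the coordinate surfaces u_j = b and u_k = c, which belong to the two other families.\<close>

lemma net_patch_corresponding:
  assumes n: "net_patch i t \<tau> f" "net_patch i t' \<tau> g" and t: "t \<in> {0..1}" "t' \<in> {0..1}" and w: "w \<in> cube"
  shows "corresponding S i (f w) (g w)"
proof -
  obtain j k where d: "distinct3 i j k" by (rule dist_ex)
  then have ne: "i \<noteq> j" "i \<noteq> k" "j \<noteq> k" "j \<noteq> i" "k \<noteq> i" "k \<noteq> j" and d': "distinct3 j k i" "distinct3 k j i"
    by (auto simp: distinct3_def)
  define b c where "b = \<tau> j (w $ j)" and "c = \<tau> k (w $ k)"
  have bc: "b \<in> {0..1}" "c \<in> {0..1}"
    unfolding b_def c_def by (rule regular_param_in[OF net_patchD(2)[OF n(1) d] cube_nth[OF w]])+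
  define z where "z = pt3 i j 0 b c"
  have z: "z \<in> cube" "z $ j = b" "z $ k = c"
    unfolding z_def using bc ne by (auto intro!: pt3_cube simp: pt3_nth)
  let ?g = "\<lambda>w. span {Net (upd w j b)}" and ?h = "\<lambda>w. span {Net (upd w k c)}"
  have a: "param_arc i ?g z = (\<lambda>s. span {NET i j k s b c}) ` {0..1}"
    unfolding net_patch_arc[OF d'(1) slice_net_patch z(1)] z(3) NET_rot[of i j k] ..
  have a': "param_arc i ?h z = (\<lambda>s. span {NET i j k s b c}) ` {0..1}"
    unfolding net_patch_arc[OF d'(2) slice_net_patch z(1)] z(2) NET_rev[of i j k] ..
  have "f w = span {NET i j k t b c}" "g w = span {NET i j k t' b c}"
    unfolding b_def c_def by (rule net_patchD(1)[OF n(1) d w] net_patchD(1)[OF n(2) d w])+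
  then have "f w \<in> param_arc i ?g z" "g w \<in> param_arc i ?g z" unfolding a using t by blast+
  then show ?thesis unfolding corresponding_def using d slice_family[OF bc(1), of j] slice_family[OF bc(2), of k] z(1) a a' by metis
qed

lemma family_fundamental_transform:
  assumes f: "f \<in> family S i" and g: "g \<in> family S i" shows "related_by_fundamental_transform S i f g"
proof -
  obtain t \<tau> where t: "t \<in> {0..1}" "net_patch i t \<tau> f" "generic_sc_patch i f" by (rule family_net_patch[OF f])
  obtain t' \<tau>' where t': "t' \<in> {0..1}" "net_patch i t' \<tau>' g" "generic_sc_patch i g" by (rule family_net_patch[OF g])
  \<comment> \<open>\<open>g'\<close> is the coordinate surface of \<open>g\<close> with the
    parameter changes of \<open>f\<close>, so that equal arguments lie on the same u_i-line.\<close>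
  define g' where "g' w = span {Net (upd (rp \<tau> w) i t')}" for w
  have n: "net_patch i t' \<tau> g'" using t(2) unfolding net_patch_def g'_def by blast
  have "reparam g g'" by (rule net_patch_reparam[OF t'(2) n])
  moreover have "\<forall>w\<in>cube. corresponding S i (f w) (g' w)" using net_patch_corresponding[OF t(2) n t(1) t'(1)] by blast
  moreover have "fundamental_transforms i f g'" by (rule net_patch_fundamental_transforms[OF t(1) t'(1) t(2) n])
  ultimately show ?thesis unfolding related_by_fundamental_transform_def by blast
qed

text \<open>Both arcs are the u_k-line at u_i = t, u_j = t', where \<open>t\<close> and
  \<open>t'\<close> are the levels of the two patches.\<close>

lemma families_intersect:
  assumes d: "distinct3 i j k" and f: "f \<in> family S i" and g: "g \<in> family S j"
  shows "\<exists>x\<in>cube. \<exists>y\<in>cube. param_arc k f x = param_arc k g y"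
proof -
  have d': "distinct3 j i k" using d by (auto simp: distinct3_def)
  obtain t \<tau> where t: "t \<in> {0..1}" "net_patch i t \<tau> f" "generic_sc_patch i f" by (rule family_net_patch[OF f])
  obtain t' \<tau>' where t': "t' \<in> {0..1}" "net_patch j t' \<tau>' g" "generic_sc_patch j g" by (rule family_net_patch[OF g])
  obtain s s' where s: "s \<in> {0..1}" "\<tau> j s = t'" "s' \<in> {0..1}" "\<tau>' i s' = t"
    using regular_param_onto[OF net_patchD(2)[OF t(2) d] t'(1)] regular_param_onto[OF net_patchD(2)[OF t'(2) d'] t(1)] by metis
  have u: "upd 0 j s \<in> cube" "upd 0 i s' \<in> cube" using upd_cube[OF zero_cube] s by blast+
  have "param_arc k f (upd 0 j s) = param_arc k g (upd 0 i s')"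
    unfolding net_patch_arc[OF d t(2) u(1)] net_patch_arc[OF d' t'(2) u(2)] upd_nth s NET_flip[of i j k] ..
  then show ?thesis using u by blast
qed

section \<open>The assertions on chains, families and common points\<close>

lemma chains:
  assumes d: "distinct3 i j k"
  shows "(\<forall>p\<in>boundary_arc S i 0. \<exists>y. conic_chain S j k y \<and> chain_point S j k y 0 = p) \<and>
        (\<forall>y. conic_chain S j k y \<longrightarrow>
           chain_end S j k y 3 = chain_point S j k y 0 \<and>
           (\<exists>g. generic_sc_patch i g \<and> bounded_by_chain S j k y g) \<and>
           (\<forall>g g'. generic_sc_patch i g \<and> bounded_by_chain S j k y g \<and>
              generic_sc_patch i g' \<and> bounded_by_chain S j k y g' \<longrightarrow> reparam g g'))"
proof (intro conjI ballI allI impI)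
  fix p assume "p \<in> boundary_arc S i 0"
  then obtain t where t: "t \<in> {0..1}" "p = span {NET i j k t 0 0}" unfolding boundary_arc_NET[OF d zero_verts] by auto
  obtain y where y: "conic_chain S j k y" "loop i j k t y" by (rule loop_ex[OF d t(1)])
  show "\<exists>y. conic_chain S j k y \<and> chain_point S j k y 0 = p" using y loopD(1)[OF y(2)] t(2) by blast
next
  fix y assume y: "conic_chain S j k y"
  obtain t where t: "t \<in> {0..1}" "loop i j k t y" by (rule conic_chain_loop[OF d y])
  show "chain_end S j k y 3 = chain_point S j k y 0" using t(2) unfolding loop_def by metis
  have "bounded_by_chain S j k y (\<lambda>w. span {NET i j k t (w $ j) (w $ k)})"
    by (rule bounded_by_loop[OF d _ regular_param_id regular_param_id t(2)]) simp
  then show "\<exists>g. generic_sc_patch i g \<and> bounded_by_chain S j k y g" using generic_slice[OF d t(1)] by blast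
  fix g g' assume "generic_sc_patch i g \<and> bounded_by_chain S j k y g \<and> generic_sc_patch i g' \<and> bounded_by_chain S j k y g'"
  then have g: "generic_sc_patch i g" "bounded_by_chain S j k y g" "generic_sc_patch i g'" "bounded_by_chain S j k y g'" by blast+
  obtain \<tau> where n: "net_patch i t \<tau> g" by (rule bounded_net_patch[OF d t g(1,2)])
  obtain \<tau>' where n': "net_patch i t \<tau>' g'" by (rule bounded_net_patch[OF d t g(3,4)])
  show "reparam g g'" by (rule net_patch_reparam[OF n n'])
qed

lemma slices:
  "\<exists>G. (\<exists>F. smooth_lift G F) \<and>
     (\<forall>t\<in>{0..1}. slice i t G \<in> family S i) \<and>
     (\<forall>g\<in>family S i. \<exists>t\<in>{0..1}. reparam (slice i t G) g) \<and>
     reparam (slice i 0 G) (S i 0) \<and> reparam (slice i 1 G) (S i 1)"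
proof (intro exI[of _ "\<lambda>w. span {Net w}"] conjI ballI)
  show "\<exists>F. smooth_lift (\<lambda>w. span {Net w}) F" using smooth_lift_Net by blast
  show "slice i t (\<lambda>w. span {Net w}) \<in> family S i" if "t \<in> {0..1}" for t
    unfolding slice_def by (rule slice_family[OF that])
  show "reparam (slice i 0 (\<lambda>w. span {Net w})) (S i 0)" "reparam (slice i 1 (\<lambda>w. span {Net w})) (S i 1)"
    unfolding slice_def by (rule net_patch_reparam[OF slice_net_patch face_net_patch]; simp)+
  fix g assume g: "g \<in> family S i"
  obtain t \<tau> where t: "t \<in> {0..1}" "net_patch i t \<tau> g" "generic_sc_patch i g" by (rule family_net_patch[OF g])
  show "\<exists>t\<in>{0..1}. reparam (slice i t (\<lambda>w. span {Net w})) g"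
    unfolding slice_def using net_patch_reparam[OF slice_net_patch t(2)] t(1) by blast
qed

lemma common_point: "\<exists>!q. q \<in> rp3 \<and> (\<forall>r f. r \<noteq> i \<and> f \<in> family S r \<longrightarrow> q \<subseteq> char_line i f)"
proof -
  obtain q where q: "q \<noteq> 0" "axis_pt i q" by (rule axis_pt_ex)
  show ?thesis
  proof (rule ex1I[of _ "span {q}"])
    show "span {q} \<in> rp3 \<and> (\<forall>r f. r \<noteq> i \<and> f \<in> family S r \<longrightarrow> span {q} \<subseteq> char_line i f)"
      using span1_rp3[OF q(1)] axis_pt_char_line[OF q(2)] by blast
    fix q' assume "q' \<in> rp3 \<and> (\<forall>r f. r \<noteq> i \<and> f \<in> family S r \<longrightarrow> q' \<subseteq> char_line i f)"
    then show "q' = span {q}"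
      using common_point_unique[of q' "span {q}" i] span1_rp3[OF q(1)] axis_pt_char_line[OF q(2)] by blast
  qed
qed

end

theorem theorem34:
  fixes X :: "real^3 \<Rightarrow> pt" and S :: "3 \<Rightarrow> real \<Rightarrow> patch"
  assumes "sc_cube X S" and "generic_cube X S"
  shows
    "(\<forall>i j k. distinct3 i j k \<longrightarrow>
        (\<forall>p\<in>boundary_arc S i 0. \<exists>y. conic_chain S j k y \<and> chain_point S j k y 0 = p) \<and>
        (\<forall>y. conic_chain S j k y \<longrightarrow>
           chain_end S j k y 3 = chain_point S j k y 0 \<and>
           (\<exists>g. generic_sc_patch i g \<and> bounded_by_chain S j k y g) \<and>
           (\<forall>g g'. generic_sc_patch i g \<and> bounded_by_chain S j k y g \<and>
              generic_sc_patch i g' \<and> bounded_by_chain S j k y g' \<longrightarrow> reparam g g'))) \<and>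
     (\<forall>i. S i 0 \<in> family S i \<and> S i 1 \<in> family S i \<and>
        (\<exists>G. (\<exists>F. smooth_lift G F) \<and>
           (\<forall>t\<in>{0..1}. slice i t G \<in> family S i) \<and>
           (\<forall>g\<in>family S i. \<exists>t\<in>{0..1}. reparam (slice i t G) g) \<and>
           reparam (slice i 0 G) (S i 0) \<and> reparam (slice i 1 G) (S i 1))) \<and>
     (\<forall>i. \<exists>!q. q \<in> rp3 \<and> (\<forall>r f. r \<noteq> i \<and> f \<in> family S r \<longrightarrow> q \<subseteq> char_line i f)) \<and>
     (\<forall>i j k. distinct3 i j k \<longrightarrow>
        (\<forall>f\<in>family S i. \<forall>g\<in>family S j.
           \<exists>x\<in>cube. \<exists>y\<in>cube. param_arc k f x = param_arc k g y)) \<and>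
     (\<forall>i. (\<forall>f\<in>family S i. \<forall>g\<in>family S i. related_by_fundamental_transform S i f g) \<and>
        related_by_fundamental_transform S i (S i 0) (S i 1))"
proof -
  obtain x zz yy a1 a2 where "gen_cube x zz yy a1 a2 X S" using gen_cube_ex[OF assms] by blast
  then interpret gen_cube x zz yy a1 a2 X S .
  have f: "S i 0 \<in> family S i" "S i 1 \<in> family S i" for i by (rule face_family; simp)+
  show ?thesis
  proof (rule conjI[OF _ conjI[OF _ conjI[OF _ conjI]]], goal_cases)
    case 1 show ?case by (intro allI impI) (rule chains)
  next
    case 2 show ?case by (rule allI) (rule conjI[OF f(1) conjI[OF f(2) slices]])
  next
    case 3 show ?case by (rule allI) (rule common_point)
  next
    case 4 show ?case by (intro allI impI ballI) (rule families_intersect)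
  next
    case 5 show ?case by (intro allI conjI ballI family_fundamental_transform f)
  qed
qed

end
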